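(* Let $G$ be a Lie group with Lie algebra $\mathfrak g$ and consider the symplectic manifold ${}^{1}T^*T^*G=(G\circledS\mathfrak g_1^* )\circledS(\mathfrak g_2^*\times\mathfrak g_3)\ni(g,\mu,\nu,\xi)$. (Poisson reduction by $G$.) The Poisson reduction of ${}^{1}T^*T^*G$ by $G$ is $\mathfrak g_1^*\circledS(\mathfrak g_2^*\times\mathfrak g_3)\ni(\mu,\nu,\xi)$: the functions that do not depend on $g$ are closed under the Poisson bracket, and for two such functions $$\{H,K\}(\mu,\nu,\xi)=\Big\langle\frac{\delta K}{\delta\mu},\frac{\delta H}{\delta\xi}\Big\rangle-\Big\langle\frac{\delta H}{\delta\mu},\frac{\delta K}{\delta\xi}\Big\rangle+\Big\langle\nu,\Big[\frac{\delta H}{\delta\nu},\frac{\delta K}{\delta\nu}\Big]\Big\rangle$$ $$\qquad+\Big\langle\xi,ad^*_{\frac{\delta K}{\delta\nu}}\frac{\delta H}{\delta\xi}-ad^*_{\frac{\delta H}{\delta\nu}}\frac{\delta K}{\delta\xi}\Big\rangle+\Big\langle\mu,\Big[\frac{\delta H}{\delta\mu},\frac{\delta K}{\delta\nu}\Big]-\Big[\frac{\delta K}{\delta\mu},\frac{\delta H}{\delta\nu}\Big]\Big\rangle.$$ (Symplectic reduction by $G$.) The Marsden–Weinstein reduction of ${}^{1}T^*T^*G$ by the action $(g;(h,\mu,\nu,\xi))\mapsto(gh,Ad^*_{g^{-1}}\mu,Ad^*_{g^{-1}}\nu,Ad_{g^{-1}}\xi)$, with momentum mapping $(g,\mu,\nu,\xi)\mapsto\nu$,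 at a value $\mu_0\in\mathfrak g^*$ is (isomorphic to) $\mathcal O_{\mu_0}\times\mathfrak g^*\times\mathfrak g$, where $\mathcal O_{\mu_0}$ is the coadjoint orbit through $\mu_0$, with the symplectic two-form given, for $\mu\in\mathcal O_{\mu_0}$, by $$\big((\eta_{\mathfrak g^*}(\mu),\lambda,\zeta),(\bar\eta_{\mathfrak g^*}(\mu),\bar\lambda,\bar\zeta)\big)\mapsto\langle\zeta,\bar\lambda\rangle-\langle\bar\zeta,\lambda\rangle-\langle\mu,[\eta,\bar\eta]\rangle$$ on elements of $T_\mu\mathcal O_{\mu_0}\times\mathfrak g^*\times\mathfrak g$.
   Context: Conventions. $G$ is a (finite-dimensional) Lie group with identity $e$, $\mathfrak g=T_eG$, $\mathfrak g^*$ its dual, $\mathfrak g^{**}=\mathfrak g$. $R_g$ is right translation. $Ad_g$ is the tangent map at $e$ of $h\mapsto g^{-1}hg$; $\langle Ad^*_g\mu,\xi\rangle=\langle\mu,Ad_{g^{-1}}\xi\rangle$. The Lie bracket is $[\xi,\eta]=ad_\xi\eta=\frac{d}{dt}|_{t=0}Ad_{\exp(t\xi)}\eta$ (the bracket of right invariant vector fields). $\langle ad^*_\xi\mu,\eta\rangle=\langle\mu,[\xi,\eta]\rangle$. $\eta_{\mathfrak g^*}(\mu)=\frac{d}{dt}|_{t=0}Ad^*_{\exp(t\eta)}\mu=-ad^*_\eta\mu$ is the infinitesimal generator of the coadjoint action. Partial derivatives: $\delta H/\delta\mu,\delta H/\delta\nu\in\mathfrak g$, $\delta H/\delta\xi\in\mathfrak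 g^*$. As a manifold ${}^{1}T^*T^*G=G\times\mathfrak g^*\times\mathfrak g^*\times\mathfrak g$ (subscripts on copies are only labels). For $(\eta,\lambda_1,\lambda_2,\zeta)\in\mathfrak g\times\mathfrak g^*\times\mathfrak g^*\times\mathfrak g$ let $$X_{(\eta,\lambda_1,\lambda_2,\zeta)}(g,\mu,\nu,\xi)=(T_eR_g\eta,\ \lambda_1+ad^*_\eta\mu,\ \lambda_2+ad^*_\eta\nu-ad^*_\xi\lambda_1,\ \zeta+[\xi,\eta]).$$ The symplectic form is determined by $$\Omega(X_{(\eta,\lambda_1,\lambda_2,\zeta)},X_{(\bar\eta,\bar\lambda_1,\bar\lambda_2,\bar\zeta)})=\langle\lambda_2,\bar\eta\rangle+\langle\zeta-[\eta,\xi],\bar\lambda_1\rangle-\langle\bar\lambda_2,\eta\rangle+\langle[\bar\eta,\xi]-\bar\zeta,\lambda_1\rangle+\langle\nu,[\eta,\bar\eta]\rangle.$$ Hamiltonian vector fields satisfy $i_{X_H}\Omega=-dH$ and $\{H,K\}=\Omega(X_H,X_K)=-\langle dH,X_K\rangle$. *)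

theory Defs
  imports "HOL-Analysis.Analysis" "HOL-Algebra.Group"
begin

section \<open>Smooth maps between (subspaces of) normed spaces\<close>

text \<open>
  A finite-dimensional Euclidean space. In contrast to the library class of Euclidean spaces the
  dimension may be zero, so that discrete Lie groups are not excluded.
\<close>

class fin_dim_inner = real_inner +
  assumes fin_dim: "\<exists>B. finite B \<and> (\<forall>x. \<exists>c. x = (\<Sum>b\<in>B. c b *\<^sub>R b))"

text \<open>
  \<open>V\<close> is a linear subspace and \<open>S\<close> is meant to be relatively open in \<open>V\<close>. The derivative within
  \<open>V\<close> is only unique on vectors of \<open>V\<close>, and it is only ever applied to those.
\<close>

primrec Ck_on ::
  "nat \<Rightarrow> 'a::real_normed_vector set \<Rightarrow> 'a set \<Rightarrow> ('a \<Rightarrow> 'b::real_normed_vector) \<Rightarrow> bool" where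
  "Ck_on 0 V S f \<longleftrightarrow> continuous_on S f"
| "Ck_on (Suc k) V S f \<longleftrightarrow>
     (\<forall>x\<in>S. f differentiable (at x within V)) \<and>
     (\<forall>v\<in>V. Ck_on k V S (\<lambda>x. frechet_derivative f (at x within V) v))"

definition smooth_on ::
  "'a::real_normed_vector set \<Rightarrow> 'a set \<Rightarrow> ('a \<Rightarrow> 'b::real_normed_vector) \<Rightarrow> bool" where
  "smooth_on V S f \<longleftrightarrow> (\<forall>k. Ck_on k V S f)"

section \<open>Smooth manifolds\<close>

text \<open>
  The model space is a finite-dimensional linear subspace of the type \<open>'e\<close>; this allows for
  manifolds such as orbits, whose dimension depends on parameters. The atlas is indexed by the
  points: \<open>(cdom M p, cmap M p)\<close> is a chart around \<open>p\<close>. The tangent space at \<open>p\<close> is the model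
  space, tangent vectors being read in the chart chosen at \<open>p\<close>.
\<close>

record ('m, 'e) mfd =
  mtop :: "'m topology"
  model :: "'e set"
  cdom :: "'m \<Rightarrow> 'm set"
  cmap :: "'m \<Rightarrow> 'm \<Rightarrow> 'e"

abbreviation pts :: "('m, 'e) mfd \<Rightarrow> 'm set" where
  "pts M \<equiv> topspace (mtop M)"

definition cinv :: "('m, 'e) mfd \<Rightarrow> 'm \<Rightarrow> 'e \<Rightarrow> 'm" where
  "cinv M p = inv_into (cdom M p) (cmap M p)"

definition smooth_manifold :: "('m, 'e::real_normed_vector) mfd \<Rightarrow> bool" where
  "smooth_manifold M \<longleftrightarrow>
     Hausdorff_space (mtop M) \<and> second_countable (mtop M) \<and>
     (\<exists>B. finite B \<and> model M = span B) \<and>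
     (\<forall>p\<in>pts M. p \<in> cdom M p \<and> openin (mtop M) (cdom M p) \<and>
        openin (top_of_set (model M)) (cmap M p ` cdom M p) \<and>
        homeomorphic_map (subtopology (mtop M) (cdom M p))
          (top_of_set (cmap M p ` cdom M p)) (cmap M p)) \<and>
     (\<forall>p\<in>pts M. \<forall>q\<in>pts M.
        smooth_on (model M) (cmap M p ` (cdom M p \<inter> cdom M q)) (cmap M q \<circ> cinv M p))"

definition smooth_map ::
  "('m, 'e::real_normed_vector) mfd \<Rightarrow> ('n, 'f::real_normed_vector) mfd \<Rightarrow> ('m \<Rightarrow> 'n) \<Rightarrow> bool" where
  "smooth_map M N f \<longleftrightarrow> continuous_map (mtop M) (mtop N) f \<and>
     (\<forall>p\<in>pts M. \<forall>q\<in>pts N.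
        smooth_on (model M) (cmap M p ` (cdom M p \<inter> f -` cdom N q)) (cmap N q \<circ> f \<circ> cinv M p))"

text \<open>The tangent map \<open>T\<^sub>p f\<close>; only its values on \<open>model M\<close> are meaningful.\<close>

definition tmap ::
  "('m, 'e::real_normed_vector) mfd \<Rightarrow> ('n, 'f::real_normed_vector) mfd \<Rightarrow> ('m \<Rightarrow> 'n) \<Rightarrow> 'm \<Rightarrow> 'e \<Rightarrow> 'f"
  where
  "tmap M N f p =
     frechet_derivative (cmap N (f p) \<circ> f \<circ> cinv M p) (at (cmap M p p) within model M)"

definition vs_mfd :: "('a::real_normed_vector, 'a) mfd" where
  "vs_mfd = \<lparr>mtop = euclidean, model = UNIV, cdom = (\<lambda>_. UNIV), cmap = (\<lambda>_ x. x)\<rparr>"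

definition prod_mfd :: "('m, 'e) mfd \<Rightarrow> ('n, 'f) mfd \<Rightarrow> ('m \<times> 'n, 'e \<times> 'f) mfd" where
  "prod_mfd M N = \<lparr>mtop = prod_topology (mtop M) (mtop N), model = model M \<times> model N,
     cdom = (\<lambda>(p, q). cdom M p \<times> cdom N q), cmap = (\<lambda>(p, q). map_prod (cmap M p) (cmap N q))\<rparr>"

abbreviation smooth_fun :: "('m, 'e::real_normed_vector) mfd \<Rightarrow> ('m \<Rightarrow> real) \<Rightarrow> bool" where
  "smooth_fun M f \<equiv> smooth_map M vs_mfd f"

definition immersion ::
  "('m, 'e::real_normed_vector) mfd \<Rightarrow> ('n, 'f::real_normed_vector) mfd \<Rightarrow> ('m \<Rightarrow> 'n) \<Rightarrow> bool" where
  "immersion M N f \<longleftrightarrow> smooth_map M N f \<and> (\<forall>p\<in>pts M. inj_on (tmap M N f p) (model M))"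

definition surj_submersion ::
  "('m, 'e::real_normed_vector) mfd \<Rightarrow> ('n, 'f::real_normed_vector) mfd \<Rightarrow> ('m \<Rightarrow> 'n) \<Rightarrow> bool" where
  "surj_submersion M N f \<longleftrightarrow> smooth_map M N f \<and> f ` pts M = pts N \<and>
     (\<forall>p\<in>pts M. tmap M N f p ` model M = model N)"

definition embedded_submanifold ::
  "('m, 'f::real_normed_vector) mfd \<Rightarrow> ('m, 'e::real_normed_vector) mfd \<Rightarrow> bool" where
  "embedded_submanifold N M \<longleftrightarrow> smooth_manifold N \<and> pts N \<subseteq> pts M \<and>
     mtop N = subtopology (mtop M) (pts N) \<and> immersion N M (\<lambda>x. x)"

definition diffeomorphism ::
  "('m, 'e::real_normed_vector) mfd \<Rightarrow> ('n, 'f::real_normed_vector) mfd \<Rightarrow> ('m \<Rightarrow> 'n) \<Rightarrow> bool" where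
  "diffeomorphism M N f \<longleftrightarrow> bij_betw f (pts M) (pts N) \<and> smooth_map M N f \<and>
     smooth_map N M (inv_into (pts M) f)"

section \<open>Symplectic forms and Hamiltonian vector fields\<close>

text \<open>
  A two-form is a family of bilinear forms on the tangent spaces; \<open>form_in_chart M \<omega> p\<close> is its
  expression in the chart at \<open>p\<close>, obtained by passing at each point \<open>q\<close> of the chart domain
  to the chart at \<open>q\<close>.
\<close>

definition form_in_chart ::
  "('m, 'e::real_normed_vector) mfd \<Rightarrow> ('m \<Rightarrow> 'e \<Rightarrow> 'e \<Rightarrow> real) \<Rightarrow> 'm \<Rightarrow> 'e \<Rightarrow> 'e \<Rightarrow> 'e \<Rightarrow> real" where
  "form_in_chart M \<omega> p y u v =
     (let q = cinv M p y;
          D = frechet_derivative (cmap M q \<circ> cinv M p) (at y within model M)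
      in \<omega> q (D u) (D v))"

definition two_form ::
  "('m, 'e::real_normed_vector) mfd \<Rightarrow> ('m \<Rightarrow> 'e \<Rightarrow> 'e \<Rightarrow> real) \<Rightarrow> bool" where
  "two_form M \<omega> \<longleftrightarrow>
     (\<forall>p\<in>pts M. \<forall>u\<in>model M. \<forall>v\<in>model M. \<forall>w\<in>model M. \<forall>a b.
        \<omega> p (a *\<^sub>R u + b *\<^sub>R v) w = a * \<omega> p u w + b * \<omega> p v w) \<and>
     (\<forall>p\<in>pts M. \<forall>u\<in>model M. \<forall>v\<in>model M. \<omega> p u v = - \<omega> p v u) \<and>
     (\<forall>p\<in>pts M. \<forall>u\<in>model M. \<forall>v\<in>model M.
        smooth_on (model M) (cmap M p ` cdom M p) (\<lambda>y. form_in_chart M \<omega> p y u v))"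

definition closed_form ::
  "('m, 'e::real_normed_vector) mfd \<Rightarrow> ('m \<Rightarrow> 'e \<Rightarrow> 'e \<Rightarrow> real) \<Rightarrow> bool" where
  "closed_form M \<omega> \<longleftrightarrow>
     (\<forall>p\<in>pts M. \<forall>y\<in>cmap M p ` cdom M p. \<forall>u\<in>model M. \<forall>v\<in>model M. \<forall>w\<in>model M.
        frechet_derivative (\<lambda>z. form_in_chart M \<omega> p z v w) (at y within model M) u +
        frechet_derivative (\<lambda>z. form_in_chart M \<omega> p z w u) (at y within model M) v +
        frechet_derivative (\<lambda>z. form_in_chart M \<omega> p z u v) (at y within model M) w = 0)"

definition symplectic_form ::
  "('m, 'e::real_normed_vector) mfd \<Rightarrow> ('m \<Rightarrow> 'e \<Rightarrow> 'e \<Rightarrow> real) \<Rightarrow> bool" where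
  "symplectic_form M \<omega> \<longleftrightarrow> two_form M \<omega> \<and> closed_form M \<omega> \<and>
     (\<forall>p\<in>pts M. \<forall>v\<in>model M. (\<forall>w\<in>model M. \<omega> p v w = 0) \<longrightarrow> v = 0)"

definition symplectic_manifold ::
  "('m, 'e::real_normed_vector) mfd \<Rightarrow> ('m \<Rightarrow> 'e \<Rightarrow> 'e \<Rightarrow> real) \<Rightarrow> bool" where
  "symplectic_manifold M \<omega> \<longleftrightarrow> smooth_manifold M \<and> symplectic_form M \<omega>"

definition symplectomorphism ::
  "('m, 'e::real_normed_vector) mfd \<Rightarrow> ('m \<Rightarrow> 'e \<Rightarrow> 'e \<Rightarrow> real) \<Rightarrow>
   ('n, 'f::real_normed_vector) mfd \<Rightarrow> ('n \<Rightarrow> 'f \<Rightarrow> 'f \<Rightarrow> real) \<Rightarrow> ('m \<Rightarrow> 'n) \<Rightarrow> bool" where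
  "symplectomorphism M \<omega> N \<rho> f \<longleftrightarrow> diffeomorphism M N f \<and>
     (\<forall>p\<in>pts M. \<forall>v\<in>model M. \<forall>w\<in>model M. \<rho> (f p) (tmap M N f p v) (tmap M N f p w) = \<omega> p v w)"

text \<open>Sign convention: \<open>i\<^bsub>X\<^sub>H\<^esub> \<omega> = - dH\<close> and \<open>{H, K} = \<omega> (X\<^sub>H, X\<^sub>K)\<close>.\<close>

definition ham_vf ::
  "('m, 'e::real_normed_vector) mfd \<Rightarrow> ('m \<Rightarrow> 'e \<Rightarrow> 'e \<Rightarrow> real) \<Rightarrow> ('m \<Rightarrow> real) \<Rightarrow> 'm \<Rightarrow> 'e" where
  "ham_vf M \<omega> H p = (THE v. v \<in> model M \<and> (\<forall>w\<in>model M. \<omega> p v w = - tmap M vs_mfd H p w))"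

definition poisson_bracket ::
  "('m, 'e::real_normed_vector) mfd \<Rightarrow> ('m \<Rightarrow> 'e \<Rightarrow> 'e \<Rightarrow> real) \<Rightarrow> ('m \<Rightarrow> real) \<Rightarrow> ('m \<Rightarrow> real) \<Rightarrow> 'm \<Rightarrow> real"
  where
  "poisson_bracket M \<omega> H K p = \<omega> p (ham_vf M \<omega> H p) (ham_vf M \<omega> K p)"

section \<open>Lie groups\<close>

record ('g, 'e) lgroup = "'g monoid" +
  gmfd :: "('g, 'e) mfd"

definition lie_group :: "('g, 'e::fin_dim_inner) lgroup \<Rightarrow> bool" where
  "lie_group G \<longleftrightarrow> group G \<and> smooth_manifold (gmfd G) \<and> pts (gmfd G) = carrier G \<and>
     model (gmfd G) = UNIV \<and>
     smooth_map (prod_mfd (gmfd G) (gmfd G)) (gmfd G) (\<lambda>(g, h). g \<otimes>\<^bsub>G\<^esub> h) \<and>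
     smooth_map (gmfd G) (gmfd G) (\<lambda>g. inv\<^bsub>G\<^esub> g)"

text \<open>The Lie algebra, i.e. the tangent space at the identity, is the whole type \<open>'e\<close>.\<close>

type_synonym 'e dual = "'e \<Rightarrow>\<^sub>L real"

text \<open>Conjugation is by \<open>g\<^sup>-\<^sup>1\<close>, so that \<open>Ad\<close> is an antihomomorphism.\<close>

definition Ad :: "('g, 'e::fin_dim_inner) lgroup \<Rightarrow> 'g \<Rightarrow> 'e \<Rightarrow> 'e" where
  "Ad G g = tmap (gmfd G) (gmfd G) (\<lambda>h. inv\<^bsub>G\<^esub> g \<otimes>\<^bsub>G\<^esub> h \<otimes>\<^bsub>G\<^esub> g) \<one>\<^bsub>G\<^esub>"

definition coAd :: "('g, 'e::fin_dim_inner) lgroup \<Rightarrow> 'g \<Rightarrow> 'e dual \<Rightarrow> 'e dual" where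
  "coAd G g \<mu> = Blinfun (\<lambda>\<xi>. \<mu> (Ad G (inv\<^bsub>G\<^esub> g) \<xi>))"

definition one_param_subgroup ::
  "('g, 'e::fin_dim_inner) lgroup \<Rightarrow> 'e \<Rightarrow> (real \<Rightarrow> 'g) \<Rightarrow> bool" where
  "one_param_subgroup G \<xi> \<gamma> \<longleftrightarrow> smooth_map vs_mfd (gmfd G) \<gamma> \<and>
     (\<forall>s t. \<gamma> (s + t) = \<gamma> s \<otimes>\<^bsub>G\<^esub> \<gamma> t) \<and> tmap vs_mfd (gmfd G) \<gamma> 0 1 = \<xi>"

definition lexp :: "('g, 'e::fin_dim_inner) lgroup \<Rightarrow> 'e \<Rightarrow> 'g" where
  "lexp G \<xi> = (THE \<gamma>. one_param_subgroup G \<xi> \<gamma>) 1"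

definition lie_bracket :: "('g, 'e::fin_dim_inner) lgroup \<Rightarrow> 'e \<Rightarrow> 'e \<Rightarrow> 'e" where
  "lie_bracket G \<xi> \<eta> = vector_derivative (\<lambda>t. Ad G (lexp G (t *\<^sub>R \<xi>)) \<eta>) (at 0)"

definition coad :: "('g, 'e::fin_dim_inner) lgroup \<Rightarrow> 'e \<Rightarrow> 'e dual \<Rightarrow> 'e dual" where
  "coad G \<xi> \<mu> = Blinfun (\<lambda>\<eta>. \<mu> (lie_bracket G \<xi> \<eta>))"

definition coad_gen :: "('g, 'e::fin_dim_inner) lgroup \<Rightarrow> 'e \<Rightarrow> 'e dual \<Rightarrow> 'e dual" where
  "coad_gen G \<eta> \<mu> = vector_derivative (\<lambda>t. coAd G (lexp G (t *\<^sub>R \<eta>)) \<mu>) (at 0)"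

definition coad_orbit :: "('g, 'e::fin_dim_inner) lgroup \<Rightarrow> 'e dual \<Rightarrow> 'e dual set" where
  "coad_orbit G \<mu> = (\<lambda>g. coAd G g \<mu>) ` carrier G"

text \<open>
  The orbit as an immersed submanifold of the dual: it carries the (unique) smooth structure for
  which the orbit map is a submersion. Its topology may be finer than the subspace topology.
\<close>

definition coad_orbit_manifold ::
  "('g, 'e::fin_dim_inner) lgroup \<Rightarrow> 'e dual \<Rightarrow> ('e dual, 'e dual) mfd \<Rightarrow> bool" where
  "coad_orbit_manifold G \<mu> O\<mu> \<longleftrightarrow> smooth_manifold O\<mu> \<and> pts O\<mu> = coad_orbit G \<mu> \<and>
     surj_submersion (gmfd G) O\<mu> (\<lambda>g. coAd G g \<mu>) \<and> immersion O\<mu> vs_mfd (\<lambda>\<alpha>. \<alpha>)"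

section \<open>Actions, momentum maps and reduction\<close>

definition lie_action ::
  "('g, 'e::fin_dim_inner) lgroup \<Rightarrow> ('p, 'f::real_normed_vector) mfd \<Rightarrow> ('g \<Rightarrow> 'p \<Rightarrow> 'p) \<Rightarrow> bool" where
  "lie_action G P act \<longleftrightarrow> smooth_map (prod_mfd (gmfd G) P) P (\<lambda>(g, x). act g x) \<and>
     (\<forall>x\<in>pts P. act \<one>\<^bsub>G\<^esub> x = x) \<and>
     (\<forall>g\<in>carrier G. \<forall>h\<in>carrier G. \<forall>x\<in>pts P. act (g \<otimes>\<^bsub>G\<^esub> h) x = act g (act h x))"

definition symplectic_action ::
  "('g, 'e::fin_dim_inner) lgroup \<Rightarrow> ('p, 'f::real_normed_vector) mfd \<Rightarrow> ('p \<Rightarrow> 'f \<Rightarrow> 'f \<Rightarrow> real) \<Rightarrow>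
   ('g \<Rightarrow> 'p \<Rightarrow> 'p) \<Rightarrow> bool" where
  "symplectic_action G P \<Omega> act \<longleftrightarrow> lie_action G P act \<and>
     (\<forall>g\<in>carrier G. symplectomorphism P \<Omega> P \<Omega> (act g))"

definition action_gen ::
  "('g, 'e::fin_dim_inner) lgroup \<Rightarrow> ('p, 'f::real_normed_vector) mfd \<Rightarrow> ('g \<Rightarrow> 'p \<Rightarrow> 'p) \<Rightarrow> 'e \<Rightarrow> 'p \<Rightarrow> 'f"
  where
  "action_gen G P act \<eta> x = tmap vs_mfd P (\<lambda>t::real. act (lexp G (t *\<^sub>R \<eta>)) x) 0 1"

text \<open>
  The generator of \<open>\<eta>\<close> is the Hamiltonian vector field of \<open>\<langle>J, \<eta>\<rangle>\<close>, and \<open>J\<close> is equivariant; with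
  the present conventions \<open>g \<mapsto> Ad*\<close> of \<open>g\<^sup>-\<^sup>1\<close> is the left coadjoint action.
\<close>

definition momentum_map ::
  "('g, 'e::fin_dim_inner) lgroup \<Rightarrow> ('p, 'f::real_normed_vector) mfd \<Rightarrow> ('p \<Rightarrow> 'f \<Rightarrow> 'f \<Rightarrow> real) \<Rightarrow>
   ('g \<Rightarrow> 'p \<Rightarrow> 'p) \<Rightarrow> ('p \<Rightarrow> 'e dual) \<Rightarrow> bool" where
  "momentum_map G P \<Omega> act J \<longleftrightarrow> smooth_map P vs_mfd J \<and>
     (\<forall>\<eta>. \<forall>x\<in>pts P. action_gen G P act \<eta> x = ham_vf P \<Omega> (\<lambda>y. J y \<eta>) x) \<and>
     (\<forall>g\<in>carrier G. \<forall>x\<in>pts P. J (act g x) = coAd G (inv\<^bsub>G\<^esub> g) (J x))"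

definition coad_isotropy :: "('g, 'e::fin_dim_inner) lgroup \<Rightarrow> 'e dual \<Rightarrow> 'g set" where
  "coad_isotropy G \<mu> = {g \<in> carrier G. coAd G (inv\<^bsub>G\<^esub> g) \<mu> = \<mu>}"

text \<open>
  \<open>(Q, \<omega>)\<close> is the Marsden--Weinstein reduced space at \<open>\<mu>\<close>: the set of orbits of the isotropy group
  on the level set \<open>N\<close> of \<open>J\<close>, with the smooth structure making the projection a submersion and
  the form characterised by \<open>\<pi>\<^sup>*\<omega> = i\<^sup>*\<Omega>\<close>.
\<close>

definition marsden_weinstein_reduction ::
  "('g, 'e::fin_dim_inner) lgroup \<Rightarrow> ('p, 'f::real_normed_vector) mfd \<Rightarrow> ('p \<Rightarrow> 'f \<Rightarrow> 'f \<Rightarrow> real) \<Rightarrow>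
   ('g \<Rightarrow> 'p \<Rightarrow> 'p) \<Rightarrow> ('p \<Rightarrow> 'e dual) \<Rightarrow> 'e dual \<Rightarrow>
   ('p set, 'f) mfd \<Rightarrow> ('p set \<Rightarrow> 'f \<Rightarrow> 'f \<Rightarrow> real) \<Rightarrow> bool" where
  "marsden_weinstein_reduction G P \<Omega> act J \<mu> Q \<omega> \<longleftrightarrow>
     symplectic_manifold P \<Omega> \<and> symplectic_action G P \<Omega> act \<and> momentum_map G P \<Omega> act J \<and>
     symplectic_manifold Q \<omega> \<and>
     (\<exists>N :: ('p, 'f) mfd. \<exists>\<pi>.
        embedded_submanifold N P \<and> pts N = {x \<in> pts P. J x = \<mu>} \<and>
        \<pi> = (\<lambda>x. (\<lambda>g. act g x) ` coad_isotropy G \<mu>) \<and>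
        pts Q = \<pi> ` pts N \<and> surj_submersion N Q \<pi> \<and>
        (\<forall>x\<in>pts N. \<forall>v\<in>model N. \<forall>w\<in>model N.
           \<omega> (\<pi> x) (tmap N Q \<pi> x v) (tmap N Q \<pi> x w) =
           \<Omega> x (tmap N P (\<lambda>y. y) x v) (tmap N P (\<lambda>y. y) x w)))"

text \<open>
  \<open>p : P \<rightarrow> M\<close> realises \<open>M\<close>, with the bracket \<open>br\<close>, as the Poisson reduction of \<open>P\<close>: \<open>M\<close> is the
  quotient of \<open>P\<close> by the action and pulling back along \<open>p\<close> intertwines the brackets.
\<close>

definition poisson_reduction ::
  "('g, 'e::fin_dim_inner) lgroup \<Rightarrow> ('p, 'f::real_normed_vector) mfd \<Rightarrow> ('p \<Rightarrow> 'f \<Rightarrow> 'f \<Rightarrow> real) \<Rightarrow>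
   ('g \<Rightarrow> 'p \<Rightarrow> 'p) \<Rightarrow> ('m, 'h::real_normed_vector) mfd \<Rightarrow> ('p \<Rightarrow> 'm) \<Rightarrow>
   (('m \<Rightarrow> real) \<Rightarrow> ('m \<Rightarrow> real) \<Rightarrow> 'm \<Rightarrow> real) \<Rightarrow> bool" where
  "poisson_reduction G P \<Omega> act M p br \<longleftrightarrow>
     symplectic_manifold P \<Omega> \<and> symplectic_action G P \<Omega> act \<and>
     smooth_manifold M \<and> surj_submersion P M p \<and>
     (\<forall>x\<in>pts P. \<forall>y\<in>pts P. p x = p y \<longleftrightarrow> (\<exists>g\<in>carrier G. y = act g x)) \<and>
     (\<forall>h k. smooth_fun M h \<and> smooth_fun M k \<longrightarrow> smooth_fun M (br h k) \<and>
        (\<forall>x\<in>pts P. poisson_bracket P \<Omega> (h \<circ> p) (k \<circ> p) x = br h k (p x)))"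

section \<open>The iterated cotangent bundle in its trivialization\<close>

type_synonym ('g, 'e) TTG = "'g \<times> 'e dual \<times> 'e dual \<times> 'e"
type_synonym 'e vTTG = "'e \<times> 'e dual \<times> 'e dual \<times> 'e"

definition TTG :: "('g, 'e::fin_dim_inner) lgroup \<Rightarrow> (('g, 'e) TTG, 'e vTTG) mfd" where
  "TTG G = prod_mfd (gmfd G) (prod_mfd vs_mfd (prod_mfd vs_mfd vs_mfd))"

definition TTG_vf :: "('g, 'e::fin_dim_inner) lgroup \<Rightarrow> 'e vTTG \<Rightarrow> ('g, 'e) TTG \<Rightarrow> 'e vTTG" where
  "TTG_vf G = (\<lambda>(\<eta>, l1, l2, \<zeta>) (g, \<mu>, \<nu>, \<xi>).
     (tmap (gmfd G) (gmfd G) (\<lambda>h. h \<otimes>\<^bsub>G\<^esub> g) \<one>\<^bsub>G\<^esub> \<eta>,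
      l1 + coad G \<eta> \<mu>,
      l2 + coad G \<eta> \<nu> - coad G \<xi> l1,
      \<zeta> + lie_bracket G \<xi> \<eta>))"

definition TTG_coeff_form ::
  "('g, 'e::fin_dim_inner) lgroup \<Rightarrow> ('g, 'e) TTG \<Rightarrow> 'e vTTG \<Rightarrow> 'e vTTG \<Rightarrow> real" where
  "TTG_coeff_form G = (\<lambda>(g, \<mu>, \<nu>, \<xi>) (\<eta>, l1, l2, \<zeta>) (\<eta>', l1', l2', \<zeta>').
     l2 \<eta>' + l1' (\<zeta> - lie_bracket G \<eta> \<xi>) - l2' \<eta> + l1 (lie_bracket G \<eta>' \<xi> - \<zeta>')
     + \<nu> (lie_bracket G \<eta> \<eta>'))"

definition TTG_form ::
  "('g, 'e::fin_dim_inner) lgroup \<Rightarrow> ('g, 'e) TTG \<Rightarrow> 'e vTTG \<Rightarrow> 'e vTTG \<Rightarrow> real" where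
  "TTG_form G x v w =
     TTG_coeff_form G x (THE a. TTG_vf G a x = v) (THE b. TTG_vf G b x = w)"

definition TTG_left ::
  "('g, 'e::fin_dim_inner) lgroup \<Rightarrow> 'g \<Rightarrow> ('g, 'e) TTG \<Rightarrow> ('g, 'e) TTG" where
  "TTG_left G g = (\<lambda>(h, \<mu>, \<nu>, \<xi>).
     (g \<otimes>\<^bsub>G\<^esub> h, coAd G (inv\<^bsub>G\<^esub> g) \<mu>, coAd G (inv\<^bsub>G\<^esub> g) \<nu>, Ad G (inv\<^bsub>G\<^esub> g) \<xi>))"

text \<open>
  Right translation, turned into a left action; in the right trivialization it only moves the
  base point, so that its invariants are the functions not depending on the group variable.
\<close>

definition TTG_right ::
  "('g, 'e::fin_dim_inner) lgroup \<Rightarrow> 'g \<Rightarrow> ('g, 'e) TTG \<Rightarrow> ('g, 'e) TTG" where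
  "TTG_right G g = (\<lambda>(h, m). (h \<otimes>\<^bsub>G\<^esub> inv\<^bsub>G\<^esub> g, m))"

definition TTG_momentum :: "('g, 'e::fin_dim_inner) TTG \<Rightarrow> 'e dual" where
  "TTG_momentum = (\<lambda>(g, \<mu>, \<nu>, \<xi>). \<nu>)"

definition indep_of_group ::
  "('g, 'e::fin_dim_inner) lgroup \<Rightarrow> (('g, 'e) TTG \<Rightarrow> real) \<Rightarrow> bool" where
  "indep_of_group G H \<longleftrightarrow> (\<forall>g\<in>carrier G. \<forall>g'\<in>carrier G. \<forall>m. H (g, m) = H (g', m))"

text \<open>Partial derivatives; the bidual is identified with the Lie algebra.\<close>

definition del_mu :: "('e::fin_dim_inner dual \<times> 'e dual \<times> 'e \<Rightarrow> real) \<Rightarrow> 'e dual \<times> 'e dual \<times> 'e \<Rightarrow> 'e"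
  where
  "del_mu h = (\<lambda>(\<mu>, \<nu>, \<xi>). THE x. ((\<lambda>m. h (m, \<nu>, \<xi>)) has_derivative (\<lambda>l. blinfun_apply l x)) (at \<mu>))"

definition del_nu :: "('e::fin_dim_inner dual \<times> 'e dual \<times> 'e \<Rightarrow> real) \<Rightarrow> 'e dual \<times> 'e dual \<times> 'e \<Rightarrow> 'e"
  where
  "del_nu h = (\<lambda>(\<mu>, \<nu>, \<xi>). THE x. ((\<lambda>n. h (\<mu>, n, \<xi>)) has_derivative (\<lambda>l. blinfun_apply l x)) (at \<nu>))"

definition del_xi ::
  "('e::fin_dim_inner dual \<times> 'e dual \<times> 'e \<Rightarrow> real) \<Rightarrow> 'e dual \<times> 'e dual \<times> 'e \<Rightarrow> 'e dual" where
  "del_xi h = (\<lambda>(\<mu>, \<nu>, \<xi>). THE l. ((\<lambda>x. h (\<mu>, \<nu>, x)) has_derivative blinfun_apply l) (at \<xi>))"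

definition reduced_bracket ::
  "('g, 'e::fin_dim_inner) lgroup \<Rightarrow> ('e dual \<times> 'e dual \<times> 'e \<Rightarrow> real) \<Rightarrow>
   ('e dual \<times> 'e dual \<times> 'e \<Rightarrow> real) \<Rightarrow> 'e dual \<times> 'e dual \<times> 'e \<Rightarrow> real" where
  "reduced_bracket G H K = (\<lambda>(\<mu>, \<nu>, \<xi>).
     let H\<mu> = del_mu H (\<mu>, \<nu>, \<xi>); H\<nu> = del_nu H (\<mu>, \<nu>, \<xi>); H\<xi> = del_xi H (\<mu>, \<nu>, \<xi>);
         K\<mu> = del_mu K (\<mu>, \<nu>, \<xi>); K\<nu> = del_nu K (\<mu>, \<nu>, \<xi>); K\<xi> = del_xi K (\<mu>, \<nu>, \<xi>)
     in blinfun_apply H\<xi> K\<mu> - blinfun_apply K\<xi> H\<mu> + blinfun_apply \<nu> (lie_bracket G H\<nu> K\<nu>)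
        + blinfun_apply (coad G K\<nu> H\<xi> - coad G H\<nu> K\<xi>) \<xi>
        + blinfun_apply \<mu> (lie_bracket G H\<mu> K\<nu> - lie_bracket G K\<mu> H\<nu>))"

end

theory Submission
  imports Defs
begin

text \<open>
  In the right trivialization the form of \<open>TTG\<close> is \<open>d\<theta>\<close> for the one-form
  \<open>\<theta> = \<nu>(\<eta>) - \<mu>(\<zeta> - [\<xi>, \<eta>])\<close>, \<open>\<eta>\<close> being the right Maurer--Cartan form, so closedness and
  smoothness reduce to the Maurer--Cartan equation; Hamiltonian vector fields can be written down,
  which gives the bracket and the momentum map. A section of the orbit map near the identity, from
  the inverse function theorem and the constancy of its rank (it is equivariant), translated by the
  group yields an atlas of the coadjoint orbit. On the level set \<open>\<nu> = \<mu>\<^sub>0\<close> the map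
  \<open>(g, \<mu>, \<nu>, \<xi>) \<mapsto> (Ad*\<^sub>g \<mu>\<^sub>0, Ad*\<^sub>g \<mu>, Ad\<^sub>g \<xi>)\<close> separates exactly the orbits of the isotropy group, and
  it is a submersion onto \<open>O \<times> \<gg>* \<times> \<gg>\<close> along which the product of the (negative)
  Kirillov--Kostant--Souriau form and the canonical form pulls back to the restricted form.
\<close>

section \<open>Smooth maps on open subsets of subspaces\<close>

text \<open>The tangent space at a point is the model space read in the chart chosen at that very
  point, so tangent vectors at neighbouring points live in unrelated charts. On the group this is
  cured by translating every derivative to the identity: the right logarithmic derivative has values
  in the fixed Lie algebra, and products, inverses, \<open>Ad\<close> and \<open>coAd\<close> get
  differentiation rules free of charts. \<open>lexp\<close> is a definite description and says
  nothing until one-parameter subgroups are known to exist and to be unique; the bracket is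
  therefore studied as the derivative of \<open>Ad\<close> at the identity and identified with
  \<open>lie_bracket\<close> afterwards. The dual carries no inner product and subspaces are not
  types, so dimension enters through explicit finite frames, and derivatives are taken within
  subspaces. The orbit form need not be exact globally; a local section into the group pulls back
  the Maurer-Cartan form and gives a potential in each chart. The points of the reduced space are
  sets, and its structure is moved there along a bijection with the product
  \<open>R\<close>.\<close>

abbreviation fd where "fd V f x \<equiv> frechet_derivative f (at x within V)"

text \<open>Both conditions are wanted together: the subspace contains the lines along which
  derivatives within it are unique, and relative openness lets the filter within \<open>V\<close> be
  exchanged for the one within \<open>S\<close>.\<close>

definition rel_open :: "'a::real_normed_vector set \<Rightarrow> 'a set \<Rightarrow> bool" where
  "rel_open V S \<longleftrightarrow> subspace V \<and> openin (top_of_set V) S"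

lemma rel_openD: "rel_open V S \<Longrightarrow> subspace V" "rel_open V S \<Longrightarrow> x \<in> S \<Longrightarrow> x \<in> V"
  unfolding rel_open_def by (auto dest: openin_imp_subset)

lemma rel_open_UNIV [simp]: "rel_open UNIV S \<longleftrightarrow> open S"
  by (simp add: rel_open_def)

lemma rel_open_Times: "rel_open V S \<Longrightarrow> rel_open W T \<Longrightarrow> rel_open (V \<times> W) (S \<times> T)"
  by (simp add: rel_open_def openin_Times subspace_Times)

lemma at_within_rel_open:
  assumes "rel_open V S" "x \<in> S" shows "at x within V = at x within S"
proof -
  obtain T where "open T" "S = V \<inter> T" using assms unfolding rel_open_def openin_open by auto
  then show ?thesis using assms by (intro at_within_nhd[of x T]) auto
qed

text \<open>The line \<open>x + t v\<close> stays inside the subspace, so composing with it reduces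
  the claim to uniqueness of derivatives of functions of one real variable.\<close>

lemma has_derivative_unique_subspace:
  assumes "(f has_derivative f') (at x within V)" "(f has_derivative g') (at x within V)"
    "subspace V" "x \<in> V" "v \<in> V"
  shows "f' v = g' v"
proof -
  let ?l = "\<lambda>t::real. x + t *\<^sub>R v"
  have l: "(?l has_derivative (\<lambda>t. t *\<^sub>R v)) (at 0)" by (auto intro!: derivative_eq_intros)
  have sub: "range ?l \<subseteq> V" using assms by (auto simp: subspace_add subspace_scale)
  have c: "((\<lambda>t. f (?l t)) has_derivative (\<lambda>t. h (t *\<^sub>R v))) (at 0)"
    if "(f has_derivative h) (at x within V)" for h
    using has_derivative_in_compose[OF l, of f h] has_derivative_subset[OF that sub] by simp
  have "(\<lambda>t. f' (t *\<^sub>R v)) = (\<lambda>t. g' (t *\<^sub>R v))"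
    using has_derivative_unique[OF c[OF assms(1)] c[OF assms(2)]] .
  from fun_cong[OF this, of 1] show ?thesis by simp
qed

text \<open>\<open>frechet_derivative\<close> is a choice among derivatives that may differ off
  \<open>V\<close>; on vectors of \<open>V\<close> the choice does not matter.\<close>

lemma fd_eq:
  assumes "(f has_derivative f') (at x within V)" "rel_open V S" "x \<in> S" "v \<in> V"
  shows "fd V f x v = f' v"
  using assms has_derivative_unique_subspace[of f "fd V f x" x V f' v]
    frechet_derivative_works[of f "at x within V"] rel_openD[OF assms(2)]
  by (auto simp: differentiable_def)

lemma fd_cong:
  assumes "rel_open V S" "x \<in> S" "\<And>y. y \<in> S \<Longrightarrow> f y = g y"
  shows "fd V f x = fd V g x" "f differentiable (at x within V) \<longleftrightarrow> g differentiable (at x within V)"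
proof -
  have "(f has_derivative f') (at x within V) \<longleftrightarrow> (g has_derivative f') (at x within V)" for f'
    unfolding at_within_rel_open[OF assms(1,2)]
    using has_derivative_transform[of x S f g f'] has_derivative_transform[of x S g f f'] assms by auto
  then show "fd V f x = fd V g x" "f differentiable (at x within V) \<longleftrightarrow> g differentiable (at x within V)"
    by (simp_all add: frechet_derivative_def differentiable_def)
qed

section \<open>Calculus of C^k maps on relatively open subsets of a subspace\<close>

lemma Ck_on_SucD:
  assumes "Ck_on (Suc k) V S f" "x \<in> S"
  shows "(f has_derivative fd V f x) (at x within V)"
  using assms by (simp add: frechet_derivative_works[symmetric])

lemma Ck_on_cong:
  assumes "rel_open V S" "\<And>x. x \<in> S \<Longrightarrow> f x = g x"
  shows "Ck_on k V S f \<longleftrightarrow> Ck_on k V S g"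
  using assms(2)
proof (induction k arbitrary: f g)
  case 0 then show ?case by (simp cong: continuous_on_cong)
next
  case (Suc k)
  have "Ck_on k V S (\<lambda>x. fd V f x v) \<longleftrightarrow> Ck_on k V S (\<lambda>x. fd V g x v)" for v
    by (rule Suc.IH) (simp add: fd_cong[OF assms(1) _ Suc.prems])
  then show ?case using fd_cong(2)[OF assms(1) _ Suc.prems] by auto
qed

text \<open>The recursive definition speaks of the chosen derivative; this form admits any explicit
  formula for it, and it closes most inductions on the order below.\<close>

lemma Ck_on_SucI:
  assumes "rel_open V S" "\<And>x. x \<in> S \<Longrightarrow> (f has_derivative f' x) (at x within V)"
    "\<And>v. v \<in> V \<Longrightarrow> Ck_on k V S (\<lambda>x. f' x v)"
  shows "Ck_on (Suc k) V S f"
proof -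
  have "Ck_on k V S (\<lambda>x. fd V f x v)" if "v \<in> V" for v
    using Ck_on_cong[OF assms(1), of "\<lambda>x. fd V f x v" "\<lambda>x. f' x v" k] assms(3)[OF that]
      fd_eq[OF assms(2) assms(1)] that by auto
  with assms(2) show ?thesis by (auto simp: differentiable_def)
qed

lemma Ck_on_continuous: "rel_open V S \<Longrightarrow> Ck_on k V S f \<Longrightarrow> continuous_on S f"
proof (cases k)
  case (Suc m)
  assume *: "rel_open V S" "Ck_on k V S f"
  have "continuous (at x within S) f" if "x \<in> S" for x
    using has_derivative_continuous[OF Ck_on_SucD[OF *(2)[unfolded Suc] that]]
      at_within_rel_open[OF *(1) that] by simp
  then show ?thesis by (simp add: continuous_on_eq_continuous_within)
qed simp

lemma Ck_on_Suc_imp: "rel_open V S \<Longrightarrow> Ck_on (Suc k) V S f \<Longrightarrow> Ck_on k V S f"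
proof (induction k arbitrary: f)
  case 0 then show ?case using Ck_on_continuous by (metis Ck_on.simps(1))
next
  case (Suc k)
  note * = iffD1[OF Ck_on.simps(2) Suc.prems(2)]
  show ?case
    by (rule iffD2[OF Ck_on.simps(2)], rule conjI[OF conjunct1[OF *]], rule ballI, rule Suc.IH[OF Suc.prems(1)])
      (rule bspec[OF conjunct2[OF *]])
qed

lemma Ck_on_subset: "Ck_on k V S f \<Longrightarrow> T \<subseteq> S \<Longrightarrow> Ck_on k V T f"
  by (induction k arbitrary: f) (auto intro: continuous_on_subset)

lemma Ck_on_local:
  assumes "rel_open V S" "\<And>x. x \<in> S \<Longrightarrow> \<exists>T. rel_open V T \<and> x \<in> T \<and> Ck_on k V T f"
  shows "Ck_on k V S f"
  using assms(2)
proof (induction k arbitrary: f)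
  case 0
  have "continuous (at x within S) f" if x: "x \<in> S" for x
  proof -
    obtain T where T: "rel_open V T" "x \<in> T" "continuous_on T f" using 0[OF x] by auto
    then show ?thesis
      using at_within_rel_open[OF T(1,2)] at_within_rel_open[OF assms(1) x]
      by (simp add: continuous_on_eq_continuous_within)
  qed
  then show ?case by (simp add: continuous_on_eq_continuous_within)
next
  case (Suc k)
  have "f differentiable (at x within V)" if "x \<in> S" for x using Suc.prems[OF that] by auto
  moreover have "Ck_on k V S (\<lambda>x. fd V f x v)" if "v \<in> V" for v
    by (rule Suc.IH) (use Suc.prems that in fastforce)
  ultimately show ?case by simp
qed

lemma Ck_on_const: "rel_open V S \<Longrightarrow> Ck_on k V S (\<lambda>x. c)"
proof (induction k arbitrary: c)
  case (Suc k) then show ?case by (intro Ck_on_SucI[where f'="\<lambda>x h. 0"]) auto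
qed simp

lemma Ck_on_bounded_linear: "rel_open V S \<Longrightarrow> bounded_linear L \<Longrightarrow> Ck_on k V S L"
proof (cases k)
  case (Suc m) assume "rel_open V S" "bounded_linear L"
  then show ?thesis unfolding Suc
    by (intro Ck_on_SucI[where f'="\<lambda>x. L"] Ck_on_const) (auto intro: bounded_linear_imp_has_derivative)
qed (auto intro: linear_continuous_on)

lemma Ck_on_linear_comp:
  "rel_open V S \<Longrightarrow> bounded_linear L \<Longrightarrow> Ck_on k V S f \<Longrightarrow> Ck_on k V S (\<lambda>x. L (f x))"
proof (induction k arbitrary: f)
  case 0 then show ?case by (auto intro: bounded_linear.continuous_on)
next
  case (Suc k)
  have "Ck_on k V S (\<lambda>x. fd V f x v)" if "v \<in> V" for v using Suc.prems(3) that by simp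
  then show ?case
    by (intro Ck_on_SucI[where f'="\<lambda>x v. L (fd V f x v)", OF Suc.prems(1)] Suc.IH Suc.prems
        bounded_linear.has_derivative[OF Suc.prems(2)] Ck_on_SucD[OF Suc.prems(3)])
qed

lemma Ck_on_add:
  "rel_open V S \<Longrightarrow> Ck_on k V S f \<Longrightarrow> Ck_on k V S g \<Longrightarrow> Ck_on k V S (\<lambda>x. f x + g x)"
proof (induction k arbitrary: f g)
  case 0 then show ?case by (auto intro: continuous_on_add)
next
  case (Suc k)
  then show ?case
    by (intro Ck_on_SucI[where f'="\<lambda>x v. fd V f x v + fd V g x v"])
      (auto intro!: has_derivative_add Ck_on_SucD)
qed

text \<open>The pair is the sum of the linear images \<open>(f x, 0)\<close> and
  \<open>(0, g x)\<close>, so the rules for sums and linear maps apply.\<close>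

lemma Ck_on_Pair:
  assumes "rel_open V S" "Ck_on k V S f" "Ck_on k V S g"
  shows "Ck_on k V S (\<lambda>x. (f x, g x))"
proof -
  have 1: "bounded_linear (\<lambda>x::'b. (x, 0::'c))" by (intro bounded_linear_Pair bounded_linear_ident bounded_linear_zero)
  have 2: "bounded_linear (\<lambda>x::'c. (0::'b, x))" by (intro bounded_linear_Pair bounded_linear_ident bounded_linear_zero)
  show ?thesis
    using Ck_on_add[OF assms(1) Ck_on_linear_comp[OF assms(1) 1 assms(2)] Ck_on_linear_comp[OF assms(1) 2 assms(3)]]
    by simp
qed

text \<open>By Leibniz the derivative is again a sum of two terms of the same shape with one factor
  differentiated; the induction hypothesis applies to each after the other factor has been lowered
  by one order.\<close>

lemma Ck_on_bilinear:
  "bounded_bilinear B \<Longrightarrow> rel_open V S \<Longrightarrow> Ck_on k V S f \<Longrightarrow> Ck_on k V S g \<Longrightarrow> Ck_on k V S (\<lambda>x. B (f x) (g x))"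
proof (induction k arbitrary: f g)
  case 0 then show ?case by (auto intro: bounded_bilinear.continuous_on)
next
  case (Suc k)
  note * = Ck_on_Suc_imp[OF Suc.prems(2,3)] Ck_on_Suc_imp[OF Suc.prems(2,4)]
  show ?case
  proof (rule Ck_on_SucI[where f'="\<lambda>x v. B (f x) (fd V g x v) + B (fd V f x v) (g x)"])
    show "((\<lambda>x. B (f x) (g x)) has_derivative (\<lambda>v. B (f x) (fd V g x v) + B (fd V f x v) (g x))) (at x within V)"
      if "x \<in> S" for x using that Suc.prems by (intro bounded_bilinear.FDERIV Ck_on_SucD)
    show "Ck_on k V S (\<lambda>x. B (f x) (fd V g x v) + B (fd V f x v) (g x))" if "v \<in> V" for v
      using that Suc.prems * by (intro Ck_on_add Suc.IH) auto
  qed (fact Suc.prems)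
qed

lemma Ck_on_sum:
  "rel_open V S \<Longrightarrow> (\<And>i. i \<in> I \<Longrightarrow> Ck_on k V S (f i)) \<Longrightarrow> Ck_on k V S (\<lambda>x. \<Sum>i\<in>I. f i x)"
  by (induction I rule: infinite_finite_induct) (auto intro!: Ck_on_add Ck_on_const)

text \<open>A form of finite dimension that passes to duals, products and subspaces: a finite list
  of vectors with bounded coefficient functionals on the whole type. The vectors need not be
  independent; only the expansion is ever used.\<close>

definition framed :: "'a::real_normed_vector set \<Rightarrow> bool" where
  "framed V \<longleftrightarrow> subspace V \<and> (\<exists>(n::nat) e c. (\<forall>i<n. e i \<in> V \<and> bounded_linear (c i)) \<and>
     (\<forall>x\<in>V. x = (\<Sum>i<n. c i x *\<^sub>R e i)))"

lemma framedE:
  assumes "framed V"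
  obtains n :: nat and e c where "\<And>i. i < n \<Longrightarrow> e i \<in> V" "\<And>i. i < n \<Longrightarrow> bounded_linear (c i :: 'a::real_normed_vector \<Rightarrow> real)"
    "\<And>x. x \<in> V \<Longrightarrow> x = (\<Sum>i<n. c i x *\<^sub>R e i)" "subspace V"
  using assms unfolding framed_def by blast

text \<open>A framed space is the equalizer of the identity and the continuous map that expands by
  the frame.\<close>

lemma framed_closed:
  assumes "framed (V::'a::real_normed_vector set)" shows "closed V"
proof -
  obtain n :: nat and e c where *: "\<And>i. i < n \<Longrightarrow> e i \<in> V" "\<And>i. i < n \<Longrightarrow> bounded_linear (c i :: 'a \<Rightarrow> real)"
    "\<And>x. x \<in> V \<Longrightarrow> x = (\<Sum>i<n. c i x *\<^sub>R e i)" "subspace V"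
    by (rule framedE[OF assms]) (rule that)
  have "V = {x. x = (\<Sum>i<n. c i x *\<^sub>R e i)}"
    using * by (auto intro!: subspace_sum subspace_scale) (metis (no_types, lifting) lessThan_iff subspace_scale subspace_sum)
  moreover have "closed \<dots>"
    by (intro closed_Collect_eq continuous_intros linear_continuous_on *(2)) auto
  ultimately show ?thesis by simp
qed

text \<open>Difference quotients along a line in \<open>V\<close> lie in \<open>W\<close>, and the
  derivative is their limit.\<close>

lemma has_derivative_in_closed_subspace:
  assumes "(f has_derivative f') (at x within V)" "rel_open V S" "x \<in> S" "v \<in> V"
    "\<And>y. y \<in> S \<Longrightarrow> f y \<in> W" "subspace W" "closed W"
  shows "f' v \<in> W"
proof -
  let ?l = "\<lambda>t::real. x + t *\<^sub>R v"
  have V: "subspace V" "x \<in> V" using rel_openD[OF assms(2)] assms(3) by auto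
  have l: "(?l has_derivative (\<lambda>t. t *\<^sub>R v)) (at 0)" by (auto intro!: derivative_eq_intros)
  have sub: "range ?l \<subseteq> V" using V assms by (auto simp: subspace_add subspace_scale)
  have "((\<lambda>t. f (?l t)) has_derivative (\<lambda>t. f' (t *\<^sub>R v))) (at 0)"
    using has_derivative_in_compose[OF l, of f f'] has_derivative_subset[OF assms(1) sub] by simp
  then have "((\<lambda>t. norm (f (?l t) - f x - t *\<^sub>R f' v) / norm t) \<longlongrightarrow> 0) (at 0)"
    using linear_simps(5)[OF has_derivative_bounded_linear[OF assms(1)]] by (simp add: has_derivative_at)
  then have "((\<lambda>t. norm ((f (?l t) - f x) /\<^sub>R t - f' v)) \<longlongrightarrow> 0) (at 0)"
  proof (rule Lim_transform_eventually)
    have "norm (f (?l t) - f x - t *\<^sub>R f' v) / norm t = norm ((f (?l t) - f x) /\<^sub>R t - f' v)" if "t \<noteq> 0" for t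
    proof -
      have "(f (?l t) - f x) /\<^sub>R t - f' v = (f (?l t) - f x - t *\<^sub>R f' v) /\<^sub>R t"
        using that by (simp add: algebra_simps)
      then show ?thesis using that by (simp add: divide_inverse mult.commute)
    qed
    then show "\<forall>\<^sub>F t in at 0. norm (f (?l t) - f x - t *\<^sub>R f' v) / norm t = norm ((f (?l t) - f x) /\<^sub>R t - f' v)"
      by (auto simp: eventually_at_filter)
  qed
  then have lim: "((\<lambda>t. (f (?l t) - f x) /\<^sub>R t) \<longlongrightarrow> f' v) (at 0)"
    using Lim_null tendsto_norm_zero_iff by blast
  obtain T where T: "open T" "S = V \<inter> T" using assms unfolding rel_open_def openin_open by auto
  have "open (?l -` T)" by (intro open_vimage T continuous_intros)
  then have "\<forall>\<^sub>F t in at 0. t \<in> ?l -` T"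
    using T assms by (intro eventually_at_in_open') auto
  then have "\<forall>\<^sub>F t in at 0. (f (?l t) - f x) /\<^sub>R t \<in> W"
    by eventually_elim (use T sub assms in \<open>auto intro!: subspace_scale subspace_diff\<close>)
  then show ?thesis using Lim_in_closed_set[OF assms(7) _ _ lim] by simp
qed

lemma linear_frame_expand:
  assumes "linear L" "x = (\<Sum>i<n. c i *\<^sub>R e i)"
  shows "L x = (\<Sum>i<n. c i *\<^sub>R L (e i))"
  using assms by (simp add: linear_sum linear_cmul o_def)

text \<open>The chain rule gives the derivative of \<open>g\<close> at the moving point
  \<open>f x\<close> in a moving direction, which the induction hypothesis does not cover. Expanding
  the direction in a frame of \<open>W\<close> turns this into a sum of scalar functions times
  derivatives of \<open>g\<close> in fixed directions.\<close>

lemma Ck_on_compose: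
  assumes "rel_open V S" "rel_open W T" "framed W" "\<And>x. x \<in> S \<Longrightarrow> f x \<in> T"
    "Ck_on k V S f" "Ck_on k W T g"
  shows "Ck_on k V S (\<lambda>x. g (f x))"
  using assms(5,6)
proof (induction k arbitrary: g)
  case 0
  then show ?case using assms by (auto intro: continuous_on_compose2)
next
  case (Suc k)
  obtain n :: nat and e c where fr: "\<And>i. i < n \<Longrightarrow> e i \<in> W" "\<And>i. i < n \<Longrightarrow> bounded_linear (c i :: 'b \<Rightarrow> real)"
    "\<And>x. x \<in> W \<Longrightarrow> x = (\<Sum>i<n. c i x *\<^sub>R e i)" "subspace W"
    by (rule framedE[OF assms(3)]) (rule that)
  note f1 = Ck_on_SucD[OF Suc.prems(1)] and g1 = Ck_on_SucD[OF Suc.prems(2)]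
  \<comment> \<open>The frame expands only vectors of \<open>W\<close>, so the derivative of
    \<open>f\<close> must be seen to stay there.\<close>
  have inW: "fd V f x v \<in> W" if "x \<in> S" "v \<in> V" for x v
    using has_derivative_in_closed_subspace[OF f1[OF that(1)] assms(1) that _ fr(4) framed_closed[OF assms(3)]]
      assms(4) rel_openD[OF assms(2)] by auto
  have expand: "fd W g (f x) (fd V f x v) = (\<Sum>i<n. c i (fd V f x v) *\<^sub>R fd W g (f x) (e i))"
    if "x \<in> S" "v \<in> V" for x v
    by (rule linear_frame_expand[OF _ fr(3)[OF inW[OF that]]])
      (use g1 assms(4) that has_derivative_linear in blast)
  have der: "((\<lambda>x. g (f x)) has_derivative (\<lambda>v. fd W g (f x) (fd V f x v))) (at x within V)" if "x \<in> S" for x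
  proof -
    have "(f has_derivative fd V f x) (at x within S)" "f ` S \<subseteq> W"
      using f1[OF that] at_within_rel_open[OF assms(1) that] assms(4) rel_openD[OF assms(2)] by auto
    moreover have "(g has_derivative fd W g (f x)) (at (f x) within W)" using g1 assms(4) that by blast
    ultimately show ?thesis
      unfolding at_within_rel_open[OF assms(1) that]
      by (intro has_derivative_in_compose[of f _ x S g]) (auto intro: has_derivative_subset)
  qed
  have "Ck_on k V S (\<lambda>x. fd W g (f x) (fd V f x v))" if v: "v \<in> V" for v
  proof -
    have "Ck_on k V S (\<lambda>x. \<Sum>i<n. c i (fd V f x v) *\<^sub>R fd W g (f x) (e i))"
    proof (intro Ck_on_sum Ck_on_bilinear[OF bounded_bilinear_scaleR] assms(1))
      fix i assume i: "i \<in> {..<n}"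
      show "Ck_on k V S (\<lambda>x. c i (fd V f x v))"
        by (rule Ck_on_linear_comp[OF assms(1) fr(2)]) (use Suc.prems(1) v i in auto)
      show "Ck_on k V S (\<lambda>x. fd W g (f x) (e i))"
        using Suc.IH[OF Ck_on_Suc_imp[OF assms(1) Suc.prems(1)]] Suc.prems(2) fr(1) i by auto
    qed
    then show ?thesis
      by (rule iffD2[OF Ck_on_cong[OF assms(1)], rotated]) (simp add: expand v)
  qed
  with der show ?case by (intro Ck_on_SucI[OF assms(1)])
qed

section \<open>Smooth maps: the same rules for all orders at once\<close>

lemma smooth_onD:
  assumes "smooth_on V S f" "x \<in> S"
  shows "(f has_derivative fd V f x) (at x within V)"
  using assms Ck_on_SucD[of 0 V S f x] unfolding smooth_on_def by blast

lemma smooth_on_fd: "smooth_on V S f \<Longrightarrow> v \<in> V \<Longrightarrow> smooth_on V S (\<lambda>x. fd V f x v)"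
  unfolding smooth_on_def
proof (intro allI)
  fix k assume "\<forall>k. Ck_on k V S f" "v \<in> V"
  then show "Ck_on k V S (\<lambda>x. fd V f x v)" using iffD1[OF Ck_on.simps(2)] by blast
qed

lemma smooth_on_cong: "rel_open V S \<Longrightarrow> (\<And>x. x \<in> S \<Longrightarrow> f x = g x) \<Longrightarrow> smooth_on V S f \<longleftrightarrow> smooth_on V S g"
  unfolding smooth_on_def by (intro all_cong1 Ck_on_cong)

lemma smooth_on_subset: "smooth_on V S f \<Longrightarrow> T \<subseteq> S \<Longrightarrow> smooth_on V T f"
  using Ck_on_subset unfolding smooth_on_def by blast

lemma smooth_on_local:
  assumes "rel_open V S" "\<And>x. x \<in> S \<Longrightarrow> \<exists>T. rel_open V T \<and> x \<in> T \<and> smooth_on V T f"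
  shows "smooth_on V S f"
  unfolding smooth_on_def
proof (intro allI Ck_on_local[OF assms(1)])
  fix k x assume "x \<in> S"
  then obtain T where "rel_open V T" "x \<in> T" "smooth_on V T f" using assms(2) by blast
  then show "\<exists>T. rel_open V T \<and> x \<in> T \<and> Ck_on k V T f" unfolding smooth_on_def by blast
qed

lemma smooth_on_continuous: "rel_open V S \<Longrightarrow> smooth_on V S f \<Longrightarrow> continuous_on S f"
  using Ck_on_continuous unfolding smooth_on_def by blast

lemma smooth_on_const: "rel_open V S \<Longrightarrow> smooth_on V S (\<lambda>x. c)"
  using Ck_on_const unfolding smooth_on_def by blast

lemma smooth_on_bounded_linear: "rel_open V S \<Longrightarrow> bounded_linear L \<Longrightarrow> smooth_on V S L"
  using Ck_on_bounded_linear unfolding smooth_on_def by blast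

lemma smooth_on_linear_comp:
  "rel_open V S \<Longrightarrow> bounded_linear L \<Longrightarrow> smooth_on V S f \<Longrightarrow> smooth_on V S (\<lambda>x. L (f x))"
  unfolding smooth_on_def by (intro allI Ck_on_linear_comp[of V S L _ f]) auto

lemma smooth_on_add: "rel_open V S \<Longrightarrow> smooth_on V S f \<Longrightarrow> smooth_on V S g \<Longrightarrow> smooth_on V S (\<lambda>x. f x + g x)"
  using Ck_on_add unfolding smooth_on_def by blast

lemma smooth_on_Pair: "rel_open V S \<Longrightarrow> smooth_on V S f \<Longrightarrow> smooth_on V S g \<Longrightarrow> smooth_on V S (\<lambda>x. (f x, g x))"
  using Ck_on_Pair unfolding smooth_on_def by blast

lemma smooth_on_bilinear:
  "bounded_bilinear B \<Longrightarrow> rel_open V S \<Longrightarrow> smooth_on V S f \<Longrightarrow> smooth_on V S g \<Longrightarrow> smooth_on V S (\<lambda>x. B (f x) (g x))"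
  unfolding smooth_on_def by (intro allI Ck_on_bilinear[of B V S _ f g]) auto

lemma smooth_on_uminus: "rel_open V S \<Longrightarrow> smooth_on V S f \<Longrightarrow> smooth_on V S (\<lambda>x. - f x)"
  by (rule smooth_on_linear_comp[OF _ bounded_linear_minus[OF bounded_linear_ident]])

lemma smooth_on_diff: "rel_open V S \<Longrightarrow> smooth_on V S f \<Longrightarrow> smooth_on V S g \<Longrightarrow> smooth_on V S (\<lambda>x. f x - g x)"
  using smooth_on_add[of V S f "\<lambda>x. - g x"] smooth_on_uminus[of V S g] by simp

lemma smooth_on_compose:
  assumes "smooth_on W T g" "smooth_on V S f" "rel_open V S" "rel_open W T" "framed W" "\<And>x. x \<in> S \<Longrightarrow> f x \<in> T"
  shows "smooth_on V S (\<lambda>x. g (f x))"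
  using assms(1,2) Ck_on_compose[where f=f and g=g, OF assms(3-6)] unfolding smooth_on_def by blast

lemma smooth_on_fd_mem:
  assumes "smooth_on V S f" "rel_open V S" "x \<in> S" "v \<in> V" "\<And>y. y \<in> S \<Longrightarrow> f y \<in> W" "framed W"
  shows "fd V f x v \<in> W"
  using has_derivative_in_closed_subspace[OF smooth_onD[OF assms(1,3)] assms(2-5)] framed_closed[OF assms(6)] assms(6)
  unfolding framed_def by auto

subsection \<open>Symmetry of second derivatives\<close>

lemma smooth_on_line:
  assumes "smooth_on V S f" "rel_open V S" "x + t *\<^sub>R u \<in> S" "u \<in> V" "x \<in> V"
  shows "((\<lambda>t. f (x + t *\<^sub>R u)) has_vector_derivative fd V f (x + t *\<^sub>R u) u) (at t)"
proof -
  let ?l = "\<lambda>t::real. x + t *\<^sub>R u"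
  note d = smooth_onD[OF assms(1,3)]
  have l: "(?l has_derivative (\<lambda>t. t *\<^sub>R u)) (at t)" by (auto intro!: derivative_eq_intros)
  have sub: "range ?l \<subseteq> V" using rel_openD(1)[OF assms(2)] assms by (auto simp: subspace_add subspace_scale)
  have "((\<lambda>t. f (?l t)) has_derivative (\<lambda>h. fd V f (?l t) (h *\<^sub>R u))) (at t)"
    using has_derivative_in_compose[OF l, of f] has_derivative_subset[OF d sub] by simp
  then show ?thesis unfolding has_vector_derivative_def
    using linear_simps(5)[OF has_derivative_bounded_linear[OF d]] by simp
qed

text \<open>The second difference of \<open>f\<close> over the parallelogram with sides
  \<open>t u\<close> and \<open>t v\<close> is \<open>t * t\<close> times a mixed derivative at an
  intermediate point, by two mean value theorems. It is symmetric in \<open>u\<close> and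
  \<open>v\<close>, and continuity of both mixed derivatives gives the limit as \<open>t\<close>
  tends to 0.\<close>

lemma second_derivative_symmetric_real:
  fixes f :: "'a::real_normed_vector \<Rightarrow> real"
  assumes sm: "smooth_on V S f" and S: "rel_open V S" and x: "x \<in> S" and uv: "u \<in> V" "v \<in> V"
  shows "fd V (\<lambda>y. fd V f y u) x v = fd V (\<lambda>y. fd V f y v) x u"
proof -
  have V: "subspace V" "x \<in> V" using rel_openD[OF S] x by auto
  define D where "D u v y = fd V (\<lambda>y. fd V f y u) y v" for u v y
  obtain T where T: "open T" "S = V \<inter> T" using S unfolding rel_open_def openin_open by auto
  then obtain d where d: "d > 0" "ball x d \<subseteq> T" using x open_contains_ball by blast
  \<comment> \<open>With this \<open>M\<close> the parallelogram of side \<open>t\<close> lies in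
    the ball of radius \<open>d\<close> as soon as \<open>t * M < d\<close>; the summand 1 keeps
    \<open>M\<close> positive when both vectors vanish.\<close>
  define M where "M = norm u + norm v + 1"
  have M: "M > 0" by (simp add: M_def add_nonneg_pos)
  have inS: "x + a *\<^sub>R u + b *\<^sub>R v \<in> S" if "\<bar>a\<bar> \<le> t" "\<bar>b\<bar> \<le> t" "t * M < d" for a b t
  proof -
    have "norm (a *\<^sub>R u + b *\<^sub>R v) \<le> t * norm u + t * norm v"
      using that by (intro norm_triangle_le) (auto intro!: add_mono mult_right_mono)
    also have "\<dots> \<le> t * M" using that by (simp add: M_def algebra_simps)
    finally have "dist (x + (a *\<^sub>R u + b *\<^sub>R v)) x < d" using that by (simp add: dist_norm)
    then have "x + a *\<^sub>R u + b *\<^sub>R v \<in> ball x d" by (simp add: dist_commute add.assoc)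
    then show ?thesis using d T V uv by (auto simp: subspace_add subspace_scale)
  qed
  \<comment> \<open>Stated for arbitrary directions because it is used once as it is and once with
    the two vectors exchanged.\<close>
  have key: "\<exists>a b. 0 \<le> a \<and> a \<le> t \<and> 0 \<le> b \<and> b \<le> t \<and>
      f (x + t *\<^sub>R u + t *\<^sub>R v) - f (x + t *\<^sub>R u) - f (x + t *\<^sub>R v) + f x = t * t * D u v (x + a *\<^sub>R u + b *\<^sub>R v)"
    if "0 < t" "t * M < d" "u \<in> V" "v \<in> V" 
      and inS: "\<And>a b. \<bar>a\<bar> \<le> t \<Longrightarrow> \<bar>b\<bar> \<le> t \<Longrightarrow> x + a *\<^sub>R u + b *\<^sub>R v \<in> S" for t u v
  proof -
    let ?g = "\<lambda>s. f (x + t *\<^sub>R v + s *\<^sub>R u) - f (x + s *\<^sub>R u)"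
    have "\<exists>z. 0 < z \<and> z < t \<and> ?g t - ?g 0 = (t - 0) * (fd V f (x + t *\<^sub>R v + z *\<^sub>R u) u - fd V f (x + z *\<^sub>R u) u)"
    proof (rule MVT2)
      fix s assume s: "0 \<le> s" "s \<le> t"
      have "x + t *\<^sub>R v + s *\<^sub>R u \<in> S" "x + s *\<^sub>R u \<in> S"
        using inS[of s t] inS[of s 0] s by (auto simp: algebra_simps)
      then show "DERIV ?g s :> fd V f (x + t *\<^sub>R v + s *\<^sub>R u) u - fd V f (x + s *\<^sub>R u) u"
        unfolding has_real_derivative_iff_has_vector_derivative
        using V that by (intro has_vector_derivative_diff smooth_on_line[OF sm S]) (auto simp: subspace_add subspace_scale)
    qed (use that in auto)
    then obtain a where a: "0 < a" "a < t"
      "?g t - ?g 0 = t * (fd V f (x + t *\<^sub>R v + a *\<^sub>R u) u - fd V f (x + a *\<^sub>R u) u)" by auto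
    let ?h = "\<lambda>s. fd V f (x + a *\<^sub>R u + s *\<^sub>R v) u"
    have "\<exists>z. 0 < z \<and> z < t \<and> ?h t - ?h 0 = (t - 0) * D u v (x + a *\<^sub>R u + z *\<^sub>R v)"
    proof (rule MVT2)
      fix s assume s: "0 \<le> s" "s \<le> t"
      have "x + a *\<^sub>R u + s *\<^sub>R v \<in> S" using inS[of a s] s a by auto
      then show "DERIV ?h s :> D u v (x + a *\<^sub>R u + s *\<^sub>R v)"
        unfolding has_real_derivative_iff_has_vector_derivative D_def
        using V that by (intro smooth_on_line[OF smooth_on_fd[OF sm] S]) (auto simp: subspace_add subspace_scale)
    qed (use that in auto)
    then obtain b where b: "0 < b" "b < t" "?h t - ?h 0 = t * D u v (x + a *\<^sub>R u + b *\<^sub>R v)" by auto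
    show ?thesis
    proof (intro exI conjI)
      show "f (x + t *\<^sub>R u + t *\<^sub>R v) - f (x + t *\<^sub>R u) - f (x + t *\<^sub>R v) + f x = t * t * D u v (x + a *\<^sub>R u + b *\<^sub>R v)"
        using a(3) b(3) by (simp add: algebra_simps)
    qed (use a b in auto)
  qed
  \<comment> \<open>A null sequence of side lengths; \<open>n + 2\<close> in place of
    \<open>n + 1\<close> makes \<open>s n * M < d\<close> strict already for
    \<open>n = 0\<close>.\<close>
  define s where "s n = d / (M * real (n + 2))" for n
  have s: "0 < s n" "s n * M < d" for n
  proof -
    show "0 < s n" using d M by (simp add: s_def)
    have "s n * M = d / real (n + 2)" using M by (simp add: s_def)
    also have "\<dots> < d" using d by (simp add: divide_less_eq)
    finally show "s n * M < d" .
  qed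
  have s0: "s \<longlonglongrightarrow> 0"
  proof -
    have "(\<lambda>n. (d / M) * inverse (real (Suc (Suc n)))) \<longlonglongrightarrow> (d / M) * 0"
      by (intro tendsto_mult tendsto_const LIMSEQ_Suc[OF LIMSEQ_inverse_real_of_nat])
    then show ?thesis by (simp add: s_def[abs_def] divide_inverse mult_ac add_ac)
  qed
  have lim: "(\<lambda>n. (f (x + s n *\<^sub>R u + s n *\<^sub>R v) - f (x + s n *\<^sub>R u) - f (x + s n *\<^sub>R v) + f x) / (s n * s n))
      \<longlonglongrightarrow> D u v x"
    if uv: "u \<in> V" "v \<in> V" and inS: "\<And>a b t. \<bar>a\<bar> \<le> t \<Longrightarrow> \<bar>b\<bar> \<le> t \<Longrightarrow> t * M < d \<Longrightarrow> x + a *\<^sub>R u + b *\<^sub>R v \<in> S" for u v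
  proof -
    have "\<exists>a b. 0 \<le> a \<and> a \<le> s n \<and> 0 \<le> b \<and> b \<le> s n \<and>
      f (x + s n *\<^sub>R u + s n *\<^sub>R v) - f (x + s n *\<^sub>R u) - f (x + s n *\<^sub>R v) + f x = s n * s n * D u v (x + a *\<^sub>R u + b *\<^sub>R v)" for n
      using key[OF s uv] inS[OF _ _ s(2)] by blast
    then obtain a b where ab: "\<And>n. 0 \<le> a n" "\<And>n. a n \<le> s n" "\<And>n. 0 \<le> b n" "\<And>n. b n \<le> s n"
      "\<And>n. f (x + s n *\<^sub>R u + s n *\<^sub>R v) - f (x + s n *\<^sub>R u) - f (x + s n *\<^sub>R v) + f x =
         s n * s n * D u v (x + a n *\<^sub>R u + b n *\<^sub>R v)" by metis
    have "a \<longlonglongrightarrow> 0" "b \<longlonglongrightarrow> 0"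
      by (rule tendsto_sandwich[OF _ _ tendsto_const s0]; simp add: ab)+
    then have "(\<lambda>n. x + a n *\<^sub>R u + b n *\<^sub>R v) \<longlonglongrightarrow> x + 0 *\<^sub>R u + 0 *\<^sub>R v" by (intro tendsto_intros)
    then have 1: "(\<lambda>n. x + a n *\<^sub>R u + b n *\<^sub>R v) \<longlonglongrightarrow> x" by simp
    have "continuous_on S (D u v)"
      unfolding D_def by (intro smooth_on_continuous[OF S] smooth_on_fd sm uv)
    moreover have "\<And>n. x + a n *\<^sub>R u + b n *\<^sub>R v \<in> S" subgoal for n by (rule inS[OF _ _ s(2)[of n]]) (simp_all add: ab) done
    ultimately have "(\<lambda>n. D u v (x + a n *\<^sub>R u + b n *\<^sub>R v)) \<longlonglongrightarrow> D u v x"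
      using 1 x unfolding continuous_on_sequentially o_def by simp
    moreover have "(f (x + s n *\<^sub>R u + s n *\<^sub>R v) - f (x + s n *\<^sub>R u) - f (x + s n *\<^sub>R v) + f x) / (s n * s n)
      = D u v (x + a n *\<^sub>R u + b n *\<^sub>R v)" for n using ab(5)[of n] s[of n] by simp
    ultimately show ?thesis by simp
  qed
  have swap: "x + a *\<^sub>R v + b *\<^sub>R u \<in> S" if "\<bar>a\<bar> \<le> t" "\<bar>b\<bar> \<le> t" "t * M < d" for a b t
    using inS[OF that(2,1,3)] by (simp add: algebra_simps)
  have "D u v x = D v u x"
    using LIMSEQ_unique[OF lim[OF uv inS] lim[OF uv(2,1) swap, THEN Lim_transform_eventually]]
    by (simp add: algebra_simps)
  then show ?thesis by (simp add: D_def)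
qed

lemma fd_linear_comp:
  assumes "bounded_linear L" "smooth_on V S f" "rel_open V S" "x \<in> S" "v \<in> V"
  shows "fd V (\<lambda>y. L (f y)) x v = L (fd V f x v)"
  using fd_eq[OF bounded_linear.has_derivative[OF assms(1) smooth_onD[OF assms(2,4)]] assms(3-5)] .

text \<open>The scalar case, applied to the inner products with all vectors of the target.\<close>

lemma second_derivative_symmetric:
  fixes f :: "'a::real_normed_vector \<Rightarrow> 'b::real_inner"
  assumes sm: "smooth_on V S f" and S: "rel_open V S" and x: "x \<in> S" and uv: "u \<in> V" "v \<in> V"
  shows "fd V (\<lambda>y. fd V f y u) x v = fd V (\<lambda>y. fd V f y v) x u"
proof (rule vector_eq_ldot[THEN iffD1], rule allI)
  fix b :: 'b
  have L: "bounded_linear (\<lambda>y. b \<bullet> y)" by (rule bounded_linear_inner_right)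
  have sb: "smooth_on V S (\<lambda>y. b \<bullet> f y)" by (rule smooth_on_linear_comp[OF S L sm])
  have "b \<bullet> fd V (\<lambda>y. fd V f y u) x v = fd V (\<lambda>y. fd V (\<lambda>y. b \<bullet> f y) y u) x v" if "u \<in> V" "v \<in> V" for u v
  proof -
    have "fd V (\<lambda>y. fd V (\<lambda>y. b \<bullet> f y) y u) x v = fd V (\<lambda>y. b \<bullet> fd V f y u) x v"
      by (rule fun_cong[OF fd_cong(1)[OF S x]]) (use fd_linear_comp[OF L sm S _ that(1)] in auto)
    then show ?thesis using fd_linear_comp[OF L smooth_on_fd[OF sm that(1)] S x that(2)] by simp
  qed
  then show "b \<bullet> fd V (\<lambda>y. fd V f y u) x v = b \<bullet> fd V (\<lambda>y. fd V f y v) x u"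
    using second_derivative_symmetric_real[OF sb S x uv] uv by simp
qed

section \<open>Finite-dimensional spaces\<close>

lemma framedI_finite:
  assumes "subspace V" "finite B" "B \<subseteq> V" "\<And>b. b \<in> B \<Longrightarrow> bounded_linear (c b :: 'a::real_normed_vector \<Rightarrow> real)"
    "\<And>x. x \<in> V \<Longrightarrow> x = (\<Sum>b\<in>B. c b x *\<^sub>R b)"
  shows "framed V"
proof -
  obtain h where h: "bij_betw h {..<card B} B"
    using ex_bij_betw_nat_finite[OF assms(2)] by (auto simp: atLeast0LessThan)
  have B: "h i \<in> B" if "i < card B" for i using h that by (auto simp: bij_betw_def)
  have "x = (\<Sum>i<card B. c (h i) x *\<^sub>R h i)" if "x \<in> V" for x
    using assms(5)[OF that] sum.reindex_bij_betw[OF h, of "\<lambda>b. c b x *\<^sub>R b"] by simp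
  then show ?thesis unfolding framed_def
    using assms(1,3,4) B by (intro conjI exI[of _ "card B"] exI[of _ h] exI[of _ "\<lambda>i. c (h i)"]) auto
qed

text \<open>After a finite spanning set has been made orthogonal, the coefficient of
  \<open>b\<close> is the inner product with \<open>b\<close> divided by that of \<open>b\<close>
  with itself, which is visibly bounded in \<open>x\<close>.\<close>

lemma framed_UNIV_fin_dim: "framed (UNIV :: 'a::fin_dim_inner set)"
proof -
  obtain B :: "'a set" where B: "finite B" "\<And>x. \<exists>c. x = (\<Sum>b\<in>B. c b *\<^sub>R b)" using fin_dim by blast
  obtain C where C: "finite C" "span C = span B" "pairwise orthogonal C" using basis_orthogonal[OF B(1)] by blast
  have span: "x \<in> span C" for x
    unfolding C(2) span_finite[OF B(1)] using B(2)[of x] by auto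
  show ?thesis
  proof (rule framedI_finite[OF subspace_UNIV C(1), where c="\<lambda>b x. (x \<bullet> b) / (b \<bullet> b)"])
    show "bounded_linear (\<lambda>x. (x \<bullet> b) / (b \<bullet> b))" for b :: 'a
      by (intro bounded_linear_compose[OF bounded_linear_divide bounded_linear_inner_left])
    fix x :: 'a
    obtain a where a: "x = (\<Sum>b\<in>C. a b *\<^sub>R b)" using span[of x] span_finite[OF C(1)] by auto
    have "((x \<bullet> b) / (b \<bullet> b)) *\<^sub>R b = a b *\<^sub>R b" if b: "b \<in> C" for b
    \<comment> \<open>The orthogonal spanning set is not known to be independent and may contain 0;
      there both sides vanish because of the factor \<open>b\<close>.\<close>
    proof (cases "b = 0")
      case False
      have "x \<bullet> b = (\<Sum>d\<in>C. a d * (d \<bullet> b))" by (simp add: a inner_sum_left)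
      also have "\<dots> = (\<Sum>d\<in>C. if d = b then a b * (b \<bullet> b) else 0)"
        using C(3) b by (intro sum.cong) (auto simp: pairwise_def orthogonal_def)
      finally show ?thesis using C(1) b False by simp
    qed simp
    then have "(\<Sum>b\<in>C. ((x \<bullet> b) / (b \<bullet> b)) *\<^sub>R b) = (\<Sum>b\<in>C. a b *\<^sub>R b)" by (rule sum.cong[OF refl])
    then show "x = (\<Sum>b\<in>C. ((x \<bullet> b) / (b \<bullet> b)) *\<^sub>R b)" using a by simp
  qed auto
qed

lemma framed_linear_bounded:
  assumes "framed (UNIV :: 'a::real_normed_vector set)" "linear (L :: 'a \<Rightarrow> 'b::real_normed_vector)"
  shows "bounded_linear L"
proof -
  obtain n :: nat and e and c :: "nat \<Rightarrow> 'a \<Rightarrow> real" where fr: "\<And>i. i < n \<Longrightarrow> e i \<in> (UNIV :: 'a set)" "\<And>i. i < n \<Longrightarrow> bounded_linear (c i)"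
    "\<And>x. x \<in> UNIV \<Longrightarrow> x = (\<Sum>i<n. c i x *\<^sub>R e i)" "subspace (UNIV :: 'a set)"
    by (rule framedE[OF assms(1)]) (rule that)
  have "L = (\<lambda>x. \<Sum>i<n. c i x *\<^sub>R L (e i))"
    by (rule ext, rule linear_frame_expand[OF assms(2) fr(3)]) simp
  moreover have "bounded_linear \<dots>"
    by (intro bounded_linear_sum bounded_linear_scaleR_const) (simp add: fr(2))
  ultimately show ?thesis by simp
qed

text \<open>A linear projection \<open>P\<close> onto \<open>W\<close> sends a frame of the whole
  space to one of \<open>W\<close>, with the same coefficient functionals.\<close>

lemma framed_subspace:
  fixes W :: "'a::real_normed_vector set"
  assumes "framed (UNIV :: 'a set)" "subspace W" shows "framed W"
proof -
  obtain n :: nat and e and c :: "nat \<Rightarrow> 'a \<Rightarrow> real" where fr: "\<And>i. i < n \<Longrightarrow> e i \<in> (UNIV :: 'a set)" "\<And>i. i < n \<Longrightarrow> bounded_linear (c i)"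
    "\<And>x. x \<in> UNIV \<Longrightarrow> x = (\<Sum>i<n. c i x *\<^sub>R e i)" "subspace (UNIV :: 'a set)"
    by (rule framedE[OF assms(1)]) (rule that)
  \<comment> \<open>A right inverse of the identity over \<open>W\<close> is a linear map into
    \<open>W\<close> that fixes \<open>W\<close> pointwise.\<close>
  obtain P where P: "range P \<subseteq> W" "linear P" "\<And>v. v \<in> W \<Longrightarrow> P v = v"
    using linear_exists_right_inverse_on[OF linear_id assms(2)] by auto
  have "x = (\<Sum>i<n. c i x *\<^sub>R P (e i))" if "x \<in> W" for x
    using linear_frame_expand[OF P(2) fr(3)[of x]] P(3)[OF that] by simp
  then show ?thesis unfolding framed_def
    using assms(2) fr(2) P(1) by (intro conjI exI[of _ n] exI[of _ "\<lambda>i. P (e i)"] exI[of _ c]) auto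
qed

lemma framed_singleton_0: "framed {0::'a::real_normed_vector}"
  by (rule framedI_finite[of _ "{}" "\<lambda>_ _. 0"]) auto

lemma framed_Times:
  assumes "framed (V::'a::real_normed_vector set)" "framed (W::'b::real_normed_vector set)"
  shows "framed (V \<times> W)"
proof -
  obtain n :: nat and e c where fr: "\<And>i. i < n \<Longrightarrow> e i \<in> V" "\<And>i. i < n \<Longrightarrow> bounded_linear (c i :: 'a \<Rightarrow> real)"
    "\<And>x. x \<in> V \<Longrightarrow> x = (\<Sum>i<n. c i x *\<^sub>R e i)" "subspace V"
    by (rule framedE[OF assms(1)]) (rule that)
  obtain m :: nat and e' c' where fr': "\<And>i. i < m \<Longrightarrow> e' i \<in> W" "\<And>i. i < m \<Longrightarrow> bounded_linear (c' i :: 'b \<Rightarrow> real)"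
    "\<And>x. x \<in> W \<Longrightarrow> x = (\<Sum>i<m. c' i x *\<^sub>R e' i)" "subspace W"
    by (rule framedE[OF assms(2)]) (rule that)
  define E where "E i = (if i < n then (e i, 0) else (0, e' (i - n)))" for i
  define C where "C i = (\<lambda>(x, y). if i < n then c i x else c' (i - n) y)" for i
  have sum: "(\<Sum>i<n + m. g i) = (\<Sum>i<n. g i) + (\<Sum>i<m. g (n + i))" for g :: "nat \<Rightarrow> 'a \<times> 'b"
    by (induction m) (auto simp: add.assoc)
  have lin: "bounded_linear (C i)" if "i < n + m" for i
    unfolding C_def split_def using fr(2) fr'(2) that
    by (cases "i < n") (auto intro!: bounded_linear_compose[OF _ bounded_linear_fst] bounded_linear_compose[OF _ bounded_linear_snd])
  have E: "E i \<in> V \<times> W" if "i < n + m" for i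
    using fr(1)[of i] fr'(1)[of "i - n"] that fr(4) fr'(4) by (auto simp: E_def subspace_0)
  have "z = (\<Sum>i<n + m. C i z *\<^sub>R E i)" if "z \<in> V \<times> W" for z
  proof -
    obtain x y where z: "z = (x, y)" "x \<in> V" "y \<in> W" using \<open>z \<in> V \<times> W\<close> by auto
    have "(\<Sum>i<n + m. C i z *\<^sub>R E i) = (\<Sum>i<n. (c i x *\<^sub>R e i, 0)) + (\<Sum>i<m. (0, c' i y *\<^sub>R e' i))"
      unfolding sum by (intro arg_cong2[where f="(+)"] sum.cong) (auto simp: C_def E_def z)
    also have "\<dots> = (x, 0) + (0, y)"
      using fr(3)[OF z(2)] fr'(3)[OF z(3)] by (simp add: sum_prod)
    finally show ?thesis by (simp add: z)
  qed
  then show ?thesis unfolding framed_def using lin E subspace_Times[OF fr(4) fr'(4)] by blast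
qed

text \<open>Dual frame: the coefficient functionals become the vectors, and evaluation at the old
  vectors gives the coefficients.\<close>

lemma framed_dual:
  assumes "framed (UNIV :: 'a::real_normed_vector set)"
  shows "framed (UNIV :: ('a \<Rightarrow>\<^sub>L real) set)"
proof -
  obtain n :: nat and e and c :: "nat \<Rightarrow> 'a \<Rightarrow> real" where fr: "\<And>i. i < n \<Longrightarrow> e i \<in> (UNIV :: 'a set)" "\<And>i. i < n \<Longrightarrow> bounded_linear (c i)"
    "\<And>x. x \<in> UNIV \<Longrightarrow> x = (\<Sum>i<n. c i x *\<^sub>R e i)" "subspace (UNIV :: 'a set)"
    by (rule framedE[OF assms(1)]) (rule that)
  have "\<mu> = (\<Sum>i<n. \<mu> (e i) *\<^sub>R Blinfun (c i))" for \<mu> :: "'a \<Rightarrow>\<^sub>L real"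
  proof (rule blinfun_eqI)
    fix x
    have "blinfun_apply \<mu> x = (\<Sum>i<n. c i x *\<^sub>R \<mu> (e i))"
      by (rule linear_frame_expand[OF _ fr(3)]) (auto intro: bounded_linear.linear blinfun.bounded_linear_right)
    then show "blinfun_apply \<mu> x = blinfun_apply (\<Sum>i<n. \<mu> (e i) *\<^sub>R Blinfun (c i)) x"
      by (simp add: blinfun.sum_left blinfun.scaleR_left bounded_linear_Blinfun_apply fr(2) mult.commute)
  qed
  then show ?thesis unfolding framed_def
    by (intro conjI exI[of _ n] exI[of _ "\<lambda>i. Blinfun (c i)"] exI[of _ "\<lambda>i \<mu>. blinfun_apply \<mu> (e i)"])
      (auto intro: blinfun.bounded_linear_left)
qed

lemma framed_span: "framed V \<Longrightarrow> \<exists>B. finite B \<and> V = span B"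
proof -
  assume "framed V"
  then obtain n :: nat and e c where fr: "\<And>i. i < n \<Longrightarrow> e i \<in> V" "\<And>i. i < n \<Longrightarrow> bounded_linear (c i :: 'a \<Rightarrow> real)"
    "\<And>x. x \<in> V \<Longrightarrow> x = (\<Sum>i<n. c i x *\<^sub>R e i)" "subspace V"
    by (rule framedE) (rule that)
  have "x \<in> span (e ` {..<n})" if "x \<in> V" for x
    by (subst fr(3)[OF that]) (intro span_sum span_scale span_base imageI)
  then have "V = span (e ` {..<n})"
    using span_minimal[of "e ` {..<n}" V] fr(1,4) by auto
  then show ?thesis by blast
qed

text \<open>Rational combinations of the frame are dense, and the balls of radius
  \<open>1 / (k + 1)\<close> about them form a countable base.\<close>

lemma framed_second_countable:
  assumes "framed (UNIV :: 'a::real_normed_vector set)"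
  shows "second_countable (euclidean :: 'a topology)"
proof -
  obtain n :: nat and e and c :: "nat \<Rightarrow> 'a \<Rightarrow> real" where fr: "\<And>i. i < n \<Longrightarrow> e i \<in> (UNIV :: 'a set)" "\<And>i. i < n \<Longrightarrow> bounded_linear (c i)"
    "\<And>x. x \<in> UNIV \<Longrightarrow> x = (\<Sum>i<n. c i x *\<^sub>R e i)" "subspace (UNIV :: 'a set)"
    by (rule framedE[OF assms(1)]) (rule that)
  define Q :: "(nat \<Rightarrow> real) set" where "Q = {..<n} \<rightarrow>\<^sub>E \<rat>"
  define D where "D = (\<lambda>q. \<Sum>i<n. q i *\<^sub>R e i) ` Q"
  define \<B> where "\<B> = (\<lambda>(x, k). ball x (1 / Suc k)) ` (D \<times> (UNIV :: nat set))"
  have "countable D" unfolding D_def Q_def by (intro countable_image countable_PiE countable_rat) auto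
  then have cB: "countable \<B>" unfolding \<B>_def by auto
  have dense: "\<exists>d\<in>D. dist d x < r" if "r > 0" for x r
  proof -
    \<comment> \<open>Coefficient errors below \<open>s\<close> add up to less than \<open>s\<close>
      times the denominator, that is \<open>r\<close>; the summand 1 keeps the denominator positive
      for an empty frame.\<close>
    define s where "s = r / (1 + (\<Sum>i<n. norm (e i)))"
    have pos: "1 + (\<Sum>i<n. norm (e i)) > 0" by (intro add_pos_nonneg sum_nonneg) auto
    have s: "s > 0" using that pos by (simp add: s_def)
    have "\<exists>q\<in>\<rat>. \<bar>q - c i x\<bar> < s" for i
      using Rats_dense_in_real[of "c i x" "c i x + s"] s by (auto simp: abs_less_iff) (smt (verit))
    then obtain q where q: "\<And>i. q i \<in> \<rat>" "\<And>i. \<bar>q i - c i x\<bar> < s" by metis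
    have "(\<Sum>i<n. q i *\<^sub>R e i) \<in> D"
      unfolding D_def Q_def
      by (intro image_eqI[of _ _ "restrict q {..<n}"]) (auto simp: q)
    moreover have "dist (\<Sum>i<n. q i *\<^sub>R e i) x < r"
    proof -
      have "dist (\<Sum>i<n. q i *\<^sub>R e i) x = norm (\<Sum>i<n. (q i - c i x) *\<^sub>R e i)"
        unfolding dist_norm by (subst fr(3)[of x]) (auto simp: sum_subtractf algebra_simps)
      also have "\<dots> \<le> (\<Sum>i<n. s * norm (e i))"
        by (intro sum_norm_le) (use less_imp_le[OF q(2)] in \<open>auto intro!: mult_right_mono\<close>)
      also have "\<dots> < s * (1 + (\<Sum>i<n. norm (e i)))"
        using s by (simp add: sum_distrib_left[symmetric] algebra_simps)
      also have "\<dots> = r" using pos by (simp add: s_def)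
      finally show ?thesis .
    qed
    ultimately show ?thesis by blast
  qed
  have "\<exists>V\<in>\<B>. x \<in> V \<and> V \<subseteq> U" if Ux: "open U" "x \<in> U" for U x
  proof -
    obtain r where r: "r > 0" "ball x r \<subseteq> U" by (rule openE[OF Ux])
    obtain k where k: "1 / real (Suc k) < r / 2" using r nat_approx_posE[of "r / 2"] by auto
    obtain d where d: "d \<in> D" "dist d x < 1 / Suc k" using dense[of "1 / Suc k" x] by auto
    have "ball d (1 / Suc k) \<subseteq> ball x r"
    proof
      fix y assume "y \<in> ball d (1 / Suc k)"
      then have "dist x y < 1 / Suc k + 1 / Suc k"
        using d dist_triangle[of x y d] by (simp add: dist_commute)
      then show "y \<in> ball x r" using k by simp
    qed
    then show ?thesis using d r unfolding \<B>_def by (intro bexI[of _ "ball d (1 / Suc k)"]) auto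
  qed
  then show ?thesis unfolding second_countable_def
    using cB by (intro exI[of _ \<B>]) (auto simp: \<B>_def)
qed

text \<open>Completeness, by convergence of the coordinates in a frame; it lets the contraction
  principle run on the Lie algebra.\<close>

instance fin_dim_inner \<subseteq> banach
proof
  fix X :: "nat \<Rightarrow> 'a" assume X: "Cauchy X"
  obtain n :: nat and e and c :: "nat \<Rightarrow> 'a \<Rightarrow> real" where fr: "\<And>i. i < n \<Longrightarrow> e i \<in> (UNIV :: 'a set)" "\<And>i. i < n \<Longrightarrow> bounded_linear (c i)"
    "\<And>x. x \<in> UNIV \<Longrightarrow> x = (\<Sum>i<n. c i x *\<^sub>R e i)" "subspace (UNIV :: 'a set)"
    by (rule framedE[OF framed_UNIV_fin_dim]) (rule that)
  have "\<exists>l. i < n \<longrightarrow> (\<lambda>k. c i (X k)) \<longlonglongrightarrow> l" for i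
    using bounded_linear.Cauchy[OF fr(2) X, of i] by (auto simp: Cauchy_convergent_iff convergent_def)
  then obtain l where l: "\<And>i. i < n \<Longrightarrow> (\<lambda>k. c i (X k)) \<longlonglongrightarrow> l i" by metis
  have "(\<lambda>k. \<Sum>i<n. c i (X k) *\<^sub>R e i) \<longlonglongrightarrow> (\<Sum>i<n. l i *\<^sub>R e i)"
    by (intro tendsto_sum tendsto_scaleR l) auto
  then show "convergent X" using fr(3) by (auto simp: convergent_def)
qed

section \<open>Inverse function theorem and ordinary differential equations\<close>

text \<open>Continuity of the derivative is known direction by direction; the finitely many frame
  directions, weighted by the norms of the coefficient functionals, bound it uniformly in
  \<open>v\<close>.\<close>

lemma derivative_locally_close:
  assumes "framed (UNIV :: 'a::real_normed_vector set)" "smooth_on UNIV S (f :: 'a \<Rightarrow> 'b::real_normed_vector)" "open S" "x0 \<in> S" "0 < \<epsilon>"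
  shows "\<exists>r>0. cball x0 r \<subseteq> S \<and> (\<forall>x\<in>cball x0 r. \<forall>v. norm (fd UNIV f x v - fd UNIV f x0 v) \<le> \<epsilon> * norm v)"
proof -
  obtain n :: nat and e and c :: "nat \<Rightarrow> 'a \<Rightarrow> real" where fr: "\<And>i. i < n \<Longrightarrow> e i \<in> (UNIV :: 'a set)" "\<And>i. i < n \<Longrightarrow> bounded_linear (c i)"
    "\<And>x. x \<in> UNIV \<Longrightarrow> x = (\<Sum>i<n. c i x *\<^sub>R e i)" "subspace (UNIV :: 'a set)"
    by (rule framedE[OF assms(1)]) (rule that)
  define h where "h x = (\<Sum>i<n. onorm (c i) * norm (fd UNIV f x (e i) - fd UNIV f x0 (e i)))" for x
  have "continuous_on S (\<lambda>x. fd UNIV f x (e i))" for i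
    using smooth_on_continuous[OF _ smooth_on_fd[OF assms(2)]] assms(3) by simp
  then have "continuous_on S h" unfolding h_def by (intro continuous_intros)
  moreover have "h x0 = 0" by (simp add: h_def)
  ultimately have "\<forall>\<^sub>F x in at x0 within S. dist (h x) 0 < \<epsilon>"
    using assms(4,5) unfolding continuous_on_def by (metis tendstoD)
  then obtain d where d: "d > 0" "\<And>x. x \<in> S \<Longrightarrow> x \<noteq> x0 \<Longrightarrow> dist x x0 < d \<Longrightarrow> dist (h x) 0 < \<epsilon>"
    unfolding eventually_at by blast
  obtain d' where d': "d' > 0" "cball x0 d' \<subseteq> S" using assms(3,4) open_contains_cball by blast
  have bound: "norm (fd UNIV f x v - fd UNIV f x0 v) \<le> h x * norm v" if "x \<in> S" for x v
  proof -
    have exp: "fd UNIV f y v = (\<Sum>i<n. c i v *\<^sub>R fd UNIV f y (e i))" if "y \<in> S" for y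
      by (rule linear_frame_expand[OF has_derivative_linear[OF smooth_onD[OF assms(2) that]] fr(3)]) simp
    have "norm (fd UNIV f x v - fd UNIV f x0 v) = norm (\<Sum>i<n. c i v *\<^sub>R (fd UNIV f x (e i) - fd UNIV f x0 (e i)))"
      using exp[OF that] exp[OF assms(4)] by (simp add: sum_subtractf scaleR_diff_right)
    also have "\<dots> \<le> (\<Sum>i<n. (onorm (c i) * norm v) * norm (fd UNIV f x (e i) - fd UNIV f x0 (e i)))"
      by (intro sum_norm_le) (auto intro!: mult_right_mono onorm[OF fr(2), simplified])
    also have "\<dots> = h x * norm v" by (simp add: h_def sum_distrib_right sum_distrib_left mult_ac)
    finally show ?thesis .
  qed
  have small: "h x \<le> \<epsilon>" if "x \<in> S" "dist x x0 < d" for x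
    using d(2)[OF that(1) _ that(2)] \<open>h x0 = 0\<close> assms(5) by (cases "x = x0") auto
  show ?thesis
  proof (intro exI[of _ "min d' (d / 2)"] conjI ballI allI)
    show "0 < min d' (d / 2)" "cball x0 (min d' (d / 2)) \<subseteq> S" using d d' by auto
    fix x v assume x: "x \<in> cball x0 (min d' (d / 2))"
    then have "x \<in> S" "dist x x0 < d" using d d' by (auto simp: dist_commute subset_iff)
    then show "norm (fd UNIV f x v - fd UNIV f x0 v) \<le> \<epsilon> * norm v"
      using bound[of x v] small[of x] mult_right_mono[of "h x" \<epsilon> "norm v"] by auto
  qed
qed

lemma lipschitz_of_derivative_bound:
  assumes "convex S" "\<And>x. x \<in> S \<Longrightarrow> (f has_derivative f' x) (at x)" "\<And>x v. x \<in> S \<Longrightarrow> norm (f' x v) \<le> B * norm v" "0 \<le> B"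
    "x \<in> S" "y \<in> S"
  shows "norm (f x - f y) \<le> B * norm (x - y)"
  by (rule differentiable_bound[OF assms(1), of f f'])
    (use assms in \<open>auto intro: has_derivative_at_withinI onorm_bound\<close>)

text \<open>A product rule in which \<open>b\<close> merely has a limit: since \<open>s\<close>
  vanishes at the point, the error \<open>s x (b x - b0)\<close> is of smaller order than
  \<open>x - x0\<close>.\<close>

lemma has_derivative_scaleR_at_zero:
  fixes s :: "'a::real_normed_vector \<Rightarrow> real" and b :: "'a \<Rightarrow> 'b::real_normed_vector"
  assumes s: "(s has_derivative s') (at x0)" and z: "s x0 = 0" and b: "(b \<longlongrightarrow> b0) (at x0)"
  shows "((\<lambda>x. s x *\<^sub>R b x) has_derivative (\<lambda>v. s' v *\<^sub>R b0)) (at x0)"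
proof -
  have bl: "bounded_linear s'" using s by (rule has_derivative_bounded_linear)
  have "((\<lambda>x. s x *\<^sub>R (b x - b0)) has_derivative (\<lambda>v. 0)) (at x0)"
    unfolding has_derivative_at2
  proof (intro conjI bounded_linear_zero)
    let ?r = "\<lambda>y. (1 / norm (y - x0)) *\<^sub>R (s y - (s x0 + s' (y - x0)))"
    have "((\<lambda>y. (norm (?r y) + onorm s') * norm (b y - b0)) \<longlongrightarrow> (norm (0::real) + onorm s') * norm (b0 - b0)) (at x0)"
      using s unfolding has_derivative_at2 by (intro tendsto_intros b) auto
    then have lim: "((\<lambda>y. (norm (?r y) + onorm s') * norm (b y - b0)) \<longlongrightarrow> 0) (at x0)" by simp
    show "((\<lambda>y. (1 / norm (y - x0)) *\<^sub>R (s y *\<^sub>R (b y - b0) - (s x0 *\<^sub>R (b x0 - b0) + 0))) \<longlongrightarrow> 0) (at x0)"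
    proof (rule Lim_null_comparison[OF _ lim], unfold eventually_at_filter, rule always_eventually, intro allI impI)
      fix y assume "y \<noteq> x0"
      then have n: "norm (y - x0) > 0" by simp
      have "\<bar>s y\<bar> \<le> \<bar>s y - s' (y - x0)\<bar> + \<bar>s' (y - x0)\<bar>" by linarith
      also have "\<dots> \<le> \<bar>s y - s' (y - x0)\<bar> + onorm s' * norm (y - x0)"
        using onorm[OF bl, of "y - x0"] by simp
      finally have "\<bar>s y\<bar> / norm (y - x0) \<le> \<bar>s y - s' (y - x0)\<bar> / norm (y - x0) + onorm s'"
        using n by (simp add: field_simps)
      then have "(\<bar>s y\<bar> / norm (y - x0)) * norm (b y - b0) \<le> (norm (?r y) + onorm s') * norm (b y - b0)"
        using z n by (intro mult_right_mono) (auto simp: abs_mult)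
      then show "norm ((1 / norm (y - x0)) *\<^sub>R (s y *\<^sub>R (b y - b0) - (s x0 *\<^sub>R (b x0 - b0) + 0))) \<le> (norm (?r y) + onorm s') * norm (b y - b0)"
        using z by simp
    qed
  qed
  from has_derivative_add[OF this has_derivative_scaleR_left[OF s, of b0]] show ?thesis
    by (simp add: algebra_simps)
qed

text \<open>Smoothness of the inverse of a smooth family of invertible operators: the difference
  quotient of \<open>B x u\<close> is governed by \<open>B x u - B x\<^sub>0 u = - B x ((A x - A x\<^sub>0) (B x\<^sub>0 u))\<close>.\<close>

lemma Ck_on_inverse_family:
  fixes A B :: "'x::real_normed_vector \<Rightarrow> 'a::real_normed_vector \<Rightarrow> 'a"
  assumes fr: "framed (UNIV :: 'a set)" and S: "open S"
    and lin: "\<And>x. x \<in> S \<Longrightarrow> linear (A x)" "\<And>x. x \<in> S \<Longrightarrow> linear (B x)"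
    and inv: "\<And>x u. x \<in> S \<Longrightarrow> A x (B x u) = u" "\<And>x u. x \<in> S \<Longrightarrow> B x (A x u) = u"
    and bd: "\<And>x u. x \<in> S \<Longrightarrow> norm (B x u) \<le> K * norm u"
  shows "(\<And>u. Ck_on k UNIV S (\<lambda>x. A x u)) \<Longrightarrow> Ck_on k UNIV S (\<lambda>x. B x u)"
proof -
  obtain n :: nat and e and c :: "nat \<Rightarrow> 'a \<Rightarrow> real" where fr: "\<And>i. i < n \<Longrightarrow> e i \<in> (UNIV :: 'a set)" "\<And>i. i < n \<Longrightarrow> bounded_linear (c i)"
    "\<And>x. x \<in> UNIV \<Longrightarrow> x = (\<Sum>i<n. c i x *\<^sub>R e i)" "subspace (UNIV :: 'a set)"
    by (rule framedE[OF assms(1)]) (rule that)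
  have RO: "rel_open UNIV S" using S by simp
  have diff: "B x u - B x0 u = - B x (A x (B x0 u) - A x0 (B x0 u))" if "x \<in> S" "x0 \<in> S" for x x0 u
    using that lin by (simp add: inv linear_diff)
  have cont: "continuous_on S (\<lambda>x. B x u)" if cA: "\<And>u. continuous_on S (\<lambda>x. A x u)" for u
    unfolding continuous_on_def
  proof
    fix x0 assume x0: "x0 \<in> S"
    have "((\<lambda>x. norm (A x (B x0 u) - A x0 (B x0 u))) \<longlongrightarrow> 0) (at x0 within S)"
      using cA[of "B x0 u"] x0 unfolding continuous_on_def
      by (intro tendsto_norm_zero) (simp add: LIM_zero)
    then have "((\<lambda>x. K * norm (A x (B x0 u) - A x0 (B x0 u))) \<longlongrightarrow> 0) (at x0 within S)"
      using tendsto_mult_right_zero by blast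
    moreover have "\<forall>\<^sub>F x in at x0 within S. norm (B x u - B x0 u) \<le> K * norm (A x (B x0 u) - A x0 (B x0 u))"
      unfolding eventually_at_topological using bd x0 by (intro exI[of _ UNIV]) (auto simp: diff)
    ultimately have "((\<lambda>x. B x u - B x0 u) \<longlongrightarrow> 0) (at x0 within S)"
      by (rule Lim_null_comparison[rotated])
    then show "((\<lambda>x. B x u) \<longlongrightarrow> B x0 u) (at x0 within S)" by (simp add: LIM_zero_iff)
  qed
  show "(\<And>u. Ck_on k UNIV S (\<lambda>x. A x u)) \<Longrightarrow> Ck_on k UNIV S (\<lambda>x. B x u)"
  proof (induction k arbitrary: u)
    case 0 then show ?case using cont by simp
  next
    case (Suc k)
    note IH = Suc.IH[OF Ck_on_Suc_imp[OF RO Suc.prems]]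
    have cB: "continuous_on S (\<lambda>x. B x u)" for u using Ck_on_continuous[OF RO IH] .
    define A' where "A' x u v = fd UNIV (\<lambda>x. A x u) x v" for x u v
    have dA: "((\<lambda>x. A x u) has_derivative A' x u) (at x)" if "x \<in> S" for x u
      using Ck_on_SucD[OF Suc.prems[of u] that] unfolding A'_def by simp
    \<comment> \<open>The derivative in the parameter stays linear in the argument, so it can later
      be evaluated at the moving argument \<open>B x u\<close>.\<close>
    have A'sum: "A' x w v = (\<Sum>i<n. c i w *\<^sub>R A' x (e i) v)" if "x \<in> S" for x w v
    proof -
      have "A y w = (\<Sum>i<n. c i w *\<^sub>R A y (e i))" if "y \<in> S" for y
        by (rule linear_frame_expand[OF lin(1)[OF that] fr(3)]) simp
      moreover have "((\<lambda>y. \<Sum>i<n. c i w *\<^sub>R A y (e i)) has_derivative (\<lambda>v. \<Sum>i<n. c i w *\<^sub>R A' x (e i) v)) (at x)"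
        by (intro has_derivative_sum has_derivative_scaleR_right dA that)
      ultimately have "((\<lambda>y. A y w) has_derivative (\<lambda>v. \<Sum>i<n. c i w *\<^sub>R A' x (e i) v)) (at x)"
        using has_derivative_transform_within_open[OF _ S that] by (metis (no_types, lifting))
      from has_derivative_unique[OF dA[OF that] this] show ?thesis by metis
    qed
    \<comment> \<open>Each coordinate of \<open>A x (B x0 u) - A x0 (B x0 u)\<close> is
      differentiable and vanishes at \<open>x0\<close>, while \<open>B x (e i)\<close> only has to
      converge. Continuity of \<open>B\<close> thus already yields its derivative.\<close>
    have der: "((\<lambda>x. B x u) has_derivative (\<lambda>v. - B x0 (A' x0 (B x0 u) v))) (at x0)" if x0: "x0 \<in> S" for x0
    proof -
      let ?q = "\<lambda>x. A x (B x0 u) - A x0 (B x0 u)"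
      have "((\<lambda>x. c i (?q x) *\<^sub>R B x (e i)) has_derivative (\<lambda>v. c i (A' x0 (B x0 u) v) *\<^sub>R B x0 (e i))) (at x0)"
        if i: "i < n" for i
      proof -
        have 1: "((\<lambda>x. c i (?q x)) has_derivative (\<lambda>v. c i (A' x0 (B x0 u) v))) (at x0)"
          using has_derivative_diff[OF dA[OF x0] has_derivative_const]
          by (intro bounded_linear.has_derivative[OF fr(2)[OF i]]) simp
        have z: "c i (?q x0) = 0" using linear_0[OF bounded_linear.linear[OF fr(2)[OF i]]] by simp
        have "((\<lambda>x. B x (e i)) \<longlongrightarrow> B x0 (e i)) (at x0)"
          using cB[of "e i"] x0 unfolding continuous_on_def by (metis at_within_open[OF x0 S])
        then show ?thesis
          using has_derivative_scaleR_at_zero[OF 1 z] by blast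
      qed
      then have "((\<lambda>x. - (\<Sum>i<n. c i (?q x) *\<^sub>R B x (e i))) has_derivative (\<lambda>v. - (\<Sum>i<n. c i (A' x0 (B x0 u) v) *\<^sub>R B x0 (e i)))) (at x0)"
        by (intro has_derivative_minus has_derivative_sum) auto
      then have "((\<lambda>x. - (\<Sum>i<n. c i (?q x) *\<^sub>R B x (e i))) has_derivative (\<lambda>v. - B x0 (A' x0 (B x0 u) v))) (at x0)"
        by (simp only: linear_frame_expand[OF lin(2)[OF x0] fr(3)[OF UNIV_I], of "A' x0 (B x0 u) v" for v])
      then have "((\<lambda>x. - B x (?q x)) has_derivative (\<lambda>v. - B x0 (A' x0 (B x0 u) v))) (at x0)"
        by (rule has_derivative_transform_within_open[OF _ S x0])
          (simp add: linear_frame_expand[OF lin(2) fr(3)[OF UNIV_I]])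
      then have "((\<lambda>x. B x u - B x0 u) has_derivative (\<lambda>v. - B x0 (A' x0 (B x0 u) v))) (at x0)"
        by (rule has_derivative_transform_within_open[OF _ S x0]) (simp add: diff x0)
      from has_derivative_add[OF this has_derivative_const[of "B x0 u"]] show ?thesis by simp
    qed
    show ?case
    proof (rule Ck_on_SucI[OF RO, where f'="\<lambda>x v. - B x (A' x (B x u) v)"])
      show "((\<lambda>x. B x u) has_derivative (\<lambda>v. - B x (A' x (B x u) v))) (at x)" if "x \<in> S" for x
        using der[OF that] .
      fix v :: 'x
      have C: "Ck_on k UNIV S (\<lambda>x. - (\<Sum>j<n. c j (\<Sum>i<n. c i (B x u) *\<^sub>R A' x (e i) v) *\<^sub>R B x (e j)))"
      proof (intro Ck_on_linear_comp[OF RO bounded_linear_minus[OF bounded_linear_ident]] Ck_on_sum RO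
            Ck_on_bilinear[OF bounded_bilinear_scaleR] IH)
        fix j assume "j \<in> {..<n}"
        show "Ck_on k UNIV S (\<lambda>x. c j (\<Sum>i<n. c i (B x u) *\<^sub>R A' x (e i) v))"
        proof (rule Ck_on_linear_comp[OF RO fr(2)])
          show "j < n" using \<open>j \<in> {..<n}\<close> by simp
          have "Ck_on k UNIV S (\<lambda>x. c i (B x u))" if "i < n" for i
            by (rule Ck_on_linear_comp[OF RO fr(2)[OF that] IH])
          moreover have "Ck_on k UNIV S (\<lambda>x. A' x (e i) v)" for i using Suc.prems[of "e i"] by (simp add: A'_def)
          ultimately show "Ck_on k UNIV S (\<lambda>x. \<Sum>i<n. c i (B x u) *\<^sub>R A' x (e i) v)"
            by (intro Ck_on_sum[OF RO] Ck_on_bilinear[OF bounded_bilinear_scaleR RO]) auto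
        qed
      qed
      have E: "- (\<Sum>j<n. c j (\<Sum>i<n. c i (B x u) *\<^sub>R A' x (e i) v) *\<^sub>R B x (e j)) = - B x (A' x (B x u) v)"
        if "x \<in> S" for x
        using linear_frame_expand[OF lin(2)[OF that] fr(3)[OF UNIV_I], of "A' x (B x u) v"]
          A'sum[OF that, of "B x u" v] by (simp only:)
      show "Ck_on k UNIV S (\<lambda>x. - B x (A' x (B x u) v))"
        by (rule iffD1[OF Ck_on_cong[OF RO E] C])
    qed
  qed
qed


text \<open>Normalised to the identity as derivative at \<open>x0\<close>, which the coordinates
  used for the orbit will satisfy. Solving \<open>f x = y\<close> means finding a fixed point of the
  map that sends \<open>x\<close> to \<open>y + (x - f x)\<close>, a contraction near
  \<open>x0\<close>. The neighbourhood \<open>U\<close> records where \<open>g\<close> is also a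
  left inverse.\<close>

lemma inverse_function_smooth:
  fixes f :: "'a::banach \<Rightarrow> 'a"
  assumes fr: "framed (UNIV :: 'a set)" and S: "open S" "x0 \<in> S" and sm: "smooth_on UNIV S f"
    and id: "\<And>v. fd UNIV f x0 v = v"
  obtains r g U where "r > 0" "smooth_on UNIV (ball (f x0) r) g"
    "\<And>y. y \<in> ball (f x0) r \<Longrightarrow> g y \<in> U \<and> f (g y) = y"
    "open U" "x0 \<in> U" "U \<subseteq> S" "\<And>x. x \<in> U \<Longrightarrow> f x \<in> ball (f x0) r \<and> g (f x) = x"
proof -
  obtain d where d: "d > 0" "cball x0 d \<subseteq> S"
    "\<And>x v. x \<in> cball x0 d \<Longrightarrow> norm (fd UNIV f x v - v) \<le> 1 / 2 * norm v"
    using derivative_locally_close[OF fr sm S, of "1 / 2"] id by auto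
  define h where "h x = x - f x" for x
  have der: "(f has_derivative fd UNIV f x) (at x)" if "x \<in> S" for x using smooth_onD[OF sm that] by simp
  have lip: "norm (h x - h y) \<le> 1 / 2 * norm (x - y)" if "x \<in> cball x0 d" "y \<in> cball x0 d" for x y
    unfolding h_def
    by (rule lipschitz_of_derivative_bound[OF convex_cball _ _ _ that, where f'="\<lambda>x v. v - fd UNIV f x v"])
      (use d der in \<open>auto intro!: derivative_eq_intros simp: subset_iff norm_minus_commute\<close>)
  have ex1: "\<exists>!x. x \<in> cball x0 d \<and> y + h x = x" and inball: "\<And>x. x \<in> cball x0 d \<Longrightarrow> y + h x = x \<Longrightarrow> x \<in> ball x0 d"
    if y: "y \<in> ball (f x0) (d / 2)" for y
  proof -
    have T: "y + h x \<in> ball x0 d" if x: "x \<in> cball x0 d" for x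
    proof -
      have "norm (y + h x - x0) = norm ((y - f x0) + (h x - h x0))" by (simp add: h_def algebra_simps)
      also have "\<dots> \<le> norm (y - f x0) + norm (h x - h x0)" by (rule norm_triangle_ineq)
      also have "norm (h x - h x0) \<le> 1 / 2 * d"
        using lip[OF x, of x0] x d(1) by (auto simp: dist_norm norm_minus_commute)
      also have "norm (y - f x0) < d / 2" using y by (simp add: dist_norm norm_minus_commute)
      finally show ?thesis by (simp add: dist_norm norm_minus_commute)
    qed
    have "\<exists>!x\<in>cball x0 d. y + h x = x"
    proof (rule Banach_fix[of _ "1 / 2"])
      show "complete (cball x0 d)" by (simp add: complete_eq_closed)
      show "(\<lambda>x. y + h x) ` cball x0 d \<subseteq> cball x0 d" using T ball_subset_cball[of x0 d] by blast
      show "dist (y + h x) (y + h z) \<le> 1 / 2 * dist x z" if "x \<in> cball x0 d" "z \<in> cball x0 d" for x z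
        using lip[OF that] by (simp add: dist_norm)
    qed (use d in auto)
    then show "\<exists>!x. x \<in> cball x0 d \<and> y + h x = x" by blast
    show "x \<in> ball x0 d" if "x \<in> cball x0 d" "y + h x = x" for x using T[OF that(1)] that(2) by simp
  qed
  define g where "g y = (THE x. x \<in> cball x0 d \<and> y + h x = x)" for y
  \<comment> \<open>For \<open>y\<close> within \<open>d / 2\<close> of \<open>f x0\<close> the
    iteration stays in the ball of radius \<open>d\<close>: one half of the radius is spent on
    \<open>y\<close>, the other on \<open>h\<close>, whose Lipschitz constant is 1/2.\<close>
  define r where "r = d / 2"
  have g: "g y \<in> cball x0 d" "y + h (g y) = g y" if "y \<in> ball (f x0) r" for y
    using theI'[OF ex1[OF that[unfolded r_def]]] unfolding g_def by blast+
  have g1: "g y \<in> ball x0 d" "f (g y) = y" if "y \<in> ball (f x0) r" for y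
    using inball[OF that[unfolded r_def] g[OF that]] g(2)[OF that] by (auto simp: h_def algebra_simps)
  have guniq: "g (f x) = x" if "x \<in> cball x0 d" "f x \<in> ball (f x0) r" for x
    unfolding g_def by (rule the1_equality[OF ex1[OF that(2)[unfolded r_def]]]) (use that in \<open>auto simp: h_def\<close>)
  have glip: "norm (g y - g z) \<le> 2 * norm (y - z)" if "y \<in> ball (f x0) r" "z \<in> ball (f x0) r" for y z
  proof -
    have "g y - g z = (y - z) + (h (g y) - h (g z))" using g(2)[OF that(1)] g(2)[OF that(2)] by (metis add_diff_add)
    then have "norm (g y - g z) \<le> norm (y - z) + 1 / 2 * norm (g y - g z)"
      using lip[OF g(1)[OF that(1)] g(1)[OF that(2)]] norm_triangle_ineq[of "y - z" "h (g y) - h (g z)"] by simp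
    then show ?thesis by simp
  qed
  let ?B = "ball (f x0) r"
  have gcont: "continuous_on ?B g"
    by (rule continuous_on_iff[THEN iffD2], intro ballI allI impI)
      (rule exI[of _ "e / 2" for e], use glip in \<open>fastforce simp: dist_norm\<close>)
  define U where "U = ball x0 d \<inter> f -` ?B"
  have U: "open U"
  proof -
    have "continuous_on (ball x0 d) f"
      using smooth_on_continuous[OF _ sm] S(1) order_trans[OF ball_subset_cball d(2)] continuous_on_subset by auto
    then show ?thesis unfolding U_def using continuous_openin_preimage_gen[of "ball x0 d" f ?B]
      by (simp add: openin_open_eq) 
  qed
  \<comment> \<open>Closeness to the identity within 1/2 bounds the derivative from below, hence its
    inverse by 2.\<close>
  have dlow: "norm v \<le> 2 * norm (fd UNIV f x v)" if "x \<in> cball x0 d" for x v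
    using d(3)[OF that, of v] norm_triangle_sub[of v "fd UNIV f x v"] by (simp add: norm_minus_commute)
  have lin: "linear (fd UNIV f x)" if "x \<in> cball x0 d" for x
    using has_derivative_linear[OF der] that d(2) by blast
  have bij: "bij (fd UNIV f x)" if x: "x \<in> cball x0 d" for x
  proof (rule bijI)
    show "inj (fd UNIV f x)"
      unfolding linear_injective_0[OF lin[OF x]] using dlow[OF x] by (metis mult_zero_right norm_le_zero_iff norm_zero)
    have "\<exists>v. fd UNIV f x v = u" for u
    proof -
      \<comment> \<open>Surjectivity of the derivative comes from the same fixed point argument,
        applied to the linear equation.\<close>
      have "\<exists>!v. v \<in> UNIV \<and> u + (v - fd UNIV f x v) = v"
      proof (rule Banach_fix[of _ "1 / 2"])
        fix v w
        have "norm ((v - w) - fd UNIV f x (v - w)) \<le> 1 / 2 * norm (v - w)" using d(3)[OF x, of "v - w"] by (simp add: norm_minus_commute)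
        then show "dist (u + (v - fd UNIV f x v)) (u + (w - fd UNIV f x w)) \<le> 1 / 2 * dist v w"
          by (simp add: dist_norm linear_diff[OF lin[OF x]] algebra_simps)
      qed (auto simp: complete_UNIV)
      then obtain v where "u + (v - fd UNIV f x v) = v" by blast
      then show ?thesis by (intro exI[of _ v]) (simp add: algebra_simps)
    qed
    then show "surj (fd UNIV f x)" by (metis surjI)
  qed
  define B where "B x = inv_into UNIV (fd UNIV f x)" for x
  have B: "fd UNIV f x (B x u) = u" "B x (fd UNIV f x u) = u" if "x \<in> cball x0 d" for x u
    using bij[OF that] by (auto simp: B_def bij_is_surj surj_f_inv_f bij_is_inj)
  have Blin: "linear (B x)" if "x \<in> cball x0 d" for x
  proof (rule linearI)
    fix u v :: 'a and a :: real
    have inj: "inj (fd UNIV f x)" using bij[OF that] bij_is_inj by blast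
    show "B x (u + v) = B x u + B x v"
      by (rule injD[OF inj]) (simp add: B(1)[OF that] linear_add[OF lin[OF that]])
    show "B x (a *\<^sub>R u) = a *\<^sub>R B x u"
      by (rule injD[OF inj]) (simp add: B(1)[OF that] linear_scale[OF lin[OF that]])
  qed
  have Bbd: "norm (B x u) \<le> 2 * norm u" if "x \<in> cball x0 d" for x u
    using dlow[OF that, of "B x u"] B[OF that] by simp
  have gder: "(g has_derivative B (g y)) (at y)" if y: "y \<in> ?B" for y
  proof (rule has_derivative_inverse_basic[of f "fd UNIV f (g y)" _ _ _ ?B])
    show "(f has_derivative fd UNIV f (g y)) (at (g y))" using der g(1)[OF y] d(2) by blast
    show "bounded_linear (B (g y))"
      using Blin[OF g(1)[OF y]] Bbd[OF g(1)[OF y]]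
      by (intro bounded_linear_intro[where K=2]) (auto simp: linear_add linear_scale mult.commute)
    show "B (g y) \<circ> fd UNIV f (g y) = id" using B(2)[OF g(1)[OF y]] by auto
    show "continuous (at y) g" using gcont y by (simp add: continuous_on_eq_continuous_at)
  qed (use y g1 in auto)
  \<comment> \<open>Bootstrap: the derivative of \<open>g\<close> is the inverse of the derivative
    of \<open>f\<close> taken at \<open>g y\<close>, so if \<open>g\<close> is of class
    \<open>k\<close>, then so is its derivative.\<close>
  have "Ck_on k UNIV ?B g" for k
  proof (induction k)
    case 0 then show ?case using gcont by simp
  next
    case (Suc k)
    show ?case
    proof (rule Ck_on_SucI[where f'="\<lambda>y. B (g y)"])
      fix v
      show "Ck_on k UNIV ?B (\<lambda>y. B (g y) v)"
      proof (rule Ck_on_inverse_family[OF fr, where A="\<lambda>y. fd UNIV f (g y)" and K=2])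
        show "Ck_on k UNIV ?B (\<lambda>y. fd UNIV f (g y) u)" for u
          using smooth_on_fd[OF sm, of u] S(1) g(1) d(2)
          by (intro Ck_on_compose[where g="\<lambda>x. fd UNIV f x u", OF _ _ fr _ Suc, of S]) (auto simp: smooth_on_def)
      qed (use g Blin Bbd B lin in auto)
    qed (use gder in auto)
  qed
  then have "smooth_on UNIV ?B g" by (simp add: smooth_on_def)
  moreover have "r > 0" "x0 \<in> U" "U \<subseteq> S" using d ball_subset_cball[of x0 d] by (auto simp: r_def U_def)
  ultimately show ?thesis using U g1 guniq ball_subset_cball[of x0 d]
    by (intro that[of r g U]) (auto simp: U_def)
qed

text \<open>Picard iteration on bounded continuous curves over the whole line with values in a
  closed ball. Only existence is extracted; uniqueness of the curves on the group will come from
  group algebra.\<close>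

lemma ode_local_solution:
  fixes X :: "'a::banach \<Rightarrow> 'a"
  assumes fr: "framed (UNIV :: 'a set)" and S: "open S" "x0 \<in> S" and sm: "smooth_on UNIV S X"
  obtains \<epsilon> c where "\<epsilon> > 0" "c 0 = x0" "\<And>t. t \<in> {-\<epsilon><..<\<epsilon>} \<Longrightarrow> c t \<in> S"
    "\<And>t. t \<in> {-\<epsilon><..<\<epsilon>} \<Longrightarrow> (c has_vector_derivative X (c t)) (at t)" "smooth_on UNIV {-\<epsilon><..<\<epsilon>} c"
proof -
  obtain r where r: "r > 0" "cball x0 r \<subseteq> S"
    "\<And>x v. x \<in> cball x0 r \<Longrightarrow> norm (fd UNIV X x v - fd UNIV X x0 v) \<le> 1 * norm v"
    using derivative_locally_close[OF fr sm S, of 1] by auto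
  have der: "(X has_derivative fd UNIV X x) (at x)" if "x \<in> S" for x using smooth_onD[OF sm that] by simp
  define L where "L = 1 + onorm (fd UNIV X x0)"
  have L: "L \<ge> 1" unfolding L_def using onorm_pos_le[OF has_derivative_bounded_linear[OF der[OF S(2)]]] by simp
  have lip: "norm (X x - X y) \<le> L * norm (x - y)" if "x \<in> cball x0 r" "y \<in> cball x0 r" for x y
  proof (rule lipschitz_of_derivative_bound[OF convex_cball _ _ _ that])
    fix x v assume x: "x \<in> cball x0 r"
    show "(X has_derivative fd UNIV X x) (at x)" using der x r by blast
    have "norm (fd UNIV X x v) \<le> norm (fd UNIV X x v - fd UNIV X x0 v) + norm (fd UNIV X x0 v)"
      using norm_triangle_sub by (simp add: add.commute)
    also have "\<dots> \<le> 1 * norm v + onorm (fd UNIV X x0) * norm v"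
      by (intro add_mono r(3) x onorm has_derivative_bounded_linear[OF der[OF S(2)]])
    finally show "norm (fd UNIV X x v) \<le> L * norm v" by (simp add: L_def algebra_simps)
  qed (use L in auto)
  define M where "M = norm (X x0) + L * r"
  have M: "M > 0" unfolding M_def using L r(1) by (intro add_nonneg_pos) auto
  have Xb: "norm (X x) \<le> M" if "x \<in> cball x0 r" for x
  proof -
    have "norm (X x) \<le> norm (X x - X x0) + norm (X x0)" using norm_triangle_sub by (simp add: add.commute)
    also have "norm (X x - X x0) \<le> L * r"
      using order_trans[OF lip[OF that, of x0] mult_left_mono[of "norm (x - x0)" r L]] that r(1) L
      by (auto simp: dist_norm norm_minus_commute)
    finally show ?thesis by (simp add: M_def)
  qed
  \<comment> \<open>\<open>r / M\<close> keeps the iterates in the ball, since \<open>M\<close>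
    bounds the field there; \<open>1 / (2 * L)\<close> makes the Picard operator a contraction with
    factor 1/2.\<close>
  define \<epsilon> where "\<epsilon> = min (r / M) (1 / (2 * L))"
  have \<epsilon>: "\<epsilon> > 0" "M * \<epsilon> \<le> r" "L * \<epsilon> \<le> 1 / 2"
    using M L r(1) by (auto simp: \<epsilon>_def min_def field_simps)
  define K where "K = {c :: real \<Rightarrow>\<^sub>C 'a. \<forall>t. apply_bcontfun c t \<in> cball x0 r}"
  \<comment> \<open>The oriented integral from 0 to \<open>t\<close>, written as a difference of
    integrals from the left end because \<open>integral\<close> over an interval with reversed ends
    is 0.\<close>
  define J where "J c t = integral {-\<epsilon>..t} (\<lambda>s. X (apply_bcontfun c s)) - integral {-\<epsilon>..0} (\<lambda>s. X (apply_bcontfun c s))" for c t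
  \<comment> \<open>Time is clamped to the interval so that the iterates are defined, bounded and
    continuous on the whole line.\<close>
  define cl where "cl t = max (-\<epsilon>) (min \<epsilon> t)" for t
  have cl: "cl t \<in> {-\<epsilon>..\<epsilon>}" "t \<in> {-\<epsilon>..\<epsilon>} \<Longrightarrow> cl t = t" for t using \<epsilon> by (auto simp: cl_def)
  have contX: "continuous_on T (\<lambda>s. X (apply_bcontfun c s))" if "c \<in> K" for c T
    using that r(2) smooth_on_continuous[OF _ sm] S(1) unfolding K_def
    by (intro continuous_on_compose2[of S X T "apply_bcontfun c"] continuous_on_apply_bcontfun) auto
  have Jd: "(J c has_vector_derivative X (apply_bcontfun c t)) (at t within {-\<epsilon>..\<epsilon>})" if "c \<in> K" "t \<in> {-\<epsilon>..\<epsilon>}" for c t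
    using has_vector_derivative_diff[OF integral_has_vector_derivative[OF contX[OF that(1)] that(2)] has_vector_derivative_const]
    unfolding J_def by simp
  have J0: "J c 0 = 0" for c by (simp add: J_def)
  have bound: "norm (F t) \<le> B * \<epsilon>" if F: "F 0 = 0" "\<And>t. t \<in> {-\<epsilon>..\<epsilon>} \<Longrightarrow> (F has_vector_derivative F' t) (at t within {-\<epsilon>..\<epsilon>})"
    "\<And>t. t \<in> {-\<epsilon>..\<epsilon>} \<Longrightarrow> norm (F' t) \<le> B" "t \<in> {-\<epsilon>..\<epsilon>}" for F :: "real \<Rightarrow> 'a" and F' B t
  proof -
    have B: "0 \<le> B" using F(3)[OF F(4)] norm_ge_zero order_trans by blast
    have "norm (F t - F 0) \<le> B * norm (t - 0)"
      by (rule differentiable_bound[of "{-\<epsilon>..\<epsilon>}" F "\<lambda>t h. h *\<^sub>R F' t"])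
        (use F \<epsilon>(1) B in \<open>auto simp: has_vector_derivative_def mult.commute[of "\<bar>_\<bar>"] intro!: onorm_bound mult_right_mono\<close>)
    also have "\<dots> \<le> B * \<epsilon>" using F(4) B by (intro mult_left_mono) auto
    finally show ?thesis by (simp add: F(1))
  qed
  have Jc: "continuous_on {-\<epsilon>..\<epsilon>} (J c)" if "c \<in> K" for c
    unfolding continuous_on_eq_continuous_within
    by (intro ballI has_vector_derivative_continuous[OF Jd[OF that]])
  define T where "T c = Bcontfun (\<lambda>t. x0 + J c (cl t))" for c
  have Jin: "x0 + J c (cl t) \<in> cball x0 r" if "c \<in> K" for c t
  proof -
    have "norm (J c (cl t)) \<le> M * \<epsilon>"
      by (rule bound[OF J0 Jd[OF that] _ cl(1)]) (use that in \<open>auto simp: K_def intro!: Xb\<close>)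
    then show ?thesis using \<epsilon>(2) by (simp add: dist_norm)
  qed
  have T: "apply_bcontfun (T c) t = x0 + J c (cl t)" if "c \<in> K" for c t
  proof -
    have "(\<lambda>t. x0 + J c (cl t)) \<in> bcontfun"
      unfolding bcontfun_def
    proof (intro CollectI conjI)
      have "continuous_on UNIV cl" unfolding cl_def by (intro continuous_intros)
      then show "continuous_on UNIV (\<lambda>t. x0 + J c (cl t))"
        by (intro continuous_intros continuous_on_compose2[OF Jc[OF that]]) (use cl in auto)
      show "bounded (range (\<lambda>t. x0 + J c (cl t)))"
        by (rule bounded_subset[OF bounded_cball[of x0 r]]) (use Jin[OF that] in blast)
    qed
    then show ?thesis by (simp add: T_def Bcontfun_inverse)
  qed
  have "\<exists>!c\<in>K. T c = c"
  proof (rule Banach_fix[of _ "1 / 2"])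
    have "K = PiC UNIV (\<lambda>_. cball x0 r)" by (auto simp: K_def mem_PiC_iff Pi_iff)
    then show "complete K" by (simp add: complete_eq_closed closed_PiC)
    have "const_bcontfun x0 \<in> K" using r(1) by (simp add: K_def)
    then show "K \<noteq> {}" by blast
    show "T ` K \<subseteq> K" using T Jin by (auto simp: K_def)
    show "dist (T c) (T d) \<le> 1 / 2 * dist c d" if "c \<in> K" "d \<in> K" for c d
    proof (rule dist_bound)
      fix t
      have "norm (J c (cl t) - J d (cl t)) \<le> (L * dist c d) * \<epsilon>"
      proof (rule bound[OF _ has_vector_derivative_diff[OF Jd[OF that(1)] Jd[OF that(2)]] _ cl(1)])
        fix s
        have "norm (X (apply_bcontfun c s) - X (apply_bcontfun d s)) \<le> L * dist (apply_bcontfun c s) (apply_bcontfun d s)"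
          unfolding dist_norm using that by (intro lip) (auto simp: K_def)
        also have "\<dots> \<le> L * dist c d" using L by (intro mult_left_mono dist_bounded) auto
        finally show "norm (X (apply_bcontfun c s) - X (apply_bcontfun d s)) \<le> L * dist c d" .
      qed (auto simp: J0)
      also have "\<dots> = (L * \<epsilon>) * dist c d" by simp
      also have "\<dots> \<le> 1 / 2 * dist c d" using \<epsilon>(3) by (intro mult_right_mono) auto
      finally show "dist (apply_bcontfun (T c) t) (apply_bcontfun (T d) t) \<le> 1 / 2 * dist c d"
        by (simp add: T that dist_norm)
    qed
  qed auto
  then obtain c where c: "c \<in> K" "T c = c" by blast
  let ?c = "apply_bcontfun c" and ?I = "{-\<epsilon><..<\<epsilon>}"
  have ct: "?c t = x0 + J c t" if "t \<in> {-\<epsilon>..\<epsilon>}" for t using T[OF c(1), of t] c(2) cl(2)[OF that] by simp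
  have cS: "?c t \<in> S" for t using c(1) r(2) by (auto simp: K_def)
  have cd: "(?c has_vector_derivative X (?c t)) (at t)" if t: "t \<in> ?I" for t
  proof -
    have "((\<lambda>t. x0 + J c t) has_vector_derivative X (?c t)) (at t within {-\<epsilon>..\<epsilon>})"
      using has_vector_derivative_add[OF has_vector_derivative_const Jd[OF c(1)], of t x0] t by simp
    then have "(?c has_vector_derivative X (?c t)) (at t within {-\<epsilon>..\<epsilon>})"
      by (rule has_vector_derivative_transform[rotated 2]) (use ct t in auto)
    then show ?thesis using at_within_interior[of t "{-\<epsilon>..\<epsilon>}"] t by simp
  qed
  \<comment> \<open>Regularity is read off from the equation: the velocity is \<open>X\<close> along
    the curve, so it is of the same class as the curve itself.\<close>
  have "Ck_on k UNIV ?I ?c" for k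
  proof (induction k)
    case (Suc k)
    have RO: "rel_open UNIV ?I" by simp
    have "Ck_on k UNIV ?I (\<lambda>t. X (?c t))"
      using S(1) sm cS by (intro Ck_on_compose[where g=X, OF RO _ fr _ Suc, of S]) (auto simp: smooth_on_def)
    then have "Ck_on k UNIV ?I (\<lambda>t. v *\<^sub>R X (?c t))" for v
      by (rule Ck_on_linear_comp[OF RO bounded_linear_scaleR_right])
    then show ?case
      using cd by (intro Ck_on_SucI[OF RO, where f'="\<lambda>t v. v *\<^sub>R X (?c t)"]) (auto simp: has_vector_derivative_def)
  qed simp
  then have "smooth_on UNIV ?I ?c" by (simp add: smooth_on_def)
  then show ?thesis using \<epsilon>(1) ct[of 0] J0[of c] cS cd by (intro that[of \<epsilon> ?c]) auto
qed

section \<open>Calculus on manifolds\<close>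

text \<open>\<open>smooth_manifold\<close> presents the model space as a finite span; the
  composition rule works with bounded coefficient functionals, so a frame is recorded as
  well.\<close>

definition good :: "('m, 'e::real_normed_vector) mfd \<Rightarrow> bool" where
  "good M \<longleftrightarrow> smooth_manifold M \<and> framed (model M)"

lemma goodD: "good M \<Longrightarrow> smooth_manifold M" "good M \<Longrightarrow> framed (model M)" "good M \<Longrightarrow> subspace (model M)"
  by (auto simp: good_def framed_def)

lemma good_chart:
  assumes "good M" "p \<in> pts M"
  shows "p \<in> cdom M p" "openin (mtop M) (cdom M p)" "rel_open (model M) (cmap M p ` cdom M p)"
    "inj_on (cmap M p) (cdom M p)" "x \<in> cdom M p \<Longrightarrow> cinv M p (cmap M p x) = x"
    "y \<in> cmap M p ` cdom M p \<Longrightarrow> cinv M p y \<in> cdom M p"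
    "y \<in> cmap M p ` cdom M p \<Longrightarrow> cmap M p (cinv M p y) = y"
    "openin (mtop M) U \<Longrightarrow> U \<subseteq> cdom M p \<Longrightarrow> rel_open (model M) (cmap M p ` U)"
    "openin (top_of_set (model M)) T \<Longrightarrow> openin (mtop M) {x \<in> cdom M p. cmap M p x \<in> T}"
    "x \<in> cdom M p \<Longrightarrow> x \<in> pts M"
proof -
  let ?c = "cmap M p" and ?D = "cdom M p"
  have *: "p \<in> ?D" "openin (mtop M) ?D" "openin (top_of_set (model M)) (?c ` ?D)"
    "homeomorphic_map (subtopology (mtop M) ?D) (top_of_set (?c ` ?D)) ?c"
    using assms unfolding good_def smooth_manifold_def by auto
  show 1: "p \<in> ?D" "openin (mtop M) ?D" by fact+
  show "rel_open (model M) (?c ` ?D)" using * goodD[OF assms(1)] by (simp add: rel_open_def)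
  have D: "?D \<subseteq> pts M" using openin_subset[OF 1(2)] .
  show inj: "inj_on ?c ?D"
    using homeomorphic_imp_injective_map[OF *(4)] D by (simp add: Int_absorb1)
  show "x \<in> ?D \<Longrightarrow> cinv M p (?c x) = x" unfolding cinv_def using inj by simp
  show "y \<in> ?c ` ?D \<Longrightarrow> cinv M p y \<in> ?D" "y \<in> ?c ` ?D \<Longrightarrow> ?c (cinv M p y) = y"
    unfolding cinv_def by (auto simp: inv_into_into f_inv_into_f)
  show "x \<in> ?D \<Longrightarrow> x \<in> pts M" using D by blast
  show "rel_open (model M) (?c ` U)" if U: "openin (mtop M) U" "U \<subseteq> ?D"
  proof -
    have "openin (subtopology (mtop M) ?D) U" using U openin_subset_topspace_eq openin_open_subtopology[OF 1(2)] by blast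
    then have "openin (top_of_set (?c ` ?D)) (?c ` U)"
      using homeomorphic_imp_open_map[OF *(4)] unfolding open_map_def by blast
    then show ?thesis using openin_trans[OF _ *(3)] goodD[OF assms(1)] by (simp add: rel_open_def)
  qed
  show "openin (mtop M) {x \<in> ?D. ?c x \<in> T}" if T: "openin (top_of_set (model M)) T"
  proof -
    have "openin (top_of_set (?c ` ?D)) (T \<inter> ?c ` ?D)"
      using openin_subset_trans[of "model M" "T \<inter> ?c ` ?D" "?c ` ?D"] T *(3) openin_imp_subset[OF *(3)] by (simp add: openin_Int)
    then have "openin (subtopology (mtop M) ?D) {x \<in> topspace (subtopology (mtop M) ?D). ?c x \<in> T \<inter> ?c ` ?D}"
      using homeomorphic_imp_continuous_map[OF *(4)] unfolding continuous_map_def by blast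
    moreover have "{x \<in> topspace (subtopology (mtop M) ?D). ?c x \<in> T \<inter> ?c ` ?D} = {x \<in> ?D. ?c x \<in> T}" using D by auto
    ultimately show ?thesis using openin_open_subtopology[OF 1(2)] by auto
  qed
qed

lemma good_transition:
  assumes "good M" "p \<in> pts M" "q \<in> pts M"
  shows "smooth_on (model M) (cmap M p ` (cdom M p \<inter> cdom M q)) (cmap M q \<circ> cinv M p)"
  using assms unfolding good_def smooth_manifold_def by blast

text \<open>Smoothness near \<open>p\<close> in the charts attached to arbitrary points
  \<open>q\<close> and \<open>r\<close>; \<open>smooth_at\<close> specialises these to
  \<open>p\<close> and \<open>f p\<close>, the charts in which \<open>tmap\<close> is read. In place
  of continuity the condition contains a neighbourhood that \<open>f\<close> maps into the target
  chart.\<close>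

definition smooth_in where
  "smooth_in M N f p q r \<longleftrightarrow> (\<exists>U. openin (mtop M) U \<and> p \<in> U \<and> U \<subseteq> cdom M q \<and> f ` U \<subseteq> cdom N r \<and>
     smooth_on (model M) (cmap M q ` U) (\<lambda>y. cmap N r (f (cinv M q y))))"

definition smooth_at where
  "smooth_at M N f p \<longleftrightarrow> p \<in> pts M \<and> f p \<in> pts N \<and> smooth_in M N f p p (f p)"

lemma smooth_inE:
  assumes "smooth_in M N f p q r" "openin (mtop M) V" "p \<in> V"
  obtains U where "openin (mtop M) U" "p \<in> U" "U \<subseteq> cdom M q" "U \<subseteq> V" "f ` U \<subseteq> cdom N r"
     "smooth_on (model M) (cmap M q ` U) (\<lambda>y. cmap N r (f (cinv M q y)))"
proof -
  obtain U where U: "openin (mtop M) U" "p \<in> U" "U \<subseteq> cdom M q" "f ` U \<subseteq> cdom N r"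
     "smooth_on (model M) (cmap M q ` U) (\<lambda>y. cmap N r (f (cinv M q y)))"
    using assms(1) unfolding smooth_in_def by blast
  show ?thesis
    by (rule that[of "U \<inter> V"]) (use U assms in \<open>auto intro: smooth_on_subset\<close>)
qed

text \<open>The coordinate expression is continuous and the charts are homeomorphisms. This is what
  permits shrinking a neighbourhood until its image lies in another chart.\<close>

lemma smooth_in_continuous:
  assumes M: "good M" "q \<in> pts M" and N: "good N" "r \<in> pts N" and f: "smooth_in M N f p q r"
    and V: "openin (mtop N) V" "f p \<in> V"
  obtains U where "openin (mtop M) U" "p \<in> U" "f ` U \<subseteq> V"
proof -
  obtain U where U: "openin (mtop M) U" "p \<in> U" "U \<subseteq> cdom M q" "f ` U \<subseteq> cdom N r"
     "smooth_on (model M) (cmap M q ` U) (\<lambda>y. cmap N r (f (cinv M q y)))"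
    using f unfolding smooth_in_def by blast
  let ?F = "\<lambda>y. cmap N r (f (cinv M q y))" and ?S = "cmap M q ` U"
  let ?T = "cmap N r ` (V \<inter> cdom N r)"
  note cM = good_chart[OF M] and cN = good_chart[OF N]
  have S: "rel_open (model M) ?S" by (rule cM(8)[OF U(1,3)])
  have T: "rel_open (model N) ?T" by (rule cN(8)) (use V cN(2) in auto)
  have "continuous_on ?S ?F" using smooth_on_continuous[OF S U(5)] .
  moreover have "?F ` ?S \<subseteq> model N"
    using U(3,4) cM(5) rel_openD(2)[OF cN(3)] by (auto simp: subset_iff)
  ultimately have "openin (top_of_set ?S) (?S \<inter> ?F -` ?T)"
    using T unfolding rel_open_def by (intro continuous_openin_preimage[where T="model N"]) auto
  then have o: "openin (top_of_set (model M)) (?S \<inter> ?F -` ?T)"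
    using S openin_trans unfolding rel_open_def by blast
  let ?U = "{x \<in> cdom M q. cmap M q x \<in> ?S \<inter> ?F -` ?T}"
  have "openin (mtop M) ?U" by (rule cM(9)[OF o])
  moreover have "p \<in> ?U" using U V cM(5) by (auto simp: subset_iff)
  moreover have "f ` ?U \<subseteq> V"
  proof
    fix z assume "z \<in> f ` ?U"
    then obtain x where x: "x \<in> cdom M q" "cmap M q x \<in> ?S" "cmap N r (f (cinv M q (cmap M q x))) \<in> ?T" "z = f x" by auto
    then have "x \<in> U" using cM(4) U(3) by (auto simp: inj_on_def)
    then have "f x \<in> cdom N r" "cmap N r (f x) \<in> ?T" using x cM(5) U by auto
    then show "z \<in> V" using x(4) cN(4) by (auto simp: inj_on_def)
  qed
  ultimately show ?thesis by (rule that)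
qed

text \<open>Coordinate expressions in two pairs of charts differ by transition maps on both sides;
  continuity first shrinks the neighbourhood so that the values lie in the new target chart
  too.\<close>

lemma smooth_in_change:
  assumes M: "good M" "q \<in> pts M" "q' \<in> pts M" and N: "good N" "r \<in> pts N" "r' \<in> pts N"
    and f: "smooth_in M N f p q r" and p: "p \<in> cdom M q'" "f p \<in> cdom N r'"
  shows "smooth_in M N f p q' r'"
proof -
  note cM = good_chart[OF M(1,2)] and cM' = good_chart[OF M(1,3)] and cN = good_chart[OF N(1,2)] and cN' = good_chart[OF N(1,3)]
  obtain V where V: "openin (mtop M) V" "p \<in> V" "f ` V \<subseteq> cdom N r'"
    using smooth_in_continuous[OF M(1,2) N(1,2) f cN'(2) p(2)] .
  obtain U where U: "openin (mtop M) U" "p \<in> U" "U \<subseteq> cdom M q" "U \<subseteq> V \<inter> cdom M q'" "f ` U \<subseteq> cdom N r"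
     "smooth_on (model M) (cmap M q ` U) (\<lambda>y. cmap N r (f (cinv M q y)))"
    using smooth_inE[OF f, of "V \<inter> cdom M q'"] V p cM'(2) by (metis IntI openin_Int)
  let ?D = "cmap N r ` (cdom N r \<inter> cdom N r')"
  have 1: "smooth_on (model M) (cmap M q' ` U) (cmap M q \<circ> cinv M q')"
    by (rule smooth_on_subset[OF good_transition[OF M(1,3,2)]]) (use U in auto)
  have 2: "smooth_on (model N) ?D (cmap N r' \<circ> cinv N r)"
    by (rule good_transition[OF N])
  have D: "rel_open (model N) ?D" by (rule cN(8)) (use cN(2) cN'(2) in auto)
  have S: "rel_open (model M) (cmap M q ` U)" "rel_open (model M) (cmap M q' ` U)"
    using cM(8)[OF U(1,3)] cM'(8)[OF U(1)] U(4) by auto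
  have 3: "smooth_on (model M) (cmap M q' ` U) (\<lambda>y. cmap N r (f (cinv M q ((cmap M q \<circ> cinv M q') y))))"
    by (rule smooth_on_compose[OF U(6) 1 S(2) S(1) goodD(2)[OF M(1)]])
      (use U cM'(5) in \<open>auto simp: subset_iff\<close>)
  have 4: "smooth_on (model M) (cmap M q' ` U) (\<lambda>y. (cmap N r' \<circ> cinv N r) (cmap N r (f (cinv M q ((cmap M q \<circ> cinv M q') y)))))"
    by (rule smooth_on_compose[OF 2 3 S(2) D goodD(2)[OF N(1)]])
      (use U V cM'(5) cM(5) in \<open>auto simp: subset_iff\<close>)
  have "smooth_on (model M) (cmap M q' ` U) (\<lambda>y. cmap N r' (f (cinv M q' y)))"
    by (rule iffD1[OF smooth_on_cong[OF S(2)] 4])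
      (use U cM'(5) cM(5) cN(5) in \<open>auto simp: subset_iff\<close>)
  then show ?thesis unfolding smooth_in_def using U V by (intro exI[of _ U]) (auto simp: subset_iff)
qed

lemma smooth_atD: "smooth_at M N f p \<Longrightarrow> p \<in> pts M" "smooth_at M N f p \<Longrightarrow> f p \<in> pts N"
  by (auto simp: smooth_at_def)

lemma smooth_in_imp_at:
  assumes "good M" "q \<in> pts M" "good N" "r \<in> pts N" "smooth_in M N f p q r"
  shows "smooth_at M N f p"
proof -
  have *: "p \<in> pts M" "f p \<in> pts N" "p \<in> cdom M q" "f p \<in> cdom N r"
    using assms(5) good_chart(10)[OF assms(1,2)] good_chart(10)[OF assms(3,4)] unfolding smooth_in_def by blast+
  show ?thesis unfolding smooth_at_def
    using * smooth_in_change[OF assms(1,2) *(1) assms(3,4) *(2) assms(5)] good_chart(1)[OF assms(1) *(1)] good_chart(1)[OF assms(3) *(2)] by blast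
qed

lemma smooth_at_in:
  assumes "good M" "q \<in> pts M" "good N" "r \<in> pts N" "smooth_at M N f p" "p \<in> cdom M q" "f p \<in> cdom N r"
  shows "smooth_in M N f p q r"
  using smooth_in_change[of M p q N "f p" r f p] assms unfolding smooth_at_def by blast

lemma smooth_at_continuous:
  assumes "good M" "good N" "smooth_at M N f p" "openin (mtop N) V" "f p \<in> V"
  obtains U where "openin (mtop M) U" "p \<in> U" "f ` U \<subseteq> V"
  using smooth_in_continuous[of M p N "f p" f p V thesis] assms that unfolding smooth_at_def by blast

lemma smooth_at_neighbourhood:
  assumes "good M" "good N" "smooth_at M N f p"
  obtains U where "openin (mtop M) U" "p \<in> U" "\<And>x. x \<in> U \<Longrightarrow> smooth_at M N f x"
proof -
  obtain U where U: "openin (mtop M) U" "p \<in> U" "U \<subseteq> cdom M p" "f ` U \<subseteq> cdom N (f p)"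
     "smooth_on (model M) (cmap M p ` U) (\<lambda>y. cmap N (f p) (f (cinv M p y)))"
    using assms(3) unfolding smooth_at_def smooth_in_def by blast
  have "smooth_at M N f x" if "x \<in> U" for x
  proof (rule smooth_in_imp_at[OF assms(1) _ assms(2)])
    show "smooth_in M N f x p (f p)" unfolding smooth_in_def using U that by blast
  qed (use assms(3) in \<open>auto simp: smooth_at_def\<close>)
  with U show ?thesis using that by blast
qed

text \<open>Reduces smoothness of a map to a pointwise condition in one pair of charts; the
  constructions below are carried out at that level.\<close>

lemma smooth_map_iff:
  assumes "good M" "good N"
  shows "smooth_map M N f \<longleftrightarrow> (\<forall>p\<in>pts M. smooth_at M N f p)"
proof
  assume f: "smooth_map M N f"
  have c: "continuous_map (mtop M) (mtop N) f" using f by (simp add: smooth_map_def)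
  show "\<forall>p\<in>pts M. smooth_at M N f p"
  proof
    fix p assume p: "p \<in> pts M"
    then have fp: "f p \<in> pts N" using c by (auto simp: continuous_map_def)
    let ?U = "cdom M p \<inter> {x \<in> pts M. f x \<in> cdom N (f p)}"
    have eq: "cdom M p \<inter> f -` cdom N (f p) = ?U" using good_chart(10)[OF assms(1) p] by auto
    have "openin (mtop M) ?U"
      by (intro openin_Int good_chart(2)[OF assms(1) p] openin_continuous_map_preimage[OF c] good_chart(2)[OF assms(2) fp])
    moreover have "smooth_on (model M) (cmap M p ` ?U) (\<lambda>y. cmap N (f p) (f (cinv M p y)))"
      using f p fp unfolding smooth_map_def eq[symmetric] by (simp add: o_def)
    ultimately show "smooth_at M N f p" unfolding smooth_at_def smooth_in_def
      using p fp good_chart(1)[OF assms(1) p] good_chart(1)[OF assms(2) fp] by (intro conjI exI[of _ ?U]) auto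
  qed
next
  assume f: "\<forall>p\<in>pts M. smooth_at M N f p"
  have "\<exists>U. openin (mtop M) U \<and> p \<in> U \<and> U \<subseteq> {x \<in> pts M. f x \<in> V}" if V: "openin (mtop N) V" and p: "p \<in> {x \<in> pts M. f x \<in> V}" for V p
  proof -
    obtain U where "openin (mtop M) U" "p \<in> U" "f ` U \<subseteq> V"
      using smooth_at_continuous[OF assms _ V] f p by blast
    then show ?thesis using openin_subset by (intro exI[of _ U]) blast
  qed
  then have "openin (mtop M) {x \<in> pts M. f x \<in> V}" if "openin (mtop N) V" for V
    using that by (subst openin_subopen) blast
  then have c: "continuous_map (mtop M) (mtop N) f"
    unfolding continuous_map_def using f by (auto simp: smooth_at_def)
  moreover have "smooth_on (model M) (cmap M p ` (cdom M p \<inter> f -` cdom N q)) (cmap N q \<circ> f \<circ> cinv M p)"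
    if p: "p \<in> pts M" and q: "q \<in> pts N" for p q
  proof (rule smooth_on_local)
    note cp = good_chart[OF assms(1) p]
    have eq: "cdom M p \<inter> f -` cdom N q = cdom M p \<inter> {x \<in> pts M. f x \<in> cdom N q}" using cp(10) by auto
    have o: "openin (mtop M) (cdom M p \<inter> f -` cdom N q)" unfolding eq
      by (intro openin_Int cp(2) openin_continuous_map_preimage[OF c] good_chart(2)[OF assms(2) q])
    show "rel_open (model M) (cmap M p ` (cdom M p \<inter> f -` cdom N q))" by (rule cp(8)[OF o]) auto
    fix y assume "y \<in> cmap M p ` (cdom M p \<inter> f -` cdom N q)"
    then obtain x where x: "y = cmap M p x" "x \<in> cdom M p" "f x \<in> cdom N q" by auto
    have "smooth_at M N f x" using f cp(10)[OF x(2)] by blast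
    then have "smooth_in M N f x p q"
      using x by (intro smooth_at_in[OF assms(1) p assms(2) q])
    then obtain U where U: "openin (mtop M) U" "x \<in> U" "U \<subseteq> cdom M p" "f ` U \<subseteq> cdom N q"
     "smooth_on (model M) (cmap M p ` U) (\<lambda>y. cmap N q (f (cinv M p y)))" unfolding smooth_in_def by blast
    then show "\<exists>T. rel_open (model M) T \<and> y \<in> T \<and> smooth_on (model M) T (cmap N q \<circ> f \<circ> cinv M p)"
      using cp(8)[OF U(1,3)] x(1) by (intro exI[of _ "cmap M p ` U"]) (auto simp: o_def)
  qed
  ultimately show "smooth_map M N f" by (simp add: smooth_map_def)
qed

lemma smooth_mapD: "good M \<Longrightarrow> good N \<Longrightarrow> smooth_map M N f \<Longrightarrow> p \<in> pts M \<Longrightarrow> smooth_at M N f p"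
  by (simp add: smooth_map_iff)

lemma smooth_at_cong:
  assumes "openin (mtop M) V" "p \<in> V" "\<And>x. x \<in> V \<Longrightarrow> f x = g x" "good M" "smooth_at M N f p"
  shows "smooth_at M N g p"
proof -
  have p: "p \<in> pts M" using assms(5) by (rule smooth_atD)
  obtain U where U: "openin (mtop M) U" "p \<in> U" "U \<subseteq> cdom M p" "U \<subseteq> V" "f ` U \<subseteq> cdom N (f p)"
     "smooth_on (model M) (cmap M p ` U) (\<lambda>y. cmap N (f p) (f (cinv M p y)))"
    using smooth_inE[OF _ assms(1,2)] assms(5) unfolding smooth_at_def by metis
  have "smooth_on (model M) (cmap M p ` U) (\<lambda>y. cmap N (f p) (g (cinv M p y)))"
    by (rule iffD1[OF smooth_on_cong[OF good_chart(8)[OF assms(4) p U(1,3)]] U(6)])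
      (use U good_chart(5)[OF assms(4) p] assms(3) in \<open>auto simp: subset_iff\<close>)
  moreover have "g ` U \<subseteq> cdom N (f p)" "f p = g p" using U assms(2,3) by (auto simp: subset_iff)
  ultimately show ?thesis using assms(5) U unfolding smooth_at_def smooth_in_def by auto
qed

section \<open>Tangent maps and the chain rule\<close>

lemma has_derivative_tmap:
  assumes "good M" "smooth_at M N f p"
  shows "((\<lambda>y. cmap N (f p) (f (cinv M p y))) has_derivative tmap M N f p) (at (cmap M p p) within model M)"
  using assms smooth_onD[of "model M" _ "\<lambda>y. cmap N (f p) (f (cinv M p y))" "cmap M p p"]
  unfolding smooth_at_def smooth_in_def tmap_def o_def by blast

lemma linear_tmap: "good M \<Longrightarrow> smooth_at M N f p \<Longrightarrow> linear (tmap M N f p)"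
  by (rule has_derivative_linear[OF has_derivative_tmap])

lemma tmap_eqI:
  assumes "good M" "p \<in> pts M" "((\<lambda>y. cmap N (f p) (f (cinv M p y))) has_derivative f') (at (cmap M p p) within model M)"
    "v \<in> model M"
  shows "tmap M N f p v = f' v"
  unfolding tmap_def o_def
  by (rule fd_eq[OF assms(3) good_chart(3)[OF assms(1,2)]]) (use assms good_chart(1)[OF assms(1,2)] in auto)

lemma tmap_mem:
  assumes "good M" "good N" "smooth_at M N f p" "v \<in> model M"
  shows "tmap M N f p v \<in> model N"
proof -
  have p: "p \<in> pts M" "f p \<in> pts N" using assms(3) by (rule smooth_atD)+
  obtain U where U: "openin (mtop M) U" "p \<in> U" "U \<subseteq> cdom M p" "f ` U \<subseteq> cdom N (f p)"
     "smooth_on (model M) (cmap M p ` U) (\<lambda>y. cmap N (f p) (f (cinv M p y)))"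
    using assms(3) unfolding smooth_at_def smooth_in_def by blast
  show ?thesis unfolding tmap_def o_def
    by (rule smooth_on_fd_mem[OF U(5) good_chart(8)[OF assms(1) p(1) U(1,3)] _ assms(4) _ goodD(2)[OF assms(2)]])
      (use U good_chart(5)[OF assms(1) p(1)] rel_openD(2)[OF good_chart(3)[OF assms(2) p(2)]] in \<open>auto simp: subset_iff\<close>)
qed

lemma tmap_cong:
  assumes "openin (mtop M) V" "p \<in> V" "\<And>x. x \<in> V \<Longrightarrow> f x = g x" "good M"
  shows "tmap M N f p = tmap M N g p"
proof -
  have p: "p \<in> pts M" using assms openin_subset by blast
  note c = good_chart[OF assms(4) p]
  have fg: "f p = g p" using assms by blast
  show ?thesis unfolding tmap_def o_def fg
    by (rule fd_cong[OF c(8)[of "V \<inter> cdom M p"]]) (use assms c in auto)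
qed

text \<open>The chart chosen at \<open>f p\<close> serves both as target chart of \<open>f\<close>
  and as source chart of \<open>g\<close>, so no derivative of a transition map enters the chain
  rule.\<close>

lemma smooth_at_compose:
  assumes M: "good M" "good N" "good P" and f: "smooth_at M N f p" and g: "smooth_at N P g (f p)"
  shows "smooth_at M P (\<lambda>x. g (f x)) p"
    and "v \<in> model M \<Longrightarrow> tmap M P (\<lambda>x. g (f x)) p v = tmap N P g (f p) (tmap M N f p v)"
proof -
  have p: "p \<in> pts M" "f p \<in> pts N" "g (f p) \<in> pts P" using f g by (auto simp: smooth_at_def)
  note cM = good_chart[OF M(1) p(1)] and cN = good_chart[OF M(2) p(2)]
  obtain V where V: "openin (mtop N) V" "f p \<in> V" "V \<subseteq> cdom N (f p)" "g ` V \<subseteq> cdom P (g (f p))"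
     "smooth_on (model N) (cmap N (f p) ` V) (\<lambda>y. cmap P (g (f p)) (g (cinv N (f p) y)))"
    using g unfolding smooth_at_def smooth_in_def by blast
  obtain V' where V': "openin (mtop M) V'" "p \<in> V'" "f ` V' \<subseteq> V" using smooth_at_continuous[OF M(1,2) f V(1,2)] .
  obtain U where U: "openin (mtop M) U" "p \<in> U" "U \<subseteq> cdom M p" "U \<subseteq> V'" "f ` U \<subseteq> cdom N (f p)"
     "smooth_on (model M) (cmap M p ` U) (\<lambda>y. cmap N (f p) (f (cinv M p y)))"
    using smooth_inE[OF _ V'(1,2)] f unfolding smooth_at_def by metis
  have S: "rel_open (model M) (cmap M p ` U)" by (rule cM(8)[OF U(1,3)])
  have T: "rel_open (model N) (cmap N (f p) ` V)" by (rule cN(8)[OF V(1,3)])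
  let ?F = "\<lambda>y. cmap N (f p) (f (cinv M p y))" and ?G = "\<lambda>y. cmap P (g (f p)) (g (cinv N (f p) y))"
  have img: "?F y \<in> cmap N (f p) ` V" if "y \<in> cmap M p ` U" for y
    using that U V' cM(5) by (auto simp: subset_iff)
  have eq: "?G (?F y) = cmap P (g (f p)) (g (f (cinv M p y)))" if "y \<in> cmap M p ` U" for y
    using that U cM(5) cN(5) by (auto simp: subset_iff)
  have "smooth_on (model M) (cmap M p ` U) (\<lambda>y. ?G (?F y))"
    by (rule smooth_on_compose[OF V(5) U(6) S T goodD(2)[OF M(2)] img])
  then have "smooth_on (model M) (cmap M p ` U) (\<lambda>y. cmap P (g (f p)) (g (f (cinv M p y))))"
    using smooth_on_cong[OF S eq] by simp
  then show "smooth_at M P (\<lambda>x. g (f x)) p"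
    unfolding smooth_at_def smooth_in_def using p U V V' by (intro conjI exI[of _ U]) (auto simp: subset_iff)
  show "tmap M P (\<lambda>x. g (f x)) p v = tmap N P g (f p) (tmap M N f p v)" if v: "v \<in> model M"
  proof -
    have in_S: "cmap M p p \<in> cmap M p ` U" using U by blast
    have dF: "(?F has_derivative tmap M N f p) (at (cmap M p p) within cmap M p ` U)"
      using has_derivative_tmap[OF M(1) f] at_within_rel_open[OF S in_S] by simp
    have Fp: "?F (cmap M p p) = cmap N (f p) (f p)" using cM(1,5) by simp
    have dG: "(?G has_derivative tmap N P g (f p)) (at (?F (cmap M p p)) within ?F ` (cmap M p ` U))"
      unfolding Fp by (rule has_derivative_subset[OF has_derivative_tmap[OF M(2) g]]) (use img rel_openD(2)[OF T] in blast)
    have "((\<lambda>y. ?G (?F y)) has_derivative (\<lambda>v. tmap N P g (f p) (tmap M N f p v))) (at (cmap M p p) within cmap M p ` U)"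
      by (rule has_derivative_in_compose[OF dF dG])
    then have "((\<lambda>y. cmap P (g (f p)) (g (f (cinv M p y)))) has_derivative (\<lambda>v. tmap N P g (f p) (tmap M N f p v))) (at (cmap M p p) within cmap M p ` U)"
      by (rule has_derivative_transform[rotated 2]) (use eq in_S in auto)
    then show ?thesis
      using tmap_eqI[OF M(1) p(1) _ v, of P "\<lambda>x. g (f x)"] at_within_rel_open[OF S in_S] by simp
  qed
qed

subsection \<open>Linear manifolds\<close>

text \<open>A subspace with its identity chart. It turns charts and their inverses into smooth maps
  between manifolds, to which the chain rule applies.\<close>

definition lin_mfd :: "'a::real_normed_vector set \<Rightarrow> ('a, 'a) mfd" where
  "lin_mfd V = \<lparr>mtop = top_of_set V, model = V, cdom = (\<lambda>_. V), cmap = (\<lambda>_ x. x)\<rparr>"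

lemma lin_mfd_simps [simp]: "mtop (lin_mfd V) = top_of_set V" "model (lin_mfd V) = V" "cdom (lin_mfd V) p = V"
  "cmap (lin_mfd V) p x = x"
  by (simp_all add: lin_mfd_def)

lemma cmap_lin_mfd: "cmap (lin_mfd V) p = (\<lambda>x. x)"
  by (simp add: lin_mfd_def)

lemma vs_mfd_simps [simp]: "mtop vs_mfd = euclidean" "model vs_mfd = UNIV" "cdom vs_mfd p = UNIV"
  "cmap vs_mfd p x = x"
  by (simp_all add: vs_mfd_def)

lemma vs_mfd_eq: "vs_mfd = lin_mfd UNIV"
  by (simp add: lin_mfd_def vs_mfd_def)

lemma cinv_lin_mfd [simp]: "x \<in> V \<Longrightarrow> cinv (lin_mfd V) p x = x"
  unfolding cinv_def by (simp add: inv_into_f_eq inj_on_def)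

lemma cinv_vs_mfd [simp]: "cinv vs_mfd p x = x"
  by (simp add: vs_mfd_eq)

lemma good_lin_mfd:
  fixes V :: "'a::real_normed_vector set"
  assumes "framed V" "framed (UNIV :: 'a set)"
  shows "good (lin_mfd V)"
proof -
  have RO: "rel_open V V" using assms(1) by (simp add: rel_open_def framed_def)
  have "smooth_on V V (\<lambda>x. x)" by (rule smooth_on_bounded_linear[OF RO bounded_linear_ident])
  then have s: "smooth_on V V (\<lambda>x. cinv (lin_mfd V) p x)" for p
    using smooth_on_cong[OF RO, of "\<lambda>x. x" "\<lambda>x. cinv (lin_mfd V) p x"] by simp
  show ?thesis unfolding good_def smooth_manifold_def
    using assms framed_span[OF assms(1)] s
    by (auto simp: o_def cmap_lin_mfd subtopology_subtopology Hausdorff_space_subtopology second_countable_subtopology framed_second_countable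
        intro!: homeomorphic_map_id[THEN iffD2, unfolded id_def])
qed

lemma good_vs_mfd: "framed (UNIV :: 'a::real_normed_vector set) \<Longrightarrow> good (vs_mfd :: ('a, 'a) mfd)"
  unfolding vs_mfd_eq by (rule good_lin_mfd)

lemma smooth_at_lin_mfd:
  assumes "smooth_on V S f" "rel_open V S" "x \<in> S" "f ` S \<subseteq> W"
  shows "smooth_at (lin_mfd V) (lin_mfd W) f x"
proof -
  have "smooth_on V S (\<lambda>y. f (cinv (lin_mfd V) x y))"
    by (rule iffD1[OF smooth_on_cong[OF assms(2)] assms(1)]) (use rel_openD(2)[OF assms(2)] in simp)
  then show ?thesis unfolding smooth_at_def smooth_in_def
    using assms rel_openD(2)[OF assms(2)] by (auto simp: rel_open_def intro!: exI[of _ S])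
qed

lemma tmap_lin_mfd:
  assumes "x \<in> V" "subspace V"
  shows "tmap (lin_mfd V) (lin_mfd W) f x = fd V f x"
  unfolding tmap_def o_def lin_mfd_simps
  by (rule fd_cong[of V V]) (use assms in \<open>auto simp: rel_open_def\<close>)

lemma tmap_vs_vs: "tmap vs_mfd vs_mfd f x = fd UNIV f x"
  by (simp add: vs_mfd_eq tmap_lin_mfd)

lemma smooth_on_of_smooth_at:
  assumes "rel_open V S" "\<And>x. x \<in> S \<Longrightarrow> smooth_at (lin_mfd V) (lin_mfd W) f x"
  shows "smooth_on V S f"
proof (rule smooth_on_local[OF assms(1)])
  fix x assume "x \<in> S"
  then obtain U where U: "openin (top_of_set V) U" "x \<in> U" "smooth_on V ((\<lambda>x. x) ` U) (\<lambda>y. f (cinv (lin_mfd V) x y))"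
    using assms(2)[of x] unfolding smooth_at_def smooth_in_def by auto
  have RO: "rel_open V U" using U(1) assms(1) by (simp add: rel_open_def)
  have "smooth_on V U f"
    by (rule iffD1[OF smooth_on_cong[OF RO]]) (use U rel_openD(2)[OF RO] in auto)
  then show "\<exists>T. rel_open V T \<and> x \<in> T \<and> smooth_on V T f" using RO U(2) by blast
qed

lemma smooth_at_cmap:
  assumes "good M" "p \<in> pts M" "x \<in> cdom M p"
  shows "smooth_at M (lin_mfd (model M)) (cmap M p) x"
proof -
  have x: "x \<in> pts M" using good_chart(10)[OF assms(1,2)] assms(3) .
  note c = good_chart[OF assms(1,2)] and cx = good_chart[OF assms(1) x]
  show ?thesis unfolding smooth_at_def smooth_in_def
    using x good_transition[OF assms(1) x assms(2)] c cx assms(3) rel_openD(2)[OF c(3)]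
    by (intro conjI exI[of _ "cdom M x \<inter> cdom M p"]) (auto simp: o_def)
qed

lemma smooth_at_cinv:
  assumes "good M" "p \<in> pts M" "y \<in> cmap M p ` cdom M p"
  shows "smooth_at (lin_mfd (model M)) M (cinv M p) y"
proof -
  note c = good_chart[OF assms(1,2)]
  define x where "x = cinv M p y"
  have x: "x \<in> cdom M p" "cmap M p x = y" "x \<in> pts M" using c assms(3) by (auto simp: x_def)
  note cx = good_chart[OF assms(1) x(3)]
  let ?U = "cmap M p ` (cdom M p \<inter> cdom M x)"
  have U: "rel_open (model M) ?U" by (rule c(8)) (use c cx in auto)
  have sm: "smooth_on (model M) ?U (\<lambda>y. cmap M x (cinv M p (cinv (lin_mfd (model M)) y' y)))" for y'
    by (rule iffD1[OF smooth_on_cong[OF U] good_transition[OF assms(1,2) x(3)]])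
      (use rel_openD(2)[OF U] in auto)
  show ?thesis unfolding smooth_at_def smooth_in_def x_def[symmetric]
    using x sm U c cx rel_openD(2)[OF c(3) assms(3)] rel_openD(2)[OF U]
    by (intro conjI exI[of _ ?U]) (auto simp: rel_open_def)
qed

text \<open>The derivative of the change from the chart at \<open>p\<close> to the chart at the
  moving point is the tangent map of \<open>cinv M p\<close>; this brings forms in charts within
  reach of the chain rule.\<close>

lemma form_in_chart_tmap:
  assumes "good M" "p \<in> pts M" "y \<in> cmap M p ` cdom M p"
  shows "form_in_chart M \<omega> p y u v =
    \<omega> (cinv M p y) (tmap (lin_mfd (model M)) M (cinv M p) y u) (tmap (lin_mfd (model M)) M (cinv M p) y v)"
proof -
  have sub: "subspace (model M)" "y \<in> model M" using goodD[OF assms(1)] rel_openD(2)[OF good_chart(3)[OF assms(1,2)] assms(3)] by auto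
  have "tmap (lin_mfd (model M)) M (cinv M p) y = fd (model M) (cmap M (cinv M p y) \<circ> cinv M p) y"
    unfolding tmap_def lin_mfd_simps
    by (rule fd_cong[of _ "model M"]) (use sub in \<open>auto simp: rel_open_def\<close>)
  then show ?thesis by (simp add: form_in_chart_def Let_def)
qed

lemma smooth_at_id: "good M \<Longrightarrow> p \<in> pts M \<Longrightarrow> smooth_at M M (\<lambda>x. x) p"
  unfolding smooth_at_def smooth_in_def
proof (intro conjI exI[of _ "cdom M p"])
  assume *: "good M" "p \<in> pts M"
  note c = good_chart[OF *]
  show "smooth_on (model M) (cmap M p ` cdom M p) (\<lambda>y. cmap M p (cinv M p y))"
    by (rule iffD1[OF smooth_on_cong[OF c(3)] smooth_on_bounded_linear[OF c(3) bounded_linear_ident]]) (use c in auto)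
qed (auto dest: good_chart)

lemma tmap_id: "good M \<Longrightarrow> p \<in> pts M \<Longrightarrow> v \<in> model M \<Longrightarrow> tmap M M (\<lambda>x. x) p v = v"
proof (rule tmap_eqI)
  assume *: "good M" "p \<in> pts M"
  note c = good_chart[OF *]
  have in_S: "cmap M p p \<in> cmap M p ` cdom M p" using c by blast
  show "((\<lambda>y. cmap M p (cinv M p y)) has_derivative (\<lambda>v. v)) (at (cmap M p p) within model M)"
    unfolding at_within_rel_open[OF c(3) in_S]
    by (rule has_derivative_transform[OF in_S _ has_derivative_ident]) (use c in auto)
qed auto

lemma smooth_at_const: "good M \<Longrightarrow> good N \<Longrightarrow> p \<in> pts M \<Longrightarrow> c \<in> pts N \<Longrightarrow> smooth_at M N (\<lambda>x. c) p"
  unfolding smooth_at_def smooth_in_def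
  by (intro conjI exI[of _ "cdom M p"] smooth_on_const) (auto dest: good_chart)

lemma tmap_const: "good M \<Longrightarrow> p \<in> pts M \<Longrightarrow> v \<in> model M \<Longrightarrow> tmap M N (\<lambda>x. c) p v = 0"
  by (rule tmap_eqI) auto

subsection \<open>Products\<close>

lemma prod_mfd_simps [simp]: "mtop (prod_mfd M N) = prod_topology (mtop M) (mtop N)"
  "model (prod_mfd M N) = model M \<times> model N"
  "cdom (prod_mfd M N) z = cdom M (fst z) \<times> cdom N (snd z)"
  "cmap (prod_mfd M N) z x = (cmap M (fst z) (fst x), cmap N (snd z) (snd x))"
  by (simp_all add: prod_mfd_def split_beta map_prod_def)

lemma cmap_prod_mfd: "cmap (prod_mfd M N) z = (\<lambda>x. (cmap M (fst z) (fst x), cmap N (snd z) (snd x)))"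
  by (rule ext) simp

lemma cmap_prod_image:
  "cmap (prod_mfd M N) z ` (A \<times> B) = (cmap M (fst z) ` A) \<times> (cmap N (snd z) ` B)"
  unfolding cmap_prod_mfd by force

lemma cinv_prod_mfd:
  assumes "good M" "good N" "z \<in> pts (prod_mfd M N)" "y \<in> cmap (prod_mfd M N) z ` cdom (prod_mfd M N) z"
  shows "cinv (prod_mfd M N) z y = (cinv M (fst z) (fst y), cinv N (snd z) (snd y))"
proof -
  have z: "fst z \<in> pts M" "snd z \<in> pts N" using assms(3) by auto
  note c1 = good_chart[OF assms(1) z(1)] and c2 = good_chart[OF assms(2) z(2)]
  obtain x where x: "x \<in> cdom (prod_mfd M N) z" "y = cmap (prod_mfd M N) z x" using assms(4) by blast
  have "inj_on (cmap (prod_mfd M N) z) (cdom (prod_mfd M N) z)"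
    using c1(4) c2(4) unfolding inj_on_def by (auto simp: prod_eq_iff)
  then have "cinv (prod_mfd M N) z y = x" unfolding cinv_def x(2) using x(1) by (rule inv_into_f_f)
  moreover have "(cinv M (fst z) (fst y), cinv N (snd z) (snd y)) = x"
    using x(1) c1(5) c2(5) by (simp add: x(2) mem_Times_iff)
  ultimately show ?thesis by simp
qed

lemma openin_prod_topologyE:
  assumes "openin (prod_topology X Y) U" "(x, y) \<in> U"
  obtains U1 U2 where "openin X U1" "openin Y U2" "x \<in> U1" "y \<in> U2" "U1 \<times> U2 \<subseteq> U"
  using assms unfolding openin_prod_topology_alt by metis

lemma second_countableE:
  assumes "second_countable X"
  obtains B where "countable B" "\<And>V. V \<in> B \<Longrightarrow> openin X V"
    "\<And>U x. openin X U \<Longrightarrow> x \<in> U \<Longrightarrow> \<exists>V\<in>B. x \<in> V \<and> V \<subseteq> U"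
proof -
  obtain B where "countable B \<and> (\<forall>V\<in>B. openin X V) \<and> (\<forall>U x. openin X U \<and> x \<in> U \<longrightarrow> (\<exists>V\<in>B. x \<in> V \<and> V \<subseteq> U))"
    using assms unfolding second_countable_def by blast
  then show ?thesis by (intro that[of B]) simp_all
qed

lemma prod_mfd_vs: "prod_mfd vs_mfd vs_mfd = vs_mfd"
  by (simp add: prod_mfd_def vs_mfd_def fun_eq_iff split_beta)

lemma good_prod_mfd:
  assumes M: "good M" and N: "good N"
  shows "good (prod_mfd M N)"
  unfolding good_def smooth_manifold_def
proof (intro conjI ballI)
  let ?P = "prod_mfd M N"
  have sM: "Hausdorff_space (mtop M)" "second_countable (mtop M)" and sN: "Hausdorff_space (mtop N)" "second_countable (mtop N)"
    using M N by (auto simp: good_def smooth_manifold_def)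
  show "Hausdorff_space (mtop ?P)" using sM sN by (simp add: Hausdorff_space_prod_topology)
  obtain A where A: "countable A" "\<And>V. V \<in> A \<Longrightarrow> openin (mtop M) V"
    "\<And>U x. openin (mtop M) U \<Longrightarrow> x \<in> U \<Longrightarrow> \<exists>V\<in>A. x \<in> V \<and> V \<subseteq> U"
    by (rule second_countableE[OF sM(2)]) (rule that)
  obtain B where B: "countable B" "\<And>V. V \<in> B \<Longrightarrow> openin (mtop N) V"
    "\<And>U x. openin (mtop N) U \<Longrightarrow> x \<in> U \<Longrightarrow> \<exists>V\<in>B. x \<in> V \<and> V \<subseteq> U"
    by (rule second_countableE[OF sN(2)]) (rule that)
  show "second_countable (mtop ?P)"
    unfolding second_countable_def
  proof (intro exI[of _ "(\<lambda>(U, V). U \<times> V) ` (A \<times> B)"] conjI allI impI)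
    show "countable ((\<lambda>(U, V). U \<times> V) ` (A \<times> B))" using A(1) B(1) by auto
    show "\<forall>V\<in>(\<lambda>(U, V). U \<times> V) ` (A \<times> B). openin (mtop ?P) V" using A(2) B(2) by (auto simp: openin_prod_Times_iff)
    fix U and z :: "'a \<times> 'c" assume U: "openin (mtop ?P) U \<and> z \<in> U"
    then obtain U1 U2 where U12: "openin (mtop M) U1" "openin (mtop N) U2" "fst z \<in> U1" "snd z \<in> U2" "U1 \<times> U2 \<subseteq> U"
      using U by - (rule openin_prod_topologyE[of "mtop M" "mtop N" U "fst z" "snd z"], auto)
    obtain V where V: "V \<in> A" "fst z \<in> V" "V \<subseteq> U1" using A(3)[OF U12(1,3)] by blast
    obtain V' where V': "V' \<in> B" "snd z \<in> V'" "V' \<subseteq> U2" using B(3)[OF U12(2,4)] by blast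
    show "\<exists>V\<in>(\<lambda>(U, V). U \<times> V) ` (A \<times> B). z \<in> V \<and> V \<subseteq> U"
      using V V' U12(5) by (intro bexI[of _ "V \<times> V'"]) (auto simp: mem_Times_iff)
  qed
  show fr: "framed (model ?P)" using goodD(2)[OF M] goodD(2)[OF N] by (simp add: framed_Times)
  show "\<exists>B. finite B \<and> model ?P = span B" by (rule framed_span[OF fr])
  fix z assume z: "z \<in> pts ?P"
  then have z': "fst z \<in> pts M" "snd z \<in> pts N" by auto
  note c1 = good_chart[OF M z'(1)] and c2 = good_chart[OF N z'(2)]
  show "z \<in> cdom ?P z" using c1(1) c2(1) by (simp add: mem_Times_iff)
  show "openin (mtop ?P) (cdom ?P z)" using c1(2) c2(2) by (simp add: openin_prod_Times_iff)
  show "openin (top_of_set (model ?P)) (cmap ?P z ` cdom ?P z)"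
    using rel_open_Times[OF c1(3) c2(3)] unfolding prod_mfd_simps(2,3) cmap_prod_image by (simp add: rel_open_def)
  have h: "\<exists>f'. homeomorphic_maps (subtopology (mtop K) (cdom K p)) (top_of_set (cmap K p ` cdom K p)) (cmap K p) f'"
    if "smooth_manifold K" "p \<in> pts K" for K :: "('x, 'y::real_normed_vector) mfd" and p
    using that unfolding smooth_manifold_def homeomorphic_map_maps by blast
  obtain f' where f': "homeomorphic_maps (subtopology (mtop M) (cdom M (fst z))) (top_of_set (cmap M (fst z) ` cdom M (fst z))) (cmap M (fst z)) f'"
    using h[OF goodD(1)[OF M] z'(1)] by blast
  obtain g' where g': "homeomorphic_maps (subtopology (mtop N) (cdom N (snd z))) (top_of_set (cmap N (snd z) ` cdom N (snd z))) (cmap N (snd z)) g'"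
    using h[OF goodD(1)[OF N] z'(2)] by blast
  have "homeomorphic_maps (prod_topology (subtopology (mtop M) (cdom M (fst z))) (subtopology (mtop N) (cdom N (snd z))))
     (prod_topology (top_of_set (cmap M (fst z) ` cdom M (fst z))) (top_of_set (cmap N (snd z) ` cdom N (snd z))))
     (\<lambda>(x, y). (cmap M (fst z) x, cmap N (snd z) y)) (\<lambda>(x, y). (f' x, g' y))"
    using f' g' by (auto simp only: homeomorphic_maps_prod)
  moreover have "(\<lambda>(x, y). (cmap M (fst z) x, cmap N (snd z) y)) = cmap ?P z" by (simp add: fun_eq_iff)
  ultimately show "homeomorphic_map (subtopology (mtop ?P) (cdom ?P z)) (top_of_set (cmap ?P z ` cdom ?P z)) (cmap ?P z)"
    unfolding homeomorphic_map_maps by (auto simp: subtopology_Times cmap_prod_image simp del: prod_mfd_simps(4))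
  fix w assume w: "w \<in> pts ?P"
  then have w': "fst w \<in> pts M" "snd w \<in> pts N" by auto
  note d1 = good_chart[OF M w'(1)] and d2 = good_chart[OF N w'(2)]
  let ?S = "cmap M (fst z) ` (cdom M (fst z) \<inter> cdom M (fst w))" and ?T = "cmap N (snd z) ` (cdom N (snd z) \<inter> cdom N (snd w))"
  have S: "rel_open (model M) ?S" and T: "rel_open (model N) ?T"
    using c1(8)[of "cdom M (fst z) \<inter> cdom M (fst w)"] c2(8)[of "cdom N (snd z) \<inter> cdom N (snd w)"] c1(2) c2(2) d1(2) d2(2) by auto
  have ST: "rel_open (model M \<times> model N) (?S \<times> ?T)" by (rule rel_open_Times[OF S T])
  have "smooth_on (model M \<times> model N) (?S \<times> ?T) (\<lambda>y. ((cmap M (fst w) \<circ> cinv M (fst z)) (fst y), (cmap N (snd w) \<circ> cinv N (snd z)) (snd y)))"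
  proof (rule smooth_on_Pair[OF ST])
    show "smooth_on (model M \<times> model N) (?S \<times> ?T) (\<lambda>y. (cmap M (fst w) \<circ> cinv M (fst z)) (fst y))"
      by (rule smooth_on_compose[OF good_transition[OF M z'(1) w'(1)] smooth_on_bounded_linear[OF ST bounded_linear_fst] ST S goodD(2)[OF M]]) auto
    show "smooth_on (model M \<times> model N) (?S \<times> ?T) (\<lambda>y. (cmap N (snd w) \<circ> cinv N (snd z)) (snd y))"
      by (rule smooth_on_compose[OF good_transition[OF N z'(2) w'(2)] smooth_on_bounded_linear[OF ST bounded_linear_snd] ST T goodD(2)[OF N]]) auto
  qed
  then have "smooth_on (model M \<times> model N) (?S \<times> ?T) (cmap ?P w \<circ> cinv ?P z)"
  proof (rule iffD1[OF smooth_on_cong[OF ST], rotated])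
    fix y assume "y \<in> ?S \<times> ?T"
    then have "cinv ?P z y = (cinv M (fst z) (fst y), cinv N (snd z) (snd y))"
      by (intro cinv_prod_mfd[OF M N z]) (auto simp: cmap_prod_image simp del: prod_mfd_simps(4))
    then show "((cmap M (fst w) \<circ> cinv M (fst z)) (fst y), (cmap N (snd w) \<circ> cinv N (snd z)) (snd y)) = (cmap ?P w \<circ> cinv ?P z) y"
      by simp
  qed
  moreover have "cmap ?P z ` (cdom ?P z \<inter> cdom ?P w) = ?S \<times> ?T"
    by (simp add: Times_Int_Times cmap_prod_image del: prod_mfd_simps(4))
  ultimately show "smooth_on (model ?P) (cmap ?P z ` (cdom ?P z \<inter> cdom ?P w)) (cmap ?P w \<circ> cinv ?P z)" by simp
qed

lemma smooth_at_Pair: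
  assumes M: "good M" and f: "smooth_at M N f p" and g: "smooth_at M P g p"
  shows "smooth_at M (prod_mfd N P) (\<lambda>x. (f x, g x)) p"
    and "v \<in> model M \<Longrightarrow> tmap M (prod_mfd N P) (\<lambda>x. (f x, g x)) p v = (tmap M N f p v, tmap M P g p v)"
proof -
  have p: "p \<in> pts M" using f by (rule smooth_atD)
  obtain U where U: "openin (mtop M) U" "p \<in> U" "U \<subseteq> cdom M p" "f ` U \<subseteq> cdom N (f p)"
     "smooth_on (model M) (cmap M p ` U) (\<lambda>y. cmap N (f p) (f (cinv M p y)))"
    using f unfolding smooth_at_def smooth_in_def by blast
  obtain U' where U': "openin (mtop M) U'" "p \<in> U'" "U' \<subseteq> cdom M p" "g ` U' \<subseteq> cdom P (g p)"
     "smooth_on (model M) (cmap M p ` U') (\<lambda>y. cmap P (g p) (g (cinv M p y)))"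
    using g unfolding smooth_at_def smooth_in_def by blast
  have RO: "rel_open (model M) (cmap M p ` (U \<inter> U'))"
    by (rule good_chart(8)[OF M p]) (use U U' in auto)
  have "smooth_on (model M) (cmap M p ` (U \<inter> U')) (\<lambda>y. (cmap N (f p) (f (cinv M p y)), cmap P (g p) (g (cinv M p y))))"
    by (intro smooth_on_Pair RO smooth_on_subset[OF U(5)] smooth_on_subset[OF U'(5)]) auto
  then show "smooth_at M (prod_mfd N P) (\<lambda>x. (f x, g x)) p"
    unfolding smooth_at_def smooth_in_def using f g U U' smooth_atD[OF f] smooth_atD[OF g]
    by (intro conjI exI[of _ "U \<inter> U'"]) auto
  show "tmap M (prod_mfd N P) (\<lambda>x. (f x, g x)) p v = (tmap M N f p v, tmap M P g p v)" if "v \<in> model M"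
    using tmap_eqI[OF M p _ that, of "prod_mfd N P" "\<lambda>x. (f x, g x)"] 
      has_derivative_Pair[OF has_derivative_tmap[OF M f] has_derivative_tmap[OF M g]] by simp
qed

lemma smooth_at_fst:
  assumes M: "good M" and N: "good N" and z: "z \<in> pts (prod_mfd M N)"
  shows "smooth_at (prod_mfd M N) M fst z"
    and "v \<in> model (prod_mfd M N) \<Longrightarrow> tmap (prod_mfd M N) M fst z v = fst v"
proof -
  let ?P = "prod_mfd M N"
  note c = good_chart[OF good_prod_mfd[OF M N] z]
  have eq: "fst y = cmap M (fst z) (fst (cinv ?P z y))" if "y \<in> cmap ?P z ` cdom ?P z" for y
    using c(7)[OF that] by (auto simp: prod_eq_iff)
  show "smooth_at ?P M fst z"
    unfolding smooth_at_def smooth_in_def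
    using z c(1,2) iffD1[OF smooth_on_cong[OF c(3) eq] smooth_on_bounded_linear[OF c(3) bounded_linear_fst]]
    by (intro conjI exI[of _ "cdom ?P z"]) auto
  have in_S: "cmap ?P z z \<in> cmap ?P z ` cdom ?P z" using c(1) by blast
  have "((\<lambda>y. cmap M (fst z) (fst (cinv ?P z y))) has_derivative fst) (at (cmap ?P z z) within model ?P)"
    unfolding at_within_rel_open[OF c(3) in_S]
    by (rule has_derivative_transform[OF in_S _ bounded_linear_imp_has_derivative[OF bounded_linear_fst]]) (use eq in auto)
  then show "v \<in> model ?P \<Longrightarrow> tmap ?P M fst z v = fst v" by (rule tmap_eqI[OF good_prod_mfd[OF M N] z])
qed

lemma smooth_at_snd:
  assumes M: "good M" and N: "good N" and z: "z \<in> pts (prod_mfd M N)"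
  shows "smooth_at (prod_mfd M N) N snd z"
    and "v \<in> model (prod_mfd M N) \<Longrightarrow> tmap (prod_mfd M N) N snd z v = snd v"
proof -
  let ?P = "prod_mfd M N"
  note c = good_chart[OF good_prod_mfd[OF M N] z]
  have eq: "snd y = cmap N (snd z) (snd (cinv ?P z y))" if "y \<in> cmap ?P z ` cdom ?P z" for y
    using c(7)[OF that] by (auto simp: prod_eq_iff)
  show "smooth_at ?P N snd z"
    unfolding smooth_at_def smooth_in_def
    using z c(1,2) iffD1[OF smooth_on_cong[OF c(3) eq] smooth_on_bounded_linear[OF c(3) bounded_linear_snd]]
    by (intro conjI exI[of _ "cdom ?P z"]) auto
  have in_S: "cmap ?P z z \<in> cmap ?P z ` cdom ?P z" using c(1) by blast
  have "((\<lambda>y. cmap N (snd z) (snd (cinv ?P z y))) has_derivative snd) (at (cmap ?P z z) within model ?P)"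
    unfolding at_within_rel_open[OF c(3) in_S]
    by (rule has_derivative_transform[OF in_S _ bounded_linear_imp_has_derivative[OF bounded_linear_snd]]) (use eq in auto)
  then show "v \<in> model ?P \<Longrightarrow> tmap ?P N snd z v = snd v" by (rule tmap_eqI[OF good_prod_mfd[OF M N] z])
qed

text \<open>The two partial maps are composites with the insertions that hold the other slot fixed;
  their tangent maps are the restrictions to the two summands.\<close>

lemma tmap_prod_split:
  assumes M: "good M" and N: "good N" and P: "good P" and F: "smooth_at (prod_mfd M N) P (\<lambda>(x, y). F x y) (m, n)"
    and u: "u \<in> model M" and v: "v \<in> model N"
  shows "tmap (prod_mfd M N) P (\<lambda>(x, y). F x y) (m, n) (u, v) =
      tmap M P (\<lambda>x. F x n) m u + tmap N P (\<lambda>y. F m y) n v"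
    and "smooth_at M P (\<lambda>x. F x n) m" "smooth_at N P (\<lambda>y. F m y) n"
proof -
  note MN = good_prod_mfd[OF M N]
  have mn: "m \<in> pts M" "n \<in> pts N" using smooth_atD(1)[OF F] by auto
  note a = smooth_at_Pair[OF M smooth_at_id[OF M mn(1)] smooth_at_const[OF M N mn]]
  note b = smooth_at_Pair[OF N smooth_at_const[OF N M mn(2,1)] smooth_at_id[OF N mn(2)]]
  show "smooth_at M P (\<lambda>x. F x n) m" "smooth_at N P (\<lambda>y. F m y) n"
    using smooth_at_compose(1)[OF M MN P a(1) F] smooth_at_compose(1)[OF N MN P b(1) F] by auto
  have 1: "tmap M P (\<lambda>x. F x n) m u = tmap (prod_mfd M N) P (\<lambda>(x, y). F x y) (m, n) (u, 0)"
    using smooth_at_compose(2)[OF M MN P a(1) F u] a(2)[OF u] by (simp add: tmap_id[OF M mn(1) u] tmap_const[OF M mn(1) u])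
  have 2: "tmap N P (\<lambda>y. F m y) n v = tmap (prod_mfd M N) P (\<lambda>(x, y). F x y) (m, n) (0, v)"
    using smooth_at_compose(2)[OF N MN P b(1) F v] b(2)[OF v] by (simp add: tmap_id[OF N mn(2) v] tmap_const[OF N mn(2) v])
  show "tmap (prod_mfd M N) P (\<lambda>(x, y). F x y) (m, n) (u, v) = tmap M P (\<lambda>x. F x n) m u + tmap N P (\<lambda>y. F m y) n v"
    unfolding 1 2 using linear_add[OF linear_tmap[OF MN F], of "(u, 0)" "(0, v)"] by simp
qed

subsection \<open>Vector-valued functions\<close>

lemma framed_UNIV_real: "framed (UNIV :: real set)"
  by (rule framedI_finite[where B="{1}" and c="\<lambda>_ x. x"]) auto

lemma framed_UNIV_prod: "framed (UNIV :: 'a::real_normed_vector set) \<Longrightarrow> framed (UNIV :: 'b::real_normed_vector set) \<Longrightarrow>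
  framed (UNIV :: ('a \<times> 'b) set)"
  using framed_Times[of "UNIV :: 'a set" "UNIV :: 'b set"] by simp

lemma framed_UNIV_dual: "framed (UNIV :: ('a::fin_dim_inner \<Rightarrow>\<^sub>L real) set)"
  by (rule framed_dual[OF framed_UNIV_fin_dim])

lemmas framed_UNIV_intros = framed_UNIV_fin_dim framed_UNIV_dual framed_UNIV_real framed_UNIV_prod

lemma smooth_at_vs_combine:
  assumes M: "good M" and f: "smooth_at M vs_mfd f p" and g: "smooth_at M vs_mfd g p"
    and h: "\<And>S F G. rel_open (model M) S \<Longrightarrow> smooth_on (model M) S F \<Longrightarrow> smooth_on (model M) S G \<Longrightarrow>
      smooth_on (model M) S (\<lambda>y. h (F y) (G y))"
  shows "smooth_at M vs_mfd (\<lambda>x. h (f x) (g x)) p"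
proof -
  have p: "p \<in> pts M" using f by (rule smooth_atD)
  obtain U where U: "openin (mtop M) U" "p \<in> U" "U \<subseteq> cdom M p" "smooth_on (model M) (cmap M p ` U) (\<lambda>y. f (cinv M p y))"
    using f unfolding smooth_at_def smooth_in_def by auto
  obtain U' where U': "openin (mtop M) U'" "p \<in> U'" "U' \<subseteq> cdom M p" "smooth_on (model M) (cmap M p ` U') (\<lambda>y. g (cinv M p y))"
    using g unfolding smooth_at_def smooth_in_def by auto
  have RO: "rel_open (model M) (cmap M p ` (U \<inter> U'))"
    by (rule good_chart(8)[OF M p]) (use U U' in auto)
  have "smooth_on (model M) (cmap M p ` (U \<inter> U')) (\<lambda>y. h (f (cinv M p y)) (g (cinv M p y)))"
    by (intro h RO smooth_on_subset[OF U(4)] smooth_on_subset[OF U'(4)]) auto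
  then show ?thesis unfolding smooth_at_def smooth_in_def using p U U' by (intro conjI exI[of _ "U \<inter> U'"]) auto
qed

lemma has_derivative_tmap_vs:
  assumes "good M" "smooth_at M vs_mfd f p"
  shows "((\<lambda>y. f (cinv M p y)) has_derivative tmap M vs_mfd f p) (at (cmap M p p) within model M)"
  using has_derivative_tmap[OF assms] by simp

lemma tmap_vs_eqI:
  assumes "good M" "p \<in> pts M" "((\<lambda>y. f (cinv M p y)) has_derivative f') (at (cmap M p p) within model M)" "v \<in> model M"
  shows "tmap M vs_mfd f p v = f' v"
  using tmap_eqI[of M p vs_mfd f f' v] assms by simp

lemma smooth_at_bilinear:
  assumes "bounded_bilinear B" "good M" "smooth_at M vs_mfd f p" "smooth_at M vs_mfd g p"
  shows "smooth_at M vs_mfd (\<lambda>x. B (f x) (g x)) p"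
    and "v \<in> model M \<Longrightarrow> tmap M vs_mfd (\<lambda>x. B (f x) (g x)) p v = B (f p) (tmap M vs_mfd g p v) + B (tmap M vs_mfd f p v) (g p)"
proof -
  have p: "p \<in> pts M" using assms(3) by (rule smooth_atD)
  show "smooth_at M vs_mfd (\<lambda>x. B (f x) (g x)) p"
    by (rule smooth_at_vs_combine[OF assms(2-4)]) (rule smooth_on_bilinear[OF assms(1)])
  show "tmap M vs_mfd (\<lambda>x. B (f x) (g x)) p v = B (f p) (tmap M vs_mfd g p v) + B (tmap M vs_mfd f p v) (g p)" if "v \<in> model M"
    using tmap_vs_eqI[OF assms(2) p bounded_bilinear.FDERIV[OF assms(1) has_derivative_tmap_vs[OF assms(2,3)] has_derivative_tmap_vs[OF assms(2,4)]] that]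
      good_chart(5)[OF assms(2) p] good_chart(1)[OF assms(2) p] by simp
qed

lemma smooth_at_linear:
  assumes "bounded_linear L" "good M" "smooth_at M vs_mfd f p"
  shows "smooth_at M vs_mfd (\<lambda>x. L (f x)) p"
    and "v \<in> model M \<Longrightarrow> tmap M vs_mfd (\<lambda>x. L (f x)) p v = L (tmap M vs_mfd f p v)"
proof -
  have p: "p \<in> pts M" using assms(3) by (rule smooth_atD)
  show "smooth_at M vs_mfd (\<lambda>x. L (f x)) p"
    by (rule smooth_at_vs_combine[OF assms(2,3,3), of "\<lambda>x _. L x"]) (rule smooth_on_linear_comp[OF _ assms(1)])
  show "tmap M vs_mfd (\<lambda>x. L (f x)) p v = L (tmap M vs_mfd f p v)" if "v \<in> model M"
    by (rule tmap_vs_eqI[OF assms(2) p bounded_linear.has_derivative[OF assms(1) has_derivative_tmap_vs[OF assms(2,3)]] that])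
qed

lemma smooth_at_add:
  assumes "good M" "smooth_at M vs_mfd f p" "smooth_at M vs_mfd g p"
  shows "smooth_at M vs_mfd (\<lambda>x. f x + g x) p"
    and "v \<in> model M \<Longrightarrow> tmap M vs_mfd (\<lambda>x. f x + g x) p v = tmap M vs_mfd f p v + tmap M vs_mfd g p v"
proof -
  have p: "p \<in> pts M" using assms(2) by (rule smooth_atD)
  show "smooth_at M vs_mfd (\<lambda>x. f x + g x) p"
    by (rule smooth_at_vs_combine[OF assms]) (rule smooth_on_add)
  show "tmap M vs_mfd (\<lambda>x. f x + g x) p v = tmap M vs_mfd f p v + tmap M vs_mfd g p v" if "v \<in> model M"
    by (rule tmap_vs_eqI[OF assms(1) p has_derivative_add[OF has_derivative_tmap_vs[OF assms(1,2)] has_derivative_tmap_vs[OF assms(1,3)]] that])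
qed

lemma smooth_at_diff:
  assumes "good M" "smooth_at M vs_mfd f p" "smooth_at M vs_mfd g p"
  shows "smooth_at M vs_mfd (\<lambda>x. f x - g x) p"
    and "v \<in> model M \<Longrightarrow> tmap M vs_mfd (\<lambda>x. f x - g x) p v = tmap M vs_mfd f p v - tmap M vs_mfd g p v"
proof -
  have p: "p \<in> pts M" using assms(2) by (rule smooth_atD)
  show "smooth_at M vs_mfd (\<lambda>x. f x - g x) p"
    by (rule smooth_at_vs_combine[OF assms]) (rule smooth_on_diff)
  show "tmap M vs_mfd (\<lambda>x. f x - g x) p v = tmap M vs_mfd f p v - tmap M vs_mfd g p v" if "v \<in> model M"
    by (rule tmap_vs_eqI[OF assms(1) p has_derivative_diff[OF has_derivative_tmap_vs[OF assms(1,2)] has_derivative_tmap_vs[OF assms(1,3)]] that])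
qed

lemma smooth_at_sum:
  assumes "good M" "p \<in> pts M" "\<And>i. i \<in> I \<Longrightarrow> smooth_at M vs_mfd (f i) p"
  shows "smooth_at M vs_mfd (\<lambda>x. \<Sum>i\<in>I. f i x) p"
  using assms(3)
proof (induction I rule: infinite_finite_induct)
  case (insert i I) then show ?case by (auto intro!: smooth_at_add(1)[OF assms(1)])
qed (use assms(1,2) in \<open>auto intro!: exI[of _ "cdom M p"] smooth_on_const good_chart simp: smooth_at_def smooth_in_def\<close>)

lemma smooth_at_vs_const: "good M \<Longrightarrow> p \<in> pts M \<Longrightarrow> smooth_at M vs_mfd (\<lambda>x. c) p"
  unfolding smooth_at_def smooth_in_def
  by (intro conjI exI[of _ "cdom M p"] smooth_on_const) (auto dest: good_chart)

lemma smooth_at_vs_vs: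
  assumes "smooth_on UNIV S f" "open S" "x \<in> S"
  shows "smooth_at vs_mfd vs_mfd f x"
  unfolding vs_mfd_eq by (rule smooth_at_lin_mfd[OF assms(1)]) (use assms in auto)

lemma smooth_on_of_smooth_at_vs:
  assumes "open S" "\<And>x. x \<in> S \<Longrightarrow> smooth_at vs_mfd vs_mfd f x"
  shows "smooth_on UNIV S f"
  by (rule smooth_on_of_smooth_at[where W=UNIV]) (use assms in \<open>auto simp: vs_mfd_eq\<close>)

lemma smooth_at_vs_weaken:
  assumes "smooth_at M (lin_mfd W) f p"
  shows "smooth_at M vs_mfd f p" "tmap M vs_mfd f p = tmap M (lin_mfd W) f p"
  using assms by (auto simp: smooth_at_def smooth_in_def tmap_def vs_mfd_eq cmap_lin_mfd)

text \<open>Directional derivatives in the second variable are taken at a fixed point, so that they can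
  be computed in a single chart of the second factor.\<close>

lemma smooth_at_partial:
  assumes M: "good M" and N: "good N" and F: "smooth_at (prod_mfd M N) vs_mfd (\<lambda>(x, y). F x y) (m, n)"
    and v: "v \<in> model N"
  shows "smooth_at M vs_mfd (\<lambda>x. tmap N vs_mfd (F x) n v) m"
proof -
  let ?P = "prod_mfd M N"
  note P = good_prod_mfd[OF M N]
  have mn: "(m, n) \<in> pts ?P" using smooth_atD(1)[OF F] .
  then have mn': "m \<in> pts M" "n \<in> pts N" by auto
  note cM = good_chart[OF M mn'(1)] and cN = good_chart[OF N mn'(2)]
  let ?F = "\<lambda>(x, y). F (cinv M m x) (cinv N n y)"
  obtain U where U: "openin (mtop ?P) U" "(m, n) \<in> U" "U \<subseteq> cdom ?P (m, n)"
     "smooth_on (model ?P) (cmap ?P (m, n) ` U) (\<lambda>y. case cinv ?P (m, n) y of (x, y) \<Rightarrow> F x y)"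
    using F unfolding smooth_at_def smooth_in_def by auto
  obtain U1 U2 where U12: "openin (mtop M) U1" "openin (mtop N) U2" "m \<in> U1" "n \<in> U2" "U1 \<times> U2 \<subseteq> U"
    by (rule openin_prod_topologyE[of "mtop M" "mtop N" U m n]) (use U in auto)
  have sub: "U1 \<subseteq> cdom M m" "U2 \<subseteq> cdom N n" using U12(3-5) U(3) by auto
  let ?S1 = "cmap M m ` U1" and ?S2 = "cmap N n ` U2"
  have S: "rel_open (model M) ?S1" "rel_open (model N) ?S2" using cM(8)[OF U12(1) sub(1)] cN(8)[OF U12(2) sub(2)] .
  have S12: "rel_open (model M \<times> model N) (?S1 \<times> ?S2)" by (rule rel_open_Times[OF S])
  have ci: "cinv ?P (m, n) y = (cinv M m (fst y), cinv N n (snd y))" if "y \<in> ?S1 \<times> ?S2" for y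
    using cinv_prod_mfd[OF M N mn, of y] that sub by (force simp: cmap_prod_mfd)
  have "smooth_on (model M \<times> model N) (?S1 \<times> ?S2) (\<lambda>y. case cinv ?P (m, n) y of (x, y) \<Rightarrow> F x y)"
    using smooth_on_subset[OF U(4), of "?S1 \<times> ?S2"] U12(5) by (force simp: cmap_prod_mfd)
  then have sm: "smooth_on (model M \<times> model N) (?S1 \<times> ?S2) ?F"
    by (rule iffD1[OF smooth_on_cong[OF S12], rotated]) (use ci in \<open>auto simp: split_beta\<close>)
  let ?y = "cmap N n n"
  have y: "?y \<in> ?S2" using U12(4) by blast
  have der: "tmap N vs_mfd (F (cinv M m x)) n v = fd (model M \<times> model N) ?F (x, ?y) (0, v)" if x: "x \<in> ?S1" for x
  proof (rule tmap_vs_eqI[OF N mn'(2) _ v])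
    have xy: "(x, ?y) \<in> ?S1 \<times> ?S2" using x y by auto
    have "(Pair x has_derivative (\<lambda>h. (0, h))) (at ?y within model N)"
      by (intro has_derivative_Pair has_derivative_const has_derivative_ident)
    moreover have "(?F has_derivative fd (model M \<times> model N) ?F (x, ?y)) (at (Pair x ?y) within Pair x ` model N)"
      by (rule has_derivative_subset[OF smooth_onD[OF sm xy]]) (use rel_openD(2)[OF S(1) x] in auto)
    ultimately show "((\<lambda>z. F (cinv M m x) (cinv N n z)) has_derivative (\<lambda>v. fd (model M \<times> model N) ?F (x, ?y) (0, v))) (at ?y within model N)"
      using has_derivative_in_compose[of "Pair x" _ ?y "model N" ?F] by simp
  qed
  have "smooth_on (model M) ?S1 (\<lambda>x. fd (model M \<times> model N) ?F (x, ?y) (0, v))"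
  proof (rule smooth_on_compose[OF smooth_on_fd[OF sm, of "(0, v)"] _ S(1) S12 framed_Times[OF goodD(2)[OF M] goodD(2)[OF N]]])
    show "(0, v) \<in> model M \<times> model N" using v goodD(3)[OF M] by (simp add: subspace_0)
    show "smooth_on (model M) ?S1 (\<lambda>x. (x, ?y))"
      by (intro smooth_on_Pair S(1) smooth_on_const smooth_on_bounded_linear bounded_linear_ident)
  qed (use y in auto)
  then have "smooth_on (model M) ?S1 (\<lambda>x. tmap N vs_mfd (F (cinv M m x)) n v)"
    using smooth_on_cong[OF S(1) der] by simp
  then show ?thesis unfolding smooth_at_def smooth_in_def
    using mn' U12 sub by (intro conjI exI[of _ U1]) auto
qed

subsection \<open>Locally exact forms\<close>

lemma fd_diff:
  assumes "smooth_on V S f" "smooth_on V S g" "rel_open V S" "x \<in> S" "v \<in> V"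
  shows "fd V (\<lambda>y. f y - g y) x v = fd V f x v - fd V g x v"
  using fd_eq[OF has_derivative_diff[OF smooth_onD[OF assms(1,4)] smooth_onD[OF assms(2,4)]] assms(3-5)] .

text \<open>The one-form may be chosen chart by chart, and in each chart closedness is
  \<open>d d = 0\<close>: the second derivatives of \<theta> in the cyclic sum cancel in pairs by
  symmetry.\<close>

lemma locally_exact_form:
  assumes M: "good M" and \<theta>: "\<And>p u. p \<in> pts M \<Longrightarrow> u \<in> model M \<Longrightarrow> smooth_on (model M) (cmap M p ` cdom M p) (\<lambda>y. \<theta> p y u)"
    and eq: "\<And>p y u v. p \<in> pts M \<Longrightarrow> y \<in> cmap M p ` cdom M p \<Longrightarrow> u \<in> model M \<Longrightarrow> v \<in> model M \<Longrightarrow>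
      form_in_chart M \<omega> p y u v = fd (model M) (\<lambda>z. \<theta> p z v) y u - fd (model M) (\<lambda>z. \<theta> p z u) y v"
  shows "closed_form M \<omega>"
    "p \<in> pts M \<Longrightarrow> u \<in> model M \<Longrightarrow> v \<in> model M \<Longrightarrow> smooth_on (model M) (cmap M p ` cdom M p) (\<lambda>y. form_in_chart M \<omega> p y u v)"
proof -
  show "smooth_on (model M) (cmap M p ` cdom M p) (\<lambda>y. form_in_chart M \<omega> p y u v)"
    if "p \<in> pts M" "u \<in> model M" "v \<in> model M" for p u v
    by (rule iffD2[OF smooth_on_cong[OF good_chart(3)[OF M that(1)] eq] smooth_on_diff[OF good_chart(3)[OF M that(1)] smooth_on_fd[OF \<theta>] smooth_on_fd[OF \<theta>]]])
      (use that in auto)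
  show "closed_form M \<omega>"
    unfolding closed_form_def
  proof (intro ballI)
    fix p y u v w assume p: "p \<in> pts M" and y: "y \<in> cmap M p ` cdom M p" and uvw: "u \<in> model M" "v \<in> model M" "w \<in> model M"
    let ?V = "model M" and ?S = "cmap M p ` cdom M p"
    note S = good_chart(3)[OF M p]
    have d: "fd ?V (\<lambda>z. form_in_chart M \<omega> p z v w) y u = fd ?V (\<lambda>z. fd ?V (\<lambda>z. \<theta> p z w) z v) y u - fd ?V (\<lambda>z. fd ?V (\<lambda>z. \<theta> p z v) z w) y u"
      if "u \<in> ?V" "v \<in> ?V" "w \<in> ?V" for u v w
      using fun_cong[OF fd_cong(1)[OF S y, of "\<lambda>z. form_in_chart M \<omega> p z v w" "\<lambda>z. fd ?V (\<lambda>z. \<theta> p z w) z v - fd ?V (\<lambda>z. \<theta> p z v) z w"], of u]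
        eq[OF p _ that(2,3)] fd_diff[OF smooth_on_fd[OF \<theta>[OF p that(3)] that(2)] smooth_on_fd[OF \<theta>[OF p that(2)] that(3)] S y that(1)] by simp
    show "fd ?V (\<lambda>z. form_in_chart M \<omega> p z v w) y u + fd ?V (\<lambda>z. form_in_chart M \<omega> p z w u) y v + fd ?V (\<lambda>z. form_in_chart M \<omega> p z u v) y w = 0"
      unfolding d[OF uvw] d[OF uvw(2,3,1)] d[OF uvw(3,1,2)]
      using second_derivative_symmetric_real[OF \<theta>[OF p uvw(1)] S y uvw(2,3)]
        second_derivative_symmetric_real[OF \<theta>[OF p uvw(2)] S y uvw(1,3)]
        second_derivative_symmetric_real[OF \<theta>[OF p uvw(3)] S y uvw(1,2)] by simp
  qed
qed

section \<open>Lie groups\<close>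

lemma framed_bounded_bilinear:
  assumes "framed (UNIV :: 'a::real_normed_vector set)" "framed (UNIV :: 'b::real_normed_vector set)"
    "\<And>x. linear (B x)" "\<And>y. linear (\<lambda>x. B x y)"
  shows "bounded_bilinear (B :: 'a \<Rightarrow> 'b \<Rightarrow> 'c::real_normed_vector)"
proof -
  obtain n :: nat and e and c :: "nat \<Rightarrow> 'a \<Rightarrow> real" where fr: "\<And>i. i < n \<Longrightarrow> e i \<in> (UNIV :: 'a set)" "\<And>i. i < n \<Longrightarrow> bounded_linear (c i)"
    "\<And>x. x \<in> UNIV \<Longrightarrow> x = (\<Sum>i<n. c i x *\<^sub>R e i)" "subspace (UNIV :: 'a set)"
    by (rule framedE[OF assms(1)]) (rule that)
  have bl: "bounded_linear (B x)" for x by (rule framed_linear_bounded[OF assms(2,3)])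
  show ?thesis
  proof
    show "B (a + a') b = B a b + B a' b" "B (r *\<^sub>R a) b = r *\<^sub>R B a b" for a a' b r
      using linear_add[OF assms(4)] linear_scale[OF assms(4)] by auto
    show "B a (b + b') = B a b + B a b'" "B a (r *\<^sub>R b) = r *\<^sub>R B a b" for a b b' r
      using linear_add[OF assms(3)] linear_scale[OF assms(3)] by auto
    show "\<exists>K. \<forall>a b. norm (B a b) \<le> norm a * norm b * K"
    proof (intro exI allI)
      fix a b
      have "B a b = (\<Sum>i<n. c i a *\<^sub>R B (e i) b)" by (rule linear_frame_expand[OF assms(4) fr(3)]) simp
      also have "norm \<dots> \<le> (\<Sum>i<n. (onorm (c i) * norm a) * (onorm (B (e i)) * norm b))"
        by (intro sum_norm_le) (auto intro!: mult_mono onorm[OF fr(2), simplified] onorm[OF bl] mult_nonneg_nonneg onorm_pos_le[OF fr(2)])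
      also have "\<dots> = norm a * norm b * (\<Sum>i<n. onorm (c i) * onorm (B (e i)))"
        by (simp add: sum_distrib_left mult_ac)
      finally show "norm (B a b) \<le> norm a * norm b * (\<Sum>i<n. onorm (c i) * onorm (B (e i)))" .
    qed
  qed
qed

text \<open>Smoothness for each fixed argument suffices for a moving one, because linearity reduces
  the argument to finitely many frame vectors. Applied below to \<open>Ad\<close>,
  \<open>coAd\<close> and the Maurer-Cartan form.\<close>

lemma smooth_at_linear_family:
  fixes A :: "'m \<Rightarrow> 'a::real_normed_vector \<Rightarrow> 'b::real_normed_vector"
  assumes fr: "framed (UNIV :: 'a set)" and N: "good N" and V: "openin (mtop N) V" "p \<in> V"
    and lin: "\<And>x. x \<in> V \<Longrightarrow> linear (A x)" and A: "\<And>u. smooth_at N vs_mfd (\<lambda>x. A x u) p" and h: "smooth_at N vs_mfd h p"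
  shows "smooth_at N vs_mfd (\<lambda>x. A x (h x)) p"
    and "v \<in> model N \<Longrightarrow> tmap N vs_mfd (\<lambda>x. A x (h x)) p v = tmap N vs_mfd (\<lambda>x. A x (h p)) p v + A p (tmap N vs_mfd h p v)"
proof -
  have p: "p \<in> pts N" using h by (rule smooth_atD)
  obtain n :: nat and e and c :: "nat \<Rightarrow> 'a \<Rightarrow> real" where fr: "\<And>i. i < n \<Longrightarrow> e i \<in> (UNIV :: 'a set)" "\<And>i. i < n \<Longrightarrow> bounded_linear (c i)"
    "\<And>x. x \<in> UNIV \<Longrightarrow> x = (\<Sum>i<n. c i x *\<^sub>R e i)" "subspace (UNIV :: 'a set)"
    by (rule framedE[OF fr]) (rule that)
  have eq: "(\<Sum>i<n. c i u *\<^sub>R A x (e i)) = A x u" if "x \<in> V" for x u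
    using linear_frame_expand[OF lin[OF that] fr(3)[OF UNIV_I], of u] by simp
  have s: "smooth_at N vs_mfd (\<lambda>x. c i (h x) *\<^sub>R A x (e i)) p" if "i < n" "smooth_at N vs_mfd h p" for i h
    using smooth_at_bilinear(1)[OF bounded_bilinear_scaleR N smooth_at_linear(1)[OF fr(2)[OF that(1)] N that(2)] A] .
  have sum: "smooth_at N vs_mfd (\<lambda>x. \<Sum>i<n. c i (h x) *\<^sub>R A x (e i)) p"
    by (rule smooth_at_sum[OF N p]) (use s h in auto)
  show "smooth_at N vs_mfd (\<lambda>x. A x (h x)) p"
    by (rule smooth_at_cong[OF V eq N sum])
  assume v: "v \<in> model N"
  have key: "tmap N vs_mfd (\<lambda>x. A x (h x)) p v =
     (\<Sum>i<n. c i (h p) *\<^sub>R tmap N vs_mfd (\<lambda>x. A x (e i)) p v) + A p (tmap N vs_mfd h p v)" if h: "smooth_at N vs_mfd h p" for h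
  proof -
    have "tmap N vs_mfd (\<lambda>x. \<Sum>i<m. c i (h x) *\<^sub>R A x (e i)) p v =
     (\<Sum>i<m. c i (h p) *\<^sub>R tmap N vs_mfd (\<lambda>x. A x (e i)) p v + c i (tmap N vs_mfd h p v) *\<^sub>R A p (e i))" if "m \<le> n" for m
      using that
    proof (induction m)
      case 0 then show ?case using tmap_const[OF N p v] by simp
    next
      case (Suc m)
      have "smooth_at N vs_mfd (\<lambda>x. \<Sum>i<m. c i (h x) *\<^sub>R A x (e i)) p"
        by (rule smooth_at_sum[OF N p]) (use s h Suc.prems in auto)
      then show ?case using Suc smooth_at_add(2)[OF N _ s[of m h] v] h
          smooth_at_bilinear(2)[OF bounded_bilinear_scaleR N smooth_at_linear(1)[OF fr(2)[of m] N h] A v, of "e m"]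
          smooth_at_linear(2)[OF fr(2)[of m] N h v] by simp
    qed
    from this[of n] show ?thesis
      using tmap_cong[where N=vs_mfd and f="\<lambda>x. \<Sum>i<n. c i (h x) *\<^sub>R A x (e i)" and g="\<lambda>x. A x (h x)", OF V eq N] eq[OF V(2)] by (simp add: sum.distrib)
  qed
  \<comment> \<open>The frame sum in \<open>key\<close> is recognised as the derivative of
    \<open>A\<close> at a fixed argument by applying \<open>key\<close> once more, to the constant
    function \<open>h p\<close>.\<close>
  show "tmap N vs_mfd (\<lambda>x. A x (h x)) p v = tmap N vs_mfd (\<lambda>x. A x (h p)) p v + A p (tmap N vs_mfd h p v)"
    unfolding key[OF h] using key[OF smooth_at_vs_const[OF N p, of "h p"]] tmap_const[OF N p v, of vs_mfd "h p"] linear_0[OF lin[OF V(2)]] by simp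
qed

lemma good_vs_fin_dim [simp]: "good (vs_mfd :: ('e::fin_dim_inner, 'e) mfd)"
  and good_vs_dual [simp]: "good (vs_mfd :: ('e::fin_dim_inner dual, 'e dual) mfd)"
  and good_vs_real [simp]: "good (vs_mfd :: (real, real) mfd)"
  by (intro good_vs_mfd framed_UNIV_intros)+

locale lie = fixes G :: "('g, 'e::fin_dim_inner) lgroup" (structure) assumes lie_group: "lie_group G"
begin

abbreviation M where "M \<equiv> gmfd G"
abbreviation "vs \<equiv> (vs_mfd :: ('e, 'e) mfd)"

sublocale group G using lie_group by (simp add: lie_group_def)

lemma pts_M [simp]: "pts M = carrier G" and model_M [simp]: "model M = UNIV"
  using lie_group by (auto simp: lie_group_def)

lemma good_M [simp]: "good M"
  using lie_group framed_UNIV_fin_dim by (auto simp: good_def lie_group_def)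

lemma smooth_mult:
  assumes N: "good N" and f: "smooth_at N M f p" and g: "smooth_at N M g p"
  shows "smooth_at N M (\<lambda>x. f x \<otimes> g x) p"
proof -
  have MM: "good (prod_mfd M M)" by (rule good_prod_mfd) simp_all
  have "smooth_map (prod_mfd M M) M (\<lambda>(g, h). g \<otimes> h)" using lie_group by (simp add: lie_group_def)
  from smooth_mapD[OF MM good_M this, of "(f p, g p)"]
  have "smooth_at (prod_mfd M M) M (\<lambda>(g, h). g \<otimes> h) (f p, g p)"
    using smooth_atD(2)[OF f] smooth_atD(2)[OF g] by simp
  from smooth_at_compose(1)[OF N MM good_M smooth_at_Pair(1)[OF N f g] this] show ?thesis by simp
qed

lemma smooth_inv:
  assumes N: "good N" and f: "smooth_at N M f p"
  shows "smooth_at N M (\<lambda>x. inv (f x)) p"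
proof -
  have "smooth_map M M (\<lambda>g. inv g)" using lie_group by (simp add: lie_group_def)
  from smooth_at_compose(1)[OF N good_M good_M f smooth_mapD[OF good_M good_M this]] smooth_atD(2)[OF f]
  show ?thesis by simp
qed

lemma smooth_group_const: "good N \<Longrightarrow> p \<in> pts N \<Longrightarrow> k \<in> carrier G \<Longrightarrow> smooth_at N M (\<lambda>x. k) p"
  by (rule smooth_at_const) auto

lemma smooth_group_id: "g \<in> carrier G \<Longrightarrow> smooth_at M M (\<lambda>x. x) g"
  by (rule smooth_at_id) auto

lemmas smooth_group = smooth_mult smooth_inv smooth_group_const smooth_group_id

subsection \<open>Logarithmic derivatives\<close>

text \<open>The right trivialization of the tangent bundle: \<open>rt g\<close> carries the Lie
  algebra to the tangent space at \<open>g\<close>, and \<open>il g\<close> carries it back.\<close>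

definition rt where "rt g \<eta> = tmap M M (\<lambda>h. h \<otimes> g) \<one> \<eta>"
definition il where "il g v = tmap M M (\<lambda>h. h \<otimes> inv g) g v"

text \<open>The right logarithmic derivative: the tangent vector of \<open>f\<close> translated to the identity.\<close>

definition ld where "ld N f p v = il (f p) (tmap N M f p v)"

lemma rt_il: "g \<in> carrier G \<Longrightarrow> rt g (il g v) = v"
proof -
  assume g: "g \<in> carrier G"
  have 1: "smooth_at M M (\<lambda>h. h \<otimes> inv g) g" and 2: "smooth_at M M (\<lambda>h. h \<otimes> g) (g \<otimes> inv g)"
    using g by (auto intro!: smooth_group)
  have "tmap M M (\<lambda>h. h \<otimes> inv g \<otimes> g) g v = rt g (il g v)"
    using smooth_at_compose(2)[OF good_M good_M good_M 1 2, of v] g by (simp add: rt_def il_def)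
  moreover have "tmap M M (\<lambda>h. h \<otimes> inv g \<otimes> g) g = tmap M M (\<lambda>h. h) g"
    by (rule tmap_cong[of M "carrier G"]) (use g openin_topspace[of "mtop M"] in \<open>auto simp: m_assoc\<close>)
  ultimately show ?thesis using g by (simp add: tmap_id)
qed

lemma il_rt: "g \<in> carrier G \<Longrightarrow> il g (rt g \<eta>) = \<eta>"
proof -
  assume g: "g \<in> carrier G"
  have 1: "smooth_at M M (\<lambda>h. h \<otimes> inv g) (\<one> \<otimes> g)" and 2: "smooth_at M M (\<lambda>h. h \<otimes> g) \<one>"
    using g by (auto intro!: smooth_group)
  have "tmap M M (\<lambda>h. h \<otimes> g \<otimes> inv g) \<one> \<eta> = il g (rt g \<eta>)"
    using smooth_at_compose(2)[OF good_M good_M good_M 2 1, of \<eta>] g by (simp add: rt_def il_def)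
  moreover have "tmap M M (\<lambda>h. h \<otimes> g \<otimes> inv g) \<one> = tmap M M (\<lambda>h. h) \<one>"
    by (rule tmap_cong[of M "carrier G"]) (use g openin_topspace[of "mtop M"] in \<open>auto simp: m_assoc\<close>)
  ultimately show ?thesis using g by (simp add: tmap_id)
qed

lemma linear_rt: "g \<in> carrier G \<Longrightarrow> linear (rt g)"
  unfolding rt_def[abs_def] by (rule linear_tmap) (auto intro!: smooth_group)

lemma linear_il: "g \<in> carrier G \<Longrightarrow> linear (il g)"
  unfolding il_def[abs_def] by (rule linear_tmap) (auto intro!: smooth_group)

lemma rt_one: "rt \<one> \<eta> = \<eta>"
proof -
  have "tmap M M (\<lambda>h. h \<otimes> \<one>) \<one> = tmap M M (\<lambda>h. h) \<one>"
    by (rule tmap_cong[of M "carrier G"]) (use openin_topspace[of "mtop M"] in auto)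
  then show ?thesis by (simp add: rt_def tmap_id)
qed

lemma il_one: "il \<one> v = v"
  using il_rt[of \<one> v] rt_one[of v] by simp

lemma tmap_ld: "smooth_at N M f p \<Longrightarrow> tmap N M f p v = rt (f p) (ld N f p v)"
  using smooth_atD(2) by (fastforce simp: ld_def rt_il)

lemma linear_ld: "good N \<Longrightarrow> smooth_at N M f p \<Longrightarrow> linear (ld N f p)"
  unfolding ld_def[abs_def]
  using linear_compose[OF linear_tmap linear_il] smooth_atD(2) by (fastforce simp: o_def)

lemma ld_compose:
  assumes "good N" "good N'" "smooth_at N N' h p" "smooth_at N' M f (h p)" "v \<in> model N"
  shows "ld N (\<lambda>x. f (h x)) p v = ld N' f (h p) (tmap N N' h p v)"
  by (simp add: ld_def smooth_at_compose(2)[OF assms(1,2) good_M assms(3-5)])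

lemma ld_const: "good N \<Longrightarrow> p \<in> pts N \<Longrightarrow> k \<in> carrier G \<Longrightarrow> v \<in> model N \<Longrightarrow> ld N (\<lambda>x. k) p v = 0"
  by (simp add: ld_def tmap_const linear_0[OF linear_il])

lemma ld_cong:
  assumes "openin (mtop N) V" "p \<in> V" "\<And>x. x \<in> V \<Longrightarrow> f x = g x" "good N"
  shows "ld N f p = ld N g p"
  unfolding ld_def[abs_def] using tmap_cong[where f=f and g=g and N=M, OF assms] assms(2,3) by simp

lemma smooth_conj: "g \<in> carrier G \<Longrightarrow> h \<in> carrier G \<Longrightarrow> smooth_at M M (\<lambda>h. inv g \<otimes> h \<otimes> g) h"
  by (auto intro!: smooth_group)

lemma Ad_ld: "g \<in> carrier G \<Longrightarrow> Ad G g \<eta> = ld M (\<lambda>h. inv g \<otimes> h \<otimes> g) \<one> \<eta>"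
  by (simp add: Ad_def ld_def il_one)

lemma linear_Ad: "g \<in> carrier G \<Longrightarrow> linear (Ad G g)"
  unfolding Ad_def by (rule linear_tmap) (auto intro!: smooth_conj)

lemma bounded_linear_Ad: "g \<in> carrier G \<Longrightarrow> bounded_linear (Ad G g)"
  by (rule framed_linear_bounded[OF framed_UNIV_fin_dim linear_Ad])

text \<open>Conjugation is by the inverse, hence the reversed order.\<close>

lemma Ad_mult:
  assumes "g \<in> carrier G" "h \<in> carrier G"
  shows "Ad G (g \<otimes> h) \<eta> = Ad G h (Ad G g \<eta>)"
proof -
  have 1: "smooth_at M M (\<lambda>k. inv g \<otimes> k \<otimes> g) \<one>" and 2: "smooth_at M M (\<lambda>k. inv h \<otimes> k \<otimes> h) (inv g \<otimes> \<one> \<otimes> g)"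
    using assms by (auto intro!: smooth_conj)
  have "tmap M M (\<lambda>k. inv h \<otimes> (inv g \<otimes> k \<otimes> g) \<otimes> h) \<one> \<eta> = Ad G h (Ad G g \<eta>)"
    using smooth_at_compose(2)[OF good_M good_M good_M 1 2, of \<eta>] assms by (simp add: Ad_def)
  moreover have "tmap M M (\<lambda>k. inv h \<otimes> (inv g \<otimes> k \<otimes> g) \<otimes> h) \<one> = tmap M M (\<lambda>k. inv (g \<otimes> h) \<otimes> k \<otimes> (g \<otimes> h)) \<one>"
    by (rule tmap_cong[of M "carrier G"]) (use assms openin_topspace[of "mtop M"] in \<open>auto simp: m_assoc inv_mult_group\<close>)
  ultimately show ?thesis by (simp add: Ad_def)
qed

lemma Ad_one: "Ad G \<one> \<eta> = \<eta>"
proof -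
  have "tmap M M (\<lambda>h. inv \<one> \<otimes> h \<otimes> \<one>) \<one> = tmap M M (\<lambda>h. h) \<one>"
    by (rule tmap_cong[of M "carrier G"]) (use openin_topspace[of "mtop M"] in auto)
  then show ?thesis by (simp add: Ad_def tmap_id)
qed

lemma Ad_inv: "g \<in> carrier G \<Longrightarrow> Ad G (inv g) (Ad G g \<eta>) = \<eta>" "g \<in> carrier G \<Longrightarrow> Ad G g (Ad G (inv g) \<eta>) = \<eta>"
  using Ad_mult[of g "inv g" \<eta>] Ad_mult[of "inv g" g \<eta>] by (auto simp: Ad_one)

lemma tmap_right_mult:
  assumes "g \<in> carrier G" "k \<in> carrier G"
  shows "tmap M M (\<lambda>x. x \<otimes> k) g (rt g \<eta>) = rt (g \<otimes> k) \<eta>"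
proof -
  have 1: "smooth_at M M (\<lambda>x. x \<otimes> g) \<one>" and 2: "smooth_at M M (\<lambda>x. x \<otimes> k) (\<one> \<otimes> g)"
    using assms by (auto intro!: smooth_group)
  have "tmap M M (\<lambda>x. x \<otimes> k) g (rt g \<eta>) = tmap M M (\<lambda>x. x \<otimes> g \<otimes> k) \<one> \<eta>"
    using smooth_at_compose(2)[OF good_M good_M good_M 1 2, of \<eta>] assms by (simp add: rt_def)
  moreover have "tmap M M (\<lambda>x. x \<otimes> g \<otimes> k) \<one> = tmap M M (\<lambda>x. x \<otimes> (g \<otimes> k)) \<one>"
    by (rule tmap_cong[of M "carrier G"]) (use assms openin_topspace[of "mtop M"] in \<open>auto simp: m_assoc\<close>)
  ultimately show ?thesis by (simp add: rt_def)
qed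

text \<open>Writing \<open>k x g\<close> as \<open>(k x inv k) (k g)\<close> shows what left
  translation becomes in the right trivialization: \<open>Ad\<close> of the inverse of
  \<open>k\<close>.\<close>

lemma tmap_left_mult:
  assumes "g \<in> carrier G" "k \<in> carrier G"
  shows "tmap M M (\<lambda>x. k \<otimes> x) g (rt g \<eta>) = rt (k \<otimes> g) (Ad G (inv k) \<eta>)"
proof -
  have 1: "smooth_at M M (\<lambda>x. x \<otimes> g) \<one>" and 2: "smooth_at M M (\<lambda>x. k \<otimes> x) (\<one> \<otimes> g)"
    using assms by (auto intro!: smooth_group)
  have 3: "smooth_at M M (\<lambda>x. inv (inv k) \<otimes> x \<otimes> inv k) \<one>"
    and 4: "smooth_at M M (\<lambda>x. x \<otimes> (k \<otimes> g)) (inv (inv k) \<otimes> \<one> \<otimes> inv k)"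
    using assms by (auto intro!: smooth_group)
  have "tmap M M (\<lambda>x. k \<otimes> x) g (rt g \<eta>) = tmap M M (\<lambda>x. k \<otimes> (x \<otimes> g)) \<one> \<eta>"
    using smooth_at_compose(2)[OF good_M good_M good_M 1 2, of \<eta>] assms by (simp add: rt_def)
  moreover have "tmap M M (\<lambda>x. inv (inv k) \<otimes> x \<otimes> inv k \<otimes> (k \<otimes> g)) \<one> \<eta> = rt (k \<otimes> g) (Ad G (inv k) \<eta>)"
    using smooth_at_compose(2)[OF good_M good_M good_M 3 4, of \<eta>] assms by (simp add: rt_def Ad_def)
  moreover have "tmap M M (\<lambda>x. k \<otimes> (x \<otimes> g)) \<one> = tmap M M (\<lambda>x. inv (inv k) \<otimes> x \<otimes> inv k \<otimes> (k \<otimes> g)) \<one>"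
  proof (rule tmap_cong[of M "carrier G"])
    fix x assume "x \<in> carrier G"
    then show "k \<otimes> (x \<otimes> g) = inv (inv k) \<otimes> x \<otimes> inv k \<otimes> (k \<otimes> g)"
      using assms by (simp add: m_assoc inv_solve_left') (simp add: m_assoc[symmetric])
  qed (use openin_topspace[of "mtop M"] in auto)
  ultimately show ?thesis by simp
qed

text \<open>In matrix notation \<open>(f g)' inv (f g) = f' inv f + f (g' inv g) inv f\<close>, and
  conjugation by \<open>f\<close> is \<open>Ad\<close> of its inverse in the present
  convention.\<close>

lemma ld_mult:
  assumes N: "good N" and f: "smooth_at N M f p" and g: "smooth_at N M g p" and v: "v \<in> model N"
  shows "ld N (\<lambda>x. f x \<otimes> g x) p v = ld N f p v + Ad G (inv (f p)) (ld N g p v)"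
proof -
  have MM: "good (prod_mfd M M)" by (rule good_prod_mfd) simp_all
  have c: "f p \<in> carrier G" "g p \<in> carrier G" using smooth_atD(2)[OF f] smooth_atD(2)[OF g] by auto
  have "smooth_map (prod_mfd M M) M (\<lambda>(g, h). g \<otimes> h)" using lie_group by (simp add: lie_group_def)
  from smooth_mapD[OF MM good_M this, of "(f p, g p)"]
  have m: "smooth_at (prod_mfd M M) M (\<lambda>(g, h). g \<otimes> h) (f p, g p)" using c by simp
  have "tmap N M (\<lambda>x. f x \<otimes> g x) p v = tmap (prod_mfd M M) M (\<lambda>(g, h). g \<otimes> h) (f p, g p) (tmap N M f p v, tmap N M g p v)"
    using smooth_at_compose(2)[OF N MM good_M smooth_at_Pair(1)[OF N f g] m v] smooth_at_Pair(2)[OF N f g v] by simp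
  also have "\<dots> = tmap M M (\<lambda>x. x \<otimes> g p) (f p) (tmap N M f p v) + tmap M M (\<lambda>x. f p \<otimes> x) (g p) (tmap N M g p v)"
    by (rule tmap_prod_split(1)[OF good_M good_M good_M m]) auto
  also have "\<dots> = rt (f p \<otimes> g p) (ld N f p v) + rt (f p \<otimes> g p) (Ad G (inv (f p)) (ld N g p v))"
    unfolding tmap_ld[OF f] tmap_ld[OF g] using c by (simp add: tmap_right_mult tmap_left_mult)
  also have "\<dots> = rt (f p \<otimes> g p) (ld N f p v + Ad G (inv (f p)) (ld N g p v))"
    using c by (simp add: linear_add[OF linear_rt])
  finally show ?thesis using c by (simp add: ld_def[of N "\<lambda>x. f x \<otimes> g x"] il_rt)
qed

text \<open>Differentiate the constant product of \<open>f\<close> and its inverse.\<close>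

lemma ld_inv:
  assumes N: "good N" and f: "smooth_at N M f p" and v: "v \<in> model N"
  shows "ld N (\<lambda>x. inv (f x)) p v = - Ad G (f p) (ld N f p v)"
proof -
  have p: "p \<in> pts N" using f by (rule smooth_atD)
  have c: "f p \<in> carrier G" using smooth_atD(2)[OF f] by simp
  obtain V where V: "openin (mtop N) V" "p \<in> V" "\<And>x. x \<in> V \<Longrightarrow> smooth_at N M f x"
    by (rule smooth_at_neighbourhood[OF N good_M f]) (rule that)
  have "ld N (\<lambda>x. f x \<otimes> inv (f x)) p = ld N (\<lambda>x. \<one>) p"
    by (rule ld_cong[OF V(1,2) _ N]) (use smooth_atD(2)[OF V(3)] in auto)
  then have "ld N f p v + Ad G (inv (f p)) (ld N (\<lambda>x. inv (f x)) p v) = 0"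
    using ld_mult[OF N f smooth_inv[OF N f] v] ld_const[OF N p one_closed v] by simp
  then have "Ad G (f p) (Ad G (inv (f p)) (ld N (\<lambda>x. inv (f x)) p v)) = Ad G (f p) (- ld N f p v)"
    by (simp add: add_eq_0_iff)
  then show ?thesis using c by (simp add: Ad_inv linear_neg[OF linear_Ad])
qed

subsection \<open>The adjoint representation and the bracket\<close>

lemma smooth_at_M_vs_cmap: "k \<in> carrier G \<Longrightarrow> x \<in> cdom M k \<Longrightarrow> smooth_at M vs_mfd (cmap M k) x"
  using smooth_at_cmap[of M k x] by (simp add: vs_mfd_eq)

lemma smooth_at_vs_M_cinv: "k \<in> carrier G \<Longrightarrow> y \<in> cmap M k ` cdom M k \<Longrightarrow> smooth_at vs_mfd M (cinv M k) y"
  using smooth_at_cinv[of M k y] by (simp add: vs_mfd_eq)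

lemma one_chart: "\<one> \<in> cdom M \<one>"
  using good_chart(1)[of M \<one>] by simp

text \<open>Composing with the chart at \<open>f p\<close> makes a group-valued map vector-valued
  without changing its derivative at \<open>p\<close>, since that is the chart used by
  \<open>tmap\<close>.\<close>

lemma tmap_cmap_self: 
  assumes "good N" "smooth_at N M f p" "v \<in> model N"
  shows "tmap N vs_mfd (\<lambda>x. cmap M (f p) (f x)) p v = tmap N M f p v"
proof -
  have "f p \<in> cdom M (f p)" using good_chart(1)[of M "f p"] smooth_atD(2)[OF assms(2)] by simp
  then have "tmap N vs_mfd (\<lambda>x. cmap M (f p) (f x)) p = tmap N M f p"
    by (simp add: tmap_def o_def)
  then show ?thesis by simp
qed

text \<open>\<open>Ad G x \<eta>\<close> is the derivative in \<open>h\<close> at the identity of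
  the jointly smooth map \<open>inv x h x\<close>. For every \<open>x\<close> this map fixes the
  identity, so one chart there serves them all.\<close>

lemma smooth_at_Ad:
  assumes g: "g \<in> carrier G" shows "smooth_at M vs_mfd (\<lambda>x. Ad G x \<eta>) g"
proof -
  have MM: "good (prod_mfd M M)" by (rule good_prod_mfd) simp_all
  have gp: "(g, \<one>) \<in> pts (prod_mfd M M)" using g by simp
  note f = smooth_at_fst(1)[OF good_M good_M gp] and s = smooth_at_snd(1)[OF good_M good_M gp]
  have "smooth_at (prod_mfd M M) M (\<lambda>z. inv (fst z) \<otimes> snd z \<otimes> fst z) (g, \<one>)"
    by (intro smooth_mult smooth_inv f s MM)
  moreover have "smooth_at M vs_mfd (cmap M \<one>) (inv (fst (g, \<one>)) \<otimes> snd (g, \<one>) \<otimes> fst (g, \<one>))"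
    using g one_chart by (intro smooth_at_M_vs_cmap) simp_all
  ultimately have "smooth_at (prod_mfd M M) vs_mfd (\<lambda>z. cmap M \<one> (inv (fst z) \<otimes> snd z \<otimes> fst z)) (g, \<one>)"
    by (rule smooth_at_compose(1)[OF MM good_M good_vs_fin_dim])
  then have F: "smooth_at (prod_mfd M M) vs_mfd (\<lambda>(x, h). cmap M \<one> (inv x \<otimes> h \<otimes> x)) (g, \<one>)"
    by (simp add: case_prod_unfold)
  have "smooth_at M vs_mfd (\<lambda>x. tmap M vs_mfd (\<lambda>h. cmap M \<one> (inv x \<otimes> h \<otimes> x)) \<one> \<eta>) g"
    by (rule smooth_at_partial[OF good_M good_M F]) simp
  then show ?thesis
  proof (rule smooth_at_cong[of M "carrier G", rotated 4])
    fix x assume x: "x \<in> carrier G"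
    have "smooth_at M M (\<lambda>h. inv x \<otimes> h \<otimes> x) \<one>" using x by (auto intro!: smooth_conj)
    from tmap_cmap_self[OF good_M this, of \<eta>] show "tmap M vs_mfd (\<lambda>h. cmap M \<one> (inv x \<otimes> h \<otimes> x)) \<one> \<eta> = Ad G x \<eta>"
      using x by (simp add: Ad_def)
  qed (use g openin_topspace[of "mtop M"] in auto)
qed

text \<open>The bracket as derivative of \<open>Ad\<close> at the identity, which makes sense before
  exponentials are available; \<open>lie_bracket_eq\<close> identifies it with the given
  bracket.\<close>

definition br where "br \<xi> \<eta> = tmap M vs_mfd (\<lambda>x. Ad G x \<eta>) \<one> \<xi>"

lemma bounded_bilinear_br: "bounded_bilinear br"
proof (rule framed_bounded_bilinear[OF framed_UNIV_fin_dim framed_UNIV_fin_dim])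
  note s = smooth_at_Ad[OF one_closed]
  show "linear (\<lambda>\<xi>. br \<xi> \<eta>)" for \<eta> unfolding br_def by (rule linear_tmap[OF good_M s])
  show "linear (br \<xi>)" for \<xi>
  proof (rule linearI)
    fix \<eta> \<eta>' and r :: real
    have "tmap M vs_mfd (\<lambda>x. Ad G x (\<eta> + \<eta>')) \<one> = tmap M vs_mfd (\<lambda>x. Ad G x \<eta> + Ad G x \<eta>') \<one>"
      by (rule tmap_cong[of M "carrier G"]) (use openin_topspace[of "mtop M"] in \<open>auto simp: linear_add[OF linear_Ad]\<close>)
    then show "br \<xi> (\<eta> + \<eta>') = br \<xi> \<eta> + br \<xi> \<eta>'"
      unfolding br_def using smooth_at_add(2)[OF good_M s s] by simp
    have "tmap M vs_mfd (\<lambda>x. Ad G x (r *\<^sub>R \<eta>)) \<one> = tmap M vs_mfd (\<lambda>x. r *\<^sub>R Ad G x \<eta>) \<one>"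
      by (rule tmap_cong[of M "carrier G"]) (use openin_topspace[of "mtop M"] in \<open>auto simp: linear_scale[OF linear_Ad]\<close>)
    then show "br \<xi> (r *\<^sub>R \<eta>) = r *\<^sub>R br \<xi> \<eta>"
      unfolding br_def using smooth_at_linear(2)[OF bounded_linear_scaleR_right good_M s] by simp
  qed
qed

lemmas br_simps = bounded_bilinear.add_left[OF bounded_bilinear_br] bounded_bilinear.add_right[OF bounded_bilinear_br]
  bounded_bilinear.diff_left[OF bounded_bilinear_br] bounded_bilinear.diff_right[OF bounded_bilinear_br]
  bounded_bilinear.minus_left[OF bounded_bilinear_br] bounded_bilinear.minus_right[OF bounded_bilinear_br]
  bounded_bilinear.zero_left[OF bounded_bilinear_br] bounded_bilinear.zero_right[OF bounded_bilinear_br]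

text \<open>By the antihomomorphism property, \<open>Ad\<close> at \<open>h g\<close> is
  \<open>Ad\<close> at \<open>h\<close> followed by the fixed linear map
  \<open>Ad G g\<close>.\<close>

lemma tmap_Ad_rt:
  assumes g: "g \<in> carrier G" shows "tmap M vs_mfd (\<lambda>x. Ad G x \<eta>) g (rt g \<xi>) = Ad G g (br \<xi> \<eta>)"
proof -
  have 1: "smooth_at M M (\<lambda>h. h \<otimes> g) \<one>" using g by (auto intro!: smooth_group)
  have 2: "smooth_at M vs_mfd (\<lambda>x. Ad G x \<eta>) (\<one> \<otimes> g)" using g by (simp add: smooth_at_Ad)
  have "tmap M vs_mfd (\<lambda>x. Ad G x \<eta>) g (rt g \<xi>) = tmap M vs_mfd (\<lambda>h. Ad G (h \<otimes> g) \<eta>) \<one> \<xi>"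
    using smooth_at_compose(2)[OF good_M good_M good_vs_fin_dim 1 2, of \<xi>] g by (simp add: rt_def)
  also have "tmap M vs_mfd (\<lambda>h. Ad G (h \<otimes> g) \<eta>) \<one> = tmap M vs_mfd (\<lambda>h. Ad G g (Ad G h \<eta>)) \<one>"
    by (rule tmap_cong[of M "carrier G"]) (use g openin_topspace[of "mtop M"] in \<open>auto simp: Ad_mult\<close>)
  also have "\<dots> \<xi> = Ad G g (br \<xi> \<eta>)"
    using smooth_at_linear(2)[OF bounded_linear_Ad[OF g] good_M smooth_at_Ad[OF one_closed], of \<xi>] by (simp add: br_def)
  finally show ?thesis .
qed

lemma smooth_at_Ad_comp:
  assumes N: "good N" and f: "smooth_at N M f p" and h: "smooth_at N vs_mfd h p"
  shows "smooth_at N vs_mfd (\<lambda>x. Ad G (f x) (h x)) p"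
    and "v \<in> model N \<Longrightarrow> tmap N vs_mfd (\<lambda>x. Ad G (f x) (h x)) p v = Ad G (f p) (br (ld N f p v) (h p) + tmap N vs_mfd h p v)"
proof -
  have c: "f p \<in> carrier G" using smooth_atD(2)[OF f] by simp
  have 0: "smooth_at N vs_mfd (\<lambda>x. Ad G (f x) \<eta>) p" "v \<in> model N \<Longrightarrow> tmap N vs_mfd (\<lambda>x. Ad G (f x) \<eta>) p v = Ad G (f p) (br (ld N f p v) \<eta>)" for \<eta> v
    using smooth_at_compose[OF N good_M good_vs_fin_dim f smooth_at_Ad[OF c]] tmap_Ad_rt[OF c] tmap_ld[OF f] by auto
  obtain V where V: "openin (mtop N) V" "p \<in> V" "\<And>x. x \<in> V \<Longrightarrow> smooth_at N M f x"
    by (rule smooth_at_neighbourhood[OF N good_M f]) (rule that)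
  have lin: "linear (Ad G (f x))" if "x \<in> V" for x using linear_Ad smooth_atD(2)[OF V(3)[OF that]] by simp
  show "smooth_at N vs_mfd (\<lambda>x. Ad G (f x) (h x)) p"
    by (rule smooth_at_linear_family(1)[OF framed_UNIV_fin_dim N V(1,2) lin 0(1) h])
  show "tmap N vs_mfd (\<lambda>x. Ad G (f x) (h x)) p v = Ad G (f p) (br (ld N f p v) (h p) + tmap N vs_mfd h p v)" if v: "v \<in> model N"
    using smooth_at_linear_family(2)[OF framed_UNIV_fin_dim N V(1,2) lin 0(1) h v] 0(2)[OF v]
    by (simp add: linear_add[OF linear_Ad[OF c]])
qed

text \<open>Differentiate in \<open>h\<close> at the identity the relation
  \<open>Ad (inv g h g) (Ad g \<eta>) = Ad g (Ad h \<eta>)\<close>.\<close>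

lemma Ad_br:
  assumes g: "g \<in> carrier G" shows "Ad G g (br \<xi> \<eta>) = br (Ad G g \<xi>) (Ad G g \<eta>)"
proof -
  have 1: "smooth_at M M (\<lambda>h. inv g \<otimes> h \<otimes> g) \<one>" using g by (auto intro!: smooth_conj)
  have 2: "smooth_at M vs_mfd (\<lambda>x. Ad G x (Ad G g \<eta>)) (inv g \<otimes> \<one> \<otimes> g)" using g by (simp add: smooth_at_Ad)
  have "br (Ad G g \<xi>) (Ad G g \<eta>) = tmap M vs_mfd (\<lambda>h. Ad G (inv g \<otimes> h \<otimes> g) (Ad G g \<eta>)) \<one> \<xi>"
    using smooth_at_compose(2)[OF good_M good_M good_vs_fin_dim 1 2, of \<xi>] g by (simp add: br_def Ad_def)
  also have "tmap M vs_mfd (\<lambda>h. Ad G (inv g \<otimes> h \<otimes> g) (Ad G g \<eta>)) \<one> = tmap M vs_mfd (\<lambda>h. Ad G g (Ad G h \<eta>)) \<one>"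
    by (rule tmap_cong[of M "carrier G"]) (use g openin_topspace[of "mtop M"] in \<open>auto simp: Ad_mult Ad_inv\<close>)
  also have "\<dots> \<xi> = Ad G g (br \<xi> \<eta>)"
    using smooth_at_linear(2)[OF bounded_linear_Ad[OF g] good_M smooth_at_Ad[OF one_closed], of \<xi>] by (simp add: br_def)
  finally show ?thesis by simp
qed

text \<open>The derivative at the identity, in direction \<zeta>, of the fact that \<open>Ad\<close>
  respects the bracket.\<close>

lemma jacobi: "br \<zeta> (br \<xi> \<eta>) = br (br \<zeta> \<xi>) \<eta> + br \<xi> (br \<zeta> \<eta>)"
proof -
  note s = smooth_at_Ad[OF one_closed]
  have "tmap M vs_mfd (\<lambda>x. Ad G x (br \<xi> \<eta>)) \<one> = tmap M vs_mfd (\<lambda>x. br (Ad G x \<xi>) (Ad G x \<eta>)) \<one>"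
    by (rule tmap_cong[of M "carrier G"]) (use openin_topspace[of "mtop M"] in \<open>auto simp: Ad_br\<close>)
  then have "br \<zeta> (br \<xi> \<eta>) = tmap M vs_mfd (\<lambda>x. br (Ad G x \<xi>) (Ad G x \<eta>)) \<one> \<zeta>" by (simp add: br_def)
  also have "\<dots> = br \<xi> (br \<zeta> \<eta>) + br (br \<zeta> \<xi>) \<eta>"
    using smooth_at_bilinear(2)[OF bounded_bilinear_br good_M s s, of \<zeta> \<xi> \<eta>] by (simp add: Ad_one br_def[symmetric])
  finally show ?thesis by (simp add: add.commute)
qed


abbreviation "rl \<equiv> (vs_mfd :: (real, real) mfd)"

subsection \<open>One-parameter subgroups\<close>

text \<open>In a chart the curve has vanishing derivative on a ball, so it is locally constant;
  connectedness of the parameter set does the rest.\<close>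

lemma curve_constant:
  assumes I: "open I" "connected I" and f: "\<And>t. t \<in> I \<Longrightarrow> smooth_at rl M f t" "\<And>t. t \<in> I \<Longrightarrow> tmap rl M f t 1 = 0"
    and st: "s \<in> I" "t \<in> I"
  shows "f s = f t"
proof (rule connected_local_const[where f=f, OF I(2) st], intro ballI)
  fix a assume a: "a \<in> I"
  have fa: "f a \<in> carrier G" using smooth_atD(2)[OF f(1)[OF a]] by simp
  note c = good_chart[of M "f a", simplified, OF fa]
  obtain U where U: "openin (mtop rl) U" "a \<in> U" "f ` U \<subseteq> cdom M (f a)"
    using smooth_at_continuous[OF good_vs_real good_M f(1)[OF a] c(2,1)] .
  then obtain e where e: "e > 0" "ball a e \<subseteq> U \<inter> I"
    using a I(1) openE[of "U \<inter> I" a] by (auto simp: open_Int)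
  have d: "((\<lambda>x. cmap M (f a) (f x)) has_derivative (\<lambda>h. 0)) (at t)" if t: "t \<in> ball a e" for t
  proof -
    have tI: "t \<in> I" "f t \<in> cdom M (f a)" using t e U(3) by (auto simp: subset_iff)
    have s: "smooth_at M vs_mfd (cmap M (f a)) (f t)" by (rule smooth_at_M_vs_cmap[OF fa tI(2)])
    note co = smooth_at_compose[OF good_vs_real good_M good_vs_fin_dim f(1)[OF tI(1)] s]
    have "tmap rl vs_mfd (\<lambda>x. cmap M (f a) (f x)) t h = 0" for h
    proof -
      have "tmap rl vs_mfd (\<lambda>x. cmap M (f a) (f x)) t (h *\<^sub>R 1) = h *\<^sub>R tmap rl vs_mfd (\<lambda>x. cmap M (f a) (f x)) t 1"
        by (rule linear_scale[OF linear_tmap[OF good_vs_real co(1)]])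
      also have "\<dots> = 0" using co(2)[of 1] f(2)[OF tI(1)] linear_0[OF linear_tmap[OF good_M s]] by simp
      finally show ?thesis by simp
    qed
    then have "tmap rl vs_mfd (\<lambda>x. cmap M (f a) (f x)) t = (\<lambda>h. 0)" by (rule ext)
    then show ?thesis using has_derivative_tmap_vs[OF good_vs_real co(1)] by simp
  qed
  have eq: "f t = f a" if t: "t \<in> ball a e" for t
  proof -
    have "cmap M (f a) (f t) = cmap M (f a) (f a)"
      by (rule has_derivative_zero_unique[OF convex_ball[of a e] has_derivative_at_withinI[OF d] t]) (use e in auto)
    moreover have "f t \<in> cdom M (f a)" using t e U(3) by (auto simp: subset_iff)
    ultimately show ?thesis using c(1,4) by (auto simp: inj_on_def)
  qed
  show "\<forall>\<^sub>F b in at a within I. f a = f b"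
    unfolding eventually_at by (intro exI[of _ e] conjI e(1) ballI impI, rule eq[symmetric]) (auto simp: dist_commute)
qed

text \<open>Integral curves of the right-invariant vector field of \<xi>, over an arbitrary
  parameter set: their right logarithmic derivative is constant.\<close>

definition icurve where
  "icurve \<xi> I \<gamma> \<longleftrightarrow> (\<forall>t\<in>I. smooth_at rl M \<gamma> t \<and> ld rl \<gamma> t 1 = \<xi>)"

lemma icurveD: "icurve \<xi> I \<gamma> \<Longrightarrow> t \<in> I \<Longrightarrow> smooth_at rl M \<gamma> t" "icurve \<xi> I \<gamma> \<Longrightarrow> t \<in> I \<Longrightarrow> ld rl \<gamma> t 1 = \<xi>"
  "icurve \<xi> I \<gamma> \<Longrightarrow> t \<in> I \<Longrightarrow> \<gamma> t \<in> carrier G"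
  unfolding icurve_def using smooth_atD(2) by fastforce+

text \<open>The right logarithmic derivative of \<open>inv (\<delta> t) \<otimes> \<gamma> t\<close>
  is \<open>- Ad G (\<delta> t) \<xi> + Ad G (\<delta> t) \<xi>\<close>, so this quotient is
  constant.\<close>

lemma icurve_unique:
  assumes I: "open I" "connected I" and c: "icurve \<xi> I \<gamma>" "icurve \<xi> I \<delta>" and t0: "t0 \<in> I" "\<gamma> t0 = \<delta> t0" and t: "t \<in> I"
  shows "\<gamma> t = \<delta> t"
proof -
  let ?f = "\<lambda>t. inv (\<delta> t) \<otimes> \<gamma> t"
  have "?f t = ?f t0"
  proof (rule curve_constant[OF I])
    fix s assume s: "s \<in> I"
    note d = icurveD[OF c(2) s] and g = icurveD[OF c(1) s]
    show sm: "smooth_at rl M ?f s" by (intro smooth_group good_vs_real d g)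
    have "ld rl ?f s 1 = 0"
      using ld_mult[OF good_vs_real smooth_inv[OF good_vs_real d(1)] g(1), of 1] ld_inv[OF good_vs_real d(1), of 1] d g by simp
    then show "tmap rl M ?f s 1 = 0"
      using tmap_ld[OF sm, of 1] linear_0[OF linear_rt, of "?f s"] d(3) g(3) by simp
  qed (use t t0 in auto)
  then have "inv (\<delta> t) \<otimes> \<gamma> t = \<one>" using t0 icurveD(3)[OF c(2) t0(1)] by simp
  then show ?thesis using icurveD(3)[OF c(1) t] icurveD(3)[OF c(2) t] by (metis inv_equality inv_inv inv_closed)
qed

lemma local_icurve:
  obtains \<epsilon> \<gamma> where "\<epsilon> > 0" "\<gamma> 0 = \<one>" "icurve \<xi> {-\<epsilon><..<\<epsilon>} \<gamma>"
proof -
  let ?S = "cmap M \<one> ` cdom M \<one>" and ?\<phi> = "cmap M \<one>"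
  note c = good_chart[of M \<one>, simplified]
  \<comment> \<open>The right-invariant field extending \<xi>, expressed in the chart at the
    identity.\<close>
  define X where "X y = tmap M vs (\<lambda>h. ?\<phi> (h \<otimes> cinv M \<one> y)) \<one> \<xi>" for y
  have S: "open ?S" using c(3) by simp
  have cin: "cinv M \<one> y \<in> carrier G" "cinv M \<one> y \<in> cdom M \<one>" if "y \<in> ?S" for y using c(6)[OF that] c(10) by auto
  have "smooth_at vs vs X y" if y: "y \<in> ?S" for y
  proof -
    have vM: "good (prod_mfd vs M)" by (intro good_prod_mfd) simp_all
    have p: "(y, \<one>) \<in> pts (prod_mfd vs M)" by simp
    note f = smooth_at_fst(1)[OF good_vs_fin_dim good_M p] and s = smooth_at_snd(1)[OF good_vs_fin_dim good_M p]
    have "smooth_at vs M (cinv M \<one>) (fst (y, \<one>))" using smooth_at_vs_M_cinv[OF one_closed y] by simp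
    note ci = smooth_at_compose(1)[OF vM good_vs_fin_dim good_M f this]
    have "smooth_at (prod_mfd vs M) M (\<lambda>z. snd z \<otimes> cinv M \<one> (fst z)) (y, \<one>)"
      by (rule smooth_mult[OF vM s ci])
    moreover have "smooth_at M vs ?\<phi> (snd (y, \<one>) \<otimes> cinv M \<one> (fst (y, \<one>)))"
      using cin[OF y] by (intro smooth_at_M_vs_cmap) simp_all
    ultimately have "smooth_at (prod_mfd vs M) vs (\<lambda>z. ?\<phi> (snd z \<otimes> cinv M \<one> (fst z))) (y, \<one>)"
      by (rule smooth_at_compose(1)[OF vM good_M good_vs_fin_dim])
    then have "smooth_at (prod_mfd vs M) vs (\<lambda>(y, h). ?\<phi> (h \<otimes> cinv M \<one> y)) (y, \<one>)" by (simp add: case_prod_unfold)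
    from smooth_at_partial[OF good_vs_fin_dim good_M this, of \<xi>] show ?thesis by (simp add: X_def[abs_def])
  qed
  then have "smooth_on UNIV ?S X" by (rule smooth_on_of_smooth_at_vs[OF S])
  then obtain \<epsilon> k where k: "\<epsilon> > 0" "k 0 = ?\<phi> \<one>" "\<And>t. t \<in> {-\<epsilon><..<\<epsilon>} \<Longrightarrow> k t \<in> ?S"
    "\<And>t. t \<in> {-\<epsilon><..<\<epsilon>} \<Longrightarrow> (k has_vector_derivative X (k t)) (at t)" "smooth_on UNIV {-\<epsilon><..<\<epsilon>} k"
    using ode_local_solution[OF framed_UNIV_fin_dim S imageI[OF c(1)], of X thesis] by blast
  have "smooth_at rl M (\<lambda>t. cinv M \<one> (k t)) t \<and> ld rl (\<lambda>t. cinv M \<one> (k t)) t 1 = \<xi>" if t: "t \<in> {-\<epsilon><..<\<epsilon>}" for t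
  proof -
    let ?g = "cinv M \<one> (k t)"
    note kS = k(3)[OF t]
    have sk: "smooth_at rl vs k t" by (rule smooth_at_vs_vs[OF k(5)]) (use t in auto)
    have sci: "smooth_at vs M (cinv M \<one>) (k t)" by (rule smooth_at_vs_M_cinv[OF one_closed kS])
    note co = smooth_at_compose[OF good_vs_real good_vs_fin_dim good_M sk sci]
    have "tmap rl vs k t 1 = X (k t)"
      using tmap_vs_eqI[OF good_vs_real, of t k "\<lambda>h. h *\<^sub>R X (k t)" 1] k(4)[OF t] by (simp add: has_vector_derivative_def)
    moreover have "X (k t) = tmap M vs ?\<phi> ?g (rt ?g \<xi>)"
    proof -
      have 1: "smooth_at M M (\<lambda>h. h \<otimes> ?g) \<one>" using cin[OF kS] by (auto intro!: smooth_group)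
      have 2: "smooth_at M vs ?\<phi> (\<one> \<otimes> ?g)" using cin[OF kS] by (simp add: smooth_at_M_vs_cmap)
      show ?thesis using smooth_at_compose(2)[OF good_M good_M good_vs_fin_dim 1 2, of \<xi>] cin[OF kS] by (simp add: X_def rt_def)
    qed
    moreover have "tmap vs M (cinv M \<one>) (k t) (tmap M vs ?\<phi> ?g w) = w" for w
    proof -
      have 1: "smooth_at M vs ?\<phi> ?g" using cin[OF kS] by (simp add: smooth_at_M_vs_cmap)
      have 2: "smooth_at vs M (cinv M \<one>) (?\<phi> ?g)" using sci c(7)[OF kS] by simp
      have "tmap vs M (cinv M \<one>) (k t) (tmap M vs ?\<phi> ?g w) = tmap M M (\<lambda>x. cinv M \<one> (?\<phi> x)) ?g w"
        using smooth_at_compose(2)[OF good_M good_vs_fin_dim good_M 1 2, of w] c(7)[OF kS] by simp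
      also have "tmap M M (\<lambda>x. cinv M \<one> (?\<phi> x)) ?g = tmap M M (\<lambda>x. x) ?g"
        by (rule tmap_cong[OF c(2)]) (use cin[OF kS] c(5) in auto)
      finally show ?thesis using cin[OF kS] by (simp add: tmap_id)
    qed
    ultimately have "tmap rl M (\<lambda>t. cinv M \<one> (k t)) t 1 = rt ?g \<xi>" using co(2)[of 1] by simp
    then show ?thesis using co(1) cin[OF kS] by (simp add: ld_def il_rt)
  qed
  then have "icurve \<xi> {-\<epsilon><..<\<epsilon>} (\<lambda>t. cinv M \<one> (k t))" by (simp add: icurve_def)
  then show ?thesis using k(1,2) c(1,5) by (intro that[of \<epsilon> "\<lambda>t. cinv M \<one> (k t)"]) auto
qed

lemma tmap_shift: "tmap rl rl (\<lambda>s. s + t) x 1 = 1" "smooth_at rl rl (\<lambda>s. s + t) x"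
  "tmap rl rl (\<lambda>s. t * s) x 1 = t" "smooth_at rl rl (\<lambda>s. t * s) x"
proof -
  have id: "smooth_at rl rl (\<lambda>s. s) x" "tmap rl rl (\<lambda>s. s) x 1 = 1"
    by (auto intro!: smooth_at_id tmap_id)
  have co: "smooth_at rl rl (\<lambda>s. t) x" "tmap rl rl (\<lambda>s. t) x 1 = 0"
    by (auto intro!: smooth_at_const tmap_const)
  show "tmap rl rl (\<lambda>s. s + t) x 1 = 1" "smooth_at rl rl (\<lambda>s. s + t) x"
    using smooth_at_add[OF good_vs_real id(1) co(1)] id co by auto
  show "tmap rl rl (\<lambda>s. t * s) x 1 = t" "smooth_at rl rl (\<lambda>s. t * s) x"
    using smooth_at_linear(1)[OF bounded_linear_mult_right[of t] good_vs_real id(1)]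
      smooth_at_linear(2)[OF bounded_linear_mult_right[of t] good_vs_real id(1), of 1] id by auto
qed

lemma icurve_shift:
  assumes "icurve \<xi> I \<gamma>" "\<And>s. s \<in> J \<Longrightarrow> s + t \<in> I" shows "icurve \<xi> J (\<lambda>s. \<gamma> (s + t))"
  unfolding icurve_def
proof
  fix s assume "s \<in> J"
  note g = icurveD[OF assms(1) assms(2)[OF this]]
  show "smooth_at rl M (\<lambda>s. \<gamma> (s + t)) s \<and> ld rl (\<lambda>s. \<gamma> (s + t)) s 1 = \<xi>"
    using smooth_at_compose(1)[OF good_vs_real good_vs_real good_M tmap_shift(2) g(1)]
      ld_compose[OF good_vs_real good_vs_real tmap_shift(2) g(1), of 1] tmap_shift(1) g(2) by auto
qed

lemma icurve_mult_right:
  assumes "icurve \<xi> I \<gamma>" "k \<in> carrier G" shows "icurve \<xi> I (\<lambda>s. \<gamma> s \<otimes> k)"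
  unfolding icurve_def
proof
  fix s assume s: "s \<in> I"
  note g = icurveD[OF assms(1) s]
  have k: "smooth_at rl M (\<lambda>_. k) s" "ld rl (\<lambda>_. k) s 1 = 0" using assms(2) by (auto intro!: smooth_group ld_const)
  show "smooth_at rl M (\<lambda>s. \<gamma> s \<otimes> k) s \<and> ld rl (\<lambda>s. \<gamma> s \<otimes> k) s 1 = \<xi>"
    using smooth_mult[OF good_vs_real g(1) k(1)] ld_mult[OF good_vs_real g(1) k(1), of 1] k g
    by (simp add: linear_0[OF linear_Ad])
qed

lemma icurve_cong:
  assumes "icurve \<xi> I \<gamma>" "open I" "\<And>s. s \<in> I \<Longrightarrow> \<gamma> s = \<delta> s" shows "icurve \<xi> I \<delta>"
  unfolding icurve_def
proof
  fix s assume s: "s \<in> I"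
  show "smooth_at rl M \<delta> s \<and> ld rl \<delta> s 1 = \<xi>"
    using smooth_at_cong[of rl I s \<gamma> \<delta> M] ld_cong[of rl I s \<gamma> \<delta>] assms(2,3) s icurveD[OF assms(1) s] by simp
qed

text \<open>As functions of \<open>s\<close> both sides are integral curves for the same \<xi>, and
  they agree at 0.\<close>

lemma icurve_hom:
  assumes e: "icurve \<xi> {-e<..<e} \<gamma>" "\<gamma> 0 = \<one>" and st: "\<bar>s\<bar> < e" "\<bar>t\<bar> < e" "\<bar>s + t\<bar> < e"
  shows "\<gamma> (s + t) = \<gamma> s \<otimes> \<gamma> t"
proof -
  let ?J = "{-e<..<e} \<inter> {-e-t<..<e-t}"
  have t: "\<gamma> t \<in> carrier G" using icurveD(3)[OF e(1), of t] st by (auto simp: abs_less_iff)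
  have 1: "icurve \<xi> ?J (\<lambda>s. \<gamma> (s + t))" by (rule icurve_shift[OF e(1)]) auto
  have "icurve \<xi> ?J \<gamma>" using e(1) unfolding icurve_def by blast
  then have 2: "icurve \<xi> ?J (\<lambda>s. \<gamma> s \<otimes> \<gamma> t)" by (rule icurve_mult_right[OF _ t])
  \<comment> \<open>The two curves can be compared only where \<open>s\<close> and
    \<open>s + t\<close> both stay within the bound; this set is an interval, as the uniqueness
    argument demands.\<close>
  have "?J = {max (-e) (-e-t)<..<min e (e-t)}" by auto
  then have J: "open ?J" "connected ?J" by auto
  show ?thesis
    using icurve_unique[OF J 1 2, of 0 s] e(2) t st by (auto simp: abs_less_iff)
qed

text \<open>Right translation by \<open>\<gamma> t\<close> carries the derivative at 0 to the one at
  \<open>t\<close>, so homomorphisms solve the differential equation; conversely, solutions are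
  homomorphisms by uniqueness.\<close>

lemma one_param_subgroup_icurve:
  "one_param_subgroup G \<xi> \<gamma> \<longleftrightarrow> icurve \<xi> UNIV \<gamma> \<and> \<gamma> 0 = \<one>"
proof
  assume g: "one_param_subgroup G \<xi> \<gamma>"
  then have sm: "smooth_at rl M \<gamma> t" for t
    unfolding one_param_subgroup_def using smooth_map_iff[OF good_vs_real good_M] by auto
  have c: "\<gamma> t \<in> carrier G" for t using smooth_atD(2)[OF sm[of t]] by simp
  have add: "\<gamma> (s + t) = \<gamma> s \<otimes> \<gamma> t" for s t using g by (simp add: one_param_subgroup_def)
  have 0: "\<gamma> 0 = \<one>" using add[of 0 0] c[of 0] by (metis add_0 l_cancel_one')
  have "ld rl \<gamma> 0 1 = \<xi>" using g 0 by (simp add: one_param_subgroup_def ld_def il_one)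
  then have "icurve \<xi> {0} \<gamma>" using sm by (simp add: icurve_def)
  then have "ld rl (\<lambda>s. \<gamma> s \<otimes> \<gamma> t) 0 1 = \<xi>" for t using icurve_mult_right[OF _ c] icurveD(2) by blast
  moreover have "ld rl (\<lambda>s. \<gamma> (s + t)) 0 1 = ld rl \<gamma> t 1" for t
    using ld_compose[OF good_vs_real good_vs_real tmap_shift(2) sm, of 1 t 0] tmap_shift(1)[of t 0] by simp
  ultimately have "ld rl \<gamma> t 1 = \<xi>" for t by (simp add: add)
  then show "icurve \<xi> UNIV \<gamma> \<and> \<gamma> 0 = \<one>" using sm 0 by (simp add: icurve_def)
next
  assume g: "icurve \<xi> UNIV \<gamma> \<and> \<gamma> 0 = \<one>"
  then have g': "icurve \<xi> {-e<..<e} \<gamma>" for e by (auto simp: icurve_def)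
  have "\<gamma> (s + t) = \<gamma> s \<otimes> \<gamma> t" for s t
    by (rule icurve_hom[OF g'[of "\<bar>s\<bar> + \<bar>t\<bar> + 1"]]) (use g in auto)
  moreover have "smooth_map rl M \<gamma>" using g smooth_map_iff[OF good_vs_real good_M] by (auto simp: icurve_def)
  moreover have "tmap rl M \<gamma> 0 1 = \<xi>" using g by (auto simp: icurve_def tmap_ld rt_one)
  ultimately show "one_param_subgroup G \<xi> \<gamma>" by (simp add: one_param_subgroup_def)
qed

text \<open>The local solution \<open>g\<close> is a homomorphism as far as it is defined, so the
  value at \<open>t\<close> is taken to be the \<open>n\<close>-th power of \<open>g (t / n)\<close>
  for large \<open>n\<close>.\<close>

lemma global_icurve:
  obtains \<gamma> where "icurve \<xi> UNIV \<gamma>" "\<gamma> 0 = \<one>"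
proof -
  obtain e g where e: "e > 0" "g 0 = \<one>" "icurve \<xi> {-e<..<e} g" by (rule local_icurve)
  have gc: "g t \<in> carrier G" if "\<bar>t\<bar> < e" for t using icurveD(3)[OF e(3), of t] that by (auto simp: abs_less_iff)
  have add: "g (s + t) = g s \<otimes> g t" if "\<bar>s\<bar> < e" "\<bar>t\<bar> < e" "\<bar>s + t\<bar> < e" for s t
    by (rule icurve_hom[OF e(3,2) that])
  have mul: "g (real k * t) = g t [^] k" if t: "\<bar>real n * t\<bar> < e" and "k \<le> n" "0 < n" for k n t
    using \<open>k \<le> n\<close>
  proof (induction k)
    case 0 then show ?case using e(2) by simp
  next
    case (Suc k)
    have b: "\<bar>real j * t\<bar> < e" if "j \<le> n" for j
      using that t mult_right_mono[of "real j" "real n" "\<bar>t\<bar>"] by (simp add: abs_mult)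
    have "\<bar>t\<bar> < e" using b[of 1] \<open>0 < n\<close> by simp
    then have "g (real k * t + t) = g (real k * t) \<otimes> g t"
      using b[of k] b[of "Suc k"] Suc.prems by (intro add) (auto simp: algebra_simps)
    then show ?case using Suc by (simp add: algebra_simps)
  qed
  \<comment> \<open>Two subdivisions are compared through their common refinement into
    \<open>n * m\<close> parts.\<close>
  have indep: "g (t / real n) [^] n = g (t / real m) [^] m"
    if nm: "0 < n" "0 < m" "\<bar>t / real n\<bar> < e" "\<bar>t / real m\<bar> < e" for t n m
  proof -
    have *: "g (t / real n) [^] n = g (t / (real n * real m)) [^] (m * n)" if "0 < n" "0 < m" "\<bar>t / real n\<bar> < e" for n m
    proof -
      have "real m * (t / (real n * real m)) = t / real n" using that by simp
      then have "g (t / real n) = g (t / (real n * real m)) [^] m"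
        using mul[of m "t / (real n * real m)" m] that by simp
      moreover have "\<bar>t / (real n * real m)\<bar> < e"
      proof -
        have "\<bar>t / (real n * real m)\<bar> = \<bar>t / real n\<bar> / real m" by (simp add: abs_mult)
        also have "\<dots> \<le> \<bar>t / real n\<bar>" using that divide_left_mono[of 1 "real m" "\<bar>t / real n\<bar>"] by simp
        finally show ?thesis using that by simp
      qed
      ultimately show ?thesis using gc by (simp add: nat_pow_pow)
    qed
    show ?thesis using *[OF nm(1,2,3)] *[OF nm(2,1,4)] by (simp add: mult.commute)
  qed
  \<comment> \<open>The ceiling plus 1 is positive and strictly exceeds \<open>|t| / e\<close>, so
    \<open>t / n\<close> lies in the domain of \<open>g\<close> for all \<open>n\<close> from
    \<open>N t\<close> on.\<close>
  define N where "N t = nat \<lceil>\<bar>t\<bar> / e\<rceil> + 1" for t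
  have N: "0 < n \<and> \<bar>t / real n\<bar> < e" if "n \<ge> N t" for n t
  proof -
    have "\<bar>t\<bar> / e < real n" using that unfolding N_def by linarith
    moreover have "0 < n" using that by (simp add: N_def)
    ultimately show ?thesis using e(1) by (simp add: field_simps)
  qed
  define \<gamma> where "\<gamma> t = g (t / real (N t)) [^] N t" for t
  have \<gamma>: "\<gamma> t = g (t / real n) [^] n" if "0 < n" "\<bar>t / real n\<bar> < e" for t n
    unfolding \<gamma>_def using N[of t "N t"] that by (intro indep) auto
  have \<gamma>g: "\<gamma> t = g t" if "\<bar>t\<bar> < e" for t using \<gamma>[of 1 t] that gc by simp
  have \<gamma>add: "\<gamma> (s + t) = \<gamma> s \<otimes> \<gamma> t" for s t
  proof -
    define n where "n = N s + N t + N (s + t)"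
    have n: "0 < n" "\<bar>s / real n\<bar> < e" "\<bar>t / real n\<bar> < e" "\<bar>(s + t) / real n\<bar> < e"
      using N[of s n] N[of t n] N[of "s + t" n] by (auto simp: n_def)
    \<comment> \<open>The two small elements commute, because \<open>g\<close> turns the sum into a
      product in either order; this is what lets the power of their product split.\<close>
    have a: "g ((s + t) / real n) = g (s / real n) \<otimes> g (t / real n)" "g ((s + t) / real n) = g (t / real n) \<otimes> g (s / real n)"
      using add[OF n(2,3)] add[OF n(3,2)] n(4) by (auto simp: add_divide_distrib add.commute)
    then show ?thesis using \<gamma>[OF n(1,2)] \<gamma>[OF n(1,3)] \<gamma>[OF n(1,4)] gc[OF n(2)] gc[OF n(3)]
      by (simp add: pow_mult_distrib)
  qed
  have \<gamma>c: "\<gamma> t \<in> carrier G" for t using gc N[of t "N t"] by (simp add: \<gamma>_def)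
  have ic: "icurve \<xi> {-e<..<e} \<gamma>" by (rule icurve_cong[OF e(3)]) (auto simp: \<gamma>g abs_less_iff)
  \<comment> \<open>Near any time \<open>t\<close> the curve is the right translate by
    \<open>\<gamma> t\<close> of the local solution, hence it solves the same equation.\<close>
  have "icurve \<xi> UNIV \<gamma>"
    unfolding icurve_def
  proof
    fix t
    have "icurve \<xi> {t-e<..<t+e} (\<lambda>s. \<gamma> (s + (- t)))" by (rule icurve_shift[OF ic]) auto
    then have "icurve \<xi> {t-e<..<t+e} (\<lambda>s. \<gamma> (s + (- t)) \<otimes> \<gamma> t)" by (rule icurve_mult_right[OF _ \<gamma>c])
    then show "smooth_at rl M \<gamma> t \<and> ld rl \<gamma> t 1 = \<xi>"
      using e(1) by (simp add: \<gamma>add[symmetric] icurve_def)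
  qed
  moreover have "\<gamma> 0 = \<one>" using \<gamma>g[of 0] e by simp
  ultimately show ?thesis by (rule that)
qed

lemma lexp_icurve:
  assumes "icurve \<xi> UNIV \<gamma>" "\<gamma> 0 = \<one>" shows "lexp G (t *\<^sub>R \<xi>) = \<gamma> t"
proof -
  have "icurve (t *\<^sub>R \<xi>) UNIV (\<lambda>s. \<gamma> (t * s))"
    unfolding icurve_def
  proof
    fix s
    note g = icurveD[OF assms(1) UNIV_I, of "t * s"]
    have "ld rl (\<lambda>s. \<gamma> (t * s)) s 1 = ld rl \<gamma> (t * s) (t *\<^sub>R 1)"
      using ld_compose[OF good_vs_real good_vs_real tmap_shift(4) g(1), of 1] tmap_shift(3) by simp
    then show "smooth_at rl M (\<lambda>s. \<gamma> (t * s)) s \<and> ld rl (\<lambda>s. \<gamma> (t * s)) s 1 = t *\<^sub>R \<xi>"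
      using smooth_at_compose(1)[OF good_vs_real good_vs_real good_M tmap_shift(4) g(1)] g(2)
        linear_scale[OF linear_ld[OF good_vs_real g(1)], of t 1] by simp
  qed
  then have *: "icurve (t *\<^sub>R \<xi>) UNIV (\<lambda>s. \<gamma> (t * s)) \<and> \<gamma> (t * 0) = \<one>" using assms(2) by simp
  have "(THE \<gamma>'. one_param_subgroup G (t *\<^sub>R \<xi>) \<gamma>') = (\<lambda>s. \<gamma> (t * s))"
    unfolding one_param_subgroup_icurve
  proof (rule the_equality, fact)
    fix \<gamma>' assume g': "icurve (t *\<^sub>R \<xi>) UNIV \<gamma>' \<and> \<gamma>' 0 = \<one>"
    show "\<gamma>' = (\<lambda>s. \<gamma> (t * s))"
      by (rule ext, rule icurve_unique[of UNIV "t *\<^sub>R \<xi>" _ _ 0]) (use g' * in auto)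
  qed
  then show ?thesis by (simp add: lexp_def)
qed

lemma lexp_curve: "smooth_at rl M (\<lambda>t. lexp G (t *\<^sub>R \<xi>)) t" "ld rl (\<lambda>t. lexp G (t *\<^sub>R \<xi>)) t 1 = \<xi>"
  "lexp G (t *\<^sub>R \<xi>) \<in> carrier G" "lexp G 0 = \<one>"
  "lexp G ((s + t) *\<^sub>R \<xi>) = lexp G (s *\<^sub>R \<xi>) \<otimes> lexp G (t *\<^sub>R \<xi>)"
proof -
  obtain \<gamma> where g: "icurve \<xi> UNIV \<gamma>" "\<gamma> 0 = \<one>" by (rule global_icurve)
  have eq: "(\<lambda>t. lexp G (t *\<^sub>R \<xi>)) = \<gamma>" using lexp_icurve[OF g] by blast
  show "smooth_at rl M (\<lambda>t. lexp G (t *\<^sub>R \<xi>)) t" "ld rl (\<lambda>t. lexp G (t *\<^sub>R \<xi>)) t 1 = \<xi>"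
    using icurveD[OF g(1) UNIV_I] unfolding eq by auto
  show "lexp G (t *\<^sub>R \<xi>) \<in> carrier G" "lexp G 0 = \<one>"
    using icurveD(3)[OF g(1) UNIV_I] fun_cong[OF eq] g(2) by auto (metis scaleR_zero_left)
  have "one_param_subgroup G \<xi> \<gamma>" using g one_param_subgroup_icurve by blast
  then show "lexp G ((s + t) *\<^sub>R \<xi>) = lexp G (s *\<^sub>R \<xi>) \<otimes> lexp G (t *\<^sub>R \<xi>)"
    using fun_cong[OF eq] by (simp add: one_param_subgroup_def)
qed

lemma vector_derivative_eq_tmap:
  assumes "smooth_at rl vs_mfd f t"
  shows "(f has_vector_derivative tmap rl vs_mfd f t 1) (at t)"
proof -
  have "tmap rl vs_mfd f t = (\<lambda>h. h *\<^sub>R tmap rl vs_mfd f t 1)"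
  proof
    fix h show "tmap rl vs_mfd f t h = h *\<^sub>R tmap rl vs_mfd f t 1"
      using linear_scale[OF linear_tmap[OF good_vs_real assms], of h 1] by simp
  qed
  then show ?thesis
    using has_derivative_tmap_vs[OF good_vs_real assms] unfolding has_vector_derivative_def by simp
qed

text \<open>The exponential curve passes through the identity at time 0 with logarithmic derivative
  \<xi>, so differentiating \<open>Ad\<close> along it gives the derivative at the identity in
  direction \<xi>.\<close>

lemma lie_bracket_eq: "lie_bracket G = br"
proof (intro ext)
  fix \<xi> \<eta>
  have h: "smooth_at rl vs (\<lambda>_. \<eta>) 0" by (rule smooth_at_vs_const) simp_all
  have s: "smooth_at rl vs (\<lambda>t. Ad G (lexp G (t *\<^sub>R \<xi>)) \<eta>) 0"
    and t: "tmap rl vs (\<lambda>t. Ad G (lexp G (t *\<^sub>R \<xi>)) \<eta>) 0 1 = br \<xi> \<eta>"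
    using smooth_at_Ad_comp(1)[OF good_vs_real lexp_curve(1)[of \<xi> 0] h]
      smooth_at_Ad_comp(2)[OF good_vs_real lexp_curve(1)[of \<xi> 0] h, of 1] lexp_curve(4) lexp_curve(2)[of \<xi> 0]
    by (auto simp: Ad_one tmap_const)
  show "lie_bracket G \<xi> \<eta> = br \<xi> \<eta>"
    unfolding lie_bracket_def using vector_derivative_at[OF vector_derivative_eq_tmap[OF s]] t by simp
qed

text \<open>The one-parameter subgroup of \<xi> is commutative, so conjugation by its elements fixes
  it pointwise and \<open>Ad\<close> along it fixes \<xi>; differentiate in
  \<open>t\<close>.\<close>

lemma br_self: "br \<xi> \<xi> = 0"
proof -
  have A: "Ad G (lexp G (t *\<^sub>R \<xi>)) \<xi> = \<xi>" for t
  proof -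
    let ?k = "lexp G (t *\<^sub>R \<xi>)" and ?g = "\<lambda>s. lexp G (s *\<^sub>R \<xi>)"
    note k = lexp_curve(3)[of t \<xi>]
    have comm: "inv ?k \<otimes> ?g s \<otimes> ?k = ?g s" for s
    proof -
      have "?g s \<otimes> ?k = ?k \<otimes> ?g s" using lexp_curve(5)[of s t \<xi>] lexp_curve(5)[of t s \<xi>] by (simp add: add.commute)
      then show ?thesis using k lexp_curve(3)[of s \<xi>] by (simp add: m_assoc) (simp add: m_assoc[symmetric])
    qed
    have 1: "smooth_at M M (\<lambda>h. inv ?k \<otimes> h \<otimes> ?k) (?g 0)" using lexp_curve(4) k by (auto intro!: smooth_conj)
    have "ld rl (\<lambda>s. inv ?k \<otimes> ?g s \<otimes> ?k) 0 1 = Ad G ?k (ld rl ?g 0 1)"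
      using ld_compose[OF good_vs_real good_M lexp_curve(1) 1, of 1] lexp_curve(4) Ad_ld[OF k]
      by (simp add: tmap_ld[OF lexp_curve(1)] rt_one)
    then show ?thesis using comm lexp_curve(2)[of \<xi> 0] by simp
  qed
  have h: "smooth_at rl vs (\<lambda>_. \<xi>) 0" by (rule smooth_at_vs_const) simp_all
  have "br \<xi> \<xi> = tmap rl vs (\<lambda>t. Ad G (lexp G (t *\<^sub>R \<xi>)) \<xi>) 0 1"
    using smooth_at_Ad_comp(2)[OF good_vs_real lexp_curve(1)[of \<xi> 0] h, of 1] lexp_curve(4)
      lexp_curve(2)[of \<xi> 0] by (simp add: Ad_one tmap_const)
  also have "\<dots> = 0" by (simp add: A tmap_const)
  finally show ?thesis .
qed

lemma br_antisym: "br \<xi> \<eta> = - br \<eta> \<xi>"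
proof -
  have "br \<eta> \<xi> + br \<xi> \<eta> = 0"
    using br_self[of "\<xi> + \<eta>"] unfolding br_simps(1,2) br_self[of \<xi>] br_self[of \<eta>] by (simp add: add.commute)
  then show ?thesis by (simp add: eq_neg_iff_add_eq_0 add.commute)
qed

subsection \<open>The Maurer--Cartan form\<close>

text \<open>The right Maurer-Cartan form in the chart at \<open>g\<close>: the coordinate vector
  \<open>u\<close> at \<open>x\<close> is taken to the group and translated to the identity.\<close>

definition mc where "mc g x u = ld vs (cinv M g) x u"

lemma linear_mc: "g \<in> carrier G \<Longrightarrow> x \<in> cmap M g ` cdom M g \<Longrightarrow> linear (mc g x)"
  unfolding mc_def[abs_def] by (intro linear_ld smooth_at_vs_M_cinv) auto

lemma tmap_cinv_cmap:
  assumes g: "g \<in> carrier G" and y: "y \<in> cmap M g ` cdom M g"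
  shows "tmap M vs (cmap M g) (cinv M g y) (tmap vs M (cinv M g) y u) = u"
proof -
  note c = good_chart[of M g, simplified, OF g]
  have 2: "smooth_at M vs (cmap M g) (cinv M g y)" using c(6)[OF y] g by (simp add: smooth_at_M_vs_cmap)
  have 1: "smooth_at vs M (cinv M g) y" by (rule smooth_at_vs_M_cinv[OF g y])
  have "tmap M vs (cmap M g) (cinv M g y) (tmap vs M (cinv M g) y u) = tmap vs vs (\<lambda>x. cmap M g (cinv M g x)) y u"
    using smooth_at_compose(2)[OF good_vs_fin_dim good_M good_vs_fin_dim 1 2, of u] by simp
  also have "tmap vs vs (\<lambda>x. cmap M g (cinv M g x)) y = tmap vs vs (\<lambda>x. x) y"
    by (rule tmap_cong[of vs "cmap M g ` cdom M g"]) (use c y in auto)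
  finally show ?thesis by (simp add: tmap_id)
qed

lemma mc_inj:
  assumes g: "g \<in> carrier G" and y: "y \<in> cmap M g ` cdom M g" and "mc g y u = mc g y w"
  shows "u = w"
proof -
  have c: "cinv M g y \<in> carrier G" using good_chart(6,10)[of M g] g y by auto
  have "tmap vs M (cinv M g) y u = tmap vs M (cinv M g) y w"
    using assms(3) rt_il[OF c] unfolding mc_def ld_def by metis
  then show ?thesis using tmap_cinv_cmap[OF g y] by metis
qed

text \<open>The value at \<open>x\<close> is the derivative at \<open>h = 0\<close> of
  \<open>cinv M g (x + h) \<otimes> inv (cinv M g x)\<close>, a jointly smooth map that equals the
  identity at \<open>h = 0\<close> for every \<open>x\<close>; hence the chart at the identity
  suffices throughout.\<close>

lemma smooth_mc:
  assumes g: "g \<in> carrier G" shows "smooth_on UNIV (cmap M g ` cdom M g) (\<lambda>x. mc g x u)"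
proof (rule smooth_on_of_smooth_at_vs)
  note c = good_chart[of M g, simplified, OF g]
  let ?S = "cmap M g ` cdom M g"
  show S: "open ?S" using c(3) by simp
  fix x assume x: "x \<in> ?S"
  have vv: "good (prod_mfd vs vs)" by (intro good_prod_mfd) simp_all
  have p: "(x, 0) \<in> pts (prod_mfd vs vs)" by simp
  note f = smooth_at_fst(1)[OF good_vs_fin_dim good_vs_fin_dim p] and s = smooth_at_snd(1)[OF good_vs_fin_dim good_vs_fin_dim p]
  have cx: "cinv M g x \<in> carrier G" if "x \<in> ?S" for x using c(6)[OF that] c(10) by auto
  let ?F = "\<lambda>x h. cmap M \<one> (cinv M g (x + h) \<otimes> inv (cinv M g x))"
  have 1: "smooth_at vs M (cinv M g) (fst (x, 0) + snd (x, 0))" "smooth_at vs M (cinv M g) (fst (x, 0))"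
    using smooth_at_vs_M_cinv[OF g x] by auto
  have 2: "smooth_at (prod_mfd vs vs) vs (\<lambda>z. fst z + snd z) (x, 0)" by (rule smooth_at_add(1)[OF vv f s])
  have 3: "smooth_at (prod_mfd vs vs) M (\<lambda>z. cinv M g (fst z + snd z) \<otimes> inv (cinv M g (fst z))) (x, 0)"
    by (intro smooth_mult smooth_inv vv smooth_at_compose(1)[OF vv good_vs_fin_dim good_M 2 1(1)] smooth_at_compose(1)[OF vv good_vs_fin_dim good_M f 1(2)])
  have 4: "smooth_at M vs (cmap M \<one>) (cinv M g (fst (x, 0) + snd (x, 0)) \<otimes> inv (cinv M g (fst (x, 0))))"
    using cx[OF x] one_chart by (intro smooth_at_M_vs_cmap) simp_all
  have "smooth_at (prod_mfd vs vs) vs (\<lambda>(x, h). ?F x h) (x, 0)"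
    using smooth_at_compose(1)[OF vv good_M good_vs_fin_dim 3 4] by (simp add: case_prod_unfold)
  from smooth_at_partial[OF good_vs_fin_dim good_vs_fin_dim this, of u]
  have sm: "smooth_at vs vs (\<lambda>x. tmap vs vs (?F x) 0 u) x" by simp
  show "smooth_at vs vs (\<lambda>x. mc g x u) x"
  proof (rule smooth_at_cong[OF _ x _ good_vs_fin_dim sm])
    show "openin (mtop vs) ?S" using S by simp
    fix z assume z: "z \<in> ?S"
    have a: "smooth_at vs vs (\<lambda>h. z + h) 0" "tmap vs vs (\<lambda>h. z + h) 0 u = u"
    proof -
      have z: "smooth_at vs vs (\<lambda>_. z) 0" by (rule smooth_at_vs_const) simp_all
      have i: "smooth_at vs vs (\<lambda>h. h) 0" by (rule smooth_at_id) simp_all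
      show "smooth_at vs vs (\<lambda>h. z + h) 0" "tmap vs vs (\<lambda>h. z + h) 0 u = u"
        using smooth_at_add(1)[OF good_vs_fin_dim z i] smooth_at_add(2)[OF good_vs_fin_dim z i, of u]
        by (auto simp: tmap_const tmap_id)
    qed
    have b: "smooth_at vs M (cinv M g) (z + 0)" using smooth_at_vs_M_cinv[OF g z] by simp
    have d: "smooth_at M M (\<lambda>k. k \<otimes> inv (cinv M g z)) (cinv M g (z + 0))" using cx[OF z] by (auto intro!: smooth_group)
    note ab = smooth_at_compose[OF good_vs_fin_dim good_vs_fin_dim good_M a(1) b]
    note abd = smooth_at_compose[OF good_vs_fin_dim good_M good_M ab(1) d]
    have "tmap vs vs (\<lambda>h. cmap M (cinv M g (z + 0) \<otimes> inv (cinv M g z)) (cinv M g (z + h) \<otimes> inv (cinv M g z))) 0 u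
      = tmap vs M (\<lambda>h. cinv M g (z + h) \<otimes> inv (cinv M g z)) 0 u"
      by (rule tmap_cmap_self[OF good_vs_fin_dim abd(1)]) simp
    then show "tmap vs vs (?F z) 0 u = mc g z u"
      using abd(2)[of u] ab(2)[of u] a(2) cx[OF z] by (simp add: mc_def ld_def il_def)
  qed
qed


text \<open>The Maurer--Cartan equation follows by differentiating the behaviour of the form under the
  geodesic symmetry \<open>z \<mapsto> y z\<^sup>-\<^sup>1 y\<close>, whose derivative at \<open>y\<close> is minus the identity; the second
  derivative of the symmetry drops out by antisymmetrization.\<close>

lemma maurer_cartan:
  assumes g: "g \<in> carrier G" and y: "y \<in> cmap M g ` cdom M g"
  shows "fd UNIV (\<lambda>x. mc g x v) y u - fd UNIV (\<lambda>x. mc g x u) y v = - br (mc g y u) (mc g y v)"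
proof -
  let ?S = "cmap M g ` cdom M g"
  note c = good_chart[of M g, simplified, OF g]
  define k where "k = cinv M g y"
  define K where "K z = k \<otimes> inv (cinv M g z) \<otimes> k" for z
  define j where "j z = cmap M g (K z)" for z
  have S: "open ?S" using c(3) by simp
  have cS: "cinv M g z \<in> carrier G" if "z \<in> ?S" for z using c(6)[OF that] c(10) by auto
  have k: "k \<in> carrier G" "k \<in> cdom M g" "cmap M g k = y" using cS[OF y] c(6,7)[OF y] by (auto simp: k_def)
  note sci = smooth_at_vs_M_cinv[OF g]
  have sK: "smooth_at vs M K z" if z: "z \<in> ?S" for z
    unfolding K_def by (intro smooth_group sci[OF z] good_vs_fin_dim k) simp_all
  have Ky: "K y = k" using k by (simp add: K_def k_def[symmetric])
  obtain V' where V': "openin (mtop vs) V'" "y \<in> V'" "K ` V' \<subseteq> cdom M g"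
    by (rule smooth_at_continuous[OF good_vs_fin_dim good_M sK[OF y] c(2)]) (use Ky k in auto)
  define V where "V = V' \<inter> ?S"
  have V: "open V" "y \<in> V" "\<And>z. z \<in> V \<Longrightarrow> K z \<in> cdom M g" "\<And>z. z \<in> V \<Longrightarrow> z \<in> ?S"
    using V' S y by (auto simp: V_def)
  have Vo: "openin (mtop vs) V" using V(1) by simp
  have j: "j z \<in> ?S" "cinv M g (j z) = K z" if "z \<in> V" for z using V(3)[OF that] c(5) by (auto simp: j_def)
  have jy: "j y = y" by (simp add: j_def Ky k)
  have sj: "smooth_at vs vs j z" if "z \<in> V" for z
    unfolding j_def
    by (rule smooth_at_compose(1)[OF good_vs_fin_dim good_M good_vs_fin_dim sK smooth_at_M_vs_cmap]) (use V that g in auto)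
  \<comment> \<open>The right logarithmic derivative of the symmetry: its constant factors
    contribute only an \<open>Ad\<close>, and the inversion contributes the sign.\<close>
  have ident: "mc g (j z) (tmap vs vs j z b) = - Ad G (cinv M g z \<otimes> inv k) (mc g z b)" if z: "z \<in> V" for z b
  proof -
    note zS = V(4)[OF z]
    have "mc g (j z) (tmap vs vs j z b) = ld vs (\<lambda>z. cinv M g (j z)) z b"
      unfolding mc_def using ld_compose[OF good_vs_fin_dim good_vs_fin_dim sj[OF z] sci[OF j(1)[OF z]], of b] by simp
    also have "ld vs (\<lambda>z. cinv M g (j z)) z = ld vs K z"
      by (rule ld_cong[OF Vo z]) (use j in auto)
    also have "ld vs K z b = Ad G (inv k) (ld vs (\<lambda>z. inv (cinv M g z)) z b)"
    proof -
      have 1: "smooth_at vs M (\<lambda>_. k) z" by (rule smooth_group_const) (use k in auto)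
      have 2: "smooth_at vs M (\<lambda>z. inv (cinv M g z)) z" by (intro smooth_group sci[OF zS]) simp
      have 3: "ld vs (\<lambda>_. k) z b = 0" by (rule ld_const) (use k in auto)
      show ?thesis unfolding K_def
        using ld_mult[OF good_vs_fin_dim smooth_mult[OF good_vs_fin_dim 1 2] 1, of b] ld_mult[OF good_vs_fin_dim 1 2, of b] 3 k cS[OF zS]
        by (simp add: linear_0[OF linear_Ad])
    qed
    also have "\<dots> = - Ad G (inv k) (Ad G (cinv M g z) (mc g z b))"
      using ld_inv[OF good_vs_fin_dim sci[OF zS], of b] k by (simp add: mc_def linear_neg[OF linear_Ad])
    finally show ?thesis using k cS[OF zS] by (simp add: Ad_mult)
  qed
  have Dj: "tmap vs vs j y b = - b" for b
  proof (rule mc_inj[OF g y])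
    show "mc g y (tmap vs vs j y b) = mc g y (- b)"
      using ident[OF V(2), of b] k by (simp add: jy k_def[symmetric] Ad_one linear_neg[OF linear_mc[OF g y]])
  qed
  have smj: "smooth_on UNIV V j" by (rule smooth_on_of_smooth_at_vs[OF V(1) sj])
  have smc: "smooth_at vs vs (\<lambda>x. mc g x b) z" if "z \<in> ?S" for b z by (rule smooth_at_vs_vs[OF smooth_mc[OF g] S that])
  \<comment> \<open>The derivative of \<open>ident\<close> at \<open>y\<close> in direction
    \<open>a\<close>. The first derivative of the symmetry is minus the identity, which is why the
    derivative of \<open>mc\<close> collects with coefficient 2.\<close>
  have key: "2 *\<^sub>R fd UNIV (\<lambda>x. mc g x b) y a = - br (mc g y a) (mc g y b) - mc g y (fd UNIV (\<lambda>z. fd UNIV j z b) y a)" for a b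
  proof -
    have sD: "smooth_at vs vs (\<lambda>z. fd UNIV j z b) y" by (rule smooth_at_vs_vs[OF smooth_on_fd[OF smj] V(1,2)]) simp
    have smj': "smooth_at vs vs (\<lambda>z. mc g (j z) b) y" for b
      by (rule smooth_at_compose(1)[OF good_vs_fin_dim good_vs_fin_dim good_vs_fin_dim sj[OF V(2)]]) (use smc y jy in auto)
    have lin: "linear (mc g (j z))" if "z \<in> V" for z by (rule linear_mc[OF g j(1)[OF that]])
    have "tmap vs vs (\<lambda>z. mc g (j z) (fd UNIV j z b)) y a = tmap vs vs (\<lambda>z. mc g (j z) (- b)) y a + mc g y (tmap vs vs (\<lambda>z. fd UNIV j z b) y a)"
      using smooth_at_linear_family(2)[OF framed_UNIV_fin_dim good_vs_fin_dim Vo V(2) lin smj' sD, of a] Dj[of b]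
      by (simp add: jy tmap_vs_vs)
    also have "tmap vs vs (\<lambda>z. mc g (j z) (- b)) y a = tmap vs vs (\<lambda>x. mc g x (- b)) y (- a)"
      using smooth_at_compose(2)[OF good_vs_fin_dim good_vs_fin_dim good_vs_fin_dim sj[OF V(2)], of "\<lambda>x. mc g x (- b)" a] smc y Dj[of a] by (simp add: jy)
    also have "\<dots> = - tmap vs vs (\<lambda>x. mc g x (- b)) y a"
      using linear_neg[OF linear_tmap[OF good_vs_fin_dim smc[OF y]]] by simp
    also have "tmap vs vs (\<lambda>x. mc g x (- b)) y = tmap vs vs (\<lambda>x. - mc g x b) y"
      by (rule tmap_cong[of vs ?S]) (use S y linear_neg[OF linear_mc[OF g]] in auto)
    also have "tmap vs vs (\<lambda>x. - mc g x b) y a = - tmap vs vs (\<lambda>x. mc g x b) y a"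
      using smooth_at_linear(2)[OF bounded_linear_minus[OF bounded_linear_ident] good_vs_fin_dim smc[OF y], of a b] by simp
    finally have L: "tmap vs vs (\<lambda>z. mc g (j z) (fd UNIV j z b)) y a = fd UNIV (\<lambda>x. mc g x b) y a + mc g y (fd UNIV (\<lambda>z. fd UNIV j z b) y a)"
      by (simp add: tmap_vs_vs)
    have 1: "smooth_at vs M (\<lambda>z. cinv M g z \<otimes> inv k) y" "ld vs (\<lambda>z. cinv M g z \<otimes> inv k) y a = mc g y a"
    proof -
      have 1: "smooth_at vs M (\<lambda>_. inv k) y" "ld vs (\<lambda>_. inv k) y a = 0" using k by (auto intro!: smooth_group_const ld_const)
      show "smooth_at vs M (\<lambda>z. cinv M g z \<otimes> inv k) y" by (intro smooth_mult sci[OF y] 1) simp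
      show "ld vs (\<lambda>z. cinv M g z \<otimes> inv k) y a = mc g y a"
        using ld_mult[OF good_vs_fin_dim sci[OF y] 1(1), of a] 1(2) k by (simp add: mc_def k_def[symmetric] linear_0[OF linear_Ad])
    qed
    note Adc = smooth_at_Ad_comp[OF good_vs_fin_dim 1(1) smc[OF y]]
    have "tmap vs vs (\<lambda>z. - Ad G (cinv M g z \<otimes> inv k) (mc g z b)) y a = - (br (mc g y a) (mc g y b) + fd UNIV (\<lambda>x. mc g x b) y a)"
      using smooth_at_linear(2)[OF bounded_linear_minus[OF bounded_linear_ident] good_vs_fin_dim Adc(1), of a b] Adc(2)[of a b] 1(2) k
      by (simp add: k_def[symmetric] Ad_one tmap_vs_vs)
    moreover have "tmap vs vs (\<lambda>z. mc g (j z) (fd UNIV j z b)) y = tmap vs vs (\<lambda>z. - Ad G (cinv M g z \<otimes> inv k) (mc g z b)) y"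
      by (rule tmap_cong[OF Vo V(2)]) (use ident in \<open>auto simp: tmap_vs_vs\<close>)
    ultimately have "fd UNIV (\<lambda>x. mc g x b) y a + mc g y (fd UNIV (\<lambda>z. fd UNIV j z b) y a) = - (br (mc g y a) (mc g y b) + fd UNIV (\<lambda>x. mc g x b) y a)"
      using L by simp
    then show ?thesis by (simp add: scaleR_2 eq_neg_iff_add_eq_0 algebra_simps)
  qed
  have "fd UNIV (\<lambda>z. fd UNIV j z u) y v = fd UNIV (\<lambda>z. fd UNIV j z v) y u"
    by (rule second_derivative_symmetric[OF smj _ V(2)]) (use V in auto)
  then have "2 *\<^sub>R (fd UNIV (\<lambda>x. mc g x v) y u - fd UNIV (\<lambda>x. mc g x u) y v) = 2 *\<^sub>R (- br (mc g y u) (mc g y v))"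
    using key[of v u] key[of u v] br_antisym[of "mc g y v" "mc g y u"] by (simp add: scaleR_diff_right scaleR_2)
  then show ?thesis unfolding scaleR_cancel_left by simp
qed

end

section \<open>The symplectic manifold \<open>TTG\<close>\<close>

lemma prod_mfd_lin: "prod_mfd (lin_mfd V) (lin_mfd W) = lin_mfd (V \<times> W)"
  by (simp add: prod_mfd_def lin_mfd_def fun_eq_iff split_beta)

lemma tmap_cinv_prod:
  fixes M :: "('m, 'e::real_normed_vector) mfd" and N :: "('n, 'f::real_normed_vector) mfd"
  assumes M: "good M" and N: "good N" and fr: "framed (UNIV :: 'e set)" "framed (UNIV :: 'f set)"
    and p: "p \<in> pts M" "q \<in> pts N" and y: "y \<in> cmap M p ` cdom M p" "z \<in> cmap N q ` cdom N q"
    and u: "u \<in> model M" "v \<in> model N"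
  shows "tmap (lin_mfd (model M \<times> model N)) (prod_mfd M N) (cinv (prod_mfd M N) (p, q)) (y, z) (u, v) =
    (tmap (lin_mfd (model M)) M (cinv M p) y u, tmap (lin_mfd (model N)) N (cinv N q) z v)"
proof -
  let ?L = "lin_mfd (model M)" and ?K = "lin_mfd (model N)"
  note cM = good_chart[OF M p(1)] and cN = good_chart[OF N p(2)]
  have L: "good ?L" "good ?K" using fr goodD(2)[OF M] goodD(2)[OF N] by (auto intro: good_lin_mfd)
  have LK: "good (prod_mfd ?L ?K)" using L by (rule good_prod_mfd)
  have pt: "(y, z) \<in> pts (prod_mfd ?L ?K)" using rel_openD(2)[OF cM(3) y(1)] rel_openD(2)[OF cN(3) y(2)] by simp
  have uv: "(u, v) \<in> model (prod_mfd ?L ?K)" using u by simp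
  have 1: "smooth_at ?L M (cinv M p) (fst (y, z))" "smooth_at ?K N (cinv N q) (snd (y, z))"
    using smooth_at_cinv[OF M p(1) y(1)] smooth_at_cinv[OF N p(2) y(2)] by auto
  note a = smooth_at_compose[OF LK L(1) M smooth_at_fst(1)[OF L pt] 1(1)]
  note b = smooth_at_compose[OF LK L(2) N smooth_at_snd(1)[OF L pt] 1(2)]
  have "tmap (prod_mfd ?L ?K) (prod_mfd M N) (cinv (prod_mfd M N) (p, q)) (y, z) =
    tmap (prod_mfd ?L ?K) (prod_mfd M N) (\<lambda>w. (cinv M p (fst w), cinv N q (snd w))) (y, z)"
  proof (rule tmap_cong[OF _ _ _ LK])
    let ?V = "(cmap M p ` cdom M p) \<times> (cmap N q ` cdom N q)"
    show "openin (mtop (prod_mfd ?L ?K)) ?V" using cM(3) cN(3) by (simp add: rel_open_def openin_Times)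
    show "(y, z) \<in> ?V" using y by simp
    fix w assume "w \<in> ?V"
    then show "cinv (prod_mfd M N) (p, q) w = (cinv M p (fst w), cinv N q (snd w))"
      using cinv_prod_mfd[OF M N, of "(p, q)" w] p by (force simp: cmap_prod_mfd)
  qed
  then show ?thesis
    using smooth_at_Pair(2)[OF LK a(1) b(1) uv] a(2)[OF uv] b(2)[OF uv] smooth_at_fst(2)[OF L pt uv] smooth_at_snd(2)[OF L pt uv]
    by (simp add: prod_mfd_lin)
qed

lemma dual_separates:
  fixes v :: "'a::fin_dim_inner"
  assumes "\<And>l :: 'a dual. blinfun_apply l v = 0" shows "v = 0"
proof -
  have "blinfun_apply (Blinfun (\<lambda>x. x \<bullet> v)) v = v \<bullet> v"
    by (simp add: bounded_linear_Blinfun_apply bounded_linear_inner_left)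
  then show ?thesis using assms by simp
qed

context lie begin

section \<open>The symplectic form in right-trivialised components\<close>

lemma coad_apply: "blinfun_apply (coad G \<xi> \<mu>) \<eta> = blinfun_apply \<mu> (br \<xi> \<eta>)"
  unfolding coad_def lie_bracket_eq
  by (simp add: bounded_linear_Blinfun_apply bounded_linear_compose[OF blinfun.bounded_linear_right bounded_bilinear.bounded_linear_right[OF bounded_bilinear_br]])

lemma coAd_apply: "g \<in> carrier G \<Longrightarrow> blinfun_apply (coAd G g \<mu>) \<eta> = blinfun_apply \<mu> (Ad G (inv g) \<eta>)"
  unfolding coAd_def
  by (simp add: bounded_linear_Blinfun_apply bounded_linear_compose[OF blinfun.bounded_linear_right bounded_linear_Ad])

lemmas blin_simps = blinfun.add_left blinfun.add_right blinfun.diff_left blinfun.diff_right blinfun.minus_left blinfun.minus_right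
  blinfun.zero_left blinfun.zero_right blinfun.scaleR_left blinfun.scaleR_right

abbreviation V3 :: "('e dual \<times> 'e dual \<times> 'e, 'e dual \<times> 'e dual \<times> 'e) mfd" where "V3 \<equiv> vs_mfd"
abbreviation T where "T \<equiv> TTG G"

lemma T_eq: "T = prod_mfd M V3"
  by (simp add: TTG_def prod_mfd_vs)

lemma good_V3 [simp]: "good V3"
  by (intro good_vs_mfd framed_UNIV_intros)

lemma good_T [simp]: "good T"
  unfolding T_eq by (rule good_prod_mfd) simp_all

lemma T_simps [simp]: "model T = UNIV" "pts T = carrier G \<times> UNIV" "mtop T = prod_topology (mtop M) euclidean"
  by (simp_all add: T_eq)

lemma TTG_vf_eq:
  "TTG_vf G (\<eta>, l1, l2, \<zeta>) (g, \<mu>, \<nu>, \<xi>) =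
    (rt g \<eta>, l1 + coad G \<eta> \<mu>, l2 + coad G \<eta> \<nu> - coad G \<xi> l1, \<zeta> + br \<xi> \<eta>)"
  by (simp add: TTG_vf_def rt_def lie_bracket_eq)

text \<open>The symplectic form in components of tangent vectors instead of the coefficients of the
  fields \<open>TTG_vf\<close>: the differences \<open>a - coad G \<eta> \<mu>\<close> and
  \<open>c - br \<xi> \<eta>\<close> are the coefficients \<open>l1\<close> and \<zeta>, and
  eliminating \<open>l2\<close> reverses the sign of the \<nu>-term.\<close>

definition tform :: "'e dual \<Rightarrow> 'e dual \<Rightarrow> 'e \<Rightarrow> 'e vTTG \<Rightarrow> 'e vTTG \<Rightarrow> real" where
  "tform \<mu> \<nu> \<xi> = (\<lambda>(\<eta>, a, b, c) (\<eta>', a', b', c'). blinfun_apply b \<eta>' - blinfun_apply b' \<eta> - blinfun_apply \<nu> (br \<eta> \<eta>')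
    + blinfun_apply (a' - coad G \<eta>' \<mu>) (c - br \<xi> \<eta>) - blinfun_apply (a - coad G \<eta> \<mu>) (c' - br \<xi> \<eta>'))"

lemma TTG_form_eq:
  assumes g: "g \<in> carrier G"
  shows "TTG_form G (g, \<mu>, \<nu>, \<xi>) (v, a, b, c) (v', a', b', c') = tform \<mu> \<nu> \<xi> (il g v, a, b, c) (il g v', a', b', c')"
proof -
  \<comment> \<open>The system for the coefficients is triangular: the group component gives \<eta>,
    then \<open>l1\<close> and \<zeta> follow, and last \<open>l2\<close>, which involves
    \<open>l1\<close>.\<close>
  have the: "(THE w. TTG_vf G w (g, \<mu>, \<nu>, \<xi>) = (v, a, b, c)) =
     (il g v, a - coad G (il g v) \<mu>, b - coad G (il g v) \<nu> + coad G \<xi> (a - coad G (il g v) \<mu>), c - br \<xi> (il g v))" for v a b c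
  proof (rule the_equality)
    fix w assume "TTG_vf G w (g, \<mu>, \<nu>, \<xi>) = (v, a, b, c)"
    then show "w = (il g v, a - coad G (il g v) \<mu>, b - coad G (il g v) \<nu> + coad G \<xi> (a - coad G (il g v) \<mu>), c - br \<xi> (il g v))"
      using g by (cases w) (auto simp: TTG_vf_eq il_rt)
  qed (use g in \<open>simp add: TTG_vf_eq rt_il\<close>)
  have s: "br \<eta> \<xi> = - br \<xi> \<eta>" for \<eta> by (rule br_antisym)
  show ?thesis
    unfolding TTG_form_def the TTG_coeff_form_def tform_def lie_bracket_eq
    by (simp add: blin_simps coad_apply s[of "il g _"] br_antisym[of "il g v'" "il g v"] br_simps)
qed

lemma coad_linear: "coad G (x + y) \<mu> = coad G x \<mu> + coad G y \<mu>" "coad G (r *\<^sub>R x) \<mu> = r *\<^sub>R coad G x \<mu>"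
  "coad G x (\<mu> + \<nu>) = coad G x \<mu> + coad G x \<nu>" "coad G x (r *\<^sub>R \<mu>) = r *\<^sub>R coad G x \<mu>" "coad G 0 \<mu> = 0" "coad G x 0 = 0"
  "coad G (- x) \<mu> = - coad G x \<mu>" "coad G x (\<mu> - \<nu>) = coad G x \<mu> - coad G x \<nu>"
  by (rule blinfun_eqI, simp add: coad_apply blin_simps br_simps bounded_bilinear.scaleR_left[OF bounded_bilinear_br])+

lemma tform_linear: "tform \<mu> \<nu> \<xi> (r *\<^sub>R u + s *\<^sub>R v) w = r * tform \<mu> \<nu> \<xi> u w + s * tform \<mu> \<nu> \<xi> v w"
  by (cases u; cases v; cases w)
    (simp add: tform_def blin_simps coad_linear br_simps bounded_bilinear.scaleR_left[OF bounded_bilinear_br]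
      bounded_bilinear.scaleR_right[OF bounded_bilinear_br] algebra_simps)

lemma tform_antisym: "tform \<mu> \<nu> \<xi> v w = - tform \<mu> \<nu> \<xi> w v"
proof -
  obtain \<eta> a b c \<eta>' a' b' c' where vw: "v = (\<eta>, a, b, c)" "w = (\<eta>', a', b', c')" by (cases v; cases w) auto
  show ?thesis by (simp add: vw tform_def blin_simps br_antisym[of \<eta> \<eta>'])
qed

text \<open>Each component is isolated by testing against vectors supported in the slot dual to it,
  in an order in which the bracket terms have already vanished: \<eta>, then \<open>c\<close>,
  \<open>a\<close> and \<open>b\<close>.\<close>

lemma tform_nondegenerate:
  assumes "\<And>w. tform \<mu> \<nu> \<xi> v w = 0" shows "v = 0"
proof -
  obtain \<eta> a b c where v: "v = (\<eta>, a, b, c)" by (cases v) auto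
  have \<eta>: "\<eta> = 0"
    by (rule dual_separates) (use assms[of "(0, 0, l, 0)" for l] in \<open>simp add: v tform_def blin_simps coad_linear br_simps\<close>)
  have c: "c = 0"
    by (rule dual_separates) (use assms[of "(0, l, 0, 0)" for l] in \<open>simp add: v tform_def blin_simps coad_linear br_simps \<eta>\<close>)
  have a: "a = 0"
    by (rule blinfun_eqI) (use assms[of "(0, 0, 0, l)" for l] in \<open>simp add: v tform_def blin_simps coad_linear br_simps \<eta> c\<close>)
  have "b = 0"
    by (rule blinfun_eqI) (use assms[of "(l, 0, 0, 0)" for l] in \<open>simp add: v tform_def blin_simps coad_linear br_simps \<eta> c a\<close>)
  then show ?thesis by (simp add: v \<eta> a c zero_prod_def)
qed

lemma form_in_chart_T:
  assumes p: "p \<in> pts T" and y: "y \<in> cmap T p ` cdom T p"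
  shows "form_in_chart T (TTG_form G) p y u v = (case snd y of (\<mu>, \<nu>, \<xi>) \<Rightarrow>
    tform \<mu> \<nu> \<xi> (mc (fst p) (fst y) (fst u), snd u) (mc (fst p) (fst y) (fst v), snd v))"
proof -
  obtain x \<mu> \<nu> \<xi> where y': "y = (x, \<mu>, \<nu>, \<xi>)" by (cases y) auto
  have p': "fst p \<in> carrier G" using p by auto
  have x: "x \<in> cmap M (fst p) ` cdom M (fst p)" using y by (auto simp: T_eq y')
  have c: "cinv M (fst p) x \<in> carrier G" using good_chart(6,10)[of M "fst p"] p' x by auto
  have ci: "cinv T p y = (cinv M (fst p) x, \<mu>, \<nu>, \<xi>)"
    using cinv_prod_mfd[of M V3 p y] p y by (simp add: T_eq y')
  have tm: "tmap (lin_mfd (model T)) T (cinv T p) y u = (tmap vs M (cinv M (fst p)) x (fst u), snd u)" for u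
  proof -
    have "tmap (lin_mfd (UNIV \<times> UNIV)) (prod_mfd M V3) (cinv (prod_mfd M V3) (fst p, snd p)) (x, \<mu>, \<nu>, \<xi>) (fst u, snd u) =
      (tmap (lin_mfd UNIV) M (cinv M (fst p)) x (fst u), tmap (lin_mfd UNIV) V3 (cinv V3 (snd p)) (\<mu>, \<nu>, \<xi>) (snd u))"
      using tmap_cinv_prod[OF good_M good_V3 framed_UNIV_fin_dim _ _ _ x, of "snd p" "(\<mu>, \<nu>, \<xi>)" "fst u" "snd u"] p'
      by (simp add: framed_UNIV_intros)
    moreover have "tmap V3 V3 (cinv V3 (snd p)) (\<mu>, \<nu>, \<xi>) (snd u) = snd u"
      using tmap_id[OF good_V3, of "(\<mu>, \<nu>, \<xi>)" "snd u"] by (simp add: vs_mfd_def cinv_def inv_into_f_eq[of id] fun_eq_iff)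
    ultimately show ?thesis by (simp add: T_eq y' vs_mfd_eq)
  qed
  show ?thesis
    unfolding form_in_chart_tmap[OF good_T p y] tm ci
    using TTG_form_eq[OF c, of \<mu> \<nu> \<xi> _ "fst (snd u)" "fst (snd (snd u))" "snd (snd (snd u))" _ "fst (snd v)" "fst (snd (snd v))" "snd (snd (snd v))"]
    by (simp add: y' mc_def ld_def)
qed

text \<open>In a chart the form is \<open>d\<theta>\<close> with \<open>\<theta> = \<langle>\<nu>, \<rho>\<rangle> - \<langle>\<mu>, d\<xi> - [\<xi>, \<rho>]\<rangle>\<close>, where \<open>\<rho>\<close> is the
  Maurer--Cartan form.\<close>

definition ttheta :: "'g \<Rightarrow> 'e vTTG \<Rightarrow> 'e vTTG \<Rightarrow> real" where
  "ttheta g y u = (case snd y of (\<mu>, \<nu>, \<xi>) \<Rightarrow> blinfun_apply \<nu> (mc g (fst y) (fst u)) -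
     blinfun_apply \<mu> (snd (snd (snd u)) - br \<xi> (mc g (fst y) (fst u))))"

lemma ttheta_smooth:
  assumes g: "g \<in> carrier G"
  shows "smooth_on UNIV ((cmap M g ` cdom M g) \<times> UNIV) (\<lambda>y. ttheta g y u)"
    and "y \<in> (cmap M g ` cdom M g) \<times> UNIV \<Longrightarrow> fd UNIV (\<lambda>y. ttheta g y u) y w = (case snd y of (\<mu>, \<nu>, \<xi>) \<Rightarrow>
      blinfun_apply (fst (snd (snd w))) (mc g (fst y) (fst u)) + blinfun_apply \<nu> (fd UNIV (\<lambda>x. mc g x (fst u)) (fst y) (fst w))
      - blinfun_apply (fst (snd w)) (snd (snd (snd u)) - br \<xi> (mc g (fst y) (fst u)))
      + blinfun_apply \<mu> (br (snd (snd (snd w))) (mc g (fst y) (fst u)) + br \<xi> (fd UNIV (\<lambda>x. mc g x (fst u)) (fst y) (fst w))))"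
proof -
  let ?S1 = "cmap M g ` cdom M g"
  let ?S = "?S1 \<times> (UNIV :: ('e dual \<times> 'e dual \<times> 'e) set)"
  have S1: "open ?S1" using good_chart(3)[of M g] g by simp
  then have S: "open ?S" by (intro open_Times) auto
  have RO: "rel_open UNIV ?S" using S by simp
  note bl = bounded_linear_fst bounded_linear_snd bounded_linear_compose[OF bounded_linear_fst bounded_linear_snd]
    bounded_linear_compose[OF bounded_linear_fst bounded_linear_compose[OF bounded_linear_snd bounded_linear_snd]]
    bounded_linear_compose[OF bounded_linear_snd bounded_linear_compose[OF bounded_linear_snd bounded_linear_snd]]
  have lin: "smooth_on UNIV ?S (\<lambda>y. fst (snd y))" "smooth_on UNIV ?S (\<lambda>y. fst (snd (snd y)))" "smooth_on UNIV ?S (\<lambda>y. snd (snd (snd y)))"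
    by (rule smooth_on_bounded_linear[OF RO], rule bl)+
  have m: "smooth_on UNIV ?S (\<lambda>y. mc g (fst y) (fst u))"
    by (rule smooth_on_compose[OF smooth_mc[OF g] smooth_on_bounded_linear[OF RO bounded_linear_fst] RO _ framed_UNIV_fin_dim])
      (use S1 in auto)
  have eq: "(\<lambda>y. ttheta g y u) = (\<lambda>y. blinfun_apply (fst (snd (snd y))) (mc g (fst y) (fst u)) -
     blinfun_apply (fst (snd y)) (snd (snd (snd u)) - br (snd (snd (snd y))) (mc g (fst y) (fst u))))"
    by (rule ext) (simp add: ttheta_def split_beta)
  show "smooth_on UNIV ?S (\<lambda>y. ttheta g y u)"
    unfolding eq by (intro smooth_on_diff smooth_on_const smooth_on_bilinear[OF bounded_bilinear_blinfun_apply] smooth_on_bilinear[OF bounded_bilinear_br] RO lin m)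
  assume y: "y \<in> ?S"
  have dm: "((\<lambda>y. mc g (fst y) (fst u)) has_derivative (\<lambda>w. fd UNIV (\<lambda>x. mc g x (fst u)) (fst y) (fst w))) (at y)"
  proof -
    have "((\<lambda>x. mc g x (fst u)) has_derivative fd UNIV (\<lambda>x. mc g x (fst u)) (fst y)) (at (fst y))"
      using smooth_onD[OF smooth_mc[OF g]] y by auto
    from has_derivative_compose[OF bounded_linear_imp_has_derivative[OF bounded_linear_fst] this] show ?thesis .
  qed
  have dl: "((\<lambda>y. fst (snd y)) has_derivative (\<lambda>w. fst (snd w))) (at y)" "((\<lambda>y. fst (snd (snd y))) has_derivative (\<lambda>w. fst (snd (snd w)))) (at y)"
    "((\<lambda>y. snd (snd (snd y))) has_derivative (\<lambda>w. snd (snd (snd w)))) (at y)"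
    by (rule bounded_linear_imp_has_derivative, rule bl)+
  note d = has_derivative_diff[OF bounded_bilinear.FDERIV[OF bounded_bilinear_blinfun_apply dl(2) dm]
      bounded_bilinear.FDERIV[OF bounded_bilinear_blinfun_apply dl(1) has_derivative_diff[OF has_derivative_const[of "snd (snd (snd u))"] bounded_bilinear.FDERIV[OF bounded_bilinear_br dl(3) dm]]]]
  have "fd UNIV (\<lambda>y. ttheta g y u) y w = blinfun_apply (fst (snd (snd y))) (fd UNIV (\<lambda>x. mc g x (fst u)) (fst y) (fst w)) +
    blinfun_apply (fst (snd (snd w))) (mc g (fst y) (fst u)) -
    (blinfun_apply (fst (snd y)) (0 - (br (snd (snd (snd y))) (fd UNIV (\<lambda>x. mc g x (fst u)) (fst y) (fst w)) + br (snd (snd (snd w))) (mc g (fst y) (fst u)))) +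
     blinfun_apply (fst (snd w)) (snd (snd (snd u)) - br (snd (snd (snd y))) (mc g (fst y) (fst u))))"
    unfolding eq by (rule fd_eq[OF d RO y]) simp
  then show "fd UNIV (\<lambda>y. ttheta g y u) y w = (case snd y of (\<mu>, \<nu>, \<xi>) \<Rightarrow>
      blinfun_apply (fst (snd (snd w))) (mc g (fst y) (fst u)) + blinfun_apply \<nu> (fd UNIV (\<lambda>x. mc g x (fst u)) (fst y) (fst w))
      - blinfun_apply (fst (snd w)) (snd (snd (snd u)) - br \<xi> (mc g (fst y) (fst u)))
      + blinfun_apply \<mu> (br (snd (snd (snd w))) (mc g (fst y) (fst u)) + br \<xi> (fd UNIV (\<lambda>x. mc g x (fst u)) (fst y) (fst w))))"
    by (simp add: split_beta blin_simps)
qed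

text \<open>The exterior derivative of the potential reproduces the form: the Maurer-Cartan equation
  turns the antisymmetrised derivatives of \<open>mc\<close> into brackets, and the Jacobi identity
  reconciles the double brackets paired with \<mu>.\<close>

lemma symplectic_T: "symplectic_manifold T (TTG_form G)"
proof -
  have dom: "cmap T p ` cdom T p = (cmap M (fst p) ` cdom M (fst p)) \<times> UNIV" for p
    unfolding T_eq by (force simp: cmap_prod_mfd)
  have ex: "form_in_chart T (TTG_form G) p y u v = fd (model T) (\<lambda>z. ttheta (fst p) z v) y u - fd (model T) (\<lambda>z. ttheta (fst p) z u) y v"
    if p: "p \<in> pts T" and y: "y \<in> cmap T p ` cdom T p" for p y u v
  proof -
    obtain x \<mu> \<nu> \<xi> where y': "y = (x, \<mu>, \<nu>, \<xi>)" by (cases y) auto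
    have g: "fst p \<in> carrier G" using p by auto
    have yS: "y \<in> (cmap M (fst p) ` cdom M (fst p)) \<times> UNIV" and x: "x \<in> cmap M (fst p) ` cdom M (fst p)"
      using y unfolding dom y' by auto
    define R where "R = mc (fst p) x"
    define D where "D = fd UNIV (\<lambda>x. mc (fst p) x (fst u)) x (fst v)"
    have D: "fd UNIV (\<lambda>x. mc (fst p) x (fst v)) x (fst u) = D - br (R (fst u)) (R (fst v))"
      using maurer_cartan[OF g x, of "fst v" "fst u"] by (simp add: D_def R_def algebra_simps)
    note J = jacobi[of \<xi> "R (fst u)" "R (fst v)"]
    have a: "br (R (fst v)) (br \<xi> (R (fst u))) = - br (br \<xi> (R (fst u))) (R (fst v))" "br (R (fst v)) (snd (snd (snd u))) = - br (snd (snd (snd u))) (R (fst v))"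
      "br (snd (snd (snd v))) (R (fst u)) = - br (R (fst u)) (snd (snd (snd v)))" by (rule br_antisym)+
    show ?thesis
      unfolding form_in_chart_T[OF p y] T_simps(1) ttheta_smooth(2)[OF g yS]
      by (simp add: y' tform_def split_beta D D_def[symmetric] R_def[symmetric] blin_simps br_simps coad_apply a J)
  qed
  have form: "TTG_form G x v w = (case snd x of (\<mu>, \<nu>, \<xi>) \<Rightarrow> tform \<mu> \<nu> \<xi> (il (fst x) (fst v), snd v) (il (fst x) (fst w), snd w))"
    if "x \<in> pts T" for x v w
    using that TTG_form_eq[of "fst x" "fst (snd x)" "fst (snd (snd x))" "snd (snd (snd x))" "fst v" "fst (snd v)" "fst (snd (snd v))" "snd (snd (snd v))"
        "fst w" "fst (snd w)" "fst (snd (snd w))" "snd (snd (snd w))"] by (auto simp: split_beta)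
  note le = locally_exact_form[OF good_T, of "\<lambda>p. ttheta (fst p)", OF _ ex]
  have sm: "smooth_on (model T) (cmap T p ` cdom T p) (\<lambda>y. ttheta (fst p) y u)" if "p \<in> pts T" for p u
    unfolding dom T_simps(1) by (rule ttheta_smooth(1)) (use that in auto)
  have two: "two_form T (TTG_form G)"
    unfolding two_form_def
  proof (intro conjI ballI allI)
    fix p u v w r s assume p: "p \<in> pts T"
    show "TTG_form G p (r *\<^sub>R u + s *\<^sub>R v) w = r * TTG_form G p u w + s * TTG_form G p v w"
      using p tform_linear[of "fst (snd p)" "fst (snd (snd p))" "snd (snd (snd p))" r "(il (fst p) (fst u), snd u)" s "(il (fst p) (fst v), snd v)" "(il (fst p) (fst w), snd w)"]
      unfolding form[OF p] by (auto simp: split_beta linear_add[OF linear_il] linear_scale[OF linear_il])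
    show "TTG_form G p u v = - TTG_form G p v u"
      unfolding form[OF p] split_beta by (rule tform_antisym)
    show "smooth_on (model T) (cmap T p ` cdom T p) (\<lambda>y. form_in_chart T (TTG_form G) p y u v)"
      by (rule le(2)) (use p sm in auto)
  qed
  moreover have "closed_form T (TTG_form G)" by (rule le(1)) (use sm in auto)
  moreover have "v = 0" if p: "p \<in> pts T" and "\<forall>w\<in>model T. TTG_form G p v w = 0" for p v
  proof -
    obtain g \<mu> \<nu> \<xi> where p': "p = (g, \<mu>, \<nu>, \<xi>)" by (cases p) auto
    have g: "g \<in> carrier G" using p p' by simp
    have "(il g (fst v), snd v) = 0"
    proof (rule tform_nondegenerate)
      fix w
      have "TTG_form G p v (rt g (fst w), snd w) = 0" using that(2) by (simp only: T_simps ball_UNIV)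
      then show "tform \<mu> \<nu> \<xi> (il g (fst v), snd v) w = 0"
        using form[OF p, of v "(rt g (fst w), snd w)"] g by (simp add: p' il_rt)
    qed
    then have "il g (fst v) = 0" "snd v = 0" by (simp_all add: prod_eq_iff zero_prod_def)
    then show ?thesis using rt_il[OF g, of "fst v"] linear_0[OF linear_rt[OF g]] by (simp add: prod_eq_iff)
  qed
  ultimately show ?thesis
    unfolding symplectic_manifold_def symplectic_form_def using good_T by (auto simp: good_def)
qed

end

section \<open>Actions and Poisson reduction\<close>

text \<open>A functional is the sum of its values on frame vectors times fixed coefficient
  functionals, so smoothness can be tested on evaluations.\<close>

lemma smooth_at_dual:
  fixes L :: "'m \<Rightarrow> 'a::fin_dim_inner dual"
  assumes N: "good N" and p: "p \<in> pts N" and L: "\<And>\<xi>. smooth_at N vs_mfd (\<lambda>x. blinfun_apply (L x) \<xi>) p"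
  shows "smooth_at N vs_mfd L p"
    and "v \<in> model N \<Longrightarrow> blinfun_apply (tmap N vs_mfd L p v) \<xi> = tmap N vs_mfd (\<lambda>x. blinfun_apply (L x) \<xi>) p v"
proof -
  obtain n :: nat and e and c :: "nat \<Rightarrow> 'a \<Rightarrow> real" where fr: "\<And>i. i < n \<Longrightarrow> e i \<in> (UNIV :: 'a set)" "\<And>i. i < n \<Longrightarrow> bounded_linear (c i)"
    "\<And>x. x \<in> UNIV \<Longrightarrow> x = (\<Sum>i<n. c i x *\<^sub>R e i)" "subspace (UNIV :: 'a set)"
    by (rule framedE[OF framed_UNIV_fin_dim]) (rule that)
  have eq: "(\<Sum>i<n. l (e i) *\<^sub>R Blinfun (c i)) = l" for l :: "'a dual"
  proof (rule blinfun_eqI)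
    fix x
    have "blinfun_apply l x = (\<Sum>i<n. c i x *\<^sub>R l (e i))"
      by (rule linear_frame_expand[OF _ fr(3)]) (auto intro: bounded_linear.linear blinfun.bounded_linear_right)
    then show "blinfun_apply (\<Sum>i<n. l (e i) *\<^sub>R Blinfun (c i)) x = blinfun_apply l x"
      by (simp add: blinfun.sum_left blinfun.scaleR_left bounded_linear_Blinfun_apply fr(2) mult.commute)
  qed
  have "smooth_at N vs_mfd (\<lambda>x. \<Sum>i<n. blinfun_apply (L x) (e i) *\<^sub>R Blinfun (c i)) p"
    by (intro smooth_at_sum N p smooth_at_linear(1)[OF bounded_linear_scaleR_left N L])
  then show s: "smooth_at N vs_mfd L p" by (simp add: eq)
  show "blinfun_apply (tmap N vs_mfd L p v) \<xi> = tmap N vs_mfd (\<lambda>x. blinfun_apply (L x) \<xi>) p v" if "v \<in> model N"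
    using smooth_at_linear(2)[OF blinfun.bounded_linear_left N s that, of \<xi>] by simp
qed

text \<open>Reflexivity in finite dimension: it produces the Lie algebra element that represents a
  partial derivative in a dual variable.\<close>

lemma bidual:
  fixes \<phi> :: "'a::fin_dim_inner dual \<Rightarrow> real"
  assumes "linear \<phi>" obtains x where "\<And>l. \<phi> l = blinfun_apply l x"
proof -
  obtain n :: nat and e and c :: "nat \<Rightarrow> 'a \<Rightarrow> real" where fr: "\<And>i. i < n \<Longrightarrow> e i \<in> (UNIV :: 'a set)" "\<And>i. i < n \<Longrightarrow> bounded_linear (c i)"
    "\<And>x. x \<in> UNIV \<Longrightarrow> x = (\<Sum>i<n. c i x *\<^sub>R e i)" "subspace (UNIV :: 'a set)"
    by (rule framedE[OF framed_UNIV_fin_dim]) (rule that)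
  have eq: "l = (\<Sum>i<n. l (e i) *\<^sub>R Blinfun (c i))" for l :: "'a dual"
  proof (rule blinfun_eqI)
    fix x
    have "blinfun_apply l x = (\<Sum>i<n. c i x *\<^sub>R l (e i))"
      by (rule linear_frame_expand[OF _ fr(3)]) (auto intro: bounded_linear.linear blinfun.bounded_linear_right)
    then show "blinfun_apply l x = blinfun_apply (\<Sum>i<n. l (e i) *\<^sub>R Blinfun (c i)) x"
      by (simp add: blinfun.sum_left blinfun.scaleR_left bounded_linear_Blinfun_apply fr(2) mult.commute)
  qed
  have "\<phi> l = blinfun_apply l (\<Sum>i<n. \<phi> (Blinfun (c i)) *\<^sub>R e i)" for l
    using linear_frame_expand[OF assms eq, of l] by (simp add: blinfun.sum_right blinfun.scaleR_right mult.commute)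
  then show ?thesis by (rule that)
qed

lemma smooth_map_cong:
  assumes "good M" "good N" "smooth_map M N f" "\<And>x. x \<in> pts M \<Longrightarrow> f x = g x"
  shows "smooth_map M N g"
  using assms smooth_at_cong[of M "pts M" _ f g N] by (simp add: smooth_map_iff)

context lie begin

section \<open>The coadjoint representation and the derivatives of the two actions\<close>

lemma linear_coAd: "g \<in> carrier G \<Longrightarrow> linear (coAd G g)"
  by (rule linearI; rule blinfun_eqI; simp add: coAd_apply blin_simps)

lemma coAd_one: "coAd G \<one> \<mu> = \<mu>"
  by (rule blinfun_eqI) (simp add: coAd_apply Ad_one)

lemma coAd_mult: "g \<in> carrier G \<Longrightarrow> h \<in> carrier G \<Longrightarrow> coAd G (g \<otimes> h) \<mu> = coAd G h (coAd G g \<mu>)"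
  by (rule blinfun_eqI) (simp add: coAd_apply Ad_mult inv_mult_group)

lemma coAd_inv: "g \<in> carrier G \<Longrightarrow> coAd G (inv g) (coAd G g \<mu>) = \<mu>" "g \<in> carrier G \<Longrightarrow> coAd G g (coAd G (inv g) \<mu>) = \<mu>"
  using coAd_mult[of g "inv g" \<mu>] coAd_mult[of "inv g" g \<mu>] by (auto simp: coAd_one)

lemma coAd_coad: "g \<in> carrier G \<Longrightarrow> coad G (Ad G g \<eta>) (coAd G g \<mu>) = coAd G g (coad G \<eta> \<mu>)"
  by (rule blinfun_eqI) (simp add: coAd_apply coad_apply Ad_br Ad_inv)

text \<open>\<open>coAd\<close> at \<open>g\<close> is the transpose of \<open>Ad\<close> at the
  inverse of \<open>g\<close>, so its derivative comes from that of \<open>Ad\<close> along the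
  inverse; this is the origin of the minus sign before \<open>coad\<close>.\<close>

lemma smooth_at_coAd_comp:
  assumes N: "good N" and f: "smooth_at N M f p" and h: "smooth_at N vs_mfd h p"
  shows "smooth_at N vs_mfd (\<lambda>x. coAd G (f x) (h x)) p"
    and "v \<in> model N \<Longrightarrow> tmap N vs_mfd (\<lambda>x. coAd G (f x) (h x)) p v = coAd G (f p) (tmap N vs_mfd h p v - coad G (ld N f p v) (h p))"
proof -
  have p: "p \<in> pts N" using f by (rule smooth_atD)
  have c: "f p \<in> carrier G" using smooth_atD(2)[OF f] by simp
  obtain V where V: "openin (mtop N) V" "p \<in> V" "\<And>x. x \<in> V \<Longrightarrow> smooth_at N M f x"
    by (rule smooth_at_neighbourhood[OF N good_M f]) (rule that)
  have Vc: "f x \<in> carrier G" if "x \<in> V" for x using smooth_atD(2)[OF V(3)[OF that]] by simp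
  note fi = smooth_inv[OF N f]
  have sA: "smooth_at N vs_mfd (\<lambda>x. Ad G (inv (f x)) \<xi>) p" for \<xi>
    by (rule smooth_at_Ad_comp(1)[OF N fi smooth_at_vs_const[OF N p]])
  have sA': "smooth_at N vs_mfd (\<lambda>x. blinfun_apply \<mu> (Ad G (inv (f x)) \<xi>)) p" for \<mu> \<xi>
    by (rule smooth_at_linear(1)[OF blinfun.bounded_linear_right N sA])
  have s1: "smooth_at N vs_mfd (\<lambda>x. blinfun_apply (coAd G (f x) \<mu>) \<xi>) p" for \<mu> \<xi>
    by (rule smooth_at_cong[OF V(1,2) _ N sA']) (simp add: coAd_apply Vc)
  note s2 = smooth_at_dual[OF N p s1]
  have t2: "tmap N vs_mfd (\<lambda>x. coAd G (f x) \<mu>) p v = - coAd G (f p) (coad G (ld N f p v) \<mu>)" if v: "v \<in> model N" for v \<mu>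
  proof (rule blinfun_eqI)
    fix \<xi>
    have "tmap N vs_mfd (\<lambda>x. blinfun_apply (coAd G (f x) \<mu>) \<xi>) p v = tmap N vs_mfd (\<lambda>x. blinfun_apply \<mu> (Ad G (inv (f x)) \<xi>)) p v"
      by (rule fun_cong[OF tmap_cong[OF V(1,2) _ N]]) (simp add: coAd_apply Vc)
    also have "\<dots> = blinfun_apply \<mu> (tmap N vs_mfd (\<lambda>x. Ad G (inv (f x)) \<xi>) p v)"
      by (rule smooth_at_linear(2)[OF blinfun.bounded_linear_right N sA v])
    also have "tmap N vs_mfd (\<lambda>x. Ad G (inv (f x)) \<xi>) p v = Ad G (inv (f p)) (br (- Ad G (f p) (ld N f p v)) \<xi>)"
      using smooth_at_Ad_comp(2)[OF N fi smooth_at_vs_const[OF N p] v] tmap_const[OF N p v, of vs \<xi>] ld_inv[OF N f v] by simp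
    also have "\<dots> = - br (ld N f p v) (Ad G (inv (f p)) \<xi>)"
      using c by (simp add: br_simps linear_neg[OF linear_Ad] Ad_br Ad_inv)
    finally show "blinfun_apply (tmap N vs_mfd (\<lambda>x. coAd G (f x) \<mu>) p v) \<xi> = blinfun_apply (- coAd G (f p) (coad G (ld N f p v) \<mu>)) \<xi>"
      using s2(2)[OF v] c by (simp add: coAd_apply coad_apply blin_simps)
  qed
  have lin: "linear (coAd G (f x))" if "x \<in> V" for x by (rule linear_coAd[OF Vc[OF that]])
  note fam = smooth_at_linear_family[OF framed_UNIV_dual N V(1,2) lin s2(1) h]
  show "smooth_at N vs_mfd (\<lambda>x. coAd G (f x) (h x)) p" by (rule fam(1))
  show "tmap N vs_mfd (\<lambda>x. coAd G (f x) (h x)) p v = coAd G (f p) (tmap N vs_mfd h p v - coad G (ld N f p v) (h p))" if "v \<in> model N"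
    using fam(2)[OF _ that] t2[OF that] by (simp add: linear_diff[OF linear_coAd[OF c]])
qed

lemma coad_gen_eq: "coad_gen G \<eta> \<mu> = - coad G \<eta> \<mu>"
proof -
  have h: "smooth_at rl vs_mfd (\<lambda>_. \<mu>) 0" by (rule smooth_at_vs_const) simp_all
  note s = smooth_at_coAd_comp[OF good_vs_real lexp_curve(1)[of \<eta> 0] h]
  show ?thesis
    unfolding coad_gen_def using vector_derivative_at[OF vector_derivative_eq_tmap[OF s(1)]] s(2)[of 1]
    by (simp add: tmap_const lexp_curve(4) coAd_one lexp_curve(2))
qed

lemma T_components:
  assumes N: "good N" and z: "smooth_at N T z p"
  shows "smooth_at N M (\<lambda>x. fst (z x)) p" "smooth_at N V3 (\<lambda>x. snd (z x)) p"
    "smooth_at N vs_mfd (\<lambda>x. fst (snd (z x))) p" "smooth_at N vs_mfd (\<lambda>x. fst (snd (snd (z x)))) p" "smooth_at N vs_mfd (\<lambda>x. snd (snd (snd (z x)))) p"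
    "v \<in> model N \<Longrightarrow> tmap N M (\<lambda>x. fst (z x)) p v = fst (tmap N T z p v)"
    "v \<in> model N \<Longrightarrow> tmap N V3 (\<lambda>x. snd (z x)) p v = snd (tmap N T z p v)"
    "v \<in> model N \<Longrightarrow> tmap N vs_mfd (\<lambda>x. fst (snd (z x))) p v = fst (snd (tmap N T z p v))"
    "v \<in> model N \<Longrightarrow> tmap N vs_mfd (\<lambda>x. fst (snd (snd (z x)))) p v = fst (snd (snd (tmap N T z p v)))"
    "v \<in> model N \<Longrightarrow> tmap N vs_mfd (\<lambda>x. snd (snd (snd (z x)))) p v = snd (snd (snd (tmap N T z p v)))"
proof -
  have zp: "z p \<in> pts (prod_mfd M V3)" using smooth_atD(2)[OF z] by (simp add: T_eq)
  note f = smooth_at_fst[OF good_M good_V3 zp] and s = smooth_at_snd[OF good_M good_V3 zp]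
  note a = smooth_at_compose[OF N good_T[unfolded T_eq] good_M z[unfolded T_eq] f(1)]
  note b = smooth_at_compose[OF N good_T[unfolded T_eq] good_V3 z[unfolded T_eq] s(1)]
  show 1: "smooth_at N M (\<lambda>x. fst (z x)) p" and 2: "smooth_at N V3 (\<lambda>x. snd (z x)) p" using a b by auto
  show "v \<in> model N \<Longrightarrow> tmap N M (\<lambda>x. fst (z x)) p v = fst (tmap N T z p v)"
    and 3: "v \<in> model N \<Longrightarrow> tmap N V3 (\<lambda>x. snd (z x)) p v = snd (tmap N T z p v)" for v
    using a(2) b(2) f(2) s(2) by (auto simp: T_eq)
  note l = smooth_at_linear[OF bounded_linear_fst N 2] 
    smooth_at_linear[OF bounded_linear_compose[OF bounded_linear_fst bounded_linear_snd] N 2]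
    smooth_at_linear[OF bounded_linear_compose[OF bounded_linear_snd bounded_linear_snd] N 2]
  show "smooth_at N vs_mfd (\<lambda>x. fst (snd (z x))) p" "smooth_at N vs_mfd (\<lambda>x. fst (snd (snd (z x)))) p" "smooth_at N vs_mfd (\<lambda>x. snd (snd (snd (z x)))) p"
    by (fact l)+
  show "v \<in> model N \<Longrightarrow> tmap N vs_mfd (\<lambda>x. fst (snd (z x))) p v = fst (snd (tmap N T z p v))"
    "v \<in> model N \<Longrightarrow> tmap N vs_mfd (\<lambda>x. fst (snd (snd (z x)))) p v = fst (snd (snd (tmap N T z p v)))"
    "v \<in> model N \<Longrightarrow> tmap N vs_mfd (\<lambda>x. snd (snd (snd (z x)))) p v = snd (snd (snd (tmap N T z p v)))" for v
    using l 3 by auto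
qed

text \<open>Group element and point both vary along \<open>N\<close>, so one formula covers three
  uses: smoothness of the action, the tangent map of a fixed group element, and the infinitesimal
  generator. The parameter \<eta> is the left logarithmic derivative of \<open>f\<close>.\<close>

lemma TTG_left_comp:
  assumes N: "good N" and f: "smooth_at N M f p" and z: "smooth_at N T z p"
  shows "smooth_at N T (\<lambda>x. TTG_left G (f x) (z x)) p"
    and "v \<in> model N \<Longrightarrow> z p = (h, \<mu>, \<nu>, \<xi>) \<Longrightarrow> tmap N T z p v = (w, a, b, c) \<Longrightarrow> \<eta> = Ad G (f p) (ld N f p v) \<Longrightarrow>
      tmap N T (\<lambda>x. TTG_left G (f x) (z x)) p v = (rt (f p \<otimes> h) (Ad G (inv (f p)) (\<eta> + il h w)),
        coAd G (inv (f p)) (a + coad G \<eta> \<mu>), coAd G (inv (f p)) (b + coad G \<eta> \<nu>), Ad G (inv (f p)) (c - br \<eta> \<xi>))"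
proof -
  note z' = T_components[OF N z]
  have c: "f p \<in> carrier G" using smooth_atD(2)[OF f] by simp
  note fi = smooth_inv[OF N f]
  note 1 = smooth_mult[OF N f z'(1)]
  note 2 = smooth_at_coAd_comp[OF N fi z'(3)] and 3 = smooth_at_coAd_comp[OF N fi z'(4)] and 4 = smooth_at_Ad_comp[OF N fi z'(5)]
  note P34 = smooth_at_Pair[OF N 3(1) 4(1)]
  note P234 = smooth_at_Pair[OF N 2(1) P34(1)]
  note P = smooth_at_Pair[OF N 1 P234(1)]
  have eq: "(\<lambda>x. TTG_left G (f x) (z x)) = (\<lambda>x. (f x \<otimes> fst (z x), coAd G (inv (f x)) (fst (snd (z x))),
     coAd G (inv (f x)) (fst (snd (snd (z x)))), Ad G (inv (f x)) (snd (snd (snd (z x))))))"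
    by (rule ext) (simp add: TTG_left_def split_beta)
  show "smooth_at N T (\<lambda>x. TTG_left G (f x) (z x)) p" unfolding eq TTG_def by (rule P(1))
  assume v: "v \<in> model N" and zp: "z p = (h, \<mu>, \<nu>, \<xi>)" and tz: "tmap N T z p v = (w, a, b, c)" and \<eta>: "\<eta> = Ad G (f p) (ld N f p v)"
  have hc: "h \<in> carrier G" using smooth_atD(2)[OF z] zp by simp
  have ldz: "ld N (\<lambda>x. fst (z x)) p v = il h w" using z'(6)[OF v] by (simp add: ld_def zp tz)
  have inv: "ld N (\<lambda>x. inv (f x)) p v = - \<eta>" using ld_inv[OF N f v] \<eta> by simp
  have "tmap N M (\<lambda>x. f x \<otimes> fst (z x)) p v = rt (f p \<otimes> h) (Ad G (inv (f p)) (\<eta> + il h w))"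
    using tmap_ld[OF 1, of v] ld_mult[OF N f z'(1) v] c by (simp add: ldz \<eta> zp Ad_inv linear_add[OF linear_Ad])
  then show "tmap N T (\<lambda>x. TTG_left G (f x) (z x)) p v = (rt (f p \<otimes> h) (Ad G (inv (f p)) (\<eta> + il h w)),
        coAd G (inv (f p)) (a + coad G \<eta> \<mu>), coAd G (inv (f p)) (b + coad G \<eta> \<nu>), Ad G (inv (f p)) (c - br \<eta> \<xi>))"
    unfolding eq TTG_def P(2)[OF v] P234(2)[OF v] P34(2)[OF v] 2(2)[OF v] 3(2)[OF v] 4(2)[OF v] inv
    using z'(8-10)[OF v] by (simp add: zp tz coad_linear br_simps)
qed

text \<open>The derivative is given only in directions in which the group element is stationary, the
  case of a fixed element acting.\<close>

lemma TTG_right_comp: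
  assumes N: "good N" and f: "smooth_at N M f p" and z: "smooth_at N T z p"
  shows "smooth_at N T (\<lambda>x. TTG_right G (f x) (z x)) p"
    and "v \<in> model N \<Longrightarrow> ld N f p v = 0 \<Longrightarrow> tmap N T (\<lambda>x. TTG_right G (f x) (z x)) p v =
      (rt (fst (z p) \<otimes> inv (f p)) (il (fst (z p)) (fst (tmap N T z p v))), snd (tmap N T z p v))"
proof -
  note z' = T_components[OF N z]
  have c: "f p \<in> carrier G" "fst (z p) \<in> carrier G" using smooth_atD(2)[OF f] smooth_atD(2)[OF z] by auto
  note fi = smooth_inv[OF N f]
  note 1 = smooth_mult[OF N z'(1) fi]
  note P = smooth_at_Pair[OF N 1 z'(2)]
  have eq: "(\<lambda>x. TTG_right G (f x) (z x)) = (\<lambda>x. (fst (z x) \<otimes> inv (f x), snd (z x)))"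
    by (rule ext) (simp add: TTG_right_def split_beta)
  show "smooth_at N T (\<lambda>x. TTG_right G (f x) (z x)) p" unfolding eq T_eq by (rule P(1))
  assume v: "v \<in> model N" and 0: "ld N f p v = 0"
  have "tmap N M (\<lambda>x. fst (z x) \<otimes> inv (f x)) p v = rt (fst (z p) \<otimes> inv (f p)) (il (fst (z p)) (fst (tmap N T z p v)))"
    using tmap_ld[OF 1, of v] ld_mult[OF N z'(1) fi v] ld_inv[OF N f v] c 0 z'(6)[OF v]
    by (simp add: linear_0[OF linear_Ad] ld_def[of N "\<lambda>x. fst (z x)"])
  then show "tmap N T (\<lambda>x. TTG_right G (f x) (z x)) p v = (rt (fst (z p) \<otimes> inv (f p)) (il (fst (z p)) (fst (tmap N T z p v))), snd (tmap N T z p v))"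
    using P(2)[OF v] z'(7)[OF v] unfolding eq T_eq[symmetric] by simp
qed

section \<open>Symplectic actions and the momentum map\<close>

lemma lie_action_diffeomorphism:
  assumes P: "good P" and a: "lie_action G P act" and g: "g \<in> carrier G"
  shows "diffeomorphism P P (act g)"
proof -
  have MP: "good (prod_mfd M P)" by (rule good_prod_mfd[OF good_M P])
  have sm: "smooth_map P P (act g)" if "g \<in> carrier G" for g
    unfolding smooth_map_iff[OF P P]
  proof
    fix p assume p: "p \<in> pts P"
    have "smooth_at (prod_mfd M P) P (\<lambda>(g, x). act g x) (g, p)"
      using a smooth_mapD[OF MP P] that p unfolding lie_action_def by simp
    from tmap_prod_split(3)[OF good_M P P this, of 0 0] show "smooth_at P P (act g) p"
      using goodD(3)[OF P] by (simp add: subspace_0)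
  qed
  have inP: "act g x \<in> pts P" if "g \<in> carrier G" "x \<in> pts P" for g x
    using smooth_atD(2)[OF smooth_mapD[OF P P sm[OF that(1)] that(2)]] .
  have inv1: "act g (act (inv g) x) = x" "act (inv g) (act g x) = x" if "x \<in> pts P" for x
  proof -
    have m: "act (g \<otimes> h) x = act g (act h x)" if "g \<in> carrier G" "h \<in> carrier G" for g h
      using a that \<open>x \<in> pts P\<close> unfolding lie_action_def by blast
    have "act \<one> x = x" using a that unfolding lie_action_def by blast
    then show "act g (act (inv g) x) = x" "act (inv g) (act g x) = x"
      using m[of g "inv g"] m[of "inv g" g] g by simp_all
  qed
  have bij: "bij_betw (act g) (pts P) (pts P)"
    by (rule bij_betw_byWitness[where f'="act (inv g)"]) (use inv1 inP g in auto)
  have "inv_into (pts P) (act g) x = act (inv g) x" if "x \<in> pts P" for x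
    using inv_into_f_eq[OF bij_betw_imp_inj_on[OF bij], of "act (inv g) x" x] inv1(1)[OF that] inP[of "inv g" x] g that by simp
  then have "smooth_map P P (inv_into (pts P) (act g))"
    using smooth_map_cong[OF P P sm[of "inv g"]] g by simp
  then show ?thesis unfolding diffeomorphism_def using bij sm g by blast
qed

text \<open>All pairings and brackets in the trivialised form are equivariant; this is the
  computation behind its invariance under left translation.\<close>

lemma tform_coAd:
  assumes k: "k \<in> carrier G"
  shows "tform (coAd G k \<mu>) (coAd G k \<nu>) (Ad G k \<xi>) (Ad G k \<eta>, coAd G k a, coAd G k b, Ad G k c) (Ad G k \<eta>', coAd G k a', coAd G k b', Ad G k c')
    = tform \<mu> \<nu> \<xi> (\<eta>, a, b, c) (\<eta>', a', b', c')"
  using k by (simp add: tform_def coAd_coad Ad_br[symmetric] coAd_apply Ad_inv linear_diff[OF linear_coAd, symmetric] linear_diff[OF linear_Ad, symmetric])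

lemma symplectic_left: "symplectic_action G T (TTG_form G) (TTG_left G)"
proof -
  have MT: "good (prod_mfd M T)" by (rule good_prod_mfd) simp_all
  have la: "lie_action G T (TTG_left G)"
    unfolding lie_action_def
  proof (intro conjI ballI)
    show "smooth_map (prod_mfd M T) T (\<lambda>(g, x). TTG_left G g x)"
      unfolding smooth_map_iff[OF MT good_T]
    proof
      fix p assume p: "p \<in> pts (prod_mfd M T)"
      show "smooth_at (prod_mfd M T) T (\<lambda>(g, x). TTG_left G g x) p"
        using TTG_left_comp(1)[OF MT smooth_at_fst(1)[OF good_M good_T p] smooth_at_snd(1)[OF good_M good_T p]]
        by (simp add: case_prod_unfold)
    qed
    show "TTG_left G \<one> x = x" if "x \<in> pts T" for x
      using that by (auto simp: TTG_left_def coAd_one Ad_one)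
    show "TTG_left G (g \<otimes> h) x = TTG_left G g (TTG_left G h x)" if "g \<in> carrier G" "h \<in> carrier G" "x \<in> pts T" for g h x
      using that by (auto simp: TTG_left_def m_assoc inv_mult_group coAd_mult Ad_mult)
  qed
  moreover have "symplectomorphism T (TTG_form G) T (TTG_form G) (TTG_left G g)" if g: "g \<in> carrier G" for g
    unfolding symplectomorphism_def
  proof (intro conjI ballI)
    show "diffeomorphism T T (TTG_left G g)" by (rule lie_action_diffeomorphism[OF good_T la g])
    fix p v w assume p: "p \<in> pts T"
    obtain h \<mu> \<nu> \<xi> where p': "p = (h, \<mu>, \<nu>, \<xi>)" by (cases p) auto
    have h: "h \<in> carrier G" using p p' by simp
    have gc: "smooth_at T M (\<lambda>_. g) p" using p g by (intro smooth_group_const) auto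
    have ld0: "ld T (\<lambda>_. g) p v = 0" for v by (rule ld_const) (use p g in auto)
    have tm: "tmap T T (TTG_left G g) p (u, a, b, c) = (rt (g \<otimes> h) (Ad G (inv g) (il h u)), coAd G (inv g) a, coAd G (inv g) b, Ad G (inv g) c)" for u a b c
      using TTG_left_comp(2)[OF good_T gc smooth_at_id[OF good_T p], of "(u, a, b, c)" h \<mu> \<nu> \<xi> u a b c 0] g p
      by (simp add: p' ld0[unfolded p'] linear_0[OF linear_Ad] coad_linear br_simps tmap_id[OF good_T, of "(h, \<mu>, \<nu>, \<xi>)"])
    have left: "TTG_left G g p = (g \<otimes> h, coAd G (inv g) \<mu>, coAd G (inv g) \<nu>, Ad G (inv g) \<xi>)" by (simp add: p' TTG_left_def)
    show "TTG_form G (TTG_left G g p) (tmap T T (TTG_left G g) p v) (tmap T T (TTG_left G g) p w) = TTG_form G p v w"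
    proof -
      obtain v1 v2 v3 v4 w1 w2 w3 w4 where vw: "v = (v1, v2, v3, v4)" "w = (w1, w2, w3, w4)" by (cases v; cases w) auto
      show ?thesis unfolding left vw tm unfolding p' using g h by (simp add: TTG_form_eq il_rt tform_coAd)
    qed
  qed
  ultimately show ?thesis by (simp add: symplectic_action_def)
qed

lemma symplectic_right: "symplectic_action G T (TTG_form G) (TTG_right G)"
proof -
  have MT: "good (prod_mfd M T)" by (rule good_prod_mfd) simp_all
  have la: "lie_action G T (TTG_right G)"
    unfolding lie_action_def
  proof (intro conjI ballI)
    show "smooth_map (prod_mfd M T) T (\<lambda>(g, x). TTG_right G g x)"
      unfolding smooth_map_iff[OF MT good_T]
    proof
      fix p assume p: "p \<in> pts (prod_mfd M T)"
      show "smooth_at (prod_mfd M T) T (\<lambda>(g, x). TTG_right G g x) p"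
        using TTG_right_comp(1)[OF MT smooth_at_fst(1)[OF good_M good_T p] smooth_at_snd(1)[OF good_M good_T p]]
        by (simp add: case_prod_unfold)
    qed
    show "TTG_right G \<one> x = x" if "x \<in> pts T" for x
      using that by (auto simp: TTG_right_def)
    show "TTG_right G (g \<otimes> h) x = TTG_right G g (TTG_right G h x)" if "g \<in> carrier G" "h \<in> carrier G" "x \<in> pts T" for g h x
      using that by (auto simp: TTG_right_def m_assoc inv_mult_group)
  qed
  moreover have "symplectomorphism T (TTG_form G) T (TTG_form G) (TTG_right G g)" if g: "g \<in> carrier G" for g
    unfolding symplectomorphism_def
  proof (intro conjI ballI)
    show "diffeomorphism T T (TTG_right G g)" by (rule lie_action_diffeomorphism[OF good_T la g])
    fix p v w assume p: "p \<in> pts T"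
    obtain h \<mu> \<nu> \<xi> where p': "p = (h, \<mu>, \<nu>, \<xi>)" by (cases p) auto
    have h: "h \<in> carrier G" using p p' by simp
    have gc: "smooth_at T M (\<lambda>_. g) p" using p g by (intro smooth_group_const) auto
    have ld0: "ld T (\<lambda>_. g) p v = 0" for v by (rule ld_const) (use p g in auto)
    have tm: "tmap T T (TTG_right G g) p u = (rt (h \<otimes> inv g) (il h (fst u)), snd u)" for u
      using TTG_right_comp(2)[OF good_T gc smooth_at_id[OF good_T p] _ ld0, of u] p tmap_id[OF good_T p, of u] by (simp add: p')
    have right: "TTG_right G g p = (h \<otimes> inv g, \<mu>, \<nu>, \<xi>)" by (simp add: p' TTG_right_def)
    show "TTG_form G (TTG_right G g p) (tmap T T (TTG_right G g) p v) (tmap T T (TTG_right G g) p w) = TTG_form G p v w"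
    proof -
      obtain v1 v2 v3 v4 w1 w2 w3 w4 where vw: "v = (v1, v2, v3, v4)" "w = (w1, w2, w3, w4)" by (cases v; cases w) auto
      show ?thesis unfolding right vw tm unfolding p' using g h by (simp add: TTG_form_eq il_rt)
    qed
  qed
  ultimately show ?thesis by (simp add: symplectic_action_def)
qed

text \<open>Nondegeneracy makes the definite description in \<open>ham_vf\<close> unique, so it is
  enough to exhibit one solution of the defining equation.\<close>

lemma ham_vf_T:
  assumes p: "p \<in> pts T" and v: "\<And>w. TTG_form G p v w = - tmap T vs_mfd H p w"
  shows "ham_vf T (TTG_form G) H p = v"
  unfolding ham_vf_def
proof (rule the_equality)
  show "v \<in> model T \<and> (\<forall>w\<in>model T. TTG_form G p v w = - tmap T vs_mfd H p w)" using v by simp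
  fix u assume u: "u \<in> model T \<and> (\<forall>w\<in>model T. TTG_form G p u w = - tmap T vs_mfd H p w)"
  have sy: "two_form T (TTG_form G)" "\<And>v. (\<forall>w\<in>model T. TTG_form G p v w = 0) \<Longrightarrow> v = 0"
    using symplectic_T p unfolding symplectic_manifold_def symplectic_form_def by auto
  have "TTG_form G p (1 *\<^sub>R u + (- 1) *\<^sub>R v) w = 1 * TTG_form G p u w + (- 1) * TTG_form G p v w" for w
    using sy(1) p unfolding two_form_def by (metis T_simps(1) UNIV_I)
  then have "1 *\<^sub>R u + (- 1) *\<^sub>R v = 0" using u v by (intro sy(2)) simp
  then show "u = v" by simp
qed

text \<open>The generator of \<eta> is the field \<open>TTG_vf\<close> with coefficients
  \<open>(\<eta>, 0, 0, 0)\<close>, and pairing it with a tangent vector leaves only minus the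
  \<nu>-component of that vector evaluated at \<eta>.\<close>

lemma momentum_left: "momentum_map G T (TTG_form G) (TTG_left G) TTG_momentum"
  unfolding momentum_map_def
proof (intro conjI allI ballI)
  have J: "TTG_momentum = (\<lambda>z. fst (snd (snd z)))" by (rule ext) (simp add: TTG_momentum_def split_beta)
  have sJ: "smooth_at T vs_mfd (TTG_momentum :: ('g, 'e) TTG \<Rightarrow> 'e dual) x" "tmap T vs_mfd TTG_momentum x w = fst (snd (snd w))"
    if "x \<in> pts T" for x w
    using T_components(4,9)[OF good_T smooth_at_id[OF good_T that]] tmap_id[OF good_T that, of w] unfolding J by auto
  show "smooth_map T vs_mfd TTG_momentum" unfolding smooth_map_iff[OF good_T good_vs_dual] using sJ by blast
  fix \<eta> x assume x: "x \<in> pts T"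
  obtain h \<mu> \<nu> \<xi> where x': "x = (h, \<mu>, \<nu>, \<xi>)" by (cases x) auto
  have h: "h \<in> carrier G" using x x' by simp
  have c: "smooth_at rl T (\<lambda>_. x) 0" by (rule smooth_at_const) (use x in auto)
  have "action_gen G T (TTG_left G) \<eta> x = (rt h \<eta>, coad G \<eta> \<mu>, coad G \<eta> \<nu>, - br \<eta> \<xi>)"
    unfolding action_gen_def
    using TTG_left_comp(2)[OF good_vs_real lexp_curve(1)[of \<eta> 0] c, of 1 h \<mu> \<nu> \<xi> 0 0 0 0 \<eta>] h
    by (simp add: x' tmap_const lexp_curve(2,4) Ad_one coAd_one linear_0[OF linear_il] zero_prod_def)
  moreover have "ham_vf T (TTG_form G) (\<lambda>y. TTG_momentum y \<eta>) x = (rt h \<eta>, coad G \<eta> \<mu>, coad G \<eta> \<nu>, - br \<eta> \<xi>)"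
  proof (rule ham_vf_T[OF x])
    fix w
    have "tmap T vs_mfd (\<lambda>y. blinfun_apply (TTG_momentum y) \<eta>) x w = blinfun_apply (fst (snd (snd w))) \<eta>"
      using smooth_at_linear(2)[OF blinfun.bounded_linear_left good_T sJ(1)[OF x], of w \<eta>] sJ(2)[OF x] by simp
    then show "TTG_form G x (rt h \<eta>, coad G \<eta> \<mu>, coad G \<eta> \<nu>, - br \<eta> \<xi>) w = - tmap T vs_mfd (\<lambda>y. blinfun_apply (TTG_momentum y) \<eta>) x w"
      using h by (cases w) (simp add: x' TTG_form_eq tform_def il_rt coad_apply br_antisym[of \<eta> \<xi>] blin_simps)
  qed
  ultimately show "action_gen G T (TTG_left G) \<eta> x = ham_vf T (TTG_form G) (\<lambda>y. TTG_momentum y \<eta>) x" by simp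
next
  fix g x show "TTG_momentum (TTG_left G g x) = coAd G (inv g) (TTG_momentum x)"
    by (cases x) (simp add: TTG_momentum_def TTG_left_def)
qed

subsection \<open>The reduced bracket\<close>

text \<open>The differential splits along the three axes. The definite descriptions in
  \<open>del_mu\<close> and \<open>del_nu\<close> are met because a representing element exists by
  reflexivity and functionals separate points.\<close>

lemma partials:
  assumes h: "smooth_at V3 vs_mfd h m"
  shows "tmap V3 vs_mfd h m (a, b, c) = blinfun_apply a (del_mu h m) + blinfun_apply b (del_nu h m) + blinfun_apply (del_xi h m) (c :: 'e)"
proof -
  obtain \<mu> \<nu> \<xi> where m: "m = (\<mu>, \<nu>, \<xi>)" by (cases m) auto
  let ?D = "tmap V3 vs_mfd h m"
  have D: "(h has_derivative ?D) (at (\<mu>, \<nu>, \<xi>))" using has_derivative_tmap_vs[OF good_V3 h] by (simp add: m)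
  note lin = linear_tmap[OF good_V3 h]
  have i: "((\<lambda>m. (m, \<nu>, \<xi>)) has_derivative (\<lambda>l. (l, 0, 0))) (at \<mu>)" "((\<lambda>n. (\<mu>, n, \<xi>)) has_derivative (\<lambda>l. (0, l, 0))) (at \<nu>)"
    "((\<lambda>x. (\<mu>, \<nu>, x)) has_derivative (\<lambda>l. (0, 0, l))) (at \<xi>)"
    by (intro has_derivative_Pair has_derivative_ident has_derivative_const)+
  have 1: "((\<lambda>m. h (m, \<nu>, \<xi>)) has_derivative (\<lambda>l. ?D (l, 0, 0))) (at \<mu>)"
    by (rule has_derivative_compose[OF i(1) D])
  have 2: "((\<lambda>n. h (\<mu>, n, \<xi>)) has_derivative (\<lambda>l. ?D (0, l, 0))) (at \<nu>)"
    by (rule has_derivative_compose[OF i(2) D])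
  have 3: "((\<lambda>x. h (\<mu>, \<nu>, x)) has_derivative (\<lambda>l. ?D (0, 0, l))) (at \<xi>)"
    by (rule has_derivative_compose[OF i(3) D])
  have l1: "linear (\<lambda>l. ?D (l, 0, 0))" and l2: "linear (\<lambda>l. ?D (0, l, 0))"
    using 1 2 has_derivative_linear by blast+
  have uniq: "x = y" if "(\<lambda>l::'e dual. blinfun_apply l x) = (\<lambda>l. blinfun_apply l y)" for x y
    using dual_separates[of "x - y"] fun_cong[OF that] by (simp add: blin_simps)
  obtain x where x: "\<And>l. ?D (l, 0, 0) = blinfun_apply l x" using bidual[OF l1] by blast
  have "del_mu h m = x"
    unfolding del_mu_def m prod.case
  proof (rule the_equality)
    show "((\<lambda>m. h (m, \<nu>, \<xi>)) has_derivative (\<lambda>l. blinfun_apply l x)) (at \<mu>)" using 1 unfolding x .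
    fix z assume "((\<lambda>m. h (m, \<nu>, \<xi>)) has_derivative (\<lambda>l. blinfun_apply l z)) (at \<mu>)"
    from has_derivative_unique[OF 1 this] show "z = x" using uniq[of x z] by (simp add: x)
  qed
  moreover obtain y where y: "\<And>l. ?D (0, l, 0) = blinfun_apply l y" using bidual[OF l2] by blast
  have "del_nu h m = y"
    unfolding del_nu_def m prod.case
  proof (rule the_equality)
    show "((\<lambda>n. h (\<mu>, n, \<xi>)) has_derivative (\<lambda>l. blinfun_apply l y)) (at \<nu>)" using 2 unfolding y .
    fix z assume "((\<lambda>n. h (\<mu>, n, \<xi>)) has_derivative (\<lambda>l. blinfun_apply l z)) (at \<nu>)"
    from has_derivative_unique[OF 2 this] show "z = y" using uniq[of y z] by (simp add: y)
  qed
  moreover have "del_xi h m = Blinfun (\<lambda>l. ?D (0, 0, l))"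
  proof -
    have b: "blinfun_apply (Blinfun (\<lambda>l. ?D (0, 0, l))) = (\<lambda>l. ?D (0, 0, l))"
      by (rule bounded_linear_Blinfun_apply[OF has_derivative_bounded_linear[OF 3]])
    show ?thesis
      unfolding del_xi_def m prod.case
    proof (rule the_equality)
      show "((\<lambda>x. h (\<mu>, \<nu>, x)) has_derivative blinfun_apply (Blinfun (\<lambda>l. tmap V3 vs_mfd h (\<mu>, \<nu>, \<xi>) (0, 0, l)))) (at \<xi>)"
        using 3 b by (simp add: m)
      fix l assume "((\<lambda>x. h (\<mu>, \<nu>, x)) has_derivative blinfun_apply l) (at \<xi>)"
      then show "l = Blinfun (\<lambda>l. tmap V3 vs_mfd h (\<mu>, \<nu>, \<xi>) (0, 0, l))"
        using has_derivative_unique[OF 3] b by (metis blinfun_eqI m)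
    qed
  qed
  moreover have "?D (a, b, c) = ?D (a, 0, 0) + ?D (0, b, 0) + ?D (0, 0, c)"
    using linear_add[OF lin, of "(a, 0, 0)" "(0, b, 0)"] linear_add[OF lin, of "(a, b, 0)" "(0, 0, c)"] by simp
  ultimately show ?thesis
    using bounded_linear_Blinfun_apply[OF has_derivative_bounded_linear[OF 3]] by (simp add: x y)
qed

text \<open>The frame coefficients of the partial derivatives are values of the differential at
  fixed vectors, hence smooth.\<close>

lemma smooth_partials:
  assumes h: "\<And>m. smooth_at V3 vs_mfd h m"
  shows "smooth_at V3 vs_mfd (del_mu h) m" "smooth_at V3 vs_mfd (del_nu h) m" "smooth_at V3 vs_mfd (del_xi h) m"
proof -
  have smh: "smooth_on UNIV UNIV h" by (rule smooth_on_of_smooth_at_vs) (use h in auto)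
  have sD: "smooth_at V3 vs_mfd (\<lambda>m. tmap V3 vs_mfd h m v) m" for v m
    unfolding tmap_vs_vs by (rule smooth_at_vs_vs[OF smooth_on_fd[OF smh]]) auto
  obtain n :: nat and e and c :: "nat \<Rightarrow> 'e \<Rightarrow> real" where fr: "\<And>i. i < n \<Longrightarrow> e i \<in> (UNIV :: 'e set)" "\<And>i. i < n \<Longrightarrow> bounded_linear (c i)"
    "\<And>x. x \<in> UNIV \<Longrightarrow> x = (\<Sum>i<n. c i x *\<^sub>R e i)" "subspace (UNIV :: 'e set)"
    by (rule framedE[OF framed_UNIV_fin_dim]) (rule that)
  have cb: "blinfun_apply (Blinfun (c i)) x = c i x" if "i < n" for i x using fr(2)[OF that] by (simp add: bounded_linear_Blinfun_apply)
  have del_mu: "del_mu h = (\<lambda>m. \<Sum>i<n. tmap V3 vs_mfd h m (Blinfun (c i), 0, 0) *\<^sub>R e i)"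
    by (rule ext) (use fr(3)[OF UNIV_I, of "del_mu h _"] in \<open>simp add: partials[OF h] cb\<close>)
  have "smooth_at V3 vs_mfd (\<lambda>m. \<Sum>i<n. tmap V3 vs_mfd h m (Blinfun (c i), 0, 0) *\<^sub>R e i) m"
    by (intro smooth_at_sum smooth_at_linear(1)[OF bounded_linear_scaleR_left] sD good_V3) simp
  then show "smooth_at V3 vs_mfd (del_mu h) m" unfolding del_mu .
  have del_nu: "del_nu h = (\<lambda>m. \<Sum>i<n. tmap V3 vs_mfd h m (0, Blinfun (c i), 0) *\<^sub>R e i)"
    by (rule ext) (use fr(3)[OF UNIV_I, of "del_nu h _"] in \<open>simp add: partials[OF h] cb\<close>)
  have "smooth_at V3 vs_mfd (\<lambda>m. \<Sum>i<n. tmap V3 vs_mfd h m (0, Blinfun (c i), 0) *\<^sub>R e i) m"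
    by (intro smooth_at_sum smooth_at_linear(1)[OF bounded_linear_scaleR_left] sD good_V3) simp
  then show "smooth_at V3 vs_mfd (del_nu h) m" unfolding del_nu .
  show "smooth_at V3 vs_mfd (del_xi h) m"
  proof (rule smooth_at_dual(1)[OF good_V3])
    fix \<xi> show "smooth_at V3 vs_mfd (\<lambda>x. blinfun_apply (del_xi h x) \<xi>) m" using sD[of "(0, 0, \<xi>)" m] by (simp add: partials[OF h])
  qed simp
qed

lemma bounded_bilinear_coad: "bounded_bilinear (coad G)"
  by (rule framed_bounded_bilinear[OF framed_UNIV_fin_dim framed_UNIV_dual]) (auto intro!: linearI simp: coad_linear)

lemma smooth_reduced_bracket:
  assumes h: "\<And>m. smooth_at V3 vs_mfd h m" and k: "\<And>m. smooth_at V3 vs_mfd k m"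
  shows "smooth_at V3 vs_mfd (reduced_bracket G h k) m"
proof -
  have id: "smooth_at V3 V3 (\<lambda>x. x) m" by (rule smooth_at_id) simp_all
  note l = smooth_at_linear(1)[OF bounded_linear_fst good_V3 id]
    smooth_at_linear(1)[OF bounded_linear_compose[OF bounded_linear_fst bounded_linear_snd] good_V3 id]
    smooth_at_linear(1)[OF bounded_linear_compose[OF bounded_linear_snd bounded_linear_snd] good_V3 id]
  note sh = smooth_partials[OF h] and sk = smooth_partials[OF k]
  note app = smooth_at_bilinear(1)[OF bounded_bilinear_blinfun_apply good_V3] and brr = smooth_at_bilinear(1)[OF bounded_bilinear_br good_V3]
    and cd = smooth_at_bilinear(1)[OF bounded_bilinear_coad good_V3]
  have eq: "reduced_bracket G h k = (\<lambda>m. blinfun_apply (del_xi h m) (del_mu k m) - blinfun_apply (del_xi k m) (del_mu h m)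
     + blinfun_apply (fst (snd m)) (br (del_nu h m) (del_nu k m))
     + blinfun_apply (coad G (del_nu k m) (del_xi h m) - coad G (del_nu h m) (del_xi k m)) (snd (snd m))
     + blinfun_apply (fst m) (br (del_mu h m) (del_nu k m) - br (del_mu k m) (del_nu h m)))"
    by (rule ext) (simp add: reduced_bracket_def Let_def split_beta lie_bracket_eq)
  have "smooth_at V3 vs_mfd (\<lambda>m. blinfun_apply (del_xi h m) (del_mu k m) - blinfun_apply (del_xi k m) (del_mu h m)
     + blinfun_apply (fst (snd m)) (br (del_nu h m) (del_nu k m))
     + blinfun_apply (coad G (del_nu k m) (del_xi h m) - coad G (del_nu h m) (del_xi k m)) (snd (snd m))
     + blinfun_apply (fst m) (br (del_mu h m) (del_nu k m) - br (del_mu k m) (del_nu h m))) m"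
    by (intro smooth_at_add(1) smooth_at_diff(1) app brr cd sh sk l good_V3)
  then show ?thesis unfolding eq .
qed

text \<open>A function \<open>f\<close> of \<open>(\<mu>, \<nu>, \<xi>)\<close> has the Hamiltonian
  field with \<open>TTG_vf\<close> coefficients
  \<open>(f\<nu>, f\<xi>, coad G f\<mu> \<mu>, - f\<mu>)\<close>, the letters denoting its partial
  derivatives.\<close>

lemma poisson_bracket_T:
  assumes H: "\<And>x. x \<in> pts T \<Longrightarrow> H x = h (snd x)" and K: "\<And>x. x \<in> pts T \<Longrightarrow> K x = k (snd x)"
    and h: "\<And>m. smooth_at V3 vs_mfd h m" and k: "\<And>m. smooth_at V3 vs_mfd k m" and x: "x \<in> pts T"
  shows "poisson_bracket T (TTG_form G) H K x = reduced_bracket G h k (snd x)"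
proof -
  obtain g \<mu> \<nu> \<xi> where x': "x = (g, \<mu>, \<nu>, \<xi>)" by (cases x) auto
  have g: "g \<in> carrier G" using x x' by simp
  have tm: "tmap T vs_mfd F x w = tmap V3 vs_mfd f (snd x) (snd w)" if F: "\<And>x. x \<in> pts T \<Longrightarrow> F x = f (snd x)" and f: "\<And>m. smooth_at V3 vs_mfd f m"
    for F :: "('g, 'e) TTG \<Rightarrow> real" and f and w :: "'e vTTG"
  proof -
    have "tmap T vs_mfd F x = tmap T vs_mfd (\<lambda>x. f (snd x)) x"
      by (rule tmap_cong[of T "pts T"]) (use F x good_T openin_topspace[of "mtop T"] in auto)
    moreover note z = T_components[OF good_T smooth_at_id[OF good_T x]]
    ultimately show ?thesis
      using smooth_at_compose(2)[OF good_T good_V3 good_vs_real z(2) f, of w] z(7)[of w] tmap_id[OF good_T x, of w] by simp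
  qed
  have ham: "ham_vf T (TTG_form G) F x = (rt g (del_nu f (snd x)), del_xi f (snd x) + coad G (del_nu f (snd x)) \<mu>,
       coad G (del_mu f (snd x)) \<mu> + coad G (del_nu f (snd x)) \<nu> - coad G \<xi> (del_xi f (snd x)), br \<xi> (del_nu f (snd x)) - del_mu f (snd x))"
    if F: "\<And>x. x \<in> pts T \<Longrightarrow> F x = f (snd x)" and f: "\<And>m. smooth_at V3 vs_mfd f m" for F :: "('g, 'e) TTG \<Rightarrow> real" and f
  proof (rule ham_vf_T[OF x])
    fix w :: "'e vTTG"
    have tF: "tmap T vs_mfd F x w = tmap V3 vs_mfd f (snd x) (snd w)" by (rule tm[OF F f])
    obtain v a b c where w: "w = (v, a, b, c)" by (cases w) auto
    show "TTG_form G x (rt g (del_nu f (snd x)), del_xi f (snd x) + coad G (del_nu f (snd x)) \<mu>,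
       coad G (del_mu f (snd x)) \<mu> + coad G (del_nu f (snd x)) \<nu> - coad G \<xi> (del_xi f (snd x)), br \<xi> (del_nu f (snd x)) - del_mu f (snd x)) w
       = - tmap T vs_mfd F x w"
      unfolding tF unfolding w snd_conv partials[OF f]
      by (simp add: x' TTG_form_eq[OF g] tform_def il_rt[OF g] coad_apply blin_simps br_simps br_antisym[of "il g v" "del_mu f (\<mu>, \<nu>, \<xi>)"])
  qed
  have tH: "tmap T vs_mfd H x w = tmap V3 vs_mfd h (snd x) (snd w)" for w by (rule tm[OF H h])
  have hH: "ham_vf T (TTG_form G) H x = (rt g (del_nu h (snd x)), del_xi h (snd x) + coad G (del_nu h (snd x)) \<mu>,
       coad G (del_mu h (snd x)) \<mu> + coad G (del_nu h (snd x)) \<nu> - coad G \<xi> (del_xi h (snd x)), br \<xi> (del_nu h (snd x)) - del_mu h (snd x))"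
    by (rule ham[OF H h])
  have hK: "ham_vf T (TTG_form G) K x = (rt g (del_nu k (snd x)), del_xi k (snd x) + coad G (del_nu k (snd x)) \<mu>,
       coad G (del_mu k (snd x)) \<mu> + coad G (del_nu k (snd x)) \<nu> - coad G \<xi> (del_xi k (snd x)), br \<xi> (del_nu k (snd x)) - del_mu k (snd x))"
    by (rule ham[OF K k])
  \<comment> \<open>The defining equation of the Hamiltonian field of \<open>H\<close>, applied to
    that of \<open>K\<close>, replaces the form by a directional derivative, which the partial
    derivatives then spell out.\<close>
  have "poisson_bracket T (TTG_form G) H K x = - tmap T vs_mfd H x (ham_vf T (TTG_form G) K x)"
  proof -
    have "\<forall>w. TTG_form G x (ham_vf T (TTG_form G) H x) w = - tmap T vs_mfd H x w"
    proof
      fix w :: "'e vTTG"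
      obtain v a b c where w: "w = (v, a, b, c)" by (cases w) auto
      show "TTG_form G x (ham_vf T (TTG_form G) H x) w = - tmap T vs_mfd H x w"
        unfolding hH tH unfolding w snd_conv partials[OF h]
        by (simp add: x' TTG_form_eq[OF g] tform_def il_rt[OF g] coad_apply blin_simps br_simps br_antisym[of "il g v" "del_mu h (\<mu>, \<nu>, \<xi>)"])
    qed
    then show ?thesis unfolding poisson_bracket_def by blast
  qed
  also have "\<dots> = reduced_bracket G h k (snd x)"
    unfolding tH hK snd_conv partials[OF h]
    by (simp add: x' reduced_bracket_def Let_def lie_bracket_eq coad_apply blin_simps
        br_antisym[of "del_nu k (\<mu>, \<nu>, \<xi>)" "del_nu h (\<mu>, \<nu>, \<xi>)"] br_antisym[of "del_nu k (\<mu>, \<nu>, \<xi>)" "del_mu h (\<mu>, \<nu>, \<xi>)"]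
        br_antisym[of \<xi>])
  finally show ?thesis .
qed

text \<open>Functions independent of the group variable are determined by their restriction to the
  fibre over the identity, where the bracket formula on the quotient applies.\<close>

lemma poisson_part:
  assumes "smooth_fun T H" "smooth_fun T K" "indep_of_group G H" "indep_of_group G K"
  shows "smooth_fun T (poisson_bracket T (TTG_form G) H K)"
    "indep_of_group G (poisson_bracket T (TTG_form G) H K)"
    "g \<in> carrier G \<Longrightarrow> poisson_bracket T (TTG_form G) H K (g, m) = reduced_bracket G (\<lambda>m. H (\<one>, m)) (\<lambda>m. K (\<one>, m)) m"
proof -
  have s: "smooth_at V3 vs_mfd (\<lambda>m. F (\<one>, m)) m" if F: "smooth_fun T F" for F m
  proof -
    have m: "m \<in> pts V3" by simp
    have "smooth_at V3 (prod_mfd M V3) (\<lambda>m. (\<one>, m)) m"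
      by (intro smooth_at_Pair(1) smooth_group_const smooth_at_id good_V3) simp_all
    then show ?thesis
      using smooth_at_compose(1)[OF good_V3 good_T good_vs_real, of "\<lambda>m. (\<one>, m)" m F] smooth_mapD[OF good_T good_vs_real F, of "(\<one>, m)"]
      by (simp add: T_eq)
  qed
  have i: "F x = F (\<one>, snd x)" if "indep_of_group G F" "x \<in> pts T" for F x
    using that unfolding indep_of_group_def by (metis T_simps(2) mem_Times_iff one_closed prod.collapse)
  have pb: "poisson_bracket T (TTG_form G) H K x = reduced_bracket G (\<lambda>m. H (\<one>, m)) (\<lambda>m. K (\<one>, m)) (snd x)" if "x \<in> pts T" for x
    by (rule poisson_bracket_T[OF i[OF assms(3)] i[OF assms(4)] s[OF assms(1)] s[OF assms(2)] that])
  then show "g \<in> carrier G \<Longrightarrow> poisson_bracket T (TTG_form G) H K (g, m) = reduced_bracket G (\<lambda>m. H (\<one>, m)) (\<lambda>m. K (\<one>, m)) m"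
    by simp
  show "indep_of_group G (poisson_bracket T (TTG_form G) H K)" unfolding indep_of_group_def using pb by simp
  show "smooth_fun T (poisson_bracket T (TTG_form G) H K)"
    unfolding smooth_map_iff[OF good_T good_vs_real]
  proof
    fix x assume x: "x \<in> pts T"
    have "smooth_at T vs_mfd (\<lambda>x. reduced_bracket G (\<lambda>m. H (\<one>, m)) (\<lambda>m. K (\<one>, m)) (snd x)) x"
      by (rule smooth_at_compose(1)[OF good_T good_V3 good_vs_real T_components(2)[OF good_T smooth_at_id[OF good_T x]]])
        (intro smooth_reduced_bracket s assms)
    then show "smooth_at T vs_mfd (poisson_bracket T (TTG_form G) H K) x"
      by (rule smooth_at_cong[of T "pts T", rotated 4]) (use x pb openin_topspace[of "mtop T"] in auto)
  qed
qed

lemma poisson_reduction_T: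
  "poisson_reduction G T (TTG_form G) (TTG_right G) V3 (\<lambda>(g, \<mu>, \<nu>, \<xi>). (\<mu>, \<nu>, \<xi>)) (reduced_bracket G)"
proof -
  have p: "(\<lambda>(g, \<mu>, \<nu>, \<xi>). (\<mu>, \<nu>, \<xi>)) = (snd :: ('g, 'e) TTG \<Rightarrow> _)" by (rule ext) (simp add: split_beta)
  note z = T_components[OF good_T smooth_at_id[OF good_T]]
  have sub: "surj_submersion T V3 snd"
    unfolding surj_submersion_def smooth_map_iff[OF good_T good_V3]
  proof (intro conjI ballI)
    show "smooth_at T V3 snd x" if "x \<in> pts T" for x using z(2)[OF that] .
    show "snd ` pts T = pts V3" using one_closed by force
    fix x assume x: "x \<in> pts T"
    have "tmap T V3 snd x v = snd v" for v using z(7)[OF x, of v] tmap_id[OF good_T x, of v] by simp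
    then have "tmap T V3 snd x = snd" by (rule ext)
    then show "tmap T V3 snd x ` model T = model V3" using snd_image_times[of UNIV UNIV] by simp
  qed
  have orb: "snd x = snd y \<longleftrightarrow> (\<exists>g\<in>carrier G. y = TTG_right G g x)" if "x \<in> pts T" "y \<in> pts T" for x y
  proof -
    obtain h m h' m' where xy: "x = (h, m)" "y = (h', m')" by (cases x; cases y) auto
    have h: "h \<in> carrier G" "h' \<in> carrier G" using that xy by auto
    \<comment> \<open>The action multiplies by the inverse on the right, so
      \<open>inv h' \<otimes> h\<close> is the element that moves \<open>h\<close> to
      \<open>h'\<close>.\<close>
    have "h' = h \<otimes> inv (inv h' \<otimes> h)" using h by (simp add: inv_mult_group m_assoc[symmetric])
    then show ?thesis using h by (auto simp: xy TTG_right_def intro!: bexI[of _ "inv h' \<otimes> h"])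
  qed
  show ?thesis
    unfolding poisson_reduction_def p
  proof (intro conjI allI impI ballI)
    show "symplectic_manifold T (TTG_form G)" by (rule symplectic_T)
    show "symplectic_action G T (TTG_form G) (TTG_right G)" by (rule symplectic_right)
    show "smooth_manifold V3" using good_V3 by (rule goodD)
    show "surj_submersion T V3 snd" by (rule sub)
    show "(snd x = snd y) = (\<exists>g\<in>carrier G. y = TTG_right G g x)" if "x \<in> pts T" "y \<in> pts T" for x y using orb[OF that] .
    fix h k assume hk: "smooth_fun V3 h \<and> smooth_fun V3 k"
    have s: "smooth_at V3 vs_mfd h m" "smooth_at V3 vs_mfd k m" for m using hk by (auto intro: smooth_mapD[OF good_V3 good_vs_real])
    show "smooth_fun V3 (reduced_bracket G h k)" unfolding smooth_map_iff[OF good_V3 good_vs_real] using smooth_reduced_bracket[OF s] by blast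
    show "poisson_bracket T (TTG_form G) (h \<circ> snd) (k \<circ> snd) x = reduced_bracket G h k (snd x)" if "x \<in> pts T" for x
      by (rule poisson_bracket_T[OF _ _ s that]) auto
  qed
qed

end

section \<open>Coadjoint orbits\<close>

lemma smooth_at_continuous_map:
  assumes "good N" "good K" "openin (mtop N) B" "\<And>x. x \<in> B \<Longrightarrow> smooth_at N K h x"
  shows "continuous_map (subtopology (mtop N) B) (mtop K) h"
  unfolding continuous_map_def
proof (intro conjI allI impI)
  have B: "topspace (subtopology (mtop N) B) = B" using openin_subset[OF assms(3)] by auto
  show "h \<in> topspace (subtopology (mtop N) B) \<rightarrow> topspace (mtop K)" unfolding B using smooth_atD(2)[OF assms(4)] by blast
  fix V assume V: "openin (mtop K) V"
  have "\<exists>U. openin (mtop N) U \<and> p \<in> U \<and> U \<subseteq> {x \<in> B. h x \<in> V}" if p: "p \<in> {x \<in> B. h x \<in> V}" for p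
  proof -
    obtain U where "openin (mtop N) U" "p \<in> U" "h ` U \<subseteq> V"
      by (rule smooth_at_continuous[OF assms(1,2) assms(4) V]) (use p in auto)
    then show ?thesis using p assms(3) by (intro exI[of _ "U \<inter> B"]) auto
  qed
  then have "openin (mtop N) {x \<in> B. h x \<in> V}" by (subst openin_subopen) blast
  then show "openin (subtopology (mtop N) B) {x \<in> topspace (subtopology (mtop N) B). h x \<in> V}"
    unfolding B by (auto simp: openin_open_subtopology[OF assms(3)])
qed

context lie begin

text \<open>The infinitesimal generator of the coadjoint action at \<mu>, as a linear map of the Lie
  algebra; its range is the tangent space of the orbit.\<close>

definition inft where "inft \<mu> \<eta> = - coad G \<eta> \<mu>"

lemma linear_inft: "linear (inft \<mu>)"
  by (rule linearI) (simp_all add: inft_def coad_linear)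

lemma bounded_linear_inft: "bounded_linear (inft \<mu>)"
  by (rule framed_linear_bounded[OF framed_UNIV_fin_dim linear_inft])

lemma smooth_orbit_map: "g \<in> carrier G \<Longrightarrow> smooth_at M vs_mfd (\<lambda>g. coAd G g \<mu>) g"
  using smooth_at_coAd_comp(1)[OF good_M smooth_group_id smooth_at_vs_const[OF good_M]] by simp

lemma tmap_orbit_comp:
  assumes "good N" "smooth_at N M f p" "v \<in> model N"
  shows "tmap N vs_mfd (\<lambda>x. coAd G (f x) \<mu>) p v = coAd G (f p) (inft \<mu> (ld N f p v))"
  using smooth_at_coAd_comp(2)[OF assms(1,2) smooth_at_vs_const[OF assms(1) smooth_atD(1)[OF assms(2)]] assms(3), of \<mu>]
    tmap_const[OF assms(1) smooth_atD(1)[OF assms(2)] assms(3), of vs_mfd \<mu>] by (simp add: inft_def)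

text \<open>A local section of the orbit map at the identity. Since the orbit map \<open>f\<close> is equivariant, its rank
  is constant, so that near the identity \<open>f\<close> factors through the projection onto the image \<open>W\<close> of its
  derivative there; \<open>S\<close> is a right inverse of that derivative.\<close>

lemma orbit_slice:
  fixes \<mu> :: "'e dual"
  defines "W \<equiv> range (inft \<mu>)" and "F \<equiv> \<lambda>x. coAd G (cinv M \<one> x) \<mu>"
  obtains S B \<sigma> U where "linear S" "\<And>w. w \<in> W \<Longrightarrow> inft \<mu> (S w) = w" "rel_open W B" "0 \<in> B"
    "smooth_on W B \<sigma>" "\<And>w. w \<in> B \<Longrightarrow> \<sigma> w \<in> cmap M \<one> ` cdom M \<one>" "\<sigma> 0 = cmap M \<one> \<one>"
    "\<And>w. w \<in> B \<Longrightarrow> inft \<mu> (S (F (\<sigma> w) - \<mu>)) = w"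
    "openin (mtop M) U" "\<one> \<in> U" "(\<lambda>g. coAd G g \<mu>) ` U = (\<lambda>w. F (\<sigma> w)) ` B"
proof -
  let ?A = "inft \<mu>"
  note c = good_chart[of M \<one>, simplified]
  let ?D = "cmap M \<one> ` cdom M \<one>" and ?e = "cmap M \<one> \<one>"
  have D: "open ?D" "?e \<in> ?D" using c by auto
  have cin: "cinv M \<one> x \<in> carrier G" "smooth_at vs M (cinv M \<one>) x" if "x \<in> ?D" for x
    using c(6)[OF that] c(10) smooth_at_vs_M_cinv[OF one_closed that] by auto
  obtain S where S: "linear S" "\<And>w. w \<in> W \<Longrightarrow> ?A (S w) = w"
    using linear_exists_right_inverse_on[OF linear_inft subspace_UNIV] unfolding W_def by blast
  have bS: "bounded_linear S" by (rule framed_linear_bounded[OF framed_UNIV_dual S(1)])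
  note bA = bounded_linear_inft[of \<mu>]
  have ASA: "?A (S (?A x)) = ?A x" for x using S(2)[of "?A x"] by (simp add: W_def)
  have sF: "smooth_at vs vs_mfd F x" if "x \<in> ?D" for x
    unfolding F_def by (rule smooth_at_coAd_comp(1)[OF good_vs_fin_dim cin(2)[OF that] smooth_at_vs_const]) simp_all
  have smF: "smooth_on UNIV ?D F" by (rule smooth_on_of_smooth_at_vs[OF D(1) sF])
  have dF: "fd UNIV F x v = coAd G (cinv M \<one> x) (?A (mc \<one> x v))" if "x \<in> ?D" for x v
    using tmap_orbit_comp[OF good_vs_fin_dim cin(2)[OF that], of v \<mu>] by (simp add: F_def tmap_vs_vs mc_def)
  have Fe: "F ?e = \<mu>" by (simp add: F_def c(1,5) coAd_one)
  have mce: "mc \<one> ?e v = v" for v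
  proof -
    have "tmap vs M (cinv M \<one>) ?e v = tmap vs vs (\<lambda>x. cmap M \<one> (cinv M \<one> x)) ?e v"
      using tmap_cmap_self[OF good_vs_fin_dim cin(2)[OF D(2)], of v] c(1,5) by simp
    also have "tmap vs vs (\<lambda>x. cmap M \<one> (cinv M \<one> x)) ?e = tmap vs vs (\<lambda>x. x) ?e"
      by (rule tmap_cong[of vs ?D]) (use D c in auto)
    finally show ?thesis by (simp add: mc_def ld_def c(1,5) il_one tmap_id)
  qed
  text \<open>near the identity, \<open>?A \<circ> S\<close> is injective on the translates of \<open>W\<close>\<close>
  define Q where "Q x w = ?A (S (coAd G (cinv M \<one> x) w))" for x w
  obtain n :: nat and e and k :: "nat \<Rightarrow> 'e dual \<Rightarrow> real" where fr: "\<And>i. i < n \<Longrightarrow> e i \<in> (UNIV :: 'e dual set)" "\<And>i. i < n \<Longrightarrow> bounded_linear (k i)"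
    "\<And>x. x \<in> UNIV \<Longrightarrow> x = (\<Sum>i<n. k i x *\<^sub>R e i)" "subspace (UNIV :: 'e dual set)"
    by (rule framedE[OF framed_UNIV_dual]) (rule that)
  \<comment> \<open>A continuous bound for the operator norm of \<open>Q x - Q ?e\<close>, vanishing
    at \<open>?e\<close>.\<close>
  define h where "h x = (\<Sum>i<n. onorm (k i) * norm (Q x (e i) - Q ?e (e i)))" for x
  have Qc: "continuous_on ?D (\<lambda>x. Q x w)" for w
  proof -
    have "smooth_at vs vs_mfd (\<lambda>x. Q x w) x" if "x \<in> ?D" for x
      unfolding Q_def
      by (intro smooth_at_linear(1)[OF bA] smooth_at_linear(1)[OF bS] smooth_at_coAd_comp(1) smooth_at_vs_const cin that good_vs_fin_dim) simp
    then show ?thesis by (intro smooth_on_continuous[of UNIV] smooth_on_of_smooth_at_vs[OF D(1)]) (use D(1) in auto)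
  qed
  have "continuous_on ?D h" unfolding h_def by (intro continuous_intros Qc)
  \<comment> \<open>Where \<open>h\<close> is below 1/2, a vector \<open>w\<close> of
    \<open>W\<close> killed by \<open>Q x\<close> satisfies
    \<open>norm w \<le> 1 / 2 * norm w\<close>.\<close>
  then have D'o: "open (?D \<inter> h -` {..<1/2})" using D(1) by (intro continuous_open_preimage) auto
  define D' where "D' = ?D \<inter> h -` {..<1/2}"
  have D': "open D'" "?e \<in> D'" "D' \<subseteq> ?D" using D'o D by (auto simp: D'_def h_def)
  have Qinj: "w = 0" if x: "x \<in> D'" and w: "w \<in> W" and 0: "Q x w = 0" for x w
  proof -
    have lin: "linear (Q y)" if "y \<in> ?D" for y
      unfolding Q_def using linear_compose[OF linear_compose[OF linear_coAd[OF cin(1)[OF that]] S(1)] linear_inft] by (simp add: o_def)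
    have "w = Q ?e w - Q x w" using 0 S(2)[OF w] by (simp add: Q_def c(1,5) coAd_one)
    also have "\<dots> = - (\<Sum>i<n. k i w *\<^sub>R (Q x (e i) - Q ?e (e i)))"
      using linear_frame_expand[OF lin fr(3)[OF UNIV_I], of ?e w] linear_frame_expand[OF lin fr(3)[OF UNIV_I], of x w] D(2) x D'(3)
      by (auto simp: sum_subtractf scaleR_diff_right)
    also have "norm \<dots> \<le> (\<Sum>i<n. (onorm (k i) * norm w) * norm (Q x (e i) - Q ?e (e i)))"
      unfolding norm_minus_cancel by (intro sum_norm_le) (auto intro!: mult_right_mono onorm[OF fr(2), simplified])
    also have "\<dots> = h x * norm w" by (simp add: h_def sum_distrib_left sum_distrib_right mult_ac)
    finally have "norm w \<le> h x * norm w" .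
    moreover have "h x < 1 / 2" using x by (simp add: D'_def)
    ultimately have "norm w \<le> 1 / 2 * norm w" using mult_right_mono[of "h x" "1/2" "norm w"] by linarith
    then show "w = 0" by simp
  qed
  \<comment> \<open>New coordinates: the first summand carries the orbit map, the second fills in
    the kernel of \<open>?A\<close>. The derivative at \<open>?e\<close> sends \<open>v\<close> to
    \<open>S (?A v) + (v - S (?A v)) = v\<close>, while applying \<open>?A\<close> leaves only
    \<open>?A (S (F x - \<mu>))\<close>.\<close>
  define \<Phi> where "\<Phi> x = S (F x - \<mu>) + ((x - ?e) - S (?A (x - ?e)))" for x
  have RO: "rel_open UNIV D'" using D' by simp
  have sm\<Phi>: "smooth_on UNIV D' \<Phi>"
    unfolding \<Phi>_def
    by (intro smooth_on_add smooth_on_diff smooth_on_linear_comp[OF RO bS] smooth_on_linear_comp[OF RO bA] smooth_on_const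
        smooth_on_subset[OF smF D'(3)] smooth_on_bounded_linear bounded_linear_ident RO)
  have d\<Phi>: "fd UNIV \<Phi> ?e v = v" for v
  proof -
    have dF': "(F has_derivative fd UNIV F ?e) (at ?e)" using smooth_onD[OF smF D(2)] .
    have "(\<Phi> has_derivative (\<lambda>v. S (fd UNIV F ?e v - 0) + ((v - 0) - S (?A (v - 0))))) (at ?e)"
      unfolding \<Phi>_def
      by (intro has_derivative_add has_derivative_diff bounded_linear.has_derivative[OF bS] bounded_linear.has_derivative[OF bA]
          dF' has_derivative_const has_derivative_ident)
    from fd_eq[OF this RO D'(2)] show ?thesis using dF[OF D(2)] by (simp add: c(1,5) coAd_one mce)
  qed
  have \<Phi>e: "\<Phi> ?e = 0" by (simp add: \<Phi>_def Fe linear_0[OF S(1)] linear_0[OF linear_inft])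
  obtain r \<Psi> U where IFT: "r > 0" "smooth_on UNIV (ball (\<Phi> ?e) r) \<Psi>"
    "\<And>y. y \<in> ball (\<Phi> ?e) r \<Longrightarrow> \<Psi> y \<in> U \<and> \<Phi> (\<Psi> y) = y"
    "open U" "?e \<in> U" "U \<subseteq> D'" "\<And>x. x \<in> U \<Longrightarrow> \<Phi> x \<in> ball (\<Phi> ?e) r \<and> \<Psi> (\<Phi> x) = x"
    by (rule inverse_function_smooth[OF framed_UNIV_fin_dim D'(1,2) sm\<Phi> d\<Phi>]) (rule that)
  let ?Y = "ball (0::'e) r"
  have smP: "smooth_on UNIV ?Y \<Psi>" using IFT(2) by (simp add: \<Phi>e)
  have P: "\<Psi> y \<in> U" "\<Psi> y \<in> D'" "\<Psi> y \<in> ?D" "\<Phi> (\<Psi> y) = y" if "y \<in> ?Y" for y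
    using IFT(3)[of y] IFT(6) D'(3) that by (auto simp: \<Phi>e)
  have A\<Phi>: "?A (\<Phi> x) = ?A (S (F x - \<mu>))" for x
    by (simp only: \<Phi>_def linear_add[OF linear_inft] linear_diff[OF linear_inft, of _ "x - ?e" "S (?A (x - ?e))"] ASA) simp
  have smFP: "smooth_on UNIV ?Y (\<lambda>y. F (\<Psi> y))"
    by (rule smooth_on_compose[OF smF smP _ _ framed_UNIV_fin_dim]) (use D P in auto)
  \<comment> \<open>In the new coordinates \<open>?A (S (F - \<mu>))\<close> becomes the linear map
    \<open>?A\<close>, so the derivative of \<open>F\<close> in a kernel direction is annihilated by
    \<open>?A \<circ> S\<close>. By equivariance that derivative lies in a translate of
    \<open>W\<close>, on which the composite is injective; hence it is 0.\<close>
  have der: "fd UNIV (\<lambda>y. F (\<Psi> y)) y v = 0" if y: "y \<in> ?Y" and v: "?A v = 0" for y v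
  proof -
    have 1: "fd UNIV (\<lambda>y. F (\<Psi> y)) y v = fd UNIV F (\<Psi> y) (fd UNIV \<Psi> y v)"
      by (rule fd_eq[OF has_derivative_compose[OF smooth_onD[OF smP y]], of _ _ ?Y]) (use smooth_onD[OF smF P(3)[OF y]] y in auto)
    have "fd UNIV (\<lambda>y. ?A (S (F (\<Psi> y) - \<mu>))) y v = ?A (S (fd UNIV (\<lambda>y. F (\<Psi> y)) y v - 0))"
    proof -
      have "((\<lambda>y. F (\<Psi> y) - \<mu>) has_derivative (\<lambda>v. fd UNIV (\<lambda>y. F (\<Psi> y)) y v - 0)) (at y)"
        by (intro has_derivative_diff has_derivative_const smooth_onD[OF smFP y])
      from fd_eq[OF bounded_linear.has_derivative[OF bA bounded_linear.has_derivative[OF bS this]], of ?Y v] show ?thesis using y by simp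
    qed
    moreover have "fd UNIV (\<lambda>y. ?A (S (F (\<Psi> y) - \<mu>))) y = fd UNIV ?A y"
      by (rule fd_cong(1)[of UNIV ?Y]) (use y A\<Phi>[of "\<Psi> _"] P(4) in \<open>auto simp flip: A\<Phi>\<close>)
    moreover have "fd UNIV ?A y v = ?A v"
      by (rule fd_eq[OF bounded_linear_imp_has_derivative[OF bA], where S="?Y"]) (use y in auto)
    ultimately have "?A (S (fd UNIV (\<lambda>y. F (\<Psi> y)) y v)) = 0" using v by simp
    then have "Q (\<Psi> y) (?A (mc \<one> (\<Psi> y) (fd UNIV \<Psi> y v))) = 0" unfolding 1 dF[OF P(3)[OF y]] Q_def .
    then have "?A (mc \<one> (\<Psi> y) (fd UNIV \<Psi> y v)) = 0" by (rule Qinj[OF P(2)[OF y], rotated]) (simp add: W_def)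
    then show ?thesis unfolding 1 dF[OF P(3)[OF y]] by (simp add: linear_0[OF linear_coAd] cin P(3)[OF y])
  qed
  \<comment> \<open>Points of the ball with equal image under \<open>?A\<close> are joined by a
    segment in a kernel direction, so \<open>F (\<Psi> y)\<close> depends on \<open>?A y\<close>
    alone.\<close>
  have const: "F (\<Psi> y) = F (\<Psi> y')" if y: "y \<in> ?Y" "y' \<in> ?Y" and eq: "?A y = ?A y'" for y y'
  proof -
    have "((\<lambda>t. F (\<Psi> (y + t *\<^sub>R (y' - y)))) has_vector_derivative 0) (at t within {0..1})" if t: "t \<in> {0..1}" for t
    proof -
      have "(1 - t) *\<^sub>R y + t *\<^sub>R y' \<in> ?Y" using convexD_alt[OF convex_ball y, of t] t by auto
      then have m: "y + t *\<^sub>R (y' - y) \<in> ?Y" by (simp add: algebra_simps)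
      have "?A (y' - y) = 0" using eq by (simp add: linear_diff[OF linear_inft])
      then show ?thesis
        using smooth_on_line[OF smFP _ m] der[OF m] has_vector_derivative_at_within by fastforce
    qed
    then obtain z where "\<And>t. t \<in> {0..1::real} \<Longrightarrow> F (\<Psi> (y + t *\<^sub>R (y' - y))) = z"
      using has_vector_derivative_zero_constant[of "{0..1::real}" "\<lambda>t. F (\<Psi> (y + t *\<^sub>R (y' - y)))"] by auto
    from this[of 0] this[of 1] show ?thesis by simp
  qed
  have subW: "subspace W" unfolding W_def using linear_subspace_image[OF linear_inft subspace_UNIV] .
  \<comment> \<open>The parameter domain of the section: vectors of \<open>W\<close> whose lifts by
    \<open>S\<close> fall into the ball on which \<open>\<Psi>\<close> is available.\<close>
  define B where "B = W \<inter> S -` ?Y"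
  have "continuous_on UNIV S" by (rule linear_continuous_on[OF bS])
  then have "open (S -` ?Y)" using continuous_open_vimage by (metis open_ball continuous_on_open_vimage open_UNIV inf_top_right)
  then have B: "rel_open W B" using subW unfolding rel_open_def B_def by (simp add: openin_open_Int)
  have 0: "0 \<in> B" using IFT(1) subW linear_0[OF S(1)] by (simp add: B_def subspace_0)
  have smB: "smooth_on W B (\<lambda>w. \<Psi> (S w))"
    by (rule smooth_on_compose[OF smP smooth_on_bounded_linear[OF B bS] B _ framed_UNIV_fin_dim]) (auto simp: B_def)
  \<comment> \<open>Only points whose image under \<open>?A \<circ> \<Phi>\<close>, lifted by
    \<open>S\<close>, is again in the ball are kept; then the orbit map sends the neighbourhood onto
    exactly the image of the section.\<close>
  define U' where "U' = {x \<in> U. S (?A (\<Phi> x)) \<in> ?Y}"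
  have U'o: "open U'"
  proof -
    have "smooth_on UNIV U (\<lambda>x. S (?A (\<Phi> x)))"
      using IFT(4) by (intro smooth_on_linear_comp[OF _ bS] smooth_on_linear_comp[OF _ bA] smooth_on_subset[OF sm\<Phi> IFT(6)]) auto
    then have "continuous_on U (\<lambda>x. S (?A (\<Phi> x)))" using smooth_on_continuous[of UNIV] IFT(4) by auto
    then have "open (U \<inter> (\<lambda>x. S (?A (\<Phi> x))) -` ?Y)" using IFT(4) by (intro continuous_open_preimage) auto
    moreover have "U \<inter> (\<lambda>x. S (?A (\<Phi> x))) -` ?Y = U'" by (auto simp: U'_def)
    ultimately show ?thesis by simp
  qed
  define U0 where "U0 = {g \<in> cdom M \<one>. cmap M \<one> g \<in> U'}"
  have "openin (mtop M) U0" unfolding U0_def by (rule c(9)) (use U'o in simp)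
  moreover have "\<one> \<in> U0" using c(1) IFT(1,5) by (simp add: U0_def U'_def \<Phi>e linear_0[OF S(1)] linear_0[OF linear_inft])
  moreover have "(\<lambda>g. coAd G g \<mu>) ` U0 = (\<lambda>w. F (\<Psi> (S w))) ` B"
  proof (intro equalityI subsetI)
    fix \<alpha> assume "\<alpha> \<in> (\<lambda>g. coAd G g \<mu>) ` U0"
    then obtain g where g: "g \<in> cdom M \<one>" "cmap M \<one> g \<in> U'" "\<alpha> = coAd G g \<mu>" by (auto simp: U0_def)
    let ?x = "cmap M \<one> g"
    have x: "\<Phi> ?x \<in> ?Y" "\<Psi> (\<Phi> ?x) = ?x" "S (?A (\<Phi> ?x)) \<in> ?Y" using g(2) IFT(7)[of ?x] by (auto simp: U'_def \<Phi>e)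
    have "\<alpha> = F (\<Psi> (\<Phi> ?x))" using g c(5) by (simp add: F_def x(2))
    also have "\<dots> = F (\<Psi> (S (?A (\<Phi> ?x))))" by (rule const) (use x ASA in auto)
    finally show "\<alpha> \<in> (\<lambda>w. F (\<Psi> (S w))) ` B" using x(3) by (auto simp: B_def W_def)
  next
    fix \<alpha> assume "\<alpha> \<in> (\<lambda>w. F (\<Psi> (S w))) ` B"
    then obtain w where w: "w \<in> W" "S w \<in> ?Y" "\<alpha> = F (\<Psi> (S w))" by (auto simp: B_def)
    have x: "\<Psi> (S w) \<in> U'" using P[OF w(2)] S(2)[OF w(1)] w(2) by (simp add: U'_def)
    then show "\<alpha> \<in> (\<lambda>g. coAd G g \<mu>) ` U0"
      using c(6,7)[OF P(3)[OF w(2)]] by (intro image_eqI[of _ _ "cinv M \<one> (\<Psi> (S w))"]) (auto simp: U0_def w(3) F_def)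
  qed
  moreover have "\<Psi> (S 0) = ?e" using IFT(7)[OF IFT(5)] by (simp add: \<Phi>e linear_0[OF S(1)])
  moreover have "?A (S (F (\<Psi> (S w)) - \<mu>)) = w" if "w \<in> B" for w
    using A\<Phi>[of "\<Psi> (S w)"] P(4)[of "S w"] S(2)[of w] that by (simp add: B_def)
  moreover have "\<Psi> (S w) \<in> ?D" if "w \<in> B" for w using P(3)[of "S w"] that by (simp add: B_def)
  ultimately show ?thesis using S B 0 smB by (intro that[of S B "\<lambda>w. \<Psi> (S w)" U0]) auto
qed

end

text \<open>The data of the slice at \<open>mu0\<close>, fixed once so that the orbit manifold, the
  reduced form and the reduced space can be defined from them.\<close>

locale orbit = lie G for G :: "('g, 'e::fin_dim_inner) lgroup" (structure) +
  fixes mu0 :: "'e dual" and S :: "'e dual \<Rightarrow> 'e" and B :: "'e dual set" and \<sigma> :: "'e dual \<Rightarrow> 'e" and U0 :: "'g set"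
  assumes linear_S: "linear S" and A_S: "\<And>w. w \<in> range (inft mu0) \<Longrightarrow> inft mu0 (S w) = w"
    and B: "rel_open (range (inft mu0)) B" and zero_B: "0 \<in> B" and smooth_\<sigma>: "smooth_on (range (inft mu0)) B \<sigma>"
    and \<sigma>_dom: "\<And>w. w \<in> B \<Longrightarrow> \<sigma> w \<in> cmap M \<one> ` cdom M \<one>" and \<sigma>_0: "\<sigma> 0 = cmap M \<one> \<one>"
    and sect: "\<And>w. w \<in> B \<Longrightarrow> inft mu0 (S (coAd G (cinv M \<one> (\<sigma> w)) mu0 - mu0)) = w"
    and U0: "openin (mtop M) U0" "\<one> \<in> U0" "(\<lambda>g. coAd G g mu0) ` U0 = (\<lambda>w. coAd G (cinv M \<one> (\<sigma> w)) mu0) ` B"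
begin

abbreviation "f \<equiv> \<lambda>g. coAd G g mu0"
text \<open>The roles of what follows: \<open>W\<close> is the tangent space of the orbit at
  \<open>mu0\<close>, \<open>sec\<close> a local section into the group, \<open>F\<close> the
  resulting parametrization of the orbit, and \<open>pr\<close> a projection of the dual onto
  \<open>W\<close> that inverts \<open>F\<close> after the shift by \<open>mu0\<close>.\<close>

definition "W = range (inft mu0)"
definition "sec w = cinv M \<one> (\<sigma> w)"
definition "F w = f (sec w)"
definition "pr \<alpha> = inft mu0 (S \<alpha>)"
definition "rep \<alpha> = (SOME g. g \<in> carrier G \<and> f g = \<alpha>)"
abbreviation "Orb \<equiv> coad_orbit G mu0"
abbreviation "LW \<equiv> lin_mfd W"

text \<open>The topology is the quotient topology of the orbit map. The chart at \<alpha> translates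
  back to \<open>mu0\<close> and then projects; being the restriction of an affine map of the whole
  dual, it makes the transition maps visibly smooth.\<close>

definition OM :: "('e dual, 'e dual) mfd" where
  "OM = \<lparr>mtop = topology (\<lambda>X. X \<subseteq> Orb \<and> openin (mtop M) {g \<in> carrier G. f g \<in> X}), model = W,
     cdom = (\<lambda>\<alpha>. coAd G (rep \<alpha>) ` F ` B), cmap = (\<lambda>\<alpha> \<beta>. pr (coAd G (inv (rep \<alpha>)) \<beta> - mu0))\<rparr>"

lemma OM_simps [simp]: "model OM = W" "cdom OM \<alpha> = coAd G (rep \<alpha>) ` F ` B" "cmap OM \<alpha> \<beta> = pr (coAd G (inv (rep \<alpha>)) \<beta> - mu0)"
  by (simp_all add: OM_def)

section \<open>The orbit as a quotient: topology, atlas and tangent spaces\<close>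

lemma framed_W: "framed W"
  unfolding W_def by (rule framed_subspace[OF framed_UNIV_dual linear_subspace_image[OF linear_inft subspace_UNIV]])

lemma subspace_W: "subspace W"
  using framed_W by (simp add: framed_def)

lemma good_LW [simp]: "good LW"
  by (rule good_lin_mfd[OF framed_W framed_UNIV_dual])

lemma RO_B: "rel_open W B" and sub_B: "w \<in> B \<Longrightarrow> w \<in> W"
  using B rel_openD(2)[OF B] by (auto simp: W_def)

lemma bounded_linear_pr: "bounded_linear pr"
  unfolding pr_def by (rule bounded_linear_compose[OF bounded_linear_inft framed_linear_bounded[OF framed_UNIV_dual linear_S]])

lemma pr_W: "w \<in> W \<Longrightarrow> pr w = w" "pr \<alpha> \<in> W"
  using A_S by (auto simp: pr_def W_def)

lemma f_carrier: "g \<in> carrier G \<Longrightarrow> f g \<in> Orb"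
  by (auto simp: coad_orbit_def)

lemma rep: "\<alpha> \<in> Orb \<Longrightarrow> rep \<alpha> \<in> carrier G" "\<alpha> \<in> Orb \<Longrightarrow> f (rep \<alpha>) = \<alpha>"
  using someI_ex[of "\<lambda>g. g \<in> carrier G \<and> f g = \<alpha>"] by (auto simp: rep_def coad_orbit_def)

lemma sec_smooth: "w \<in> B \<Longrightarrow> smooth_at LW M sec w" and sec_carrier: "w \<in> B \<Longrightarrow> sec w \<in> carrier G"
proof -
  assume w: "w \<in> B"
  have "smooth_at LW vs \<sigma> w"
    unfolding vs_mfd_eq by (rule smooth_at_lin_mfd[OF _ RO_B w]) (use smooth_\<sigma> in \<open>auto simp: W_def\<close>)
  moreover have "smooth_at vs M (cinv M \<one>) (\<sigma> w)" by (rule smooth_at_vs_M_cinv[OF one_closed \<sigma>_dom[OF w]])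
  ultimately show "smooth_at LW M sec w"
    unfolding sec_def[abs_def] by (rule smooth_at_compose(1)[OF good_LW good_vs_fin_dim good_M])
  then show "sec w \<in> carrier G" using smooth_atD(2) by fastforce
qed

lemma sec_0: "sec 0 = \<one>"
  using good_chart(1,5)[of M \<one>] by (simp add: sec_def \<sigma>_0)

lemma F_0: "F 0 = mu0"
  by (simp add: F_def sec_0 coAd_one)

lemma pr_F: "w \<in> B \<Longrightarrow> pr (F w - mu0) = w"
  using sect by (simp add: pr_def F_def sec_def)

lemma F_smooth: "w \<in> B \<Longrightarrow> smooth_at LW vs_mfd F w"
  unfolding F_def by (rule smooth_at_coAd_comp(1)[OF good_LW sec_smooth smooth_at_vs_const[OF good_LW]]) (simp_all add: sub_B)

lemma tmap_F: "w \<in> B \<Longrightarrow> u \<in> W \<Longrightarrow> tmap LW vs_mfd F w u = coAd G (sec w) (inft mu0 (ld LW sec w u))"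
  unfolding F_def using tmap_orbit_comp[OF good_LW sec_smooth, of w u mu0] by simp

text \<open>Differentiate \<open>pr (F w - mu0) = w\<close> at 0; the derivative of \<open>F\<close>
  there has values in \<open>W\<close>, where \<open>pr\<close> is the identity.\<close>

lemma tmap_F_0: "u \<in> W \<Longrightarrow> tmap LW vs_mfd F 0 u = u"
proof -
  assume u: "u \<in> W"
  have z: "0 \<in> B" "0 \<in> W" using zero_B sub_B by auto
  have c: "smooth_at LW vs_mfd (\<lambda>_. mu0) 0" by (rule smooth_at_vs_const) (use z in auto)
  note d = smooth_at_diff[OF good_LW F_smooth[OF z(1)] c]
  have "tmap LW vs_mfd (\<lambda>w. pr (F w - mu0)) 0 u = pr (tmap LW vs_mfd F 0 u)"
    using smooth_at_linear(2)[OF bounded_linear_pr good_LW d(1), of u] d(2)[of u] u tmap_const[OF good_LW, of 0 u vs_mfd mu0] z by simp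
  moreover have "tmap LW vs_mfd (\<lambda>w. pr (F w - mu0)) 0 = tmap LW vs_mfd (\<lambda>w. w) 0"
    by (rule tmap_cong[of LW B]) (use RO_B pr_F z in \<open>auto simp: rel_open_def\<close>)
  moreover have "tmap LW vs_mfd (\<lambda>w. w) 0 u = u"
    using smooth_at_vs_weaken(2)[OF smooth_at_id[OF good_LW, of 0]] tmap_id[OF good_LW, of 0 u] z u by simp
  moreover have "tmap LW vs_mfd F 0 u \<in> W"
    unfolding tmap_F[OF z(1) u] sec_0 coAd_one by (simp add: W_def)
  ultimately show ?thesis using pr_W(1) by simp
qed

lemma openin_OM: "openin (mtop OM) X \<longleftrightarrow> X \<subseteq> Orb \<and> openin (mtop M) {g \<in> carrier G. f g \<in> X}"
proof -
  have "istopology (\<lambda>X. X \<subseteq> Orb \<and> openin (mtop M) {g \<in> carrier G. f g \<in> X})"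
    unfolding istopology_def
  proof (intro conjI allI impI)
    fix X Y assume "X \<subseteq> Orb \<and> openin (mtop M) {g \<in> carrier G. f g \<in> X}" "Y \<subseteq> Orb \<and> openin (mtop M) {g \<in> carrier G. f g \<in> Y}"
    moreover have "{g \<in> carrier G. f g \<in> X \<inter> Y} = {g \<in> carrier G. f g \<in> X} \<inter> {g \<in> carrier G. f g \<in> Y}" by auto
    ultimately show "X \<inter> Y \<subseteq> Orb" "openin (mtop M) {g \<in> carrier G. f g \<in> X \<inter> Y}" by auto
  next
    fix \<K> assume K: "\<forall>K\<in>\<K>. K \<subseteq> Orb \<and> openin (mtop M) {g \<in> carrier G. f g \<in> K}"
    then show "\<Union> \<K> \<subseteq> Orb" by blast
    have "{g \<in> carrier G. f g \<in> \<Union> \<K>} = (\<Union>K\<in>\<K>. {g \<in> carrier G. f g \<in> K})" by auto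
    then show "openin (mtop M) {g \<in> carrier G. f g \<in> \<Union> \<K>}" using K by auto
  qed
  then show ?thesis by (simp add: OM_def topology_inverse')
qed

lemma openin_carrier: "openin (mtop M) (carrier G)"
  using openin_topspace[of "mtop M"] by simp

lemma pts_OM [simp]: "pts OM = Orb"
proof -
  have "{g \<in> carrier G. f g \<in> Orb} = carrier G" using f_carrier by auto
  then have "openin (mtop OM) Orb" using openin_carrier by (simp add: openin_OM)
  moreover have "pts OM \<subseteq> Orb" using openin_OM[of "pts OM"] openin_topspace by blast
  ultimately show ?thesis using openin_subset by blast
qed

lemma continuous_translate:
  assumes k: "k \<in> carrier G" and V: "openin (mtop M) V"
  shows "openin (mtop M) {g \<in> carrier G. k \<otimes> g \<in> V}" "openin (mtop M) {g \<in> carrier G. g \<otimes> k \<in> V}"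
proof -
  have "smooth_map M M (\<lambda>g. k \<otimes> g)" "smooth_map M M (\<lambda>g. g \<otimes> k)"
    unfolding smooth_map_iff[OF good_M good_M] using k by (auto intro!: smooth_group)
  then show "openin (mtop M) {g \<in> carrier G. k \<otimes> g \<in> V}" "openin (mtop M) {g \<in> carrier G. g \<otimes> k \<in> V}"
    using openin_continuous_map_preimage[OF _ V, of "mtop M"] by (auto simp: smooth_map_def)
qed

lemma continuous_f: "continuous_map (mtop M) (mtop OM) f"
  unfolding continuous_map_def using f_carrier by (auto simp: openin_OM)

lemma f_eq_iff:
  assumes "g \<in> carrier G" "h \<in> carrier G"
  shows "f g = f h \<longleftrightarrow> f (g \<otimes> inv h) = mu0"
  using assms coAd_mult[of g "inv h" mu0] by (metis coAd_inv inv_closed)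

text \<open>The saturation of an open set is the union of its left translates by the stabiliser of
  \<open>mu0\<close>.\<close>

lemma open_f: "open_map (mtop M) (mtop OM) f"
  unfolding open_map_def openin_OM
proof (intro allI impI conjI)
  fix V assume V: "openin (mtop M) V"
  have Vc: "V \<subseteq> carrier G" using openin_subset[OF V] by simp
  then show "f ` V \<subseteq> Orb" using f_carrier by blast
  have "{g \<in> carrier G. f g \<in> f ` V} = (\<Union>s\<in>{s \<in> carrier G. f s = mu0}. {g \<in> carrier G. inv s \<otimes> g \<in> V})"
  proof (intro equalityI subsetI)
    fix g assume "g \<in> {g \<in> carrier G. f g \<in> f ` V}"
    then obtain v where v: "g \<in> carrier G" "v \<in> V" "f g = f v" by auto
    then have vc: "v \<in> carrier G" using Vc by auto
    have "inv (g \<otimes> inv v) \<otimes> g = v" using v(1) vc by (simp add: inv_mult_group m_assoc)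
    then show "g \<in> (\<Union>s\<in>{s \<in> carrier G. f s = mu0}. {g \<in> carrier G. inv s \<otimes> g \<in> V})"
      using v vc f_eq_iff by (intro UN_I[of "g \<otimes> inv v"]) auto
  next
    fix g assume "g \<in> (\<Union>s\<in>{s \<in> carrier G. f s = mu0}. {g \<in> carrier G. inv s \<otimes> g \<in> V})"
    then obtain s where s: "s \<in> carrier G" "f s = mu0" "g \<in> carrier G" "inv s \<otimes> g \<in> V" by auto
    have "f (inv s \<otimes> g) = f g" using coAd_mult[of "inv s" g mu0] coAd_inv(1)[of s mu0] s by simp
    then show "g \<in> {g \<in> carrier G. f g \<in> f ` V}" using s by (auto intro!: image_eqI[of _ _ "inv s \<otimes> g"])
  qed
  also have "openin (mtop M) \<dots>" using continuous_translate(1)[OF _ V] by auto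
  finally show "openin (mtop M) {g \<in> carrier G. f g \<in> f ` V}" .
qed

lemma continuous_incl: "continuous_map (mtop OM) euclidean (\<lambda>\<alpha>. \<alpha>)"
proof -
  have "smooth_map M vs_mfd f" unfolding smooth_map_iff[OF good_M good_vs_dual] using smooth_orbit_map by simp
  then have "continuous_map (mtop M) euclidean f" by (simp add: smooth_map_def)
  then have "openin (mtop M) {g \<in> carrier G. f g \<in> V}" if "open V" for V
    using openin_continuous_map_preimage[of "mtop M" euclidean f V] that by simp
  moreover have "{g \<in> carrier G. f g \<in> {x \<in> Orb. x \<in> V}} = {g \<in> carrier G. f g \<in> V}" for V using f_carrier by auto
  ultimately show ?thesis unfolding continuous_map_def by (auto simp: openin_OM)
qed

lemma cdom_eq: "\<alpha> \<in> Orb \<Longrightarrow> cdom OM \<alpha> = f ` ((\<lambda>h. h \<otimes> rep \<alpha>) ` U0)"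
proof -
  assume \<alpha>: "\<alpha> \<in> Orb"
  have "U0 \<subseteq> carrier G" using openin_subset[OF U0(1)] by simp
  then have "f (h \<otimes> rep \<alpha>) = coAd G (rep \<alpha>) (f h)" if "h \<in> U0" for h using that rep[OF \<alpha>] by (auto simp: coAd_mult)
  moreover have "F ` B = f ` U0" unfolding U0(3) F_def sec_def ..
  ultimately show ?thesis by (auto simp: image_image)
qed

text \<open>The domain is the image under the open map \<open>f\<close> of a right translate of
  \<open>U0\<close>, and the inverse of the chart factors through the section into the group; this
  gives openness and continuity for the quotient topology.\<close>

lemma OM_chart:
  assumes \<alpha>: "\<alpha> \<in> Orb"
  shows "openin (mtop OM) (cdom OM \<alpha>)" "\<alpha> \<in> cdom OM \<alpha>" "cmap OM \<alpha> \<alpha> = 0" "cmap OM \<alpha> ` cdom OM \<alpha> = B"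
    "w \<in> B \<Longrightarrow> cmap OM \<alpha> (coAd G (rep \<alpha>) (F w)) = w" "w \<in> B \<Longrightarrow> cinv OM \<alpha> w = coAd G (rep \<alpha>) (F w)"
    "homeomorphic_map (subtopology (mtop OM) (cdom OM \<alpha>)) (top_of_set B) (cmap OM \<alpha>)"
proof -
  note r = rep[OF \<alpha>]
  have "{g \<in> carrier G. g \<otimes> inv (rep \<alpha>) \<in> U0} = (\<lambda>h. h \<otimes> rep \<alpha>) ` U0"
  proof (intro equalityI subsetI)
    fix g assume g: "g \<in> {g \<in> carrier G. g \<otimes> inv (rep \<alpha>) \<in> U0}"
    then have "g = (g \<otimes> inv (rep \<alpha>)) \<otimes> rep \<alpha>" using r by (simp add: m_assoc)
    then show "g \<in> (\<lambda>h. h \<otimes> rep \<alpha>) ` U0" using g by blast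
  next
    fix g assume "g \<in> (\<lambda>h. h \<otimes> rep \<alpha>) ` U0"
    then obtain h where h: "h \<in> U0" "g = h \<otimes> rep \<alpha>" by blast
    moreover have "h \<in> carrier G" using h(1) openin_subset[OF U0(1)] by auto
    ultimately show "g \<in> {g \<in> carrier G. g \<otimes> inv (rep \<alpha>) \<in> U0}" using r by (simp add: m_assoc)
  qed
  then have "openin (mtop M) ((\<lambda>h. h \<otimes> rep \<alpha>) ` U0)" using continuous_translate(2)[OF _ U0(1), of "inv (rep \<alpha>)"] r by simp
  then show op: "openin (mtop OM) (cdom OM \<alpha>)" using open_f unfolding cdom_eq[OF \<alpha>] open_map_def by blast
  have F0: "coAd G (rep \<alpha>) (F 0) = \<alpha>" using r by (simp add: F_0)
  have "coAd G (rep \<alpha>) (F 0) \<in> cdom OM \<alpha>" using zero_B unfolding OM_simps by blast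
  then show "\<alpha> \<in> cdom OM \<alpha>" unfolding F0 .
  show cw: "cmap OM \<alpha> (coAd G (rep \<alpha>) (F w)) = w" if "w \<in> B" for w using r pr_F[OF that] by (simp add: coAd_inv)
  from cw[OF zero_B] show "cmap OM \<alpha> \<alpha> = 0" unfolding F0 .
  show img: "cmap OM \<alpha> ` cdom OM \<alpha> = B"
  proof -
    have "cmap OM \<alpha> ` cdom OM \<alpha> = (\<lambda>w. cmap OM \<alpha> (coAd G (rep \<alpha>) (F w))) ` B" by (simp only: OM_simps(2) image_image)
    also have "\<dots> = (\<lambda>w. w) ` B" by (rule image_cong[OF refl cw])
    finally show ?thesis by simp
  qed
  have inj: "inj_on (cmap OM \<alpha>) (cdom OM \<alpha>)"
    by (rule inj_on_inverseI[where g="\<lambda>w. coAd G (rep \<alpha>) (F w)"]) (use cw in \<open>auto simp del: OM_simps(3)\<close>)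
  show ci: "cinv OM \<alpha> w = coAd G (rep \<alpha>) (F w)" if "w \<in> B" for w
    unfolding cinv_def by (rule inv_into_f_eq[OF inj _ cw[OF that]]) (use that in auto)
  have "homeomorphic_maps (subtopology (mtop OM) (cdom OM \<alpha>)) (top_of_set B) (cmap OM \<alpha>) (\<lambda>w. coAd G (rep \<alpha>) (F w))"
    unfolding homeomorphic_maps_def
  proof (intro conjI ballI)
    have "continuous_on UNIV (\<lambda>\<beta>. pr (coAd G (inv (rep \<alpha>)) \<beta> - mu0))"
      using r by (intro bounded_linear.continuous_on[OF bounded_linear_pr] continuous_intros linear_continuous_on framed_linear_bounded[OF framed_UNIV_dual linear_coAd]) simp
    then have "continuous_map euclidean euclidean (\<lambda>\<beta>. pr (coAd G (inv (rep \<alpha>)) \<beta> - mu0))" by simp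
    from continuous_map_compose[OF continuous_incl this]
    have "continuous_map (mtop OM) euclidean (cmap OM \<alpha>)" by (simp add: o_def OM_def)
    then show "continuous_map (subtopology (mtop OM) (cdom OM \<alpha>)) (top_of_set B) (cmap OM \<alpha>)"
      using img by (intro continuous_map_into_subtopology continuous_map_from_subtopology) auto
    have "smooth_at LW M (\<lambda>w. sec w \<otimes> rep \<alpha>) w" if "w \<in> B" for w
      using that r sub_B by (intro smooth_group sec_smooth good_LW) auto
    moreover have "openin (mtop LW) B" using RO_B by (simp add: rel_open_def)
    ultimately have "continuous_map (subtopology (mtop LW) B) (mtop M) (\<lambda>w. sec w \<otimes> rep \<alpha>)"
      by (intro smooth_at_continuous_map good_LW good_M)
    moreover have "subtopology (mtop LW) B = top_of_set B" using sub_B by (simp add: subtopology_subtopology Int_absorb1 subsetI)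
    ultimately have "continuous_map (top_of_set B) (mtop OM) (f \<circ> (\<lambda>w. sec w \<otimes> rep \<alpha>))"
      using continuous_map_compose[OF _ continuous_f] by simp
    then have "continuous_map (top_of_set B) (mtop OM) (\<lambda>w. coAd G (rep \<alpha>) (F w))"
      by (rule continuous_map_eq) (use r sec_carrier in \<open>auto simp: F_def coAd_mult\<close>)
    then show "continuous_map (top_of_set B) (subtopology (mtop OM) (cdom OM \<alpha>)) (\<lambda>w. coAd G (rep \<alpha>) (F w))"
      by (intro continuous_map_into_subtopology) auto
    show "coAd G (rep \<alpha>) (F (cmap OM \<alpha> \<beta>)) = \<beta>" if \<beta>: "\<beta> \<in> topspace (subtopology (mtop OM) (cdom OM \<alpha>))" for \<beta>
    proof -
      obtain w where "w \<in> B" "\<beta> = coAd G (rep \<alpha>) (F w)" using \<beta> by auto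
      then show ?thesis using cw[of w] by (simp del: OM_simps(3))
    qed
    show "cmap OM \<alpha> (coAd G (rep \<alpha>) (F w)) = w" if "w \<in> topspace (top_of_set B)" for w using that cw by simp
  qed
  then show "homeomorphic_map (subtopology (mtop OM) (cdom OM \<alpha>)) (top_of_set B) (cmap OM \<alpha>)"
    unfolding homeomorphic_map_maps by blast
qed

lemma bounded_linear_coAd: "g \<in> carrier G \<Longrightarrow> bounded_linear (coAd G g)"
  by (rule framed_linear_bounded[OF framed_UNIV_dual linear_coAd])

lemma smooth_on_F: "smooth_on W B F"
  using smooth_on_of_smooth_at[OF RO_B, of UNIV F] F_smooth by (simp add: vs_mfd_eq)

text \<open>The Hausdorff property is inherited through the continuous injection into the dual,
  second countability through the open orbit map.\<close>

lemma good_OM [simp]: "good OM"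
  unfolding good_def smooth_manifold_def
proof (intro conjI ballI)
  show "Hausdorff_space (mtop OM)"
    by (rule Hausdorff_space_injective_preimage[OF _ continuous_incl]) auto
  show "second_countable (mtop OM)"
    by (rule second_countable_open_map_image[OF continuous_f open_f])
      (use good_M in \<open>auto simp: good_def smooth_manifold_def coad_orbit_def\<close>)
  show "\<exists>B. finite B \<and> model OM = span B" using framed_span[OF framed_W] by simp
  show "framed (model OM)" using framed_W by simp
  fix \<alpha> assume "\<alpha> \<in> pts OM"
  then have \<alpha>: "\<alpha> \<in> Orb" by simp
  note c = OM_chart[OF \<alpha>]
  show "\<alpha> \<in> cdom OM \<alpha>" "openin (mtop OM) (cdom OM \<alpha>)" by (fact c)+
  show "openin (top_of_set (model OM)) (cmap OM \<alpha> ` cdom OM \<alpha>)" unfolding c(4) using RO_B by (simp add: rel_open_def)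
  show "homeomorphic_map (subtopology (mtop OM) (cdom OM \<alpha>)) (top_of_set (cmap OM \<alpha> ` cdom OM \<alpha>)) (cmap OM \<alpha>)"
    unfolding c(4) by (fact c(7))
  fix \<beta> assume "\<beta> \<in> pts OM"
  then have \<beta>: "\<beta> \<in> Orb" by simp
  have sub: "cmap OM \<alpha> ` (cdom OM \<alpha> \<inter> cdom OM \<beta>) \<subseteq> B" using c(4) by blast
  have "smooth_on W B (\<lambda>w. pr (coAd G (inv (rep \<beta>)) (coAd G (rep \<alpha>) (F w)) - mu0))"
    using rep[OF \<alpha>] rep[OF \<beta>]
    by (intro smooth_on_linear_comp[OF RO_B bounded_linear_pr] smooth_on_diff smooth_on_const RO_B
        smooth_on_linear_comp[OF RO_B bounded_linear_coAd] smooth_on_F) auto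
  then have "smooth_on W B (cmap OM \<beta> \<circ> cinv OM \<alpha>)"
    by (rule iffD1[OF smooth_on_cong[OF RO_B], rotated]) (simp add: c(6))
  then show "smooth_on (model OM) (cmap OM \<alpha> ` (cdom OM \<alpha> \<inter> cdom OM \<beta>)) (cmap OM \<beta> \<circ> cinv OM \<alpha>)"
    using smooth_on_subset[OF _ sub] by simp
qed

text \<open>A chart vector \<open>u\<close> at \<alpha> stands for the covector
  \<open>coAd G (rep \<alpha>) u\<close>, because the chart undoes the translation by
  \<open>rep \<alpha>\<close>. This dictionary carries the computations on the orbit.\<close>

lemma smooth_incl:
  assumes \<alpha>: "\<alpha> \<in> Orb" shows "smooth_at OM vs_mfd (\<lambda>\<alpha>. \<alpha>) \<alpha>"
    and "u \<in> W \<Longrightarrow> tmap OM vs_mfd (\<lambda>\<alpha>. \<alpha>) \<alpha> u = coAd G (rep \<alpha>) u"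
proof -
  note c = OM_chart[OF \<alpha>] and r = rep[OF \<alpha>]
  have "smooth_on W B (\<lambda>w. coAd G (rep \<alpha>) (F w))" by (rule smooth_on_linear_comp[OF RO_B bounded_linear_coAd[OF r(1)] smooth_on_F])
  then have "smooth_on W B (\<lambda>w. cinv OM \<alpha> w)" by (rule iffD1[OF smooth_on_cong[OF RO_B], rotated]) (simp add: c(6))
  then show "smooth_at OM vs_mfd (\<lambda>\<alpha>. \<alpha>) \<alpha>"
    unfolding smooth_at_def smooth_in_def using \<alpha> c(1,2,4) by (intro conjI exI[of _ "cdom OM \<alpha>"]) auto
  assume u: "u \<in> W"
  have B0: "0 \<in> B" by (rule zero_B)
  have "((\<lambda>w. coAd G (rep \<alpha>) (F w)) has_derivative (\<lambda>u. coAd G (rep \<alpha>) (fd W F 0 u))) (at 0 within W)"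
    by (rule bounded_linear.has_derivative[OF bounded_linear_coAd[OF r(1)] smooth_onD[OF smooth_on_F B0]])
  then have "((\<lambda>w. cinv OM \<alpha> w) has_derivative (\<lambda>u. coAd G (rep \<alpha>) (fd W F 0 u))) (at 0 within W)"
    unfolding at_within_rel_open[OF RO_B B0] by (rule has_derivative_transform[OF B0, rotated]) (simp add: c(6))
  then have "tmap OM vs_mfd (\<lambda>\<alpha>. \<alpha>) \<alpha> u = coAd G (rep \<alpha>) (fd W F 0 u)"
    using tmap_vs_eqI[OF good_OM, of \<alpha> "\<lambda>\<alpha>. \<alpha>" _ u] \<alpha> u c(3) by simp
  moreover have "fd W F 0 u = u" using tmap_F_0[OF u] tmap_lin_mfd[OF sub_B[OF B0] subspace_W, of UNIV F] by (simp add: vs_mfd_eq)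
  ultimately show "tmap OM vs_mfd (\<lambda>\<alpha>. \<alpha>) \<alpha> u = coAd G (rep \<alpha>) u" by simp
qed

lemma inft_coAd: "g \<in> carrier G \<Longrightarrow> coAd G g (inft \<mu> \<eta>) = inft (coAd G g \<mu>) (Ad G g \<eta>)"
  by (simp add: inft_def coAd_coad linear_neg[OF linear_coAd])

text \<open>Translation by \<open>rep \<alpha>\<close> intertwines the generators at
  \<open>mu0\<close> and at \<alpha>, their arguments being moved by the bijection
  \<open>Ad\<close>.\<close>

lemma tangent_orbit:
  assumes \<alpha>: "\<alpha> \<in> Orb" shows "tmap OM vs_mfd (\<lambda>\<alpha>. \<alpha>) \<alpha> ` W = range (inft \<alpha>)"
proof -
  note r = rep[OF \<alpha>]
  have "tmap OM vs_mfd (\<lambda>\<alpha>. \<alpha>) \<alpha> ` W = coAd G (rep \<alpha>) ` W" using smooth_incl(2)[OF \<alpha>] by (intro image_cong) auto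
  also have "\<dots> = range (\<lambda>\<eta>. inft \<alpha> (Ad G (rep \<alpha>) \<eta>))" unfolding W_def image_image inft_coAd[OF r(1)] r(2) ..
  also have "\<dots> = range (inft \<alpha>)" using Ad_inv(2)[OF r(1)] by (auto simp: image_iff) (metis)
  finally show ?thesis .
qed

text \<open>Charts of the orbit are restrictions of affine maps, so smoothness into the dual passes
  to the orbit once the values near \<open>p\<close> stay in one chart domain. Since the orbit
  topology may be finer, that neighbourhood is supplied by hypothesis.\<close>

lemma smooth_at_OM:
  assumes N: "good N" and k: "smooth_at N vs_mfd k p" and V: "openin (mtop N) V" "p \<in> V" "\<And>x. x \<in> V \<Longrightarrow> k x \<in> cdom OM (k p)"
    and kp: "k p \<in> Orb"
  shows "smooth_at N OM k p" and "v \<in> model N \<Longrightarrow> coAd G (rep (k p)) (tmap N OM k p v) = tmap N vs_mfd k p v"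
proof -
  note r = rep[OF kp]
  have p: "p \<in> pts N" using k by (rule smooth_atD)
  have c: "smooth_at N vs_mfd (\<lambda>_. mu0) p" by (rule smooth_at_vs_const[OF N p])
  have "smooth_at N vs_mfd (\<lambda>x. pr (coAd G (inv (rep (k p))) (k x) - mu0)) p"
    using r(1) by (intro smooth_at_linear(1)[OF bounded_linear_pr N] smooth_at_diff(1)[OF N] c smooth_at_linear(1)[OF bounded_linear_coAd N k]) auto
  then have si: "smooth_in N vs_mfd (\<lambda>x. pr (coAd G (inv (rep (k p))) (k x) - mu0)) p p (pr (coAd G (inv (rep (k p))) (k p) - mu0))"
    by (simp add: smooth_at_def)
  obtain U where U: "openin (mtop N) U" "p \<in> U" "U \<subseteq> cdom N p" "U \<subseteq> V"
    "smooth_on (model N) (cmap N p ` U) (\<lambda>y. pr (coAd G (inv (rep (k p))) (k (cinv N p y)) - mu0))"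
    by (rule smooth_inE[OF si V(1,2)]) (simp add: that)
  show s: "smooth_at N OM k p" unfolding smooth_at_def smooth_in_def
    using p kp U V(3) by (intro conjI exI[of _ U]) (auto simp: subset_iff simp del: OM_simps(2))
  assume v: "v \<in> model N"
  show "coAd G (rep (k p)) (tmap N OM k p v) = tmap N vs_mfd k p v"
    using smooth_at_compose(2)[OF N good_OM good_vs_dual s smooth_incl(1)[OF kp] v] smooth_incl(2)[OF kp tmap_mem[OF N good_OM s v, simplified]] by simp
qed

text \<open>Continuity of the orbit map into the quotient topology supplies the neighbourhood whose
  values stay in one chart domain.\<close>

lemma smooth_f_comp:
  assumes N: "good N" and h: "smooth_at N M h p"
  shows "smooth_at N OM (\<lambda>x. f (h x)) p"
    and "v \<in> model N \<Longrightarrow> coAd G (rep (f (h p))) (tmap N OM (\<lambda>x. f (h x)) p v) = inft (f (h p)) (Ad G (h p) (ld N h p v))"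
proof -
  have c: "h p \<in> carrier G" using smooth_atD(2)[OF h] by simp
  have fo: "f (h p) \<in> Orb" by (rule f_carrier[OF c])
  have s: "smooth_at N vs_mfd (\<lambda>x. f (h x)) p"
    by (rule smooth_at_compose(1)[OF N good_M good_vs_dual h smooth_orbit_map[OF c]])
  have o: "openin (mtop M) {g \<in> carrier G. f g \<in> cdom OM (f (h p))}" using OM_chart(1)[OF fo] by (simp add: openin_OM)
  obtain V where V: "openin (mtop N) V" "p \<in> V" "h ` V \<subseteq> {g \<in> carrier G. f g \<in> cdom OM (f (h p))}"
    by (rule smooth_at_continuous[OF N good_M h o]) (use c OM_chart(2)[OF fo] in auto)
  have V3: "f (h x) \<in> cdom OM (f (h p))" if "x \<in> V" for x using V(3) that by blast
  show "smooth_at N OM (\<lambda>x. f (h x)) p"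
    by (rule smooth_at_OM(1)[OF N s V(1,2) V3 fo])
  assume v: "v \<in> model N"
  show "coAd G (rep (f (h p))) (tmap N OM (\<lambda>x. f (h x)) p v) = inft (f (h p)) (Ad G (h p) (ld N h p v))"
    using smooth_at_OM(2)[OF N s V(1,2) V3 fo v] tmap_orbit_comp[OF N h v, of mu0] inft_coAd[OF c] by simp
qed

lemma coad_orbit_manifold_OM: "coad_orbit_manifold G mu0 OM"
  unfolding coad_orbit_manifold_def
proof (intro conjI)
  show "smooth_manifold OM" using good_OM by (rule goodD)
  show "pts OM = Orb" by simp
  show "surj_submersion M OM f"
    unfolding surj_submersion_def smooth_map_iff[OF good_M good_OM]
  proof (intro conjI ballI)
    show "f ` pts M = pts OM" by (simp add: coad_orbit_def)
    fix h assume "h \<in> pts M" then have h: "h \<in> carrier G" by simp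
    note id = smooth_group_id[OF h]
    show s: "smooth_at M OM f h" by (rule smooth_f_comp(1)[OF good_M id])
    note r = rep[OF f_carrier[OF h]]
    show "tmap M OM f h ` model M = model OM"
    proof (intro equalityI subsetI)
      show "x \<in> model OM" if "x \<in> tmap M OM f h ` model M" for x
        using that tmap_mem[OF good_M good_OM s] by auto
      fix u assume "u \<in> model OM"
      then have u: "u \<in> W" by simp
      have "tmap OM vs_mfd (\<lambda>\<alpha>. \<alpha>) (f h) u \<in> range (inft (f h))"
        using imageI[OF u] unfolding tangent_orbit[OF f_carrier[OF h], symmetric] .
      then obtain \<eta> where \<eta>: "coAd G (rep (f h)) u = inft (f h) \<eta>"
        unfolding smooth_incl(2)[OF f_carrier[OF h] u] by (rule rangeE)
      define v where "v = rt h (Ad G (inv h) \<eta>)"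
      have ldv: "ld M (\<lambda>x. x) h v = Ad G (inv h) \<eta>" using h by (simp add: ld_def tmap_id v_def il_rt)
      have "coAd G (rep (f h)) (tmap M OM f h v) = coAd G (rep (f h)) u"
        using smooth_f_comp(2)[OF good_M id, of v] h by (simp add: ldv Ad_inv \<eta>)
      then have "tmap M OM f h v = u" using coAd_inv(1)[OF r(1)] by metis
      then show "u \<in> tmap M OM f h ` model M" by auto
    qed
  qed
  show "immersion OM vs_mfd (\<lambda>\<alpha>. \<alpha>)"
    unfolding immersion_def smooth_map_iff[OF good_OM good_vs_dual]
  proof (intro conjI ballI)
    fix \<alpha> assume "\<alpha> \<in> pts OM" then have \<alpha>: "\<alpha> \<in> Orb" by simp
    show "smooth_at OM vs_mfd (\<lambda>\<alpha>. \<alpha>) \<alpha>" by (rule smooth_incl(1)[OF \<alpha>])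
    show "inj_on (tmap OM vs_mfd (\<lambda>\<alpha>. \<alpha>) \<alpha>) (model OM)"
      by (rule inj_on_inverseI[where g="coAd G (inv (rep \<alpha>))"]) (use smooth_incl(2)[OF \<alpha>] rep[OF \<alpha>] coAd_inv in auto)
  qed
qed


subsection \<open>The reduced symplectic form\<close>

abbreviation VV :: "('e dual \<times> 'e, 'e dual \<times> 'e) mfd" where "VV \<equiv> vs_mfd"

definition "R = prod_mfd OM VV"
text \<open>A tangent vector determines its generator only up to the stabiliser algebra; one is
  chosen, and by \<open>kks_cong\<close> the form does not see the choice.\<close>

definition "el \<alpha> u = (SOME \<eta>. inft \<alpha> \<eta> = coAd G (rep \<alpha>) u)"
definition rho :: "'e dual \<times> 'e dual \<times> 'e \<Rightarrow> 'e dual \<times> 'e dual \<times> 'e \<Rightarrow> 'e dual \<times> 'e dual \<times> 'e \<Rightarrow> real" where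
  "rho = (\<lambda>(\<alpha>, \<beta>, x) (u, l, \<zeta>) (u', l', \<zeta>'). blinfun_apply l' \<zeta> - blinfun_apply l \<zeta>' - blinfun_apply \<alpha> (br (el \<alpha> u) (el \<alpha> u')))"

lemma good_VV [simp]: "good VV"
  by (intro good_vs_mfd framed_UNIV_intros)

lemma good_R [simp]: "good R"
  unfolding R_def by (rule good_prod_mfd) simp_all

lemma R_simps [simp]: "model R = W \<times> UNIV" "pts R = Orb \<times> UNIV"
  by (simp_all add: R_def)

lemma el: "\<alpha> \<in> Orb \<Longrightarrow> u \<in> W \<Longrightarrow> inft \<alpha> (el \<alpha> u) = coAd G (rep \<alpha>) u"
proof -
  assume \<alpha>: "\<alpha> \<in> Orb" and u: "u \<in> W"
  have "tmap OM vs_mfd (\<lambda>\<alpha>. \<alpha>) \<alpha> u \<in> range (inft \<alpha>)" using imageI[OF u] unfolding tangent_orbit[OF \<alpha>, symmetric] .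
  then have "\<exists>\<eta>. inft \<alpha> \<eta> = coAd G (rep \<alpha>) u" unfolding smooth_incl(2)[OF \<alpha> u] by auto
  then show ?thesis unfolding el_def by (rule someI_ex)
qed

text \<open>The pairing of \<alpha> with \<open>br \<eta> x\<close> is minus
  \<open>inft \<alpha> \<eta>\<close> at \<open>x\<close>; antisymmetry of the bracket treats the
  second slot.\<close>

lemma kks_cong:
  assumes "inft \<alpha> \<eta> = inft \<alpha> \<eta>1" "inft \<alpha> \<eta>' = inft \<alpha> \<eta>1'"
  shows "blinfun_apply \<alpha> (br \<eta> \<eta>') = blinfun_apply \<alpha> (br \<eta>1 \<eta>1')"
proof -
  have a: "blinfun_apply \<alpha> (br \<eta> x) = blinfun_apply \<alpha> (br \<eta>1 x)" "blinfun_apply \<alpha> (br \<eta>' x) = blinfun_apply \<alpha> (br \<eta>1' x)" for x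
    using assms unfolding inft_def by (metis coad_apply neg_equal_iff_equal)+
  have "blinfun_apply \<alpha> (br \<eta>1 \<eta>') = - blinfun_apply \<alpha> (br \<eta>' \<eta>1)" "blinfun_apply \<alpha> (br \<eta>1 \<eta>1') = - blinfun_apply \<alpha> (br \<eta>1' \<eta>1)"
    using br_antisym[of \<eta>1] by (metis blinfun.minus_right)+
  then show ?thesis using a by simp
qed

lemma rho_eq:
  assumes "\<alpha> \<in> Orb" "u \<in> W" "u' \<in> W" "coAd G (rep \<alpha>) u = inft \<alpha> \<eta>" "coAd G (rep \<alpha>) u' = inft \<alpha> \<eta>'"
  shows "rho (\<alpha>, \<beta>, x) (u, l, \<zeta>) (u', l', \<zeta>') = blinfun_apply l' \<zeta> - blinfun_apply l \<zeta>' - blinfun_apply \<alpha> (br \<eta> \<eta>')"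
  using kks_cong[of \<alpha> "el \<alpha> u" \<eta> "el \<alpha> u'" \<eta>'] el assms by (simp add: rho_def)

text \<open>The Maurer-Cartan form pulled back along the section inherits the structure equation:
  second derivatives of \<sigma> enter symmetrically and cancel.\<close>

lemma sec_ld_smooth:
  assumes u: "u \<in> W" shows "smooth_on W B (\<lambda>w. ld LW sec w u)"
    and "w \<in> B \<Longrightarrow> v \<in> W \<Longrightarrow> fd W (\<lambda>w. ld LW sec w v) w u - fd W (\<lambda>w. ld LW sec w u) w v = - br (ld LW sec w u) (ld LW sec w v)"
proof -
  have sm\<sigma>: "smooth_on W B \<sigma>" using smooth_\<sigma> by (simp add: W_def)
  have s\<sigma>: "smooth_at LW vs \<sigma> w" if "w \<in> B" for w
    unfolding vs_mfd_eq by (rule smooth_at_lin_mfd[OF sm\<sigma> RO_B that]) simp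
  have tl: "tmap LW vs_mfd k w v = fd W k w v" if "w \<in> B" for k :: "'e dual \<Rightarrow> 'e" and w v
    by (simp add: vs_mfd_eq tmap_lin_mfd[OF sub_B[OF that] subspace_W])
  have L: "ld LW sec w v = mc \<one> (\<sigma> w) (fd W \<sigma> w v)" if "w \<in> B" "v \<in> W" for w v
    using ld_compose[OF good_LW good_vs_fin_dim s\<sigma>[OF that(1)] smooth_at_vs_M_cinv[OF one_closed \<sigma>_dom[OF that(1)]], of v] that
    by (simp add: sec_def[abs_def] mc_def tl)
  have S1: "open (cmap M \<one> ` cdom M \<one>)" using good_chart(3)[of M \<one>] by simp
  have smc: "smooth_at vs vs (\<lambda>x. mc \<one> x b) (\<sigma> w)" if "w \<in> B" for b w
    by (rule smooth_at_vs_vs[OF smooth_mc[OF one_closed] S1 \<sigma>_dom[OF that]])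
  note mc\<sigma> = smooth_at_compose[OF good_LW good_vs_fin_dim good_vs_fin_dim s\<sigma> smc]
  have sD: "smooth_at LW vs (\<lambda>w. fd W \<sigma> w v) w" if "w \<in> B" "v \<in> W" for w v
    unfolding vs_mfd_eq by (rule smooth_at_lin_mfd[OF smooth_on_fd[OF sm\<sigma> that(2)] RO_B that(1)]) simp
  have Bo: "openin (mtop LW) B" using RO_B by (simp add: rel_open_def)
  have lin: "linear (mc \<one> (\<sigma> w))" if "w \<in> B" for w by (rule linear_mc[OF one_closed \<sigma>_dom[OF that]])
  have fam: "smooth_at LW vs (\<lambda>w. mc \<one> (\<sigma> w) (fd W \<sigma> w v)) w" 
    "x \<in> W \<Longrightarrow> tmap LW vs (\<lambda>w. mc \<one> (\<sigma> w) (fd W \<sigma> w v)) w x = fd UNIV (\<lambda>y. mc \<one> y (fd W \<sigma> w v)) (\<sigma> w) (fd W \<sigma> w x) + mc \<one> (\<sigma> w) (fd W (\<lambda>w. fd W \<sigma> w v) w x)"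
    if w: "w \<in> B" and v: "v \<in> W" for w v x
  proof -
    have h: "smooth_at LW vs (\<lambda>w. mc \<one> (\<sigma> w) b) w" for b by (rule mc\<sigma>(1)[OF w w])
    show "smooth_at LW vs (\<lambda>w. mc \<one> (\<sigma> w) (fd W \<sigma> w v)) w"
      by (rule smooth_at_linear_family(1)[OF framed_UNIV_fin_dim good_LW Bo w lin h sD[OF w v]])
    assume x: "x \<in> W"
    have "tmap LW vs (\<lambda>w. mc \<one> (\<sigma> w) (fd W \<sigma> w v)) w x = tmap LW vs (\<lambda>w'. mc \<one> (\<sigma> w') (fd W \<sigma> w v)) w x + mc \<one> (\<sigma> w) (tmap LW vs (\<lambda>w. fd W \<sigma> w v) w x)"
      by (rule smooth_at_linear_family(2)[OF framed_UNIV_fin_dim good_LW Bo w lin h sD[OF w v]]) (use x in simp_all)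
    then show "tmap LW vs (\<lambda>w. mc \<one> (\<sigma> w) (fd W \<sigma> w v)) w x = fd UNIV (\<lambda>y. mc \<one> y (fd W \<sigma> w v)) (\<sigma> w) (fd W \<sigma> w x) + mc \<one> (\<sigma> w) (fd W (\<lambda>w. fd W \<sigma> w v) w x)"
      using mc\<sigma>(2)[OF w w, of x "fd W \<sigma> w v"] x by (simp add: tl[OF w] tmap_vs_vs)
  qed
  have "smooth_on W B (\<lambda>w. mc \<one> (\<sigma> w) (fd W \<sigma> w u))"
    by (rule smooth_on_of_smooth_at[OF RO_B, of UNIV]) (use fam(1)[OF _ u] in \<open>simp add: vs_mfd_eq\<close>)
  then show "smooth_on W B (\<lambda>w. ld LW sec w u)" by (rule iffD1[OF smooth_on_cong[OF RO_B], rotated]) (simp add: L u)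
  assume w: "w \<in> B" and v: "v \<in> W"
  have d: "fd W (\<lambda>w. ld LW sec w v) w u = fd UNIV (\<lambda>y. mc \<one> y (fd W \<sigma> w v)) (\<sigma> w) (fd W \<sigma> w u) + mc \<one> (\<sigma> w) (fd W (\<lambda>w. fd W \<sigma> w v) w u)"
    if "u \<in> W" "v \<in> W" for u v
  proof -
    have "fd W (\<lambda>w. ld LW sec w v) w = fd W (\<lambda>w. mc \<one> (\<sigma> w) (fd W \<sigma> w v)) w"
      by (rule fd_cong(1)[OF RO_B w]) (rule L[OF _ that(2)])
    then show ?thesis using fam(2)[OF w that(2,1)] by (simp add: tl[OF w])
  qed
  show "fd W (\<lambda>w. ld LW sec w v) w u - fd W (\<lambda>w. ld LW sec w u) w v = - br (ld LW sec w u) (ld LW sec w v)"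
    unfolding d[OF u v] d[OF v u] L[OF w u] L[OF w v]
    using maurer_cartan[OF one_closed \<sigma>_dom[OF w], of "fd W \<sigma> w v" "fd W \<sigma> w u"] second_derivative_symmetric[OF sm\<sigma> RO_B w u v] by simp
qed

text \<open>Local potential of the reduced form: \<open>mu0\<close> paired with the pulled-back
  Maurer-Cartan form, minus the canonical one-form on the product of the dual and the Lie
  algebra.\<close>

definition rtheta :: "'e dual \<times> 'e dual \<times> 'e \<Rightarrow> 'e dual \<times> 'e dual \<times> 'e \<Rightarrow> real" where
  "rtheta y u = blinfun_apply mu0 (ld LW sec (fst y) (fst u)) - blinfun_apply (fst (snd y)) (snd (snd u))"

lemma RO_BV: "rel_open (W \<times> UNIV) (B \<times> (UNIV :: ('e dual \<times> 'e) set))"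
  by (intro rel_open_Times RO_B) simp

lemma rtheta_smooth:
  assumes u: "u \<in> W \<times> UNIV"
  shows "smooth_on (W \<times> UNIV) (B \<times> UNIV) (\<lambda>y. rtheta y u)"
    and "y \<in> B \<times> UNIV \<Longrightarrow> v \<in> W \<times> UNIV \<Longrightarrow> fd (W \<times> UNIV) (\<lambda>y. rtheta y u) y v =
      blinfun_apply mu0 (fd W (\<lambda>w. ld LW sec w (fst u)) (fst y) (fst v)) - blinfun_apply (fst (snd v)) (snd (snd u))"
proof -
  note RO = RO_BV
  have fu: "fst u \<in> W" using u by auto
  note bl = bounded_linear_compose[OF bounded_linear_fst bounded_linear_snd]
  note sL = sec_ld_smooth(1)[OF fu]
  have 1: "smooth_on (W \<times> UNIV) (B \<times> UNIV) (\<lambda>y::'e dual \<times> 'e dual \<times> 'e. ld LW sec (fst y) (fst u))"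
    by (rule smooth_on_compose[OF sL smooth_on_bounded_linear[OF RO bounded_linear_fst] RO RO_B framed_W]) auto
  show "smooth_on (W \<times> UNIV) (B \<times> UNIV) (\<lambda>y. rtheta y u)"
    unfolding rtheta_def
    by (intro smooth_on_diff RO smooth_on_linear_comp[OF RO blinfun.bounded_linear_right 1]
        smooth_on_linear_comp[OF RO blinfun.bounded_linear_left] smooth_on_bounded_linear[OF RO bl])
  assume y: "y \<in> B \<times> UNIV" and v: "v \<in> W \<times> UNIV"
  have d1: "((\<lambda>w. ld LW sec w (fst u)) has_derivative fd W (\<lambda>w. ld LW sec w (fst u)) (fst y)) (at (fst y) within fst ` (W \<times> (UNIV :: ('e dual \<times> 'e) set)))"
    using smooth_onD[OF sL, of "fst y"] y by auto
  have "((\<lambda>y. ld LW sec (fst y) (fst u)) has_derivative (\<lambda>v. fd W (\<lambda>w. ld LW sec w (fst u)) (fst y) (fst v))) (at y within W \<times> UNIV)"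
    by (rule has_derivative_in_compose[OF bounded_linear_imp_has_derivative[OF bounded_linear_fst] d1])
  from has_derivative_diff[OF bounded_linear.has_derivative[OF blinfun.bounded_linear_right this]
      bounded_linear.has_derivative[OF blinfun.bounded_linear_left bounded_linear_imp_has_derivative[OF bl]]]
  have "((\<lambda>y. rtheta y u) has_derivative (\<lambda>v. blinfun_apply mu0 (fd W (\<lambda>w. ld LW sec w (fst u)) (fst y) (fst v)) - blinfun_apply (fst (snd v)) (snd (snd u)))) (at y within W \<times> UNIV)"
    unfolding rtheta_def .
  from fd_eq[OF this RO y v] show "fd (W \<times> UNIV) (\<lambda>y. rtheta y u) y v =
      blinfun_apply mu0 (fd W (\<lambda>w. ld LW sec w (fst u)) (fst y) (fst v)) - blinfun_apply (fst (snd v)) (snd (snd u))" .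
qed

lemma img_R: "p \<in> pts R \<Longrightarrow> cmap R p ` cdom R p = B \<times> UNIV"
proof -
  assume p: "p \<in> pts R"
  have "cmap R p ` cdom R p = (cmap OM (fst p) ` cdom OM (fst p)) \<times> (cmap VV (snd p) ` cdom VV (snd p))"
    unfolding R_def prod_mfd_simps(3) by (rule cmap_prod_image)
  moreover have "cmap OM (fst p) ` cdom OM (fst p) = B" by (rule OM_chart(4)) (use p in auto)
  moreover have "cmap VV (snd p) ` cdom VV (snd p) = UNIV" by auto
  ultimately show ?thesis by (simp only:)
qed

text \<open>Charts at different points are translates of one another, and invariance of the orbit
  form under the coadjoint action moves everything back to \<open>mu0\<close>. The resulting
  expression does not mention \<open>p\<close>, so a single potential serves all charts.\<close>

lemma form_in_chart_R:
  assumes p: "p \<in> pts R" and y: "y \<in> B \<times> UNIV" and u: "u \<in> W \<times> UNIV" and v: "v \<in> W \<times> UNIV"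
  shows "form_in_chart R rho p y u v = blinfun_apply (fst (snd v)) (snd (snd u)) - blinfun_apply (fst (snd u)) (snd (snd v))
    - blinfun_apply mu0 (br (ld LW sec (fst y) (fst u)) (ld LW sec (fst y) (fst v)))"
proof -
  obtain w l z where y': "y = (w, l, z)" "w \<in> B" using y by (cases y) auto
  obtain \<alpha>0 m0 where p': "p = (\<alpha>0, m0)" "\<alpha>0 \<in> Orb" using p by (cases p) auto
  note c = OM_chart[OF p'(2)] and r = rep[OF p'(2)]
  let ?g = "rep \<alpha>0" and ?k = "sec w \<otimes> rep \<alpha>0"
  have k: "?k \<in> carrier G" using sec_carrier[OF y'(2)] r by simp
  have ci: "cinv R p y = (coAd G ?g (F w), l, z)"
  proof -
    have "cinv (prod_mfd OM VV) p y = (cinv OM (fst p) (fst y), cinv VV (snd p) (snd y))"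
      by (rule cinv_prod_mfd) (use p y img_R[OF p] in \<open>auto simp: R_def[symmetric]\<close>)
    then show ?thesis using c(6)[OF y'(2)] by (simp add: R_def y' p' del: OM_simps)
  qed
  define \<alpha> where "\<alpha> = coAd G ?g (F w)"
  have \<alpha>: "\<alpha> = f ?k" using sec_carrier[OF y'(2)] r by (simp add: \<alpha>_def F_def coAd_mult)
  then have \<alpha>O: "\<alpha> \<in> Orb" using f_carrier[OF k] by simp
  define D where "D = tmap LW OM (cinv OM \<alpha>0) w"
  have wimg: "w \<in> cmap OM \<alpha>0 ` cdom OM \<alpha>0" using c(4) y'(2) by (simp del: OM_simps)
  have tm: "tmap (lin_mfd (model R)) R (cinv R p) y x = (D (fst x), snd x)" if "x \<in> W \<times> UNIV" for x
  proof -
    have "tmap (lin_mfd (model OM \<times> model VV)) (prod_mfd OM VV) (cinv (prod_mfd OM VV) (\<alpha>0, m0)) (w, l, z) (fst x, snd x) =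
      (tmap (lin_mfd (model OM)) OM (cinv OM \<alpha>0) w (fst x), tmap (lin_mfd (model VV)) VV (cinv VV m0) (l, z) (snd x))"
      by (rule tmap_cinv_prod) (use p' that wimg in \<open>auto simp: framed_UNIV_intros simp del: OM_simps(2,3)\<close>)
    moreover have "tmap VV VV (cinv VV m0) (l, z) (snd x) = snd x"
      using tmap_id[OF good_VV, of "(l, z)" "snd x"] by (simp add: vs_mfd_def cinv_def inv_into_f_eq[of id] fun_eq_iff)
    ultimately show ?thesis by (simp add: R_def y' p' D_def vs_mfd_eq)
  qed
  have sci: "smooth_at LW OM (cinv OM \<alpha>0) w" using smooth_at_cinv[OF good_OM _ wimg] p' by simp
  have DW: "D x \<in> W" if "x \<in> W" for x using tmap_mem[OF good_LW good_OM sci] that by (simp add: D_def)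
  have el1: "coAd G (rep \<alpha>) (D x) = inft \<alpha> (Ad G ?k (ld LW sec w x))" if x: "x \<in> W" for x
  proof -
    have xm: "x \<in> model LW" using x by simp
    have civ: "cinv OM \<alpha>0 w = \<alpha>" using c(6)[OF y'(2)] by (simp add: \<alpha>_def)
    have "coAd G (rep \<alpha>) (D x) = tmap LW vs_mfd (\<lambda>w. cinv OM \<alpha>0 w) w x"
      using smooth_at_compose(2)[OF good_LW good_OM good_vs_dual sci, of "\<lambda>\<alpha>. \<alpha>" x] smooth_incl[OF \<alpha>O] DW[OF x] x civ by (simp add: D_def)
    also have "tmap LW vs_mfd (\<lambda>w. cinv OM \<alpha>0 w) w = tmap LW vs_mfd (\<lambda>w. f (sec w \<otimes> ?g)) w"
      by (rule tmap_cong[of LW B]) (use RO_B y' c(6) sec_carrier r in \<open>auto simp: rel_open_def F_def coAd_mult simp del: OM_simps\<close>)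
    also have "\<dots> x = coAd G ?k (inft mu0 (ld LW (\<lambda>w. sec w \<otimes> ?g) w x))"
      by (rule tmap_orbit_comp[OF good_LW _ xm]) (intro smooth_mult good_LW sec_smooth y'(2) smooth_group_const; use sub_B[OF y'(2)] r in simp)
    also have "ld LW (\<lambda>w. sec w \<otimes> ?g) w x = ld LW sec w x"
    proof -
      have 1: "smooth_at LW M (\<lambda>_. ?g) w" "ld LW (\<lambda>_. ?g) w x = 0"
        using sub_B[OF y'(2)] r x by (auto intro!: smooth_group_const ld_const)
      show ?thesis using ld_mult[OF good_LW sec_smooth[OF y'(2)] 1(1) xm] 1(2) sec_carrier[OF y'(2)] by (simp add: linear_0[OF linear_Ad])
    qed
    also have "coAd G ?k (inft mu0 (ld LW sec w x)) = inft \<alpha> (Ad G ?k (ld LW sec w x))"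
      using inft_coAd[OF k] \<alpha> by simp
    finally show ?thesis .
  qed
  have "form_in_chart R rho p y u v = rho (\<alpha>, l, z) (D (fst u), snd u) (D (fst v), snd v)"
    using form_in_chart_tmap[OF good_R p, of y rho u v] y img_R[OF p] tm[OF u] tm[OF v] ci by (simp add: \<alpha>_def)
  also have "\<dots> = blinfun_apply (fst (snd v)) (snd (snd u)) - blinfun_apply (fst (snd u)) (snd (snd v))
     - blinfun_apply \<alpha> (br (Ad G ?k (ld LW sec w (fst u))) (Ad G ?k (ld LW sec w (fst v))))"
    using rho_eq[OF \<alpha>O DW DW el1 el1, of "fst u" "fst v" l z "fst (snd u)" "snd (snd u)" "fst (snd v)" "snd (snd v)"] u v by auto
  also have "blinfun_apply \<alpha> (br (Ad G ?k (ld LW sec w (fst u))) (Ad G ?k (ld LW sec w (fst v)))) = blinfun_apply mu0 (br (ld LW sec w (fst u)) (ld LW sec w (fst v)))"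
    using k by (simp add: \<alpha> Ad_br[symmetric] coAd_apply Ad_inv)
  finally show ?thesis by (simp add: y')
qed

lemma symplectic_R: "symplectic_manifold R rho"
proof -
  have ex: "form_in_chart R rho p y u v = fd (model R) (\<lambda>z. rtheta z v) y u - fd (model R) (\<lambda>z. rtheta z u) y v"
    if p: "p \<in> pts R" and y: "y \<in> cmap R p ` cdom R p" and u: "u \<in> model R" and v: "v \<in> model R" for p y u v
  proof -
    have uv: "u \<in> W \<times> UNIV" "v \<in> W \<times> UNIV" and y': "y \<in> B \<times> UNIV" using u v y img_R[OF p] by auto
    have s: "blinfun_apply mu0 (fd W (\<lambda>w. ld LW sec w (fst v)) (fst y) (fst u)) - blinfun_apply mu0 (fd W (\<lambda>w. ld LW sec w (fst u)) (fst y) (fst v))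
      = - blinfun_apply mu0 (br (ld LW sec (fst y) (fst u)) (ld LW sec (fst y) (fst v)))"
      using sec_ld_smooth(2)[of "fst u" "fst y" "fst v"] uv y' by (auto simp: blin_simps(4,6)[symmetric])
    show ?thesis unfolding form_in_chart_R[OF p y' uv] R_simps rtheta_smooth(2)[OF uv(1) y' uv(2)] rtheta_smooth(2)[OF uv(2) y' uv(1)]
      using s by simp
  qed
  have sm: "smooth_on (model R) (cmap R p ` cdom R p) (\<lambda>y. rtheta y u)" if "p \<in> pts R" "u \<in> model R" for p u
    unfolding img_R[OF that(1)] R_simps by (rule rtheta_smooth(1)) (use that in auto)
  note le = locally_exact_form[OF good_R, of "\<lambda>_. rtheta", OF sm ex]
  have two: "two_form R rho"
    unfolding two_form_def
  proof (intro conjI ballI allI)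
    fix p u v assume p: "p \<in> pts R" and u: "u \<in> model R" and v: "v \<in> model R"
    obtain \<alpha> \<beta> x where p': "p = (\<alpha>, \<beta>, x)" "\<alpha> \<in> Orb" using p by (cases p) auto
    show "smooth_on (model R) (cmap R p ` cdom R p) (\<lambda>y. form_in_chart R rho p y u v)"
      by (rule le(2)) (use p u v in auto)
    obtain u1 u2 u3 where u': "u = (u1, u2, u3)" "u1 \<in> W" using u by (cases u) auto
    obtain v1 v2 v3 where v': "v = (v1, v2, v3)" "v1 \<in> W" using v by (cases v) auto
    show "rho p u v = - rho p v u"
      using br_antisym[of "el \<alpha> u1" "el \<alpha> v1"] by (simp add: rho_def p' u' v' blin_simps)
    fix w r s assume w: "w \<in> model R"
    obtain w1 w2 w3 where w': "w = (w1, w2, w3)" "w1 \<in> W" using w by (cases w) auto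
    have sum: "r *\<^sub>R u1 + s *\<^sub>R v1 \<in> W" using u'(2) v'(2) subspace_W by (simp add: subspace_add subspace_scale)
    have lin: "linear (coAd G (rep \<alpha>))" using rep[OF p'(2)] by (simp add: linear_coAd)
    have e: "coAd G (rep \<alpha>) (r *\<^sub>R u1 + s *\<^sub>R v1) = inft \<alpha> (r *\<^sub>R el \<alpha> u1 + s *\<^sub>R el \<alpha> v1)"
      by (simp add: linear_add[OF lin] linear_scale[OF lin] linear_add[OF linear_inft] linear_scale[OF linear_inft] el[OF p'(2)] u'(2) v'(2))
    show "rho p (r *\<^sub>R u + s *\<^sub>R v) w = r * rho p u w + s * rho p v w"
      using rho_eq[OF p'(2) sum w'(2) e el[OF p'(2) w'(2), symmetric], of \<beta> x "r *\<^sub>R u2 + s *\<^sub>R v2" "r *\<^sub>R u3 + s *\<^sub>R v3" w2 w3]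
      by (simp add: u' v' w' p' rho_def blin_simps br_simps bounded_bilinear.scaleR_left[OF bounded_bilinear_br] algebra_simps)
  qed
  moreover have "closed_form R rho" by (rule le(1)) auto
  moreover have "v = 0" if p: "p \<in> pts R" and v: "v \<in> model R" and 0: "\<forall>w\<in>model R. rho p v w = 0" for p v
  proof -
    obtain \<alpha> \<beta> x where p': "p = (\<alpha>, \<beta>, x)" "\<alpha> \<in> Orb" using p by (cases p) auto
    obtain v1 v2 v3 where v': "v = (v1, v2, v3)" "v1 \<in> W" using v by (cases v) auto
    note r = rep[OF p'(2)]
    have W0: "0 \<in> W" using subspace_W by (rule subspace_0)
    have e0: "coAd G (rep \<alpha>) 0 = inft \<alpha> 0" using r by (simp add: linear_0[OF linear_coAd] linear_0[OF linear_inft])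
    note ev = el[OF p'(2) v'(2), symmetric]
    have v3: "v3 = 0"
    proof (rule dual_separates)
      fix l have "rho p v (0, l, 0) = 0" using 0 W0 by simp
      then show "blinfun_apply l v3 = 0" using rho_eq[OF p'(2) v'(2) W0 ev e0, of \<beta> x v2 v3 l 0] by (simp add: p' v' blin_simps br_simps)
    qed
    have v2: "v2 = 0"
    proof (rule blinfun_eqI)
      fix z have "rho p v (0, 0, z) = 0" using 0 W0 by simp
      then show "blinfun_apply v2 z = blinfun_apply 0 z" using rho_eq[OF p'(2) v'(2) W0 ev e0, of \<beta> x v2 v3 0 z] by (simp add: p' v' blin_simps br_simps)
    qed
    \<comment> \<open>Every generator at \<alpha> is a tangent vector of the orbit, so testing
      against all of them shows that \<alpha> annihilates all brackets with
      \<open>el \<alpha> v1\<close>.\<close>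
    have "inft \<alpha> (el \<alpha> v1) = 0"
    proof (rule blinfun_eqI)
      fix \<eta>
      have "inft \<alpha> \<eta> \<in> tmap OM vs_mfd (\<lambda>\<alpha>. \<alpha>) \<alpha> ` W" unfolding tangent_orbit[OF p'(2)] by simp
      then obtain u where u: "u \<in> W" "inft \<alpha> \<eta> = coAd G (rep \<alpha>) u" using smooth_incl(2)[OF p'(2)] by auto
      have "rho p v (u, 0, 0) = 0" using 0 u by simp
      then have "blinfun_apply \<alpha> (br (el \<alpha> v1) \<eta>) = 0"
        using rho_eq[OF p'(2) v'(2) u(1) ev u(2)[symmetric], of \<beta> x v2 v3 0 0] by (simp add: p' v' blin_simps)
      then show "blinfun_apply (inft \<alpha> (el \<alpha> v1)) \<eta> = blinfun_apply 0 \<eta>" by (simp add: inft_def coad_apply blin_simps)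
    qed
    then have "coAd G (inv (rep \<alpha>)) (coAd G (rep \<alpha>) v1) = 0" using ev r by (simp add: linear_0[OF linear_coAd])
    then show ?thesis using r by (simp add: v' v2 v3 coAd_inv zero_prod_def)
  qed
  ultimately show ?thesis
    unfolding symplectic_manifold_def symplectic_form_def using good_R by (auto simp: good_def)
qed

end

subsection \<open>Transport of structure along a bijection\<close>

text \<open>The extra factor \<open>{0}\<close> of the model space only adjusts the type of the tangent vectors.\<close>

definition transport :: "'q set \<Rightarrow> ('q \<Rightarrow> 'm) \<Rightarrow> ('m, 'e) mfd \<Rightarrow> ('q, 'a::real_normed_vector \<times> 'e) mfd" where
  "transport X \<Phi> K = \<lparr>mtop = pullback_topology X \<Phi> (mtop K), model = {0} \<times> model K,
     cdom = (\<lambda>q. {x \<in> X. \<Phi> x \<in> cdom K (\<Phi> q)}), cmap = (\<lambda>q x. (0, cmap K (\<Phi> q) (\<Phi> x)))\<rparr>"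

lemma transport_simps [simp]: "mtop (transport X \<Phi> K) = pullback_topology X \<Phi> (mtop K)" "model (transport X \<Phi> K) = {0} \<times> model K"
  "cdom (transport X \<Phi> K) q = {x \<in> X. \<Phi> x \<in> cdom K (\<Phi> q)}" "cmap (transport X \<Phi> K) q x = (0, cmap K (\<Phi> q) (\<Phi> x))"
  by (simp_all add: transport_def)

lemma bij_betw_image_Collect: "bij_betw \<Phi> X Y \<Longrightarrow> V \<subseteq> Y \<Longrightarrow> \<Phi> ` {x \<in> X. \<Phi> x \<in> V} = V"
  by (auto simp: bij_betw_def image_iff subset_iff)

lemma fd_snd:
  assumes "smooth_on V S h" "rel_open V S" "y \<in> {0::'a::real_normed_vector} \<times> S" "u \<in> {0} \<times> V"
  shows "fd ({0} \<times> V) (\<lambda>z. h (snd z)) y u = fd V h (snd y) (snd u)"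
proof -
  have ro: "rel_open ({0::'a} \<times> V) ({0} \<times> S)"
    by (intro rel_open_Times assms(2)) (simp add: rel_open_def)
  have "(h has_derivative fd V h (snd y)) (at (snd y) within snd ` ({0::'a} \<times> V))"
    using smooth_onD[OF assms(1), of "snd y"] assms(3) by auto
  from has_derivative_in_compose[OF bounded_linear_imp_has_derivative[OF bounded_linear_snd] this]
  show ?thesis by (rule fd_eq[OF _ ro assms(3,4)])
qed

lemma smooth_on_snd:
  assumes "smooth_on V S h" "rel_open V S" "framed V"
  shows "smooth_on ({0::'a::real_normed_vector} \<times> V) ({0} \<times> S) (\<lambda>z. h (snd z))"
proof -
  have ro: "rel_open ({0::'a} \<times> V) ({0} \<times> S)"
    by (intro rel_open_Times assms(2)) (simp add: rel_open_def)
  show ?thesis by (rule smooth_on_compose[OF assms(1) smooth_on_bounded_linear[OF ro bounded_linear_snd] ro assms(2,3)]) auto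
qed

context
  fixes K :: "('m, 'e::real_normed_vector) mfd" and X :: "'q set" and \<Phi> :: "'q \<Rightarrow> 'm" and Q :: "('q, 'a::real_normed_vector \<times> 'e) mfd"
  assumes K: "good K" and \<Phi>: "bij_betw \<Phi> X (pts K)" and Q: "Q = transport X \<Phi> K"
begin

lemma pts_transport: "pts Q = X"
  using \<Phi> by (auto simp: Q topspace_pullback_topology bij_betw_def)

lemma transport_homeo: "homeomorphic_map (mtop Q) (mtop K) \<Phi>"
proof (rule bijective_open_imp_homeomorphic_map)
  show "continuous_map (mtop Q) (mtop K) \<Phi>"
    using continuous_map_pullback[OF continuous_map_id, of X \<Phi> "mtop K"] by (simp add: Q)
  show "open_map (mtop Q) (mtop K) \<Phi>"
    unfolding open_map_def Q transport_simps openin_pullback_topology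
  proof (intro allI impI)
    fix U assume "\<exists>V. openin (mtop K) V \<and> U = \<Phi> -` V \<inter> X"
    then obtain V where V: "openin (mtop K) V" "U = \<Phi> -` V \<inter> X" by auto
    then have "U = {x \<in> X. \<Phi> x \<in> V}" by blast
    then have "\<Phi> ` U = V" using bij_betw_image_Collect[OF \<Phi> openin_subset[OF V(1)]] by simp
    then show "openin (mtop K) (\<Phi> ` U)" using V(1) by simp
  qed
  show "\<Phi> ` pts Q = pts K" "inj_on \<Phi> (pts Q)" using \<Phi> unfolding pts_transport by (auto simp: bij_betw_def)
qed

lemma transport_chart:
  assumes q: "q \<in> X"
  shows "\<Phi> q \<in> pts K" "\<Phi> ` cdom Q q = cdom K (\<Phi> q)" "openin (mtop Q) (cdom Q q)" "q \<in> cdom Q q"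
    "cmap Q q ` (cdom Q q \<inter> {x \<in> X. \<Phi> x \<in> Z}) = {0} \<times> (cmap K (\<Phi> q) ` (cdom K (\<Phi> q) \<inter> Z))"
    "cmap Q q ` cdom Q q = {0} \<times> (cmap K (\<Phi> q) ` cdom K (\<Phi> q))"
    "y \<in> cmap Q q ` cdom Q q \<Longrightarrow> \<Phi> (cinv Q q y) = cinv K (\<Phi> q) (snd y)"
    "y \<in> cmap Q q ` cdom Q q \<Longrightarrow> cinv Q q y \<in> X"
proof -
  show pK: "\<Phi> q \<in> pts K" using q \<Phi> by (auto simp: bij_betw_def)
  note c = good_chart[OF K pK]
  have img: "\<Phi> ` {x \<in> X. \<Phi> x \<in> cdom K (\<Phi> q) \<inter> Z} = cdom K (\<Phi> q) \<inter> Z" for Z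
    by (rule bij_betw_image_Collect[OF \<Phi>]) (use c(10) in blast)
  show "\<Phi> ` cdom Q q = cdom K (\<Phi> q)" using img[of UNIV] by (simp add: Q)
  show "openin (mtop Q) (cdom Q q)"
    unfolding Q transport_simps openin_pullback_topology using c(2) by blast
  show "q \<in> cdom Q q" using q c(1) by (simp add: Q)
  have i: "cmap Q q ` (cdom Q q \<inter> {x \<in> X. \<Phi> x \<in> Z}) = {0} \<times> (cmap K (\<Phi> q) ` (cdom K (\<Phi> q) \<inter> Z))" for Z
  proof -
    have "cdom Q q \<inter> {x \<in> X. \<Phi> x \<in> Z} = {x \<in> X. \<Phi> x \<in> cdom K (\<Phi> q) \<inter> Z}" by (auto simp: Q)
    then have "cmap Q q ` (cdom Q q \<inter> {x \<in> X. \<Phi> x \<in> Z}) = (\<lambda>x. (0, cmap K (\<Phi> q) x)) ` \<Phi> ` {x \<in> X. \<Phi> x \<in> cdom K (\<Phi> q) \<inter> Z}"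
      by (simp add: Q image_image)
    then show ?thesis unfolding img by auto
  qed
  show "cmap Q q ` (cdom Q q \<inter> {x \<in> X. \<Phi> x \<in> Z}) = {0} \<times> (cmap K (\<Phi> q) ` (cdom K (\<Phi> q) \<inter> Z))" by (rule i)
  have "cdom Q q \<inter> {x \<in> X. \<Phi> x \<in> UNIV} = cdom Q q" by (auto simp: Q)
  with i[of UNIV] show "cmap Q q ` cdom Q q = {0} \<times> (cmap K (\<Phi> q) ` cdom K (\<Phi> q))" by simp
  assume y: "y \<in> cmap Q q ` cdom Q q"
  then obtain x where x: "x \<in> cdom Q q" "y = cmap Q q x" by auto
  have "cmap Q q (cinv Q q y) = y" "cinv Q q y \<in> cdom Q q"
    unfolding cinv_def using y by (auto intro: f_inv_into_f inv_into_into)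
  then show "\<Phi> (cinv Q q y) = cinv K (\<Phi> q) (snd y)" "cinv Q q y \<in> X" using c(5)[of "\<Phi> (cinv Q q y)"] by (auto simp: Q prod_eq_iff)
qed

lemma good_transport: "good Q"
  unfolding good_def smooth_manifold_def
proof (intro conjI ballI)
  have hs: "mtop Q homeomorphic_space mtop K" by (rule homeomorphic_map_imp_homeomorphic_space[OF transport_homeo])
  show "Hausdorff_space (mtop Q)" "second_countable (mtop Q)"
    using homeomorphic_Hausdorff_space[OF hs] homeomorphic_space_second_countability[OF hs] K by (auto simp: good_def smooth_manifold_def)
  show fr: "framed (model Q)" using framed_Times[OF framed_singleton_0 goodD(2)[OF K]] by (simp add: Q)
  show "\<exists>B. finite B \<and> model Q = span B" by (rule framed_span[OF fr])
  fix q assume "q \<in> pts Q"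
  then have q: "q \<in> X" by (simp add: pts_transport)
  note t = transport_chart[OF q]
  note c = good_chart[OF K t(1)]
  show "q \<in> cdom Q q" "openin (mtop Q) (cdom Q q)" by (fact t)+
  have ro: "rel_open (model Q) ({0} \<times> S)" if "rel_open (model K) S" for S
    unfolding Q transport_simps by (intro rel_open_Times that) (simp add: rel_open_def)
  show "openin (top_of_set (model Q)) (cmap Q q ` cdom Q q)" using ro[OF c(3)] unfolding t(6) by (simp add: rel_open_def)
  let ?I = "cmap K (\<Phi> q) ` cdom K (\<Phi> q)"
  have sub: "cdom Q q \<subseteq> topspace (mtop Q)" using openin_subset[OF t(3)] .
  have "homeomorphic_map (subtopology (mtop Q) (cdom Q q)) (subtopology (mtop K) (cdom K (\<Phi> q))) \<Phi>"
    by (rule homeomorphic_map_subtopologies[OF transport_homeo])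
      (use t(2) sub c(10) pts_transport \<Phi> in \<open>auto simp: Q bij_betw_def\<close>)
  moreover have "homeomorphic_map (subtopology (mtop K) (cdom K (\<Phi> q))) (top_of_set ?I) (cmap K (\<Phi> q))"
    using K t(1) by (auto simp: good_def smooth_manifold_def)
  moreover have "homeomorphic_map (top_of_set ?I) (top_of_set ({0} \<times> ?I)) (\<lambda>y. (0, y))"
    unfolding homeomorphic_map_maps homeomorphic_maps_def
    by (rule exI[of _ snd]) (auto intro!: continuous_intros)
  ultimately have "homeomorphic_map (subtopology (mtop Q) (cdom Q q)) (top_of_set ({0} \<times> ?I)) ((\<lambda>y. (0, y)) \<circ> (cmap K (\<Phi> q) \<circ> \<Phi>))"
    by (intro homeomorphic_map_compose)
  then show "homeomorphic_map (subtopology (mtop Q) (cdom Q q)) (top_of_set (cmap Q q ` cdom Q q)) (cmap Q q)"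
    unfolding t(6) by (simp add: Q transport_def o_def)
  fix r assume "r \<in> pts Q"
  then have r: "r \<in> X" by (simp add: pts_transport)
  let ?S = "cmap K (\<Phi> q) ` (cdom K (\<Phi> q) \<inter> cdom K (\<Phi> r))"
  have "cdom Q r = {x \<in> X. \<Phi> x \<in> cdom K (\<Phi> r)}" by (simp add: Q)
  then have S: "cmap Q q ` (cdom Q q \<inter> cdom Q r) = {0} \<times> ?S" using t(5)[of "cdom K (\<Phi> r)"] by simp
  have oS: "rel_open (model K) ?S"
    by (rule c(8)) (use c(2) good_chart(2)[OF K transport_chart(1)[OF r]] in auto)
  have "smooth_on ({0::'a} \<times> model K) ({0} \<times> ?S) (\<lambda>y. (cmap K (\<Phi> r) \<circ> cinv K (\<Phi> q)) (snd y))"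
    by (rule smooth_on_snd[OF good_transition[OF K t(1) transport_chart(1)[OF r]] oS goodD(2)[OF K]])
  then have "smooth_on ({0::'a} \<times> model K) ({0} \<times> ?S) (\<lambda>y. (0::'a, (cmap K (\<Phi> r) \<circ> cinv K (\<Phi> q)) (snd y)))"
    by (intro smooth_on_linear_comp[where L="\<lambda>y. (0, y)"] ro[OF oS, unfolded Q transport_simps]
      bounded_linear_Pair bounded_linear_zero bounded_linear_ident)
  then show "smooth_on (model Q) (cmap Q q ` (cdom Q q \<inter> cdom Q r)) (cmap Q r \<circ> cinv Q q)"
    unfolding S
  proof (subst (asm) smooth_on_cong[where g="cmap Q r \<circ> cinv Q q"])
    show "rel_open ({0::'a} \<times> model K) ({0} \<times> ?S)" using ro[OF oS] by (simp add: Q)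
    fix y assume "y \<in> {0::'a} \<times> ?S"
    then have "y \<in> cmap Q q ` cdom Q q" unfolding t(6) by auto
    then show "(0, (cmap K (\<Phi> r) \<circ> cinv K (\<Phi> q)) (snd y)) = (cmap Q r \<circ> cinv Q q) y"
      using t(7) by (simp add: Q)
  qed (simp add: Q)
qed

lemma transport_map:
  assumes q: "q \<in> X"
  shows "smooth_at Q K \<Phi> q" "v \<in> model Q \<Longrightarrow> tmap Q K \<Phi> q v = snd v"
proof -
  note t = transport_chart[OF q]
  have ro: "rel_open (model Q) (cmap Q q ` cdom Q q)" by (rule good_chart(3)[OF good_transport]) (simp add: pts_transport q)
  have e: "cmap K (\<Phi> q) (\<Phi> (cinv Q q y)) = snd y" if "y \<in> cmap Q q ` cdom Q q" for y
    using t(7)[OF that] that good_chart(7)[OF K t(1)] unfolding t(6) by auto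
  have "smooth_on (model Q) (cmap Q q ` cdom Q q) (\<lambda>y. cmap K (\<Phi> q) (\<Phi> (cinv Q q y)))"
    by (rule iffD1[OF smooth_on_cong[OF ro] smooth_on_bounded_linear[OF ro bounded_linear_snd]]) (simp add: e)
  then show "smooth_at Q K \<Phi> q" unfolding smooth_at_def smooth_in_def
    using t(1,2,3,4) q by (intro conjI exI[of _ "cdom Q q"]) (auto simp: pts_transport)
  have y: "cmap Q q q \<in> cmap Q q ` cdom Q q" using t(4) by simp
  have "((\<lambda>y. cmap K (\<Phi> q) (\<Phi> (cinv Q q y))) has_derivative snd) (at (cmap Q q q) within model Q)"
    unfolding at_within_rel_open[OF ro y]
    by (rule has_derivative_transform[OF y _ bounded_linear_imp_has_derivative[OF bounded_linear_snd]]) (rule e)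
  from tmap_eqI[OF good_transport _ this] show "v \<in> model Q \<Longrightarrow> tmap Q K \<Phi> q v = snd v"
    by (simp add: pts_transport q)
qed

lemma transport_inverse:
  assumes x: "x \<in> pts K"
  shows "smooth_at K Q (inv_into X \<Phi>) x" "v \<in> model K \<Longrightarrow> tmap K Q (inv_into X \<Phi>) x v = (0, v)"
proof -
  let ?q = "inv_into X \<Phi> x"
  have i: "inv_into X \<Phi> z \<in> X" "\<Phi> (inv_into X \<Phi> z) = z" if "z \<in> pts K" for z
    using that \<Phi> by (auto simp: bij_betw_def intro: inv_into_into f_inv_into_f)
  note c = good_chart[OF K x]
  have e: "cmap Q ?q (inv_into X \<Phi> (cinv K x y)) = (0, y)" if "y \<in> cmap K x ` cdom K x" for y
    using i(2)[OF x] i(2)[OF c(10)[OF c(6)[OF that]]] c(7)[OF that] by (simp add: Q)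
  have bl: "bounded_linear (\<lambda>y::'e. (0::'a, y))" by (intro bounded_linear_Pair bounded_linear_zero bounded_linear_ident)
  have "smooth_on (model K) (cmap K x ` cdom K x) (\<lambda>y. cmap Q ?q (inv_into X \<Phi> (cinv K x y)))"
    by (rule iffD1[OF smooth_on_cong[OF c(3)] smooth_on_bounded_linear[OF c(3) bl]]) (simp add: e)
  then show "smooth_at K Q (inv_into X \<Phi>) x" unfolding smooth_at_def smooth_in_def
    using x i c(1,2,10) pts_transport by (intro conjI exI[of _ "cdom K x"]) (auto simp: Q)
  have y: "cmap K x x \<in> cmap K x ` cdom K x" using c(1) by simp
  have "((\<lambda>y. cmap Q ?q (inv_into X \<Phi> (cinv K x y))) has_derivative (\<lambda>y. (0, y))) (at (cmap K x x) within model K)"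
    unfolding at_within_rel_open[OF c(3) y]
    by (rule has_derivative_transform[OF y _ bounded_linear_imp_has_derivative[OF bl]]) (rule e)
  from tmap_eqI[OF K x this] show "v \<in> model K \<Longrightarrow> tmap K Q (inv_into X \<Phi>) x v = (0, v)" .
qed

lemma diffeomorphism_transport: "diffeomorphism Q K \<Phi>"
  unfolding diffeomorphism_def smooth_map_iff[OF good_transport K] smooth_map_iff[OF K good_transport] pts_transport
  using \<Phi> transport_map(1) transport_inverse(1) by blast

text \<open>The inverse charts of \<open>Q\<close> correspond under \<open>\<Phi>\<close> to those
  of \<open>K\<close>, so in charts the transported form is the old one composed with
  \<open>snd\<close>; smoothness and closedness follow.\<close>

lemma symplectic_transport:
  assumes fr: "framed (UNIV :: 'e set)" "framed (UNIV :: 'a set)" and \<rho>: "symplectic_manifold K \<rho>"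
  shows "symplectic_manifold Q (\<lambda>q u v. \<rho> (\<Phi> q) (snd u) (snd v))" "symplectomorphism Q (\<lambda>q u v. \<rho> (\<Phi> q) (snd u) (snd v)) K \<rho> \<Phi>"
proof -
  let ?\<omega> = "\<lambda>q u v. \<rho> (\<Phi> q) (snd u) (snd v)"
  let ?LQ = "lin_mfd (model Q)" and ?LK = "lin_mfd (model K)"
  have gLQ: "good ?LQ" by (rule good_lin_mfd[OF goodD(2)[OF good_transport] framed_UNIV_prod[OF fr(2,1)]])
  have gLK: "good ?LK" by (rule good_lin_mfd[OF goodD(2)[OF K] fr(1)])
  have mQ: "model Q = {0} \<times> model K" by (simp add: Q)
  have two: "two_form K \<rho>" and cl: "closed_form K \<rho>" and nd: "\<And>p v. p \<in> pts K \<Longrightarrow> v \<in> model K \<Longrightarrow> \<forall>w\<in>model K. \<rho> p v w = 0 \<Longrightarrow> v = 0"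
    using \<rho> by (auto simp: symplectic_manifold_def symplectic_form_def)
  have sm: "smooth_on (model K) (cmap K p ` cdom K p) (\<lambda>y. form_in_chart K \<rho> p y u v)" if "p \<in> pts K" "u \<in> model K" "v \<in> model K" for p u v
    using two that by (auto simp: two_form_def)
  have d: "snd (tmap ?LQ Q (cinv Q p) y u) = tmap ?LK K (cinv K (\<Phi> p)) (snd y) (snd u)"
    if p: "p \<in> X" and y: "y \<in> cmap Q p ` cdom Q p" and u: "u \<in> model Q" for p y u
  proof -
    note t = transport_chart[OF p]
    have pQ: "p \<in> pts Q" using p by (simp add: pts_transport)
    note ci = smooth_at_cinv[OF good_transport pQ y]
    have yK: "snd y \<in> cmap K (\<Phi> p) ` cdom K (\<Phi> p)" using y unfolding t(6) by auto
    have ro: "rel_open (model Q) (cmap Q p ` cdom Q p)" by (rule good_chart(3)[OF good_transport pQ])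
    have ym: "y \<in> model Q" by (rule rel_openD(2)[OF ro y])
    have roM: "rel_open (model Q) (model Q)" using goodD(3)[OF good_transport] by (simp add: rel_open_def)
    have s: "smooth_at ?LQ ?LK snd y"
      by (rule smooth_at_lin_mfd[OF smooth_on_bounded_linear[OF roM bounded_linear_snd] roM ym]) (auto simp: mQ)
    have ts: "tmap ?LQ ?LK snd y u = snd u"
      unfolding tmap_lin_mfd[OF ym goodD(3)[OF good_transport]]
      by (rule fd_eq[OF bounded_linear_imp_has_derivative[OF bounded_linear_snd] roM ym u])
    have "snd (tmap ?LQ Q (cinv Q p) y u) = tmap Q K \<Phi> (cinv Q p y) (tmap ?LQ Q (cinv Q p) y u)"
      by (rule transport_map(2)[symmetric, OF t(8)[OF y] tmap_mem[OF gLQ good_transport ci]]) (use u in simp)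
    also have "\<dots> = tmap ?LQ K (\<lambda>y. \<Phi> (cinv Q p y)) y u"
      by (rule smooth_at_compose(2)[symmetric, OF gLQ good_transport K ci transport_map(1)[OF t(8)[OF y]]]) (use u in simp)
    also have "tmap ?LQ K (\<lambda>y. \<Phi> (cinv Q p y)) y = tmap ?LQ K (\<lambda>y. cinv K (\<Phi> p) (snd y)) y"
      by (rule tmap_cong[OF _ y t(7) gLQ]) (use ro in \<open>simp add: rel_open_def\<close>)
    also have "\<dots> u = tmap ?LK K (cinv K (\<Phi> p)) (snd y) (snd u)"
      using smooth_at_compose(2)[OF gLQ gLK K s smooth_at_cinv[OF K t(1) yK], of u] u ts by simp
    finally show ?thesis .
  qed
  have fc: "form_in_chart Q ?\<omega> p y u v = form_in_chart K \<rho> (\<Phi> p) (snd y) (snd u) (snd v)"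
    if p: "p \<in> X" and y: "y \<in> cmap Q p ` cdom Q p" and u: "u \<in> model Q" and v: "v \<in> model Q" for p y u v
  proof -
    note t = transport_chart[OF p]
    have pQ: "p \<in> pts Q" using p by (simp add: pts_transport)
    have yK: "snd y \<in> cmap K (\<Phi> p) ` cdom K (\<Phi> p)" using y unfolding t(6) by auto
    show ?thesis
      unfolding form_in_chart_tmap[OF good_transport pQ y] form_in_chart_tmap[OF K t(1) yK] d[OF p y u] d[OF p y v] t(7)[OF y] ..
  qed
  have ro: "rel_open (model Q) (cmap Q p ` cdom Q p)" if "p \<in> X" for p
    by (rule good_chart(3)[OF good_transport]) (use that in \<open>simp add: pts_transport\<close>)
  have fcd: "fd (model Q) (\<lambda>z. form_in_chart Q ?\<omega> p z u v) y w = fd (model K) (\<lambda>z. form_in_chart K \<rho> (\<Phi> p) z (snd u) (snd v)) (snd y) (snd w)"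
    if p: "p \<in> X" and y: "y \<in> cmap Q p ` cdom Q p" and uvw: "u \<in> model Q" "v \<in> model Q" "w \<in> model Q" for p y u v w
  proof -
    note t = transport_chart[OF p]
    have "fd (model Q) (\<lambda>z. form_in_chart Q ?\<omega> p z u v) y = fd (model Q) (\<lambda>z. form_in_chart K \<rho> (\<Phi> p) (snd z) (snd u) (snd v)) y"
      by (rule fd_cong(1)[OF ro[OF p] y]) (rule fc[OF p _ uvw(1,2)])
    then have "fd (model Q) (\<lambda>z. form_in_chart Q ?\<omega> p z u v) y w = fd (model Q) (\<lambda>z. form_in_chart K \<rho> (\<Phi> p) (snd z) (snd u) (snd v)) y w"
      by simp
    also have "\<dots> = fd (model K) (\<lambda>z. form_in_chart K \<rho> (\<Phi> p) z (snd u) (snd v)) (snd y) (snd w)"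
      unfolding mQ by (rule fd_snd[OF sm[OF t(1)] good_chart(3)[OF K t(1)]]) (use uvw y in \<open>auto simp: mQ t(6) simp del: transport_simps\<close>)
    finally show ?thesis .
  qed
  have "two_form Q ?\<omega>" unfolding two_form_def
  proof (intro conjI ballI allI)
    fix p u v assume "p \<in> pts Q" and u: "u \<in> model Q" and v: "v \<in> model Q"
    then have p: "p \<in> X" by (simp add: pts_transport)
    note t = transport_chart[OF p]
    have m: "snd u \<in> model K" "snd v \<in> model K" using u v by (auto simp: mQ)
    show "\<rho> (\<Phi> p) (snd u) (snd v) = - \<rho> (\<Phi> p) (snd v) (snd u)" using two t(1) m unfolding two_form_def by blast
    have "smooth_on (model Q) (cmap Q p ` cdom Q p) (\<lambda>y. form_in_chart K \<rho> (\<Phi> p) (snd y) (snd u) (snd v))"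
      unfolding t(6) mQ by (rule smooth_on_snd[OF sm[OF t(1) m] good_chart(3)[OF K t(1)] goodD(2)[OF K]])
    then show "smooth_on (model Q) (cmap Q p ` cdom Q p) (\<lambda>y. form_in_chart Q ?\<omega> p y u v)"
      by (rule iffD1[OF smooth_on_cong[OF ro[OF p]], rotated]) (simp add: fc[OF p _ u v])
    fix w a b assume "w \<in> model Q"
    then have "snd w \<in> model K" by (auto simp: mQ)
    then have "\<rho> (\<Phi> p) (a *\<^sub>R snd u + b *\<^sub>R snd v) (snd w) = a * \<rho> (\<Phi> p) (snd u) (snd w) + b * \<rho> (\<Phi> p) (snd v) (snd w)"
      using conjunct1[OF two[unfolded two_form_def]] t(1) m by blast
    then show "\<rho> (\<Phi> p) (snd (a *\<^sub>R u + b *\<^sub>R v)) (snd w) = a * \<rho> (\<Phi> p) (snd u) (snd w) + b * \<rho> (\<Phi> p) (snd v) (snd w)"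
      unfolding snd_add snd_scaleR .
  qed
  moreover have "closed_form Q ?\<omega>" unfolding closed_form_def
  proof (intro ballI)
    fix p y u v w assume "p \<in> pts Q" and y: "y \<in> cmap Q p ` cdom Q p" and u: "u \<in> model Q" and v: "v \<in> model Q" and w: "w \<in> model Q"
    then have p: "p \<in> X" by (simp add: pts_transport)
    note t = transport_chart[OF p]
    have m: "snd u \<in> model K" "snd v \<in> model K" "snd w \<in> model K" using u v w by (auto simp: mQ)
    have yK: "snd y \<in> cmap K (\<Phi> p) ` cdom K (\<Phi> p)" using y unfolding t(6) by auto
    show "fd (model Q) (\<lambda>z. form_in_chart Q ?\<omega> p z v w) y u + fd (model Q) (\<lambda>z. form_in_chart Q ?\<omega> p z w u) y v
       + fd (model Q) (\<lambda>z. form_in_chart Q ?\<omega> p z u v) y w = 0"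
      unfolding fcd[OF p y v w u] fcd[OF p y w u v] fcd[OF p y u v w]
      using cl t(1) yK m unfolding closed_form_def by blast
  qed
  moreover have "v = 0" if p: "p \<in> pts Q" and v: "v \<in> model Q" and 0: "\<forall>w\<in>model Q. \<rho> (\<Phi> p) (snd v) (snd w) = 0" for p v
  proof -
    have "\<Phi> p \<in> pts K" using p transport_chart(1) by (simp add: pts_transport)
    moreover have "\<rho> (\<Phi> p) (snd v) w = 0" if "w \<in> model K" for w using 0 that by (force simp: mQ)
    ultimately have "snd v = 0" using nd v by (auto simp: mQ)
    then show ?thesis using v by (auto simp: mQ zero_prod_def)
  qed
  ultimately show "symplectic_manifold Q ?\<omega>"
    unfolding symplectic_manifold_def symplectic_form_def using goodD(1)[OF good_transport] by blast
  show "symplectomorphism Q ?\<omega> K \<rho> \<Phi>"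
    unfolding symplectomorphism_def using diffeomorphism_transport transport_map(2) by (simp add: pts_transport)
qed

end

text \<open>A vector as a zero-dimensional manifold with model \<open>{0}\<close>. It will freeze
  the \<nu>-slot of the product while keeping the types of points and tangent vectors, as fits a
  submanifold of \<open>TTG G\<close>.\<close>

definition point_mfd :: "'a::real_normed_vector \<Rightarrow> ('a, 'a) mfd" where
  "point_mfd c = \<lparr>mtop = top_of_set {c}, model = {0}, cdom = (\<lambda>_. {c}), cmap = (\<lambda>_ _. 0)\<rparr>"

lemma point_mfd_simps [simp]: "mtop (point_mfd c) = top_of_set {c}" "model (point_mfd c) = {0}"
  "cdom (point_mfd c) p = {c}" "cmap (point_mfd c) p x = 0"
  by (simp_all add: point_mfd_def)

lemma good_point_mfd [simp]: "good (point_mfd c)"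
  unfolding good_def smooth_manifold_def
proof (intro conjI ballI)
  show "Hausdorff_space (mtop (point_mfd c))" by (simp add: Hausdorff_space_subtopology)
  have "finite {U. openin (top_of_set {c}) U}"
    by (rule finite_subset[of _ "Pow {c}"]) (use openin_imp_subset in auto)
  then show "second_countable (mtop (point_mfd c))"
    unfolding second_countable_def by (intro exI[of _ "{U. openin (top_of_set {c}) U}"]) (auto simp: countable_finite)
  show "framed (model (point_mfd c))" using framed_singleton_0 by simp
  show "\<exists>B. finite B \<and> model (point_mfd c) = span B" by (intro exI[of _ "{}"]) simp
  fix p assume "p \<in> pts (point_mfd c)"
  then show "p \<in> cdom (point_mfd c) p" by simp
  show "openin (mtop (point_mfd c)) (cdom (point_mfd c) p)" by simp
  show "openin (top_of_set (model (point_mfd c))) (cmap (point_mfd c) p ` cdom (point_mfd c) p)" by simp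
  show "homeomorphic_map (subtopology (mtop (point_mfd c)) (cdom (point_mfd c) p))
      (top_of_set (cmap (point_mfd c) p ` cdom (point_mfd c) p)) (cmap (point_mfd c) p)"
    unfolding homeomorphic_map_maps homeomorphic_maps_def
    by (rule exI[of _ "\<lambda>_. c"]) (auto simp: point_mfd_def)
  fix q
  show "smooth_on (model (point_mfd c)) (cmap (point_mfd c) p ` (cdom (point_mfd c) p \<inter> cdom (point_mfd c) q)) (cmap (point_mfd c) q \<circ> cinv (point_mfd c) p)"
    using smooth_on_const[of "{0}" "{0}" 0] by (simp add: o_def rel_open_def)
qed

lemma smooth_at_point_incl: 
  assumes "good (vs_mfd :: ('a::real_normed_vector, 'a) mfd)"
  shows "smooth_at (point_mfd (c::'a)) vs_mfd (\<lambda>x. x) c"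
  by (rule smooth_at_cong[OF _ _ _ good_point_mfd smooth_at_vs_const[OF good_point_mfd, of c c c], of "{c}"]) auto

context orbit begin

subsection \<open>The reduced space\<close>

definition NM :: "(('g, 'e) TTG, 'e vTTG) mfd" where
  "NM = prod_mfd M (prod_mfd vs_mfd (prod_mfd (point_mfd mu0) vs_mfd))"

section \<open>The level set of the momentum map\<close>

lemma good_NM [simp]: "good NM"
  unfolding NM_def by (intro good_prod_mfd good_point_mfd good_M good_vs_fin_dim good_vs_dual)

lemma NM_simps [simp]: "model NM = UNIV \<times> UNIV \<times> {0} \<times> UNIV" "pts NM = carrier G \<times> UNIV \<times> {mu0} \<times> UNIV"
  by (simp_all add: NM_def)

lemma NM_components:
  assumes p: "p \<in> pts NM" and v: "v \<in> model NM"
  shows "smooth_at NM M fst p" "tmap NM M fst p v = fst v"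
    "smooth_at NM vs_mfd (\<lambda>x. fst (snd x)) p" "tmap NM vs_mfd (\<lambda>x. fst (snd x)) p v = fst (snd v)"
    "smooth_at NM vs_mfd (\<lambda>x. fst (snd (snd x))) p" "tmap NM vs_mfd (\<lambda>x. fst (snd (snd x))) p v = 0"
    "smooth_at NM vs_mfd (\<lambda>x. snd (snd (snd x))) p" "tmap NM vs_mfd (\<lambda>x. snd (snd (snd x))) p v = snd (snd (snd v))"
proof -
  let ?P = "point_mfd mu0" and ?D = "vs_mfd :: ('e dual, 'e dual) mfd"
  let ?N3 = "prod_mfd ?P vs" let ?N2 = "prod_mfd ?D ?N3"
  have g3: "good ?N3" by (intro good_prod_mfd) simp_all
  have g2: "good ?N2" by (intro good_prod_mfd g3) simp
  have N: "NM = prod_mfd M ?N2" by (simp add: NM_def)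
  have p1: "p \<in> pts (prod_mfd M ?N2)" and v1: "v \<in> model (prod_mfd M ?N2)" using p v by (auto simp: NM_def)
  show "smooth_at NM M fst p" "tmap NM M fst p v = fst v"
    unfolding N by (rule smooth_at_fst[OF good_M g2 p1])+ (rule v1)
  have 2: "smooth_at NM ?N2 snd p" "tmap NM ?N2 snd p v = snd v"
    unfolding N by (rule smooth_at_snd[OF good_M g2 p1])+ (rule v1)
  have p2: "snd p \<in> pts ?N2" and v2: "snd v \<in> model ?N2" using p v by auto
  note f2 = smooth_at_fst[OF good_vs_dual g3 p2] and s2 = smooth_at_snd[OF good_vs_dual g3 p2]
  show "smooth_at NM vs_mfd (\<lambda>x. fst (snd x)) p" "tmap NM vs_mfd (\<lambda>x. fst (snd x)) p v = fst (snd v)"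
    using smooth_at_compose[OF good_NM g2 good_vs_dual 2(1) f2(1)] 2(2) f2(2)[OF v2] v by auto
  have 3: "smooth_at NM ?N3 (\<lambda>x. snd (snd x)) p" "tmap NM ?N3 (\<lambda>x. snd (snd x)) p v = snd (snd v)"
    using smooth_at_compose[OF good_NM g2 g3 2(1) s2(1)] 2(2) s2(2)[OF v2] v by auto
  have p3: "snd (snd p) \<in> pts ?N3" and v3: "snd (snd v) \<in> model ?N3" using p v by auto
  note f3 = smooth_at_fst[OF good_point_mfd good_vs_fin_dim p3] and s3 = smooth_at_snd[OF good_point_mfd good_vs_fin_dim p3]
  show "smooth_at NM vs_mfd (\<lambda>x. snd (snd (snd x))) p" "tmap NM vs_mfd (\<lambda>x. snd (snd (snd x))) p v = snd (snd (snd v))"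
    using smooth_at_compose[OF good_NM g3 good_vs_fin_dim 3(1) s3(1)] 3(2) s3(2)[OF v3] v by auto
  have 4: "smooth_at NM ?P (\<lambda>x. fst (snd (snd x))) p" "tmap NM ?P (\<lambda>x. fst (snd (snd x))) p v = 0"
    using smooth_at_compose[OF good_NM g3 good_point_mfd 3(1) f3(1)] 3(2) f3(2)[OF v3] v by auto
  have c: "fst (snd (snd p)) = mu0" using p by auto
  note j = smooth_at_point_incl[OF good_vs_dual, of mu0]
  have j': "smooth_at ?P vs_mfd (\<lambda>x. x) (fst (snd (snd p)))" unfolding c by (rule j)
  show "smooth_at NM vs_mfd (\<lambda>x. fst (snd (snd x))) p" "tmap NM vs_mfd (\<lambda>x. fst (snd (snd x))) p v = 0"
    using smooth_at_compose[OF good_NM good_point_mfd good_vs_dual 4(1) j'] 4(2) linear_0[OF linear_tmap[OF good_point_mfd j']] v by auto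
qed

lemma smooth_incl_NM:
  assumes p: "p \<in> pts NM"
  shows "smooth_at NM T (\<lambda>x. x) p" "v \<in> model NM \<Longrightarrow> tmap NM T (\<lambda>x. x) p v = v"
proof -
  have *: "smooth_at NM T (\<lambda>x. x) p \<and> tmap NM T (\<lambda>x. x) p v = v" if v: "v \<in> model NM" for v
  proof -
    note c = NM_components[OF p v]
    note P3 = smooth_at_Pair[OF good_NM c(5) c(7)]
    note P2 = smooth_at_Pair[OF good_NM c(3) P3(1)]
    note P1 = smooth_at_Pair[OF good_NM c(1) P2(1)]
    have i: "(\<lambda>x. (fst x, fst (snd x), fst (snd (snd x)), snd (snd (snd x)))) = (\<lambda>x. x :: ('g, 'e) TTG)" by simp
    have "fst (snd (snd v)) = 0" using v by auto
    then show ?thesis unfolding TTG_def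
      using P1 P2(2) P3(2) c(2,4,6,8) v unfolding i by (auto simp: prod_eq_iff)
  qed
  show "smooth_at NM T (\<lambda>x. x) p" by (rule conjunct1[OF *[of 0]]) (simp add: zero_prod_def)
  show "v \<in> model NM \<Longrightarrow> tmap NM T (\<lambda>x. x) p v = v" by (rule conjunct2[OF *])
qed

lemma embedded_NM: "embedded_submanifold NM T"
  unfolding embedded_submanifold_def immersion_def smooth_map_iff[OF good_NM good_T]
proof (intro conjI ballI)
  show "smooth_manifold NM" by (rule goodD[OF good_NM])
  show "pts NM \<subseteq> pts T" by auto
  have "prod_topology (mtop M) (prod_topology euclidean (prod_topology (top_of_set {mu0}) euclidean)) =
    subtopology (prod_topology (mtop M) (prod_topology euclidean (prod_topology euclidean euclidean))) (carrier G \<times> UNIV \<times> {mu0} \<times> UNIV)"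
    using subtopology_topspace[of "mtop M"] by (simp only: subtopology_Times subtopology_UNIV pts_M)
  then show "mtop NM = subtopology (mtop T) (pts NM)"
    by (simp only: NM_simps) (simp add: NM_def TTG_def)
  show "smooth_at NM T (\<lambda>x. x) p" if "p \<in> pts NM" for p using smooth_incl_NM(1)[OF that] .
  show "inj_on (tmap NM T (\<lambda>x. x) p) (model NM)" if "p \<in> pts NM" for p
    using smooth_incl_NM(2)[OF that] by (simp add: inj_on_def)
qed

definition Ph :: "('g, 'e) TTG \<Rightarrow> 'e dual \<times> 'e dual \<times> 'e" where
  "Ph x = (f (fst x), coAd G (fst x) (fst (snd x)), Ad G (fst x) (snd (snd (snd x))))"

definition "proj x = (\<lambda>g. TTG_left G g x) ` coad_isotropy G mu0"

section \<open>Orbits of the isotropy group on the level set\<close>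

lemma left_action:
  "x \<in> pts T \<Longrightarrow> TTG_left G \<one> x = x"
  "g \<in> carrier G \<Longrightarrow> h \<in> carrier G \<Longrightarrow> x \<in> pts T \<Longrightarrow> TTG_left G (g \<otimes> h) x = TTG_left G g (TTG_left G h x)"
  using symplectic_left unfolding symplectic_action_def lie_action_def by blast+

lemma isotropy:
  "s \<in> coad_isotropy G mu0 \<Longrightarrow> s \<in> carrier G" "s \<in> coad_isotropy G mu0 \<Longrightarrow> coAd G s mu0 = mu0"
  "\<one> \<in> coad_isotropy G mu0" "s \<in> coad_isotropy G mu0 \<Longrightarrow> inv s \<in> coad_isotropy G mu0"
  "s \<in> coad_isotropy G mu0 \<Longrightarrow> t \<in> coad_isotropy G mu0 \<Longrightarrow> s \<otimes> t \<in> coad_isotropy G mu0"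
  "s \<in> carrier G \<Longrightarrow> coAd G s mu0 = mu0 \<Longrightarrow> s \<in> coad_isotropy G mu0"
proof -
  have i: "s \<in> coad_isotropy G mu0 \<longleftrightarrow> s \<in> carrier G \<and> coAd G s mu0 = mu0" for s
    unfolding coad_isotropy_def using coAd_inv[of s mu0] by auto
  show "s \<in> coad_isotropy G mu0 \<Longrightarrow> s \<in> carrier G" "s \<in> coad_isotropy G mu0 \<Longrightarrow> coAd G s mu0 = mu0"
    "\<one> \<in> coad_isotropy G mu0" "s \<in> carrier G \<Longrightarrow> coAd G s mu0 = mu0 \<Longrightarrow> s \<in> coad_isotropy G mu0"
    using coAd_one i by auto
  show "s \<in> coad_isotropy G mu0 \<Longrightarrow> inv s \<in> coad_isotropy G mu0" using coAd_inv[of s mu0] unfolding i by auto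
  show "s \<in> coad_isotropy G mu0 \<Longrightarrow> t \<in> coad_isotropy G mu0 \<Longrightarrow> s \<otimes> t \<in> coad_isotropy G mu0"
    unfolding i by (auto simp: coAd_mult)
qed

lemma proj_left:
  assumes s: "s \<in> coad_isotropy G mu0" and x: "x \<in> pts T"
  shows "proj (TTG_left G s x) = proj x"
proof -
  note c = isotropy(1)
  have "TTG_left G g (TTG_left G s x) = TTG_left G (g \<otimes> s) x" if "g \<in> coad_isotropy G mu0" for g
    using left_action(2)[OF c[OF that] c[OF s] x] by simp
  then have "proj (TTG_left G s x) = (\<lambda>g. TTG_left G g x) ` (\<lambda>g. g \<otimes> s) ` coad_isotropy G mu0"
    unfolding proj_def image_image by (rule image_cong[OF refl])
  also have "(\<lambda>g. g \<otimes> s) ` coad_isotropy G mu0 = coad_isotropy G mu0"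
  proof (intro equalityI subsetI)
    show "g \<in> coad_isotropy G mu0" if "g \<in> (\<lambda>g. g \<otimes> s) ` coad_isotropy G mu0" for g
      using that s isotropy(5) by auto
    show "g \<in> (\<lambda>g. g \<otimes> s) ` coad_isotropy G mu0" if "g \<in> coad_isotropy G mu0" for g
      by (rule image_eqI[of _ _ "g \<otimes> inv s"]) (use that s c isotropy(4,5) in \<open>auto simp: m_assoc\<close>)
  qed
  finally show ?thesis by (simp add: proj_def)
qed

text \<open>Equal values of \<open>Ph\<close> force the points to differ by the action of
  \<open>g \<otimes> inv h\<close>, which stabilises \<open>mu0\<close> because the orbit components
  agree.\<close>

lemma Ph_proj:
  assumes x: "x \<in> pts NM" and y: "y \<in> pts NM"
  shows "Ph x = Ph y \<longleftrightarrow> proj x = proj y"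
proof
  obtain g \<mu> \<xi> where x': "x = (g, \<mu>, mu0, \<xi>)" "g \<in> carrier G" using x by auto
  obtain h \<mu>' \<xi>' where y': "y = (h, \<mu>', mu0, \<xi>')" "h \<in> carrier G" using y by auto
  have xT: "x \<in> pts T" and yT: "y \<in> pts T" using x' y' by auto
  {
    assume "Ph x = Ph y"
    then have e: "f g = f h" "coAd G g \<mu> = coAd G h \<mu>'" "Ad G g \<xi> = Ad G h \<xi>'" by (auto simp: Ph_def x' y')
    let ?s = "g \<otimes> inv h"
    have s: "?s \<in> coad_isotropy G mu0" using f_eq_iff[OF x'(2) y'(2)] e(1) x'(2) y'(2) by (intro isotropy(6)) auto
    have "TTG_left G ?s y = x"
    proof -
      have "inv ?s = h \<otimes> inv g" using x'(2) y'(2) by (simp add: inv_mult_group)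
      moreover have "coAd G (h \<otimes> inv g) \<mu>' = \<mu>" "Ad G (h \<otimes> inv g) \<xi>' = \<xi>"
        using x'(2) y'(2) by (simp_all add: coAd_mult Ad_mult e(2,3)[symmetric] coAd_inv Ad_inv)
      moreover have "coAd G (h \<otimes> inv g) mu0 = mu0"
        using isotropy(2)[OF isotropy(4)[OF s]] calculation(1) by simp
      moreover have "?s \<otimes> h = g" using x'(2) y'(2) by (simp add: m_assoc)
      ultimately show ?thesis by (simp add: TTG_left_def x' y')
    qed
    then show "proj x = proj y" using proj_left[OF s yT] by simp
  next
    assume "proj x = proj y"
    moreover have "x \<in> proj x" unfolding proj_def using isotropy(3) left_action(1)[OF xT] by (intro image_eqI[of _ _ \<one>]) auto
    ultimately obtain s where s: "s \<in> coad_isotropy G mu0" "x = TTG_left G s y" by (auto simp: proj_def)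
    note sc = isotropy(1)[OF s(1)]
    show "Ph x = Ph y"
      using s(2) sc y'(2) isotropy(2)[OF s(1)]
      by (simp add: Ph_def TTG_left_def y' coAd_mult Ad_mult coAd_inv Ad_inv)
  }
qed

lemma Ph_surj: "Ph ` pts NM = pts R"
proof (intro equalityI subsetI)
  show "z \<in> pts R" if "z \<in> Ph ` pts NM" for z using that f_carrier by (auto simp: Ph_def)
  fix z assume "z \<in> pts R"
  then obtain \<alpha> \<beta> x where z: "z = (\<alpha>, \<beta>, x)" "\<alpha> \<in> Orb" by auto
  note r = rep[OF z(2)]
  show "z \<in> Ph ` pts NM"
    by (rule image_eqI[of _ _ "(rep \<alpha>, coAd G (inv (rep \<alpha>)) \<beta>, mu0, Ad G (inv (rep \<alpha>)) x)"])
      (use r in \<open>auto simp: Ph_def z coAd_inv Ad_inv\<close>)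
qed

text \<open>\<open>Ph\<close> descends to the classes, and \<open>QM\<close> receives the structure
  of \<open>R\<close> along the induced bijection; that \<open>proj\<close> becomes a submersion for
  this structure is verified separately.\<close>

definition "Phi q = Ph (SOME x. x \<in> pts NM \<and> proj x = q)"
definition QM :: "(('g, 'e) TTG set, 'e vTTG) mfd" where "QM = transport (proj ` pts NM) Phi R"
definition omega :: "('g, 'e) TTG set \<Rightarrow> 'e vTTG \<Rightarrow> 'e vTTG \<Rightarrow> real" where
  "omega q u v = rho (Phi q) (snd u) (snd v)"

lemma Phi_proj: "x \<in> pts NM \<Longrightarrow> Phi (proj x) = Ph x"
  unfolding Phi_def using someI[of "\<lambda>y. y \<in> pts NM \<and> proj y = proj x" x] Ph_proj by blast

lemma bij_Phi: "bij_betw Phi (proj ` pts NM) (pts R)"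
proof -
  have "inj_on Phi (proj ` pts NM)" using Ph_proj Phi_proj by (auto intro!: inj_onI simp del: NM_simps)
  moreover have "Phi ` proj ` pts NM = pts R" unfolding Ph_surj[symmetric] image_image using Phi_proj by (rule image_cong[OF refl])
  ultimately show ?thesis by (simp add: bij_betw_def)
qed

lemmas good_QM = good_transport[OF good_R bij_Phi QM_def]
lemmas pts_QM = pts_transport[OF good_R bij_Phi QM_def]

text \<open>The orbit component of the tangent map is described only through the covector it stands
  for, since its chart vector depends on the choice of \<open>rep\<close>.\<close>

lemma smooth_Ph:
  assumes p: "p \<in> pts NM" "p = (g, \<mu>, mu0, \<xi>)"
  shows "smooth_at NM R Ph p"
    "v \<in> model NM \<Longrightarrow> v = (v1, a, 0, c) \<Longrightarrow> \<eta> = il g v1 \<Longrightarrow> \<exists>u\<in>W. coAd G (rep (f g)) u = inft (f g) (Ad G g \<eta>) \<and>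
       tmap NM R Ph p v = (u, coAd G g (a - coad G \<eta> \<mu>), Ad G g (c + br \<eta> \<xi>))"
proof -
  have *: "smooth_at NM R Ph p \<and> (\<exists>u\<in>W. coAd G (rep (f g)) u = inft (f g) (Ad G g (il g v1)) \<and>
       tmap NM R Ph p v = (u, coAd G g (a - coad G (il g v1) \<mu>), Ad G g (c + br (il g v1) \<xi>)))"
    if v: "v \<in> model NM" "v = (v1, a, 0, c)" for v v1 a c
  proof -
    note n = NM_components[OF p(1) v(1)]
    have l: "ld NM fst p v = il g v1" unfolding ld_def n(2) by (simp add: p(2) v(2))
    note s1 = smooth_f_comp[OF good_NM n(1)]
    note s2 = smooth_at_coAd_comp[OF good_NM n(1,3)] and s3 = smooth_at_Ad_comp[OF good_NM n(1,7)]
    note P2 = smooth_at_Pair[OF good_NM s2(1) s3(1), unfolded prod_mfd_vs]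
    note P1 = smooth_at_Pair[OF good_NM s1(1) P2(1)]
    have s: "smooth_at NM R Ph p" unfolding R_def Ph_def[abs_def] by (rule P1(1))
    have "tmap NM R Ph p v = (tmap NM OM (\<lambda>x. f (fst x)) p v, coAd G g (a - coad G (il g v1) \<mu>), Ad G g (br (il g v1) \<xi> + c))"
      unfolding R_def Ph_def[abs_def]
      using P1(2)[OF v(1)] unfolding P2(2)[OF v(1)] s2(2)[OF v(1)] s3(2)[OF v(1)] n(4,8) l by (simp add: p(2) v(2))
    moreover have "tmap NM OM (\<lambda>x. f (fst x)) p v \<in> W" using tmap_mem[OF good_NM good_OM s1(1) v(1)] by simp
    ultimately show ?thesis using s s1(2)[OF v(1), unfolded l] by (auto simp: p(2) add.commute)
  qed
  show "smooth_at NM R Ph p" using *[of "(0, 0, 0, 0)" 0 0 0] by auto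
  show "v \<in> model NM \<Longrightarrow> v = (v1, a, 0, c) \<Longrightarrow> \<eta> = il g v1 \<Longrightarrow> \<exists>u\<in>W. coAd G (rep (f g)) u = inft (f g) (Ad G g \<eta>) \<and>
       tmap NM R Ph p v = (u, coAd G g (a - coad G \<eta> \<mu>), Ad G g (c + br \<eta> \<xi>))"
    using *[of v v1 a c] by blast
qed

text \<open>On the level set the projection is \<open>Ph\<close> followed by the inverse of
  \<open>Phi\<close>, whose tangent map merely prepends 0.\<close>

lemma smooth_proj:
  assumes p: "p \<in> pts NM"
  shows "smooth_at NM QM proj p" "v \<in> model NM \<Longrightarrow> tmap NM QM proj p v = (0, tmap NM R Ph p v)"
proof -
  have pe: "inv_into (proj ` pts NM) Phi (Ph x) = proj x" if "x \<in> pts NM" for x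
    using bij_Phi Phi_proj[OF that] that by (intro inv_into_f_eq) (auto simp: bij_betw_def simp del: NM_simps)
  obtain g \<mu> \<xi> where p': "p = (g, \<mu>, mu0, \<xi>)" using p by auto
  note sP = smooth_Ph(1)[OF p p']
  have PR: "Ph p \<in> pts R" using p unfolding Ph_surj[symmetric] by (rule imageI)
  note i = transport_inverse[OF good_R bij_Phi QM_def PR]
  note c = smooth_at_compose[OF good_NM good_R good_QM sP i(1)]
  have o: "openin (mtop NM) (pts NM)" by (rule openin_topspace)
  show "smooth_at NM QM proj p" by (rule smooth_at_cong[OF o p pe good_NM c(1)])
  assume v: "v \<in> model NM"
  have "tmap NM QM proj p v = tmap NM QM (\<lambda>x. inv_into (proj ` pts NM) Phi (Ph x)) p v"
    using tmap_cong[OF o p pe[symmetric] good_NM, where N=QM] by simp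
  also have "\<dots> = (0, tmap NM R Ph p v)"
    unfolding c(2)[OF v] by (rule i(2)[OF tmap_mem[OF good_NM good_R sP v]])
  finally show "tmap NM QM proj p v = (0, tmap NM R Ph p v)" .
qed

lemma submersion_proj: "surj_submersion NM QM proj"
  unfolding surj_submersion_def smooth_map_iff[OF good_NM good_QM] pts_QM
proof (intro conjI ballI refl smooth_proj(1))
  fix p assume p: "p \<in> pts NM"
  then obtain g \<mu> \<xi> where p': "p = (g, \<mu>, mu0, \<xi>)" and g: "g \<in> carrier G" by auto
  show "tmap NM QM proj p ` model NM = model QM"
  proof (intro equalityI subsetI)
    show "z \<in> model QM" if "z \<in> tmap NM QM proj p ` model NM" for z
      using that tmap_mem[OF good_NM good_QM smooth_proj(1)[OF p]] by auto
    fix z assume "z \<in> model QM"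
    then obtain u l \<zeta> where z: "z = (0, u, l, \<zeta>)" "u \<in> W" by (auto simp: QM_def)
    note fg = f_carrier[OF g]
    obtain \<eta>' where \<eta>': "coAd G (rep (f g)) u = inft (f g) \<eta>'" using el[OF fg z(2)] by metis
    define \<eta> where "\<eta> = Ad G (inv g) \<eta>'"
    \<comment> \<open>A preimage obtained by solving component by component: the terms in
      \<open>coad\<close> and \<open>br\<close> cancel the shifts in the tangent map of
      \<open>Ph\<close>, and the inverse translation undoes \<open>Ad\<close> and
      \<open>coAd\<close>.\<close>
    define v where "v = (rt g \<eta>, coAd G (inv g) l + coad G \<eta> \<mu>, 0 :: 'e dual, Ad G (inv g) \<zeta> - br \<eta> \<xi>)"
    have vm: "v \<in> model NM" by (simp add: v_def)
    obtain u' where u': "u' \<in> W" "coAd G (rep (f g)) u' = inft (f g) (Ad G g \<eta>)" and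
      t: "tmap NM R Ph p v = (u', coAd G g (coAd G (inv g) l + coad G \<eta> \<mu> - coad G \<eta> \<mu>), Ad G g (Ad G (inv g) \<zeta> - br \<eta> \<xi> + br \<eta> \<xi>))"
      using smooth_Ph(2)[OF p p' vm v_def, of \<eta>] il_rt[OF g] by auto
    have "coAd G (rep (f g)) u' = coAd G (rep (f g)) u" using u'(2) g by (simp add: \<eta>_def Ad_inv \<eta>')
    then have "u' = u" using coAd_inv(1)[OF rep(1)[OF fg]] by metis
    then have "tmap NM QM proj p v = z" using smooth_proj(2)[OF p vm] t g by (simp add: z coAd_inv Ad_inv)
    then show "z \<in> tmap NM QM proj p ` model NM" using vm by blast
  qed
qed

text \<open>On the level set the \<nu>-components of tangent vectors vanish, and the shifted
  components \<open>a - coad G \<eta> \<mu>\<close> and \<open>c + br \<eta> \<xi>\<close> in the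
  tangent map of \<open>Ph\<close> are exactly those paired in \<open>tform\<close>; invariance of
  pairings and brackets removes the translation by \<open>g\<close>.\<close>

lemma omega_pullback:
  assumes p: "p \<in> pts NM" and v: "v \<in> model NM" and w: "w \<in> model NM"
  shows "omega (proj p) (tmap NM QM proj p v) (tmap NM QM proj p w) = TTG_form G p (tmap NM T (\<lambda>y. y) p v) (tmap NM T (\<lambda>y. y) p w)"
proof -
  obtain g \<mu> \<xi> where p': "p = (g, \<mu>, mu0, \<xi>)" and g: "g \<in> carrier G" using p by auto
  obtain v1 a c where v': "v = (v1, a, 0, c)" using v by auto
  obtain w1 a' c' where w': "w = (w1, a', 0, c')" using w by auto
  let ?\<eta> = "il g v1" and ?\<eta>' = "il g w1"
  obtain u where u: "u \<in> W" "coAd G (rep (f g)) u = inft (f g) (Ad G g ?\<eta>)"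
    "tmap NM R Ph p v = (u, coAd G g (a - coad G ?\<eta> \<mu>), Ad G g (c + br ?\<eta> \<xi>))"
    using smooth_Ph(2)[OF p p' v v' refl] by blast
  obtain u' where u': "u' \<in> W" "coAd G (rep (f g)) u' = inft (f g) (Ad G g ?\<eta>')"
    "tmap NM R Ph p w = (u', coAd G g (a' - coad G ?\<eta>' \<mu>), Ad G g (c' + br ?\<eta>' \<xi>))"
    using smooth_Ph(2)[OF p p' w w' refl] by blast
  have Ap: "blinfun_apply (coAd G g l) (Ad G g x) = blinfun_apply l x" for l x
    using g by (simp add: coAd_apply Ad_inv)
  have Php: "Ph p = (f g, coAd G g \<mu>, Ad G g \<xi>)" by (simp add: Ph_def p')
  have "omega (proj p) (tmap NM QM proj p v) (tmap NM QM proj p w) = rho (Ph p) (tmap NM R Ph p v) (tmap NM R Ph p w)"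
    by (simp add: omega_def Phi_proj[OF p] smooth_proj(2)[OF p v] smooth_proj(2)[OF p w])
  also have "\<dots> = blinfun_apply (a' - coad G ?\<eta>' \<mu>) (c + br ?\<eta> \<xi>) - blinfun_apply (a - coad G ?\<eta> \<mu>) (c' + br ?\<eta>' \<xi>) - blinfun_apply mu0 (br ?\<eta> ?\<eta>')"
    unfolding Php u(3) u'(3) rho_eq[OF f_carrier[OF g] u(1) u'(1) u(2) u'(2)] Ad_br[OF g, symmetric] Ap ..
  also have "\<dots> = tform \<mu> mu0 \<xi> (?\<eta>, a, 0, c) (?\<eta>', a', 0, c')"
    using br_antisym[of ?\<eta> \<xi>] br_antisym[of ?\<eta>' \<xi>] by (simp add: tform_def)
  also have "\<dots> = TTG_form G p v w" unfolding p' v' w' TTG_form_eq[OF g] ..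
  finally show ?thesis unfolding smooth_incl_NM(2)[OF p v] smooth_incl_NM(2)[OF p w] .
qed

lemma symplectic_QM: "symplectic_manifold QM omega" "symplectomorphism QM omega R rho Phi"
proof -
  have fr: "framed (UNIV :: ('e dual \<times> 'e dual \<times> 'e) set)" by (intro framed_UNIV_intros)
  show "symplectic_manifold QM omega" "symplectomorphism QM omega R rho Phi"
    using symplectic_transport[OF good_R bij_Phi QM_def fr framed_UNIV_fin_dim symplectic_R]
    unfolding omega_def[abs_def] by blast+
qed

lemma marsden_weinstein_QM:
  "marsden_weinstein_reduction G T (TTG_form G) (TTG_left G) TTG_momentum mu0 QM omega"
  unfolding marsden_weinstein_reduction_def
proof (intro conjI symplectic_T symplectic_left momentum_left symplectic_QM(1) exI[of _ NM] exI[of _ proj])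
  show "embedded_submanifold NM T" by (rule embedded_NM)
  show "pts NM = {x \<in> pts T. TTG_momentum x = mu0}" by (auto simp: TTG_momentum_def)
  show "proj = (\<lambda>x. (\<lambda>g. TTG_left G g x) ` coad_isotropy G mu0)" by (simp add: proj_def fun_eq_iff)
  show "pts QM = proj ` pts NM" by (rule pts_QM)
  show "surj_submersion NM QM proj" by (rule submersion_proj)
qed (use omega_pullback in blast)

end

theorem mainTheorem11:
  fixes G :: "('g, 'e::fin_dim_inner) lgroup" and \<mu>\<^sub>0 :: "'e dual"
  assumes "lie_group G"
  shows
    "(\<forall>H K. smooth_fun (TTG G) H \<and> smooth_fun (TTG G) K \<and>
        indep_of_group G H \<and> indep_of_group G K \<longrightarrow>
        smooth_fun (TTG G) (poisson_bracket (TTG G) (TTG_form G) H K) \<and>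
        indep_of_group G (poisson_bracket (TTG G) (TTG_form G) H K) \<and>
        (\<forall>g\<in>carrier G. \<forall>\<mu> \<nu> \<xi>.
           poisson_bracket (TTG G) (TTG_form G) H K (g, \<mu>, \<nu>, \<xi>) =
           reduced_bracket G (\<lambda>m. H (\<one>\<^bsub>G\<^esub>, m)) (\<lambda>m. K (\<one>\<^bsub>G\<^esub>, m)) (\<mu>, \<nu>, \<xi>))) \<and>
     poisson_reduction G (TTG G) (TTG_form G) (TTG_right G)
       (prod_mfd vs_mfd (prod_mfd vs_mfd vs_mfd)) (\<lambda>(g, \<mu>, \<nu>, \<xi>). (\<mu>, \<nu>, \<xi>)) (reduced_bracket G) \<and>
     (\<exists>O\<mu> Q \<omega> \<rho> \<Phi>.
        coad_orbit_manifold G \<mu>\<^sub>0 O\<mu> \<and>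
        marsden_weinstein_reduction G (TTG G) (TTG_form G) (TTG_left G) TTG_momentum \<mu>\<^sub>0 Q \<omega> \<and>
        symplectic_manifold (prod_mfd O\<mu> (prod_mfd vs_mfd vs_mfd)) \<rho> \<and>
        symplectomorphism Q \<omega> (prod_mfd O\<mu> (prod_mfd (vs_mfd :: ('e dual, 'e dual) mfd) vs_mfd)) \<rho> \<Phi> \<and>
        (\<forall>\<mu>\<in>coad_orbit G \<mu>\<^sub>0. tmap O\<mu> vs_mfd (\<lambda>\<alpha>. \<alpha>) \<mu> ` model O\<mu> = range (\<lambda>\<eta>. coad_gen G \<eta> \<mu>)) \<and>
        (\<forall>\<mu>\<in>coad_orbit G \<mu>\<^sub>0. \<forall>\<beta> (x::'e). \<forall>u\<in>model O\<mu>. \<forall>u'\<in>model O\<mu>. \<forall>\<eta> \<eta>' l l' \<zeta> \<zeta>'.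
           tmap O\<mu> vs_mfd (\<lambda>\<alpha>. \<alpha>) \<mu> u = coad_gen G \<eta> \<mu> \<and>
           tmap O\<mu> vs_mfd (\<lambda>\<alpha>. \<alpha>) \<mu> u' = coad_gen G \<eta>' \<mu> \<longrightarrow>
           \<rho> (\<mu>, \<beta>, x) (u, l, \<zeta>) (u', l', \<zeta>') =
             blinfun_apply l' \<zeta> - blinfun_apply l \<zeta>' - blinfun_apply \<mu> (lie_bracket G \<eta> \<eta>')))"
proof -
  interpret lie G by unfold_locales (rule assms)
  obtain S B \<sigma> U where "orbit G \<mu>\<^sub>0 S B \<sigma> U"
    by (rule orbit_slice[of \<mu>\<^sub>0]) (rule that, intro orbit.intro orbit_axioms.intro lie_axioms)
  then interpret orbit G "\<mu>\<^sub>0" S B \<sigma> U .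
  have R: "prod_mfd OM (prod_mfd (vs_mfd :: ('e dual, 'e dual) mfd) vs_mfd) = R" by (simp add: R_def prod_mfd_vs)
  have V: "prod_mfd vs_mfd (prod_mfd vs_mfd vs_mfd) = V3" by (simp add: prod_mfd_vs)
  have gen: "coad_gen G \<eta> \<mu> = inft \<mu> \<eta>" for \<eta> \<mu> by (simp add: coad_gen_eq inft_def)
  show ?thesis
    unfolding V
  proof (intro conjI allI impI ballI poisson_reduction_T)
    fix H K
    assume *: "smooth_fun T H \<and> smooth_fun T K \<and> indep_of_group G H \<and> indep_of_group G K"
    note pp = poisson_part[of H K]
    show "smooth_fun T (poisson_bracket T (TTG_form G) H K)" "indep_of_group G (poisson_bracket T (TTG_form G) H K)"
      using * by (auto intro: pp(1,2))
    fix g \<mu> \<nu> \<xi> assume "g \<in> carrier G"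
    with * show "poisson_bracket T (TTG_form G) H K (g, \<mu>, \<nu>, \<xi>) =
        reduced_bracket G (\<lambda>m. H (\<one>\<^bsub>G\<^esub>, m)) (\<lambda>m. K (\<one>\<^bsub>G\<^esub>, m)) (\<mu>, \<nu>, \<xi>)" by (auto intro: pp(3))
  next
    show "\<exists>O\<mu> Q \<omega> \<rho> \<Phi>.
        coad_orbit_manifold G \<mu>\<^sub>0 O\<mu> \<and>
        marsden_weinstein_reduction G T (TTG_form G) (TTG_left G) TTG_momentum \<mu>\<^sub>0 Q \<omega> \<and>
        symplectic_manifold (prod_mfd O\<mu> (prod_mfd vs_mfd vs_mfd)) \<rho> \<and>
        symplectomorphism Q \<omega> (prod_mfd O\<mu> (prod_mfd (vs_mfd :: ('e dual, 'e dual) mfd) vs_mfd)) \<rho> \<Phi> \<and>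
        (\<forall>\<mu>\<in>coad_orbit G \<mu>\<^sub>0. tmap O\<mu> vs_mfd (\<lambda>\<alpha>. \<alpha>) \<mu> ` model O\<mu> = range (\<lambda>\<eta>. coad_gen G \<eta> \<mu>)) \<and>
        (\<forall>\<mu>\<in>coad_orbit G \<mu>\<^sub>0. \<forall>\<beta> (x::'e). \<forall>u\<in>model O\<mu>. \<forall>u'\<in>model O\<mu>. \<forall>\<eta> \<eta>' l l' \<zeta> \<zeta>'.
           tmap O\<mu> vs_mfd (\<lambda>\<alpha>. \<alpha>) \<mu> u = coad_gen G \<eta> \<mu> \<and>
           tmap O\<mu> vs_mfd (\<lambda>\<alpha>. \<alpha>) \<mu> u' = coad_gen G \<eta>' \<mu> \<longrightarrow>
           \<rho> (\<mu>, \<beta>, x) (u, l, \<zeta>) (u', l', \<zeta>') =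
             blinfun_apply l' \<zeta> - blinfun_apply l \<zeta>' - blinfun_apply \<mu> (lie_bracket G \<eta> \<eta>'))"
      unfolding gen lie_bracket_eq
    proof (intro exI[of _ OM] exI[of _ QM] exI[of _ omega] exI[of _ rho] exI[of _ Phi] conjI ballI allI impI)
      show "coad_orbit_manifold G \<mu>\<^sub>0 OM" by (rule coad_orbit_manifold_OM)
      show "marsden_weinstein_reduction G T (TTG_form G) (TTG_left G) TTG_momentum \<mu>\<^sub>0 QM omega" by (rule marsden_weinstein_QM)
      show "symplectic_manifold (prod_mfd OM (prod_mfd vs_mfd vs_mfd)) rho" unfolding R by (rule symplectic_R)
      show "symplectomorphism QM omega (prod_mfd OM (prod_mfd vs_mfd vs_mfd)) rho Phi" unfolding R by (rule symplectic_QM(2))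
      fix \<mu> assume \<mu>: "\<mu> \<in> coad_orbit G \<mu>\<^sub>0"
      show "tmap OM vs_mfd (\<lambda>\<alpha>. \<alpha>) \<mu> ` model OM = range (\<lambda>\<eta>. inft \<mu> \<eta>)" using tangent_orbit[OF \<mu>] by simp
      fix \<beta> x u u' \<eta> \<eta>' l l' \<zeta> \<zeta>'
      assume "u \<in> model OM" "u' \<in> model OM"
        and "tmap OM vs_mfd (\<lambda>\<alpha>. \<alpha>) \<mu> u = inft \<mu> \<eta> \<and> tmap OM vs_mfd (\<lambda>\<alpha>. \<alpha>) \<mu> u' = inft \<mu> \<eta>'"
      then show "rho (\<mu>, \<beta>, x) (u, l, \<zeta>) (u', l', \<zeta>') = blinfun_apply l' \<zeta> - blinfun_apply l \<zeta>' - blinfun_apply \<mu> (br \<eta> \<eta>')"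
        using smooth_incl(2)[OF \<mu>] by (intro rho_eq[OF \<mu>]) auto
    qed
  qed
qed

end
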